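(* Let $V$ be a real vector space of dimension $4n$, $n>1$, with a Euclidean inner product and an $Sp(n)Sp(1)$-structure as in the context, and let $I,J,K$ be an adapted basis. Under $Sp(n)Sp(1)$ one has $\Lambda^3V^*=KH+EH+\Lambda_0^3E\,S^3H+E\,S^3H$ (with $\Lambda_0^3E=\{0\}$ if $n=2$). For $b\in\Lambda^3V^*$, $b$ belongs to the submodule on the left if and only if the condition on the right holds ("or" separates equivalent alternatives): 1. $\{0\}$: $b=0$. 2. $KH$: [$L(b)=3b$, or $\sum_{1\le i<j\le3}A_{(i)}A_{(j)}b=b$ for each $A=I,J,K$] and $\xi_b=0$. 3. $EH$: $b=\xi_b\lrcorner\Omega$. 4. $\Lambda_0^3E\,S^3H$: [$L(b)=-3b$, or $\sum_{A=I,J,K}A_{(2)}A_{(3)}b=-b$] and $\xi_{b;I}=\xi_{b;J}=\xi_{b;K}=0$. 5. $E\,S^3H$: $b=-2\sum_{A=I,J,K}A\xi_{b;A}\wedge\omega_A$ and $\xi_b=0$. 6. $(K+E)H$: $L(b)=3b$, or $\sum_{1\le i<j\le3}A_{(i)}A_{(j)}b=b$ for each $A=I,J,K$. 7. $KH+\Lambda_0^3E\,S^3H$: $\xi_{b;I}=\xi_{b;J}=\xi_{b;K}=0$. 8. $KH+E\,S^3H$: $L(b)=3b+12\sum_{A=I,J,K}A\xi_{b;A}\wedge\omega_A$. 9. $EH+\Lambda_0^3E\,S^3H$: $L(b)=-3b+6\,\xi_b\lrcorner\Omega$ and $\xi_{b;I}=\xi_{b;J}=\xi_{b;K}$. 10.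 $E(H+S^3H)$: $b=-2\sum_{A=I,J,K}A\xi_{b;A}\wedge\omega_A$. 11. $(\Lambda_0^3E+E)S^3H$: $L(b)=-3b$, or $\sum_{A=I,J,K}A_{(2)}A_{(3)}b=-b$. 12. $(K+E)H+\Lambda_0^3E\,S^3H$: $\xi_{b;I}=\xi_{b;J}=\xi_{b;K}$. 13. $(K+E)H+E\,S^3H$: $L(b)=3b+6\,\xi_b\lrcorner\Omega+12\sum_{A=I,J,K}A\xi_{b;A}\wedge\omega_A$. 14. $KH+(\Lambda_0^3E+E)S^3H$: $\xi_b=0$. 15. $EH+(\Lambda_0^3E+E)S^3H$: $L(b)=-3b+6\,\xi_b\lrcorner\Omega$. 16. $(K+E)H+(\Lambda_0^3E+E)S^3H$: no condition.
   Context: $V$ carries an inner product $\langle\cdot,\cdot\rangle$ and a three-dimensional subspace $\mathcal G\subset\mathrm{End}\,V$ having an adapted basis $I,J,K$: $I^2=J^2=-1$, $K=IJ=-JI$, $\langle Ax,Ay\rangle=\langle x,y\rangle$ for $A=I,J,K$. Put $\omega_A(x,y)=\langle x,Ay\rangle$ and $\Omega=\sum_{A=I,J,K}\omega_A\wedge\omega_A$; $Sp(n)Sp(1)\subset SO(4n)$ is the stabilizer of $\Omega$. $V$ and $V^*$ are identified via the metric. Wedge convention: $(a\wedge b)(x,y)=a(x)b(y)-a(y)b(x)$ for one-forms. $E\cong\mathbb C^{2n}$, $H\cong\mathbb C^2$ are the fundamental representations of $Sp(n)$ and $Sp(1)$ ($V\otimes\mathbb C\cong E\otimes H$); $S^kH$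 is the symmetric power; $\Lambda_0^3E$ is the $Sp(n)$-invariant complement of $\omega_E\wedge E$ in $\Lambda^3E$; $K$ (as a module) is the irreducible $Sp(n)$-module of highest weight $(2,1,0,\dots,0)$. The same symbols denote the underlying real modules and the corresponding (unique) submodules of $\Lambda^3V^*$, whose irreducible summands are pairwise inequivalent. For a $(0,s)$-tensor $b$: $A_{(i)}b(x_1,\dots,x_s)=-b(x_1,\dots,Ax_i,\dots,x_s)$; for a one-form $A\xi=-\xi(A\cdot)$; $\langle a,b\rangle=\frac1{s!}\sum a(e_{i_1},\dots,e_{i_s})b(e_{i_1},\dots,e_{i_s})$ with $\{e_i\}$ an orthonormal basis. For a three-form $b$: $L(b)=\sum_{A=I,J,K}\sum_{1\le i<j\le3}A_{(i)}A_{(j)}b$, $\xi_b(x)=-\frac1{6(2n+1)}\sum_{A=I,J,K}\langle Ax\lrcorner b,\omega_A\rangle$, $\xi_{b;A}(x)=-\frac3{2(n-1)}\xi_b(x)-\frac1{4(n-1)}\langle Ax\lrcorner b,\omega_A\rangle$ for $A=I,J,K$. *)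

theory Defs
  imports "HOL-Analysis.Analysis"
begin

section \<open>Adapted bases, groups and forms\<close>

definition adapted_basis ::
  "('a::euclidean_space \<Rightarrow> 'a) \<Rightarrow> ('a \<Rightarrow> 'a) \<Rightarrow> ('a \<Rightarrow> 'a) \<Rightarrow> bool" where
  "adapted_basis I J K \<longleftrightarrow>
     linear I \<and> linear J \<and> linear K \<and>
     (\<forall>x. I (I x) = - x) \<and> (\<forall>x. J (J x) = - x) \<and>
     (\<forall>x. K x = I (J x)) \<and> (\<forall>x. K x = - J (I x)) \<and>
     (\<forall>x y. I x \<bullet> I y = x \<bullet> y) \<and> (\<forall>x y. J x \<bullet> J y = x \<bullet> y) \<and> (\<forall>x y. K x \<bullet> K y = x \<bullet> y)"

definition omega :: "('a::euclidean_space \<Rightarrow> 'a) \<Rightarrow> 'a \<Rightarrow> 'a \<Rightarrow> real" where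
  "omega A x y = x \<bullet> A y"

text \<open>The wedge products are shuffle sums, so that for one-forms
  \<open>(a \<and> b)(x,y) = a(x) b(y) - a(y) b(x)\<close>.\<close>

definition wedge12 :: "('a \<Rightarrow> 'b::comm_ring_1) \<Rightarrow> ('a \<Rightarrow> 'a \<Rightarrow> 'b) \<Rightarrow> 'a \<Rightarrow> 'a \<Rightarrow> 'a \<Rightarrow> 'b" where
  "wedge12 a w x y z = a x * w y z - a y * w x z + a z * w x y"

definition wedge22 ::
  "('a \<Rightarrow> 'a \<Rightarrow> real) \<Rightarrow> ('a \<Rightarrow> 'a \<Rightarrow> real) \<Rightarrow> 'a \<Rightarrow> 'a \<Rightarrow> 'a \<Rightarrow> 'a \<Rightarrow> real" where
  "wedge22 a b x y z w =
     a x y * b z w - a x z * b y w + a x w * b y z +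
     a y z * b x w - a y w * b x z + a z w * b x y"

definition Omega4 ::
  "('a::euclidean_space \<Rightarrow> 'a) \<Rightarrow> ('a \<Rightarrow> 'a) \<Rightarrow> ('a \<Rightarrow> 'a) \<Rightarrow> 'a \<Rightarrow> 'a \<Rightarrow> 'a \<Rightarrow> 'a \<Rightarrow> real" where
  "Omega4 I J K x y z w =
     wedge22 (omega I) (omega I) x y z w +
     wedge22 (omega J) (omega J) x y z w +
     wedge22 (omega K) (omega K) x y z w"

text \<open>Determinant of an endomorphism, from its matrix in the orthonormal basis \<open>Basis\<close>.\<close>

definition det_endo :: "('a::euclidean_space \<Rightarrow> 'a) \<Rightarrow> real" where
  "det_endo T = (\<Sum>p | p permutes (Basis :: 'a set). of_int (sign p) * (\<Prod>u\<in>Basis. T u \<bullet> p u))"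

definition SpnSp1 ::
  "('a::euclidean_space \<Rightarrow> 'a) \<Rightarrow> ('a \<Rightarrow> 'a) \<Rightarrow> ('a \<Rightarrow> 'a) \<Rightarrow> ('a \<Rightarrow> 'a) set" where
  "SpnSp1 I J K = {T. orthogonal_transformation T \<and> det_endo T = 1 \<and>
     (\<forall>x y z w. Omega4 I J K (T x) (T y) (T z) (T w) = Omega4 I J K x y z w)}"

definition Spn ::
  "('a::euclidean_space \<Rightarrow> 'a) \<Rightarrow> ('a \<Rightarrow> 'a) \<Rightarrow> ('a \<Rightarrow> 'a) \<Rightarrow> ('a \<Rightarrow> 'a) set" where
  "Spn I J K = {g. orthogonal_transformation g \<and>
     (\<forall>x. g (I x) = I (g x)) \<and> (\<forall>x. g (J x) = J (g x)) \<and> (\<forall>x. g (K x) = K (g x))}"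

text \<open>\<open>Sp(1)\<close> is taken as \<open>SU(2)\<close>: the matrix with first row \<open>(\<alpha>, \<beta>)\<close> is the unit quaternion
  \<open>\<alpha> + \<beta> j\<close>, and \<open>quat\<close> is the resulting action on \<open>V\<close>. The group \<open>Sp(n) \<times> Sp(1)\<close> acts on \<open>V\<close>
  by \<open>(g, U) \<mapsto> g \<circ> quat U\<close>, with image \<open>SpnSp1\<close> for \<open>n > 1\<close>.\<close>

definition Sp1 :: "(complex^2^2) set" where
  "Sp1 = {U. U ** (\<chi> i j. cnj (U $ j $ i)) = mat 1 \<and> det U = 1}"

definition quat ::
  "('a::euclidean_space \<Rightarrow> 'a) \<Rightarrow> ('a \<Rightarrow> 'a) \<Rightarrow> ('a \<Rightarrow> 'a) \<Rightarrow> complex^2^2 \<Rightarrow> 'a \<Rightarrow> 'a" where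
  "quat I J K U x =
     Re (U $ 1 $ 1) *\<^sub>R x + Im (U $ 1 $ 1) *\<^sub>R I x + Re (U $ 1 $ 2) *\<^sub>R J x + Im (U $ 1 $ 2) *\<^sub>R K x"

type_synonym 'a form3 = "'a \<Rightarrow> 'a \<Rightarrow> 'a \<Rightarrow> real"

definition Lambda3 :: "('a::euclidean_space) form3 set" where
  "Lambda3 = {b. (\<forall>y z. linear (\<lambda>x. b x y z)) \<and> (\<forall>x z. linear (\<lambda>y. b x y z)) \<and>
     (\<forall>x y. linear (\<lambda>z. b x y z)) \<and>
     (\<forall>x y z. b y x z = - b x y z) \<and> (\<forall>x y z. b x z y = - b x y z)}"

definition add3 :: "'a form3 \<Rightarrow> 'a form3 \<Rightarrow> 'a form3" where
  "add3 a b = (\<lambda>x y z. a x y z + b x y z)"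

definition scale3 :: "real \<Rightarrow> 'a form3 \<Rightarrow> 'a form3" where
  "scale3 c b = (\<lambda>x y z. c * b x y z)"

definition zero3 :: "'a form3" where
  "zero3 = (\<lambda>x y z. 0)"

definition sum3 :: "'a form3 set \<Rightarrow> 'a form3 set \<Rightarrow> 'a form3 set" where
  "sum3 M N = {add3 a b | a b. a \<in> M \<and> b \<in> N}"

definition submodule3 ::
  "('a::euclidean_space \<Rightarrow> 'a) \<Rightarrow> ('a \<Rightarrow> 'a) \<Rightarrow> ('a \<Rightarrow> 'a) \<Rightarrow> 'a form3 set \<Rightarrow> bool" where
  "submodule3 I J K M \<longleftrightarrow> M \<subseteq> Lambda3 \<and> zero3 \<in> M \<and>
     (\<forall>a\<in>M. \<forall>b\<in>M. add3 a b \<in> M) \<and> (\<forall>c. \<forall>b\<in>M. scale3 c b \<in> M) \<and>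
     (\<forall>T\<in>SpnSp1 I J K. \<forall>b\<in>M. (\<lambda>x y z. b (inv T x) (inv T y) (inv T z)) \<in> M)"


section \<open>Complex modules\<close>

text \<open>Complex vector spaces are realised as spaces of complex-valued functions on some set. For
  such spaces the span of the products \<open>f(x) h(y)\<close> is a tensor product.\<close>

definition cspace :: "('x \<Rightarrow> complex) set \<Rightarrow> bool" where
  "cspace S \<longleftrightarrow> (\<lambda>x. 0) \<in> S \<and> (\<forall>f\<in>S. \<forall>h\<in>S. (\<lambda>x. f x + h x) \<in> S) \<and>
     (\<forall>c. \<forall>f\<in>S. (\<lambda>x. c * f x) \<in> S)"

definition cfinite_dim :: "('x \<Rightarrow> complex) set \<Rightarrow> bool" where
  "cfinite_dim S \<longleftrightarrow> (\<exists>B. finite B \<and> B \<subseteq> S \<and> (\<forall>f\<in>S. \<exists>c. f = (\<lambda>x. \<Sum>h\<in>B. c h * h x)))"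

definition clinear_on :: "('x \<Rightarrow> complex) set \<Rightarrow> (('x \<Rightarrow> complex) \<Rightarrow> ('y \<Rightarrow> complex)) \<Rightarrow> bool" where
  "clinear_on S \<Phi> \<longleftrightarrow>
     (\<forall>f\<in>S. \<forall>h\<in>S. \<Phi> (\<lambda>x. f x + h x) = (\<lambda>y. \<Phi> f y + \<Phi> h y)) \<and>
     (\<forall>c. \<forall>f\<in>S. \<Phi> (\<lambda>x. c * f x) = (\<lambda>y. c * \<Phi> f y))"

definition outer :: "('x \<Rightarrow> complex) \<Rightarrow> ('y \<Rightarrow> complex) \<Rightarrow> 'x \<times> 'y \<Rightarrow> complex" where
  "outer f h = (\<lambda>(x, y). f x * h y)"

definition tensor :: "('x \<Rightarrow> complex) set \<Rightarrow> ('y \<Rightarrow> complex) set \<Rightarrow> ('x \<times> 'y \<Rightarrow> complex) set" where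
  "tensor A B = {(\<lambda>p. \<Sum>i<m. outer (f i) (h i) p) | (m::nat) f h. \<forall>i<m. f i \<in> A \<and> h i \<in> B}"

definition complexify :: "'a form3 set \<Rightarrow> ('a \<times> 'a \<times> 'a \<Rightarrow> complex) set" where
  "complexify M =
     {(\<lambda>(x, y, z). complex_of_real (b x y z) + \<i> * complex_of_real (c x y z)) | b c. b \<in> M \<and> c \<in> M}"

definition act1 :: "('a \<Rightarrow> 'a) \<Rightarrow> ('a \<Rightarrow> complex) \<Rightarrow> 'a \<Rightarrow> complex" where
  "act1 T f = (\<lambda>x. f (inv T x))"

definition act3 :: "('a \<Rightarrow> 'a) \<Rightarrow> ('a \<times> 'a \<times> 'a \<Rightarrow> complex) \<Rightarrow> 'a \<times> 'a \<times> 'a \<Rightarrow> complex" where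
  "act3 T F = (\<lambda>(x, y, z). F (inv T x, inv T y, inv T z))"

text \<open>\<open>M\<close> is the submodule of \<open>\<Lambda>\<^sup>3V\<^sup>*\<close> underlying \<open>A \<otimes> B\<close>, where \<open>A\<close> is an \<open>Sp(n)\<close>-module with
  action \<open>\<rho>\<close> and \<open>B\<close> an \<open>Sp(1)\<close>-module with action \<open>\<sigma>\<close>: the complexification of \<open>M\<close> is
  \<open>Sp(n) \<times> Sp(1)\<close>-isomorphic to \<open>A \<otimes> B\<close>.\<close>

definition underlies ::
  "('a::euclidean_space \<Rightarrow> 'a) \<Rightarrow> ('a \<Rightarrow> 'a) \<Rightarrow> ('a \<Rightarrow> 'a) \<Rightarrow> 'a form3 set \<Rightarrow>
   ('x \<Rightarrow> complex) set \<Rightarrow> (('a \<Rightarrow> 'a) \<Rightarrow> ('x \<Rightarrow> complex) \<Rightarrow> ('x \<Rightarrow> complex)) \<Rightarrow>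
   ('y \<Rightarrow> complex) set \<Rightarrow> (complex^2^2 \<Rightarrow> ('y \<Rightarrow> complex) \<Rightarrow> ('y \<Rightarrow> complex)) \<Rightarrow> bool" where
  "underlies I J K M A \<rho> B \<sigma> \<longleftrightarrow> submodule3 I J K M \<and>
     (\<exists>\<Phi>. bij_betw \<Phi> (tensor A B) (complexify M) \<and> clinear_on (tensor A B) \<Phi> \<and>
        (\<forall>g\<in>Spn I J K. \<forall>U\<in>Sp1. \<forall>f\<in>A. \<forall>h\<in>B.
           \<Phi> (outer (\<rho> g f) (\<sigma> U h)) = act3 (g \<circ> quat I J K U) (\<Phi> (outer f h))))"


subsection \<open>The modules \<open>H\<close> and \<open>S\<^sup>3H\<close>\<close>

definition H_mod :: "(2 \<Rightarrow> complex) set" where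
  "H_mod = UNIV"

definition H_act :: "complex^2^2 \<Rightarrow> (2 \<Rightarrow> complex) \<Rightarrow> 2 \<Rightarrow> complex" where
  "H_act U h = (\<lambda>i. \<Sum>j\<in>UNIV. U $ i $ j * h j)"

definition S3H_mod :: "(2 \<times> 2 \<times> 2 \<Rightarrow> complex) set" where
  "S3H_mod = {s. \<forall>i j k. s (j, i, k) = s (i, j, k) \<and> s (i, k, j) = s (i, j, k)}"

definition S3H_act :: "complex^2^2 \<Rightarrow> (2 \<times> 2 \<times> 2 \<Rightarrow> complex) \<Rightarrow> 2 \<times> 2 \<times> 2 \<Rightarrow> complex" where
  "S3H_act U s = (\<lambda>(i, j, k). \<Sum>a\<in>UNIV. \<Sum>b\<in>UNIV. \<Sum>c\<in>UNIV. U $ i $ a * U $ j $ b * U $ k $ c * s (a, b, c))"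


subsection \<open>The modules \<open>E\<close> and \<open>\<Lambda>\<^sub>0\<^sup>3E\<close>\<close>

text \<open>\<open>(V, I) \<cong> \<complex>\<^sup>2\<^sup>n\<close> with the action of \<open>Sp(n)\<close> is the fundamental representation. It is
  identified with its dual, the space of complex-linear forms on \<open>(V, I)\<close>, by the invariant
  complex-bilinear symplectic form \<open>\<omega>\<^sub>E = \<omega>\<^sub>J + \<i> \<omega>\<^sub>K\<close>; so \<open>\<Lambda>\<^sup>3E\<close> consists of alternating forms.\<close>

definition E_mod :: "('a::euclidean_space \<Rightarrow> 'a) \<Rightarrow> ('a \<Rightarrow> complex) set" where
  "E_mod I = {f. linear f \<and> (\<forall>x. f (I x) = \<i> * f x)}"

definition L3E_mod :: "('a::euclidean_space \<Rightarrow> 'a) \<Rightarrow> ('a \<times> 'a \<times> 'a \<Rightarrow> complex) set" where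
  "L3E_mod I = {F. (\<forall>y z. (\<lambda>x. F (x, y, z)) \<in> E_mod I) \<and> (\<forall>x z. (\<lambda>y. F (x, y, z)) \<in> E_mod I) \<and>
     (\<forall>x y. (\<lambda>z. F (x, y, z)) \<in> E_mod I) \<and>
     (\<forall>x y z. F (y, x, z) = - F (x, y, z)) \<and> (\<forall>x y z. F (x, z, y) = - F (x, y, z))}"

definition omega_E ::
  "('a::euclidean_space \<Rightarrow> 'a) \<Rightarrow> ('a \<Rightarrow> 'a) \<Rightarrow> 'a \<Rightarrow> 'a \<Rightarrow> complex" where
  "omega_E J K x y = complex_of_real (omega J x y) + \<i> * complex_of_real (omega K x y)"

definition omegaE_wedge_E ::
  "('a::euclidean_space \<Rightarrow> 'a) \<Rightarrow> ('a \<Rightarrow> 'a) \<Rightarrow> ('a \<Rightarrow> 'a) \<Rightarrow> ('a \<times> 'a \<times> 'a \<Rightarrow> complex) set" where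
  "omegaE_wedge_E I J K = {(\<lambda>(x, y, z). wedge12 f (omega_E J K) x y z) | f. f \<in> E_mod I}"

definition invariant_complement ::
  "('a::euclidean_space \<Rightarrow> 'a) \<Rightarrow> ('a \<Rightarrow> 'a) \<Rightarrow> ('a \<Rightarrow> 'a) \<Rightarrow> ('a \<times> 'a \<times> 'a \<Rightarrow> complex) set \<Rightarrow> bool" where
  "invariant_complement I J K C \<longleftrightarrow>
     C \<subseteq> L3E_mod I \<and> cspace C \<and> (\<forall>g\<in>Spn I J K. \<forall>F\<in>C. act3 g F \<in> C) \<and>
     C \<inter> omegaE_wedge_E I J K = {\<lambda>p. 0} \<and>
     (\<forall>F\<in>L3E_mod I. \<exists>G\<in>C. \<exists>D\<in>omegaE_wedge_E I J K. F = (\<lambda>p. G p + D p))"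

definition L03E_mod ::
  "('a::euclidean_space \<Rightarrow> 'a) \<Rightarrow> ('a \<Rightarrow> 'a) \<Rightarrow> ('a \<Rightarrow> 'a) \<Rightarrow> ('a \<times> 'a \<times> 'a \<Rightarrow> complex) set" where
  "L03E_mod I J K = (THE C. invariant_complement I J K C)"


subsection \<open>Irreducible \<open>Sp(n)\<close>-modules of given highest weight\<close>

definition Spn_rep ::
  "('a::euclidean_space \<Rightarrow> 'a) \<Rightarrow> ('a \<Rightarrow> 'a) \<Rightarrow> ('a \<Rightarrow> 'a) \<Rightarrow>
   ('x \<Rightarrow> complex) set \<Rightarrow> (('a \<Rightarrow> 'a) \<Rightarrow> ('x \<Rightarrow> complex) \<Rightarrow> ('x \<Rightarrow> complex)) \<Rightarrow> bool" where
  "Spn_rep I J K S \<rho> \<longleftrightarrow> cspace S \<and> cfinite_dim S \<and>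
     (\<forall>g\<in>Spn I J K. \<rho> g ` S \<subseteq> S \<and> clinear_on S (\<rho> g)) \<and>
     (\<forall>f\<in>S. \<rho> id f = f) \<and>
     (\<forall>g\<in>Spn I J K. \<forall>h\<in>Spn I J K. \<forall>f\<in>S. \<rho> (g \<circ> h) f = \<rho> g (\<rho> h f)) \<and>
     (\<forall>f\<in>S. continuous_on (Spn I J K) (\<lambda>g. \<rho> g f))"

definition irreducible_Spn_rep ::
  "('a::euclidean_space \<Rightarrow> 'a) \<Rightarrow> ('a \<Rightarrow> 'a) \<Rightarrow> ('a \<Rightarrow> 'a) \<Rightarrow>
   ('x \<Rightarrow> complex) set \<Rightarrow> (('a \<Rightarrow> 'a) \<Rightarrow> ('x \<Rightarrow> complex) \<Rightarrow> ('x \<Rightarrow> complex)) \<Rightarrow> bool" where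
  "irreducible_Spn_rep I J K S \<rho> \<longleftrightarrow> Spn_rep I J K S \<rho> \<and> S \<noteq> {\<lambda>x. 0} \<and>
     (\<forall>W. cspace W \<and> W \<subseteq> S \<and> (\<forall>g\<in>Spn I J K. \<rho> g ` W \<subseteq> W) \<longrightarrow> W = {\<lambda>x. 0} \<or> W = S)"

definition quaternionic_unitary_basis ::
  "('a::euclidean_space \<Rightarrow> 'a) \<Rightarrow> ('a \<Rightarrow> 'a) \<Rightarrow> ('a \<Rightarrow> 'a) \<Rightarrow> nat \<Rightarrow> (nat \<Rightarrow> 'a) \<Rightarrow> bool" where
  "quaternionic_unitary_basis I J K n e \<longleftrightarrow>
     (\<forall>r<n. \<forall>s<n. e r \<bullet> e s = (if r = s then 1 else 0) \<and>
        e r \<bullet> I (e s) = 0 \<and> e r \<bullet> J (e s) = 0 \<and> e r \<bullet> K (e s) = 0)"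

text \<open>Weights with respect to the maximal torus of all \<open>g \<in> Sp(n)\<close> with
  \<open>g e\<^sub>r = cos \<theta>\<^sub>r e\<^sub>r + sin \<theta>\<^sub>r I e\<^sub>r\<close>; an element of \<open>Sp(n)\<close> is determined by the \<open>g e\<^sub>r\<close>.
  On \<open>(V, I)\<close> the vectors \<open>e\<^sub>r\<close> and \<open>J e\<^sub>r\<close> have the weights \<open>\<epsilon>\<^sub>r\<close> and \<open>- \<epsilon>\<^sub>r\<close>.
  Only the entries \<open>\<mu> r\<close> with \<open>r < n\<close> matter.\<close>

definition is_weight ::
  "('a::euclidean_space \<Rightarrow> 'a) \<Rightarrow> ('a \<Rightarrow> 'a) \<Rightarrow> ('a \<Rightarrow> 'a) \<Rightarrow> nat \<Rightarrow> (nat \<Rightarrow> 'a) \<Rightarrow>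
   ('x \<Rightarrow> complex) set \<Rightarrow> (('a \<Rightarrow> 'a) \<Rightarrow> ('x \<Rightarrow> complex) \<Rightarrow> ('x \<Rightarrow> complex)) \<Rightarrow> (nat \<Rightarrow> int) \<Rightarrow> bool" where
  "is_weight I J K n e S \<rho> \<mu> \<longleftrightarrow>
     (\<exists>f\<in>S. f \<noteq> (\<lambda>x. 0) \<and>
        (\<forall>g\<in>Spn I J K. \<forall>\<theta>. (\<forall>r<n. g (e r) = cos (\<theta> r) *\<^sub>R e r + sin (\<theta> r) *\<^sub>R I (e r)) \<longrightarrow>
           \<rho> g f = (\<lambda>x. cis (\<Sum>r<n. of_int (\<mu> r) * \<theta> r) * f x)))"

text \<open>Simple roots \<open>\<epsilon>\<^sub>k - \<epsilon>\<^sub>k\<^sub>+\<^sub>1\<close> (\<open>k < n - 1\<close>) and \<open>2 \<epsilon>\<^sub>n\<^sub>-\<^sub>1\<close> of type \<open>C\<^sub>n\<close>, indexed from \<open>0\<close>.\<close>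

definition simple_root :: "nat \<Rightarrow> nat \<Rightarrow> nat \<Rightarrow> int" where
  "simple_root n k r =
     (if Suc k = n then (if r = k then 2 else 0)
      else if r = k then 1 else if r = Suc k then - 1 else 0)"

definition highest_weight ::
  "('a::euclidean_space \<Rightarrow> 'a) \<Rightarrow> ('a \<Rightarrow> 'a) \<Rightarrow> ('a \<Rightarrow> 'a) \<Rightarrow> nat \<Rightarrow>
   ('x \<Rightarrow> complex) set \<Rightarrow> (('a \<Rightarrow> 'a) \<Rightarrow> ('x \<Rightarrow> complex) \<Rightarrow> ('x \<Rightarrow> complex)) \<Rightarrow> (nat \<Rightarrow> int) \<Rightarrow> bool" where
  "highest_weight I J K n S \<rho> \<kappa> \<longleftrightarrow>
     (\<exists>e. quaternionic_unitary_basis I J K n e \<and> is_weight I J K n e S \<rho> \<kappa> \<and>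
        (\<forall>\<mu>. is_weight I J K n e S \<rho> \<mu> \<longrightarrow>
           (\<exists>c :: nat \<Rightarrow> nat. \<forall>r<n. \<kappa> r - \<mu> r = (\<Sum>k<n. int (c k) * simple_root n k r))))"

definition is_K_mod ::
  "('a::euclidean_space \<Rightarrow> 'a) \<Rightarrow> ('a \<Rightarrow> 'a) \<Rightarrow> ('a \<Rightarrow> 'a) \<Rightarrow> nat \<Rightarrow>
   ('x \<Rightarrow> complex) set \<Rightarrow> (('a \<Rightarrow> 'a) \<Rightarrow> ('x \<Rightarrow> complex) \<Rightarrow> ('x \<Rightarrow> complex)) \<Rightarrow> bool" where
  "is_K_mod I J K n S \<rho> \<longleftrightarrow> irreducible_Spn_rep I J K S \<rho> \<and>
     highest_weight I J K n S \<rho> (\<lambda>r. if r = 0 then 2 else if r = 1 then 1 else 0)"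


section \<open>The submodules of \<open>\<Lambda>\<^sup>3V\<^sup>*\<close>\<close>

text \<open>Every finite-dimensional complex module is isomorphic to one carried by functions on
  \<open>'a \<times> 'a \<times> 'a\<close> (an infinite set), so fixing this carrier type for \<open>S\<close> is no restriction.\<close>

definition is_KH ::
  "('a::euclidean_space \<Rightarrow> 'a) \<Rightarrow> ('a \<Rightarrow> 'a) \<Rightarrow> ('a \<Rightarrow> 'a) \<Rightarrow> nat \<Rightarrow> 'a form3 set \<Rightarrow> bool" where
  "is_KH I J K n M \<longleftrightarrow>
     (\<exists>(S :: ('a \<times> 'a \<times> 'a \<Rightarrow> complex) set) \<rho>.
        is_K_mod I J K n S \<rho> \<and> underlies I J K M S \<rho> H_mod H_act)"

definition is_EH ::
  "('a::euclidean_space \<Rightarrow> 'a) \<Rightarrow> ('a \<Rightarrow> 'a) \<Rightarrow> ('a \<Rightarrow> 'a) \<Rightarrow> 'a form3 set \<Rightarrow> bool" where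
  "is_EH I J K M \<longleftrightarrow> underlies I J K M (E_mod I) act1 H_mod H_act"

definition is_L03E_S3H ::
  "('a::euclidean_space \<Rightarrow> 'a) \<Rightarrow> ('a \<Rightarrow> 'a) \<Rightarrow> ('a \<Rightarrow> 'a) \<Rightarrow> 'a form3 set \<Rightarrow> bool" where
  "is_L03E_S3H I J K M \<longleftrightarrow> underlies I J K M (L03E_mod I J K) act3 S3H_mod S3H_act"

definition is_E_S3H ::
  "('a::euclidean_space \<Rightarrow> 'a) \<Rightarrow> ('a \<Rightarrow> 'a) \<Rightarrow> ('a \<Rightarrow> 'a) \<Rightarrow> 'a form3 set \<Rightarrow> bool" where
  "is_E_S3H I J K M \<longleftrightarrow> underlies I J K M (E_mod I) act1 S3H_mod S3H_act"


section \<open>The operators of the classification\<close>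

definition slot1 :: "('a \<Rightarrow> 'a) \<Rightarrow> 'a form3 \<Rightarrow> 'a form3" where
  "slot1 A b = (\<lambda>x y z. - b (A x) y z)"

definition slot2 :: "('a \<Rightarrow> 'a) \<Rightarrow> 'a form3 \<Rightarrow> 'a form3" where
  "slot2 A b = (\<lambda>x y z. - b x (A y) z)"

definition slot3 :: "('a \<Rightarrow> 'a) \<Rightarrow> 'a form3 \<Rightarrow> 'a form3" where
  "slot3 A b = (\<lambda>x y z. - b x y (A z))"

definition pair_op :: "('a \<Rightarrow> 'a) \<Rightarrow> 'a form3 \<Rightarrow> 'a form3" where
  "pair_op A b = add3 (slot1 A (slot2 A b)) (add3 (slot1 A (slot3 A b)) (slot2 A (slot3 A b)))"

definition L_op :: "('a \<Rightarrow> 'a) \<Rightarrow> ('a \<Rightarrow> 'a) \<Rightarrow> ('a \<Rightarrow> 'a) \<Rightarrow> 'a form3 \<Rightarrow> 'a form3" where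
  "L_op I J K b = add3 (pair_op I b) (add3 (pair_op J b) (pair_op K b))"

text \<open>\<open>\<Sum>\<^sub>A A\<^sub>(\<^sub>2\<^sub>) A\<^sub>(\<^sub>3\<^sub>) b\<close>\<close>

definition L23_op :: "('a \<Rightarrow> 'a) \<Rightarrow> ('a \<Rightarrow> 'a) \<Rightarrow> ('a \<Rightarrow> 'a) \<Rightarrow> 'a form3 \<Rightarrow> 'a form3" where
  "L23_op I J K b =
     add3 (slot2 I (slot3 I b)) (add3 (slot2 J (slot3 J b)) (slot2 K (slot3 K b)))"

definition inner2 :: "('a::euclidean_space \<Rightarrow> 'a \<Rightarrow> real) \<Rightarrow> ('a \<Rightarrow> 'a \<Rightarrow> real) \<Rightarrow> real" where
  "inner2 a b = 1 / fact 2 * (\<Sum>u\<in>Basis. \<Sum>v\<in>Basis. a u v * b u v)"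

text \<open>\<open>\<langle>Ax \<lrcorner> b, \<omega>\<^sub>A\<rangle>\<close>\<close>

definition contr :: "('a::euclidean_space \<Rightarrow> 'a) \<Rightarrow> 'a form3 \<Rightarrow> 'a \<Rightarrow> real" where
  "contr A b x = inner2 (b (A x)) (omega A)"

definition xi ::
  "('a::euclidean_space \<Rightarrow> 'a) \<Rightarrow> ('a \<Rightarrow> 'a) \<Rightarrow> ('a \<Rightarrow> 'a) \<Rightarrow> nat \<Rightarrow> 'a form3 \<Rightarrow> 'a \<Rightarrow> real" where
  "xi I J K n b x = - 1 / (6 * (2 * real n + 1)) * (contr I b x + contr J b x + contr K b x)"

definition xiA ::
  "('a::euclidean_space \<Rightarrow> 'a) \<Rightarrow> ('a \<Rightarrow> 'a) \<Rightarrow> ('a \<Rightarrow> 'a) \<Rightarrow> nat \<Rightarrow> ('a \<Rightarrow> 'a) \<Rightarrow> 'a form3 \<Rightarrow> 'a \<Rightarrow> real" where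
  "xiA I J K n A b x =
     - 3 / (2 * (real n - 1)) * xi I J K n b x - 1 / (4 * (real n - 1)) * contr A b x"

definition actA :: "('a \<Rightarrow> 'a) \<Rightarrow> ('a \<Rightarrow> real) \<Rightarrow> 'a \<Rightarrow> real" where
  "actA A f = (\<lambda>x. - f (A x))"

definition sharp :: "('a::euclidean_space \<Rightarrow> real) \<Rightarrow> 'a" where
  "sharp f = (\<Sum>u\<in>Basis. f u *\<^sub>R u)"

text \<open>\<open>\<xi>\<^sub>b \<lrcorner> \<Omega>\<close> and \<open>\<Sum>\<^sub>A A\<xi>\<^bsub>b;A\<^esub> \<and> \<omega>\<^sub>A\<close>\<close>

definition xi_Omega ::
  "('a::euclidean_space \<Rightarrow> 'a) \<Rightarrow> ('a \<Rightarrow> 'a) \<Rightarrow> ('a \<Rightarrow> 'a) \<Rightarrow> nat \<Rightarrow> 'a form3 \<Rightarrow> 'a form3" where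
  "xi_Omega I J K n b = Omega4 I J K (sharp (xi I J K n b))"

definition xi_omega ::
  "('a::euclidean_space \<Rightarrow> 'a) \<Rightarrow> ('a \<Rightarrow> 'a) \<Rightarrow> ('a \<Rightarrow> 'a) \<Rightarrow> nat \<Rightarrow> 'a form3 \<Rightarrow> 'a form3" where
  "xi_omega I J K n b =
     add3 (wedge12 (actA I (xiA I J K n I b)) (omega I))
       (add3 (wedge12 (actA J (xiA I J K n J b)) (omega J))
             (wedge12 (actA K (xiA I J K n K b)) (omega K)))"

end

(* Over the complex numbers V* = E \<otimes> H, so a trilinear form is a family of eight forms t_ijk in E \<otimes> E \<otimes> E
   indexed by the basis of H \<otimes> H \<otimes> H. In these components the operator L is 3 minus twice the sum of the
   transpositions of the indices, hence its eigenvalues on three-forms are 3 (t of type (2,1), values in S^{(2,1)}E) and -3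
   (t symmetric, values in \<Lambda>^3 E); the three contractions with \<omega>_I, \<omega>_J, \<omega>_K are the
   traces of the t_ijk with respect to \<omega>_E. This identifies the four modules with explicit linear
   conditions, and the sixteen criteria become linear algebra over the four projections.
   Uniqueness: (1 + A)/sqrt 2 with A = \<plusminus>I, \<plusminus>J, \<plusminus>K are six elements of Sp(1) whose
   sum acts on three-forms by a multiple of 3 + L, which gives the eigenvalue of L on any copy of the module;
   since there are no nonzero Sp(n)-maps from E to K, from E to \<Lambda>_0^3 E and from \<Lambda>_0^3 E to E, the copy
   lies in the explicit module, hence equals it by dimension. As the module K is only given by its highest weight,
   for KH one compares highest weight vectors instead. *)

theory Submission
  imports Defs "HOL-Library.Function_Algebras"
begin

text \<open>Three points carry the argument besides the component calculus. The group is given only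
  as the stabilizer of \<open>Omega4\<close>. Its elements normalize the span of \<open>I\<close>,
  \<open>J\<close>, \<open>K\<close>, which makes \<open>L\<close> invariant, because contraction
  with \<Omega> acts on two-forms and the span of the three \<omega>'s can be recognized by its
  eigenvalue. Maps out of E are killed inside the group algebra: if \<open>g\<close> moves only one
  quaternionic line and \<open>h\<close> fixes that line, then \<open>(1 - g) (1 - h)\<close>
  annihilates E, while suitable choices multiply the decisive components of a form in \<Lambda>_0^3
  E or K by 4. Generation and irreducibility use the Hermitian product given by the values on
  triples of basis vectors. Pairing a form with a decomposable tensor is evaluation of the form, so
  everything comes down to one kind of statement: a trace-free form that vanishes on
  quaternionically orthogonal vectors is zero. The proof of that is polarization along a frame
  followed by taking the trace.\<close>

lemma scaleR_numerals:
  fixes x :: "'b::real_vector"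
  shows "3 *\<^sub>R x = x + x + x" "9 *\<^sub>R x = 3 *\<^sub>R x + 3 *\<^sub>R x + 3 *\<^sub>R x"
proof -
  show *: "3 *\<^sub>R x = x + x + x" for x :: 'b
    using scaleR_left_distrib[of 2 1 x] by (simp add: scaleR_2)
  show "9 *\<^sub>R x = 3 *\<^sub>R x + 3 *\<^sub>R x + 3 *\<^sub>R x"
    using *[of "3 *\<^sub>R x"] by simp
qed

section \<open>Trilinear and alternating maps\<close>

definition trilin :: "('a::real_vector \<Rightarrow> 'a \<Rightarrow> 'a \<Rightarrow> 'b::real_vector) \<Rightarrow> bool" where
  "trilin b \<longleftrightarrow> (\<forall>y z. linear (\<lambda>x. b x y z)) \<and> (\<forall>x z. linear (\<lambda>y. b x y z)) \<and> (\<forall>x y. linear (\<lambda>z. b x y z))"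

definition alt3 :: "('a::real_vector \<Rightarrow> 'a \<Rightarrow> 'a \<Rightarrow> 'b::real_vector) \<Rightarrow> bool" where
  "alt3 b \<longleftrightarrow> trilin b \<and> (\<forall>x y z. b y x z = - b x y z) \<and> (\<forall>x y z. b x z y = - b x y z)"

lemma trilinD:
  assumes "trilin b"
  shows "linear (\<lambda>x. b x y z)" "linear (\<lambda>y. b x y z)" "linear (\<lambda>z. b x y z)"
  using assms by (auto simp: trilin_def)

lemma trilin_simps:
  assumes "trilin b"
  shows "b (x + x') y z = b x y z + b x' y z" "b x (y + y') z = b x y z + b x y' z"
    "b x y (z + z') = b x y z + b x y z'"
    "b (x - x') y z = b x y z - b x' y z" "b x (y - y') z = b x y z - b x y' z"
    "b x y (z - z') = b x y z - b x y z'"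
    "b (- x) y z = - b x y z" "b x (- y) z = - b x y z" "b x y (- z) = - b x y z"
    "b (c *\<^sub>R x) y z = c *\<^sub>R b x y z" "b x (c *\<^sub>R y) z = c *\<^sub>R b x y z"
    "b x y (c *\<^sub>R z) = c *\<^sub>R b x y z"
    "b 0 y z = 0" "b x 0 z = 0" "b x y 0 = 0"
  by (simp_all add: trilinD[OF assms, THEN linear_add] trilinD[OF assms, THEN linear_diff]
      trilinD[OF assms, THEN linear_neg] trilinD[OF assms, THEN linear_cmul]
      trilinD[OF assms, THEN linear_0])

lemma alt3_trilin: "alt3 b \<Longrightarrow> trilin b"
  by (simp add: alt3_def)

lemma alt3_swap12: "alt3 b \<Longrightarrow> b y x z = - b x y z"
  and alt3_swap23: "alt3 b \<Longrightarrow> b x z y = - b x y z"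
  unfolding alt3_def by blast+

lemma alt3_swap13: "alt3 b \<Longrightarrow> b z y x = - b x y z"
  using alt3_swap12[of b] alt3_swap23[of b] by (metis minus_minus)

lemma Lambda3_alt3: "Lambda3 = {b. alt3 b}"
  by (auto simp: Lambda3_def alt3_def trilin_def)

section \<open>The quaternionic structure\<close>

locale adapted =
  fixes I J K :: "'a::euclidean_space \<Rightarrow> 'a"
  assumes adapted_basis: "adapted_basis I J K"
begin

lemma lin: "linear I" "linear J" "linear K"
  using adapted_basis by (auto simp: adapted_basis_def)

lemmas lin_simps [simp] =
  linear_add[OF lin(1)] linear_add[OF lin(2)] linear_add[OF lin(3)]
  linear_diff[OF lin(1)] linear_diff[OF lin(2)] linear_diff[OF lin(3)]
  linear_neg[OF lin(1)] linear_neg[OF lin(2)] linear_neg[OF lin(3)]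
  linear_cmul[OF lin(1)] linear_cmul[OF lin(2)] linear_cmul[OF lin(3)]
  linear_0[OF lin(1)] linear_0[OF lin(2)] linear_0[OF lin(3)]

lemma quat_mult [simp]:
  "I (I x) = - x" "J (J x) = - x" "K (K x) = - x"
  "I (J x) = K x" "J (I x) = - K x" "J (K x) = I x"
  "K (J x) = - I x" "K (I x) = J x" "I (K x) = - J x"
proof -
  have *: "I (I x) = - x" "J (J x) = - x" "K x = I (J x)" "K x = - J (I x)" for x
    using adapted_basis unfolding adapted_basis_def by blast+
  show "I (I x) = - x" "J (J x) = - x" using * by auto
  show ij: "I (J x) = K x" for x using *(3) by simp
  show ji: "J (I x) = - K x" for x using *(4)[of x] by simp
  show ik: "I (K x) = - J x" for x using *(3)[of x] *(1) by simp
  show jk: "J (K x) = I x" for x using *(4)[of x] *(2) by simp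
  show "K (K x) = - x" using *(3)[of "K x"] jk *(1) by simp
  show "K (J x) = - I x" using *(3)[of "J x"] *(2) by simp
  show "K (I x) = J x" using *(3)[of "I x"] ji ik by simp
qed

lemma inner_left [simp]:
  "I x \<bullet> y = - (x \<bullet> I y)" "J x \<bullet> y = - (x \<bullet> J y)" "K x \<bullet> y = - (x \<bullet> K y)"
proof -
  have *: "I x \<bullet> I y = x \<bullet> y" "J x \<bullet> J y = x \<bullet> y" "K x \<bullet> K y = x \<bullet> y" for x y
    using adapted_basis unfolding adapted_basis_def by blast+
  show "I x \<bullet> y = - (x \<bullet> I y)" using *(1)[of x "I y"] by simp
  show "J x \<bullet> y = - (x \<bullet> J y)" using *(2)[of x "J y"] by simp
  show "K x \<bullet> y = - (x \<bullet> K y)" using *(3)[of x "K y"] by simp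
qed

lemma inner_self [simp]: "x \<bullet> I x = 0" "x \<bullet> J x = 0" "x \<bullet> K x = 0"
  using inner_left[of x x] by (simp_all add: inner_commute)

lemma inner_flip: "y \<bullet> I x = - (x \<bullet> I y)" "y \<bullet> J x = - (x \<bullet> J y)" "y \<bullet> K x = - (x \<bullet> K y)"
  by (metis inner_left inner_commute)+

text \<open>The signs of the slot operators cancel in every product of two, so none appear. The
  values lie in an arbitrary real vector space because the same operator acts later on complex
  forms.\<close>

definition Lq :: "('a \<Rightarrow> 'a \<Rightarrow> 'a \<Rightarrow> 'b::real_vector) \<Rightarrow> 'a \<Rightarrow> 'a \<Rightarrow> 'a \<Rightarrow> 'b" where
  "Lq b x y z = b (I x) (I y) z + b (I x) y (I z) + b x (I y) (I z) +
     (b (J x) (J y) z + b (J x) y (J z) + b x (J y) (J z)) +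
     (b (K x) (K y) z + b (K x) y (K z) + b x (K y) (K z))"

lemma L_op_eq: "L_op I J K b = Lq b"
  by (auto simp: fun_eq_iff L_op_def pair_op_def add3_def slot1_def slot2_def slot3_def Lq_def)

lemma pair_op_apply: "pair_op A b x y z = b (A x) (A y) z + b (A x) y (A z) + b x (A y) (A z)"
  by (auto simp: pair_op_def add3_def slot1_def slot2_def slot3_def)

lemma L23_op_apply: "L23_op I J K b x y z = b x (I y) (I z) + b x (J y) (J z) + b x (K y) (K z)"
  by (auto simp: L23_op_def add3_def slot1_def slot2_def slot3_def)

text \<open>The sum of the three transpositions on \<open>H \<otimes> H \<otimes> H\<close> has only
  the eigenvalues 3 and 0, since a two-dimensional space has no alternating tensors of degree 3.
  Hence \<open>L\<close> is diagonalizable on all trilinear forms, alternating or not.\<close>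

lemma Lq_Lq: "trilin b \<Longrightarrow> Lq (Lq b) x y z = 9 *\<^sub>R b x y z"
  by (simp add: Lq_def trilin_simps scaleR_numerals algebra_simps)

text \<open>On \<open>H\<otimes>H\<otimes>H\<close> the operator \<open>L\<close> is \<open>-3\<close> on \<open>S\<^sup>3H\<close> and \<open>3\<close> on the two copies of \<open>H\<close>; the next two
  identities say that \<open>L23\<close> is \<open>-1\<close> on the former and each \<open>pair_op A\<close> is \<open>1\<close> on the latter.\<close>

lemma pair_of_Lq3:
  assumes "trilin b" and "\<And>x y z. Lq b x y z = 3 *\<^sub>R b x y z" and "A \<in> {I, J, K}"
  shows "b (A x) (A y) z + b (A x) y (A z) + b x (A y) (A z) = b x y z"
proof -
  let ?p = "\<lambda>b. b (A x) (A y) z + b (A x) y (A z) + b x (A y) (A z) - b x y z"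
  \<comment> \<open>\<open>L + 3\<close> maps any form into the eigenspace of 3, so the identity is
    checked formally for that image; on the given \<open>b\<close> the operator \<open>L + 3\<close>
    is multiplication by 6.\<close>
  have "?p (\<lambda>x y z. Lq b x y z + 3 *\<^sub>R b x y z) = 0"
    using assms(3) by (auto simp: Lq_def trilin_simps[OF assms(1)] scaleR_numerals algebra_simps)
  then have "6 *\<^sub>R ?p b = 0"
    by (simp add: assms(2) algebra_simps scaleR_left_distrib[symmetric])
  then show ?thesis by simp
qed

lemma Lq23_of_Lq_minus3:
  assumes "trilin b" and "\<And>x y z. Lq b x y z = - 3 *\<^sub>R b x y z"
  shows "b x (I y) (I z) + b x (J y) (J z) + b x (K y) (K z) = - b x y z"
proof -
  let ?p = "\<lambda>b. b x (I y) (I z) + b x (J y) (J z) + b x (K y) (K z) + b x y z"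
  have "?p (\<lambda>x y z. Lq b x y z - 3 *\<^sub>R b x y z) = 0"
    by (auto simp: Lq_def trilin_simps[OF assms(1)] scaleR_numerals algebra_simps)
  moreover have "Lq b x y z - 3 *\<^sub>R b x y z = - 6 *\<^sub>R b x y z" for x y z
    by (simp only: assms(2) scaleR_left_diff_distrib[symmetric]) simp
  ultimately have "- 6 *\<^sub>R ?p b = 0"
    by (simp only: scaleR_right_distrib)
  then show ?thesis by (simp add: add_eq_0_iff2)
qed

end

section \<open>Traces over an orthonormal basis\<close>

lemma sum_Basis_linear:
  assumes "linear f"
  shows "(\<Sum>u\<in>Basis. (y \<bullet> u) *\<^sub>R f u) = f (y :: 'a::euclidean_space)"
proof -
  have "f y = f (\<Sum>u\<in>Basis. (y \<bullet> u) *\<^sub>R u)" by (simp add: euclidean_representation)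
  also have "\<dots> = (\<Sum>u\<in>Basis. (y \<bullet> u) *\<^sub>R f u)"
    using assms by (simp add: linear_sum linear_cmul o_def)
  finally show ?thesis ..
qed

text \<open>A resolution of the identity is all that a trace needs. It is applied to the image of
  \<open>Basis\<close> under an orthogonal map and to the family generated by a quaternionic
  frame.\<close>

lemma trace_tight_frame:
  fixes h :: "'a::euclidean_space \<Rightarrow> 'a \<Rightarrow> 'b::real_vector"
  assumes fr: "\<And>x. (\<Sum>i\<in>A. (x \<bullet> a i) *\<^sub>R a i) = x"
    and h: "\<And>y. linear (\<lambda>x. h x y)" "\<And>x. linear (\<lambda>y. h x y)"
  shows "(\<Sum>i\<in>A. h (a i) (a i)) = (\<Sum>u\<in>Basis. h u u)"
proof -
  have e: "h x y = (\<Sum>u\<in>Basis. (y \<bullet> u) *\<^sub>R h x u)" for x y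
    using sum_Basis_linear[OF h(2)] by simp
  have "(\<Sum>i\<in>A. h (a i) (a i)) = (\<Sum>i\<in>A. \<Sum>u\<in>Basis. (a i \<bullet> u) *\<^sub>R h (a i) u)"
    by (subst e) simp
  also have "\<dots> = (\<Sum>u\<in>Basis. \<Sum>i\<in>A. (u \<bullet> a i) *\<^sub>R h (a i) u)"
    by (subst sum.swap) (simp add: inner_commute)
  also have "\<dots> = (\<Sum>u\<in>Basis. h (\<Sum>i\<in>A. (u \<bullet> a i) *\<^sub>R a i) u)"
    by (simp add: linear_sum[OF h(1)] linear_cmul[OF h(1)])
  finally show ?thesis by (simp add: fr)
qed

lemma trace_orthogonal:
  fixes h :: "'a::euclidean_space \<Rightarrow> 'a \<Rightarrow> 'b::real_vector"
  assumes T: "orthogonal_transformation (T :: 'a \<Rightarrow> 'a)"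
    and h: "\<And>y. linear (\<lambda>x. h x y)" "\<And>x. linear (\<lambda>y. h x y)"
  shows "(\<Sum>u\<in>Basis. h (T u) (T u)) = (\<Sum>u\<in>Basis. h u u)"
proof (rule trace_tight_frame[OF _ h])
  fix x
  obtain y where y: "x = T y"
    using orthogonal_transformation_surj[OF T] by (metis surjD)
  have "(\<Sum>u\<in>Basis. (T y \<bullet> T u) *\<^sub>R T u) = T y"
    using sum_Basis_linear[OF orthogonal_transformation_linear[OF T], of y] T
    by (simp add: orthogonal_transformation_def)
  then show "(\<Sum>u\<in>Basis. (x \<bullet> T u) *\<^sub>R T u) = x" by (simp add: y)
qed

text \<open>For real forms this is \<open>contr\<close> up to a factor and the substitution of
  \<open>A x\<close> for \<open>x\<close>, see \<open>contr_eq\<close>. No product of values occurs,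
  so it also serves complex forms.\<close>

definition ctr :: "('a::euclidean_space \<Rightarrow> 'a) \<Rightarrow> ('a \<Rightarrow> 'a \<Rightarrow> 'a \<Rightarrow> 'b::real_vector) \<Rightarrow> 'a \<Rightarrow> 'b" where
  "ctr A b x = (\<Sum>u\<in>Basis. b x u (A u))"

definition wd :: "('a::euclidean_space \<Rightarrow> 'b::real_vector) \<Rightarrow> ('a \<Rightarrow> 'a) \<Rightarrow> 'a \<Rightarrow> 'a \<Rightarrow> 'a \<Rightarrow> 'b" where
  "wd \<zeta> A x y z = (y \<bullet> A z) *\<^sub>R \<zeta> x - (x \<bullet> A z) *\<^sub>R \<zeta> y + (x \<bullet> A y) *\<^sub>R \<zeta> z"

lemma wedge12_omega: "wedge12 \<zeta> (omega A) = wd \<zeta> A"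
  by (simp add: fun_eq_iff wedge12_def omega_def wd_def)

text \<open>The dimension enters the constants through the trace in the first term: it is
  \<open>- 4 n\<close> for \<open>A = B\<close> and 0 for two different elements of the adapted
  basis.\<close>

lemma ctr_wd:
  assumes \<zeta>: "linear \<zeta>" and skew: "\<And>x y. A x \<bullet> y = - (x \<bullet> A y)" "\<And>x y. B x \<bullet> y = - (x \<bullet> B y)"
    and B: "linear B"
  shows "ctr B (wd \<zeta> A) x = (\<Sum>u\<in>Basis. u \<bullet> A (B u)) *\<^sub>R \<zeta> x - 2 *\<^sub>R \<zeta> (B (A x))"
proof -
  have 1: "(\<Sum>u\<in>Basis. (x \<bullet> A (B u)) *\<^sub>R \<zeta> u) = \<zeta> (B (A x))"
    using sum_Basis_linear[OF \<zeta>, of "B (A x)"] by (simp add: skew)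
  have 2: "(\<Sum>u\<in>Basis. (x \<bullet> A u) *\<^sub>R \<zeta> (B u)) = - \<zeta> (B (A x))"
  proof -
    have "linear (\<lambda>u. \<zeta> (B u))" using linear_compose[OF B \<zeta>] by (simp add: o_def)
    from sum_Basis_linear[OF this, of "A x"] show ?thesis
      by (simp add: skew sum_negf minus_equation_iff[of "sum _ _"] eq_commute)
  qed
  have "ctr B (wd \<zeta> A) x = (\<Sum>u\<in>Basis. (u \<bullet> A (B u)) *\<^sub>R \<zeta> x) -
     (\<Sum>u\<in>Basis. (x \<bullet> A (B u)) *\<^sub>R \<zeta> u) + (\<Sum>u\<in>Basis. (x \<bullet> A u) *\<^sub>R \<zeta> (B u))"
    by (simp add: ctr_def wd_def sum.distrib sum_subtractf)
  then show ?thesis unfolding 1 2 by (simp add: scaleR_sum_left scaleR_2)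
qed

lemma trilin_wd:
  assumes "linear \<zeta>" "linear A" shows "trilin (wd \<zeta> A)"
proof -
  note simps = linear_add[OF assms(1)] linear_add[OF assms(2)] linear_cmul[OF assms(1)]
     linear_cmul[OF assms(2)] inner_add_left inner_add_right scaleR_add_left scaleR_add_right
     scaleR_diff_right
  show ?thesis unfolding trilin_def wd_def
    by (intro conjI allI; rule linearI) (simp_all add: simps)
qed

lemma alt3_wd:
  assumes "linear \<zeta>" "linear A" "\<And>x y. A x \<bullet> y = - (x \<bullet> A y)"
  shows "alt3 (wd \<zeta> A)"
proof -
  have sk: "y \<bullet> A x = - (x \<bullet> A y)" for x y by (metis assms(3) inner_commute)
  have "wd \<zeta> A y x z = - wd \<zeta> A x y z" "wd \<zeta> A x z y = - wd \<zeta> A x y z" for x y z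
    unfolding wd_def using sk[of x y] sk[of y z] by simp_all
  then show ?thesis using trilin_wd[OF assms(1,2)] unfolding alt3_def by blast
qed

lemma trilin_add:
  assumes "trilin b" "trilin c" shows "trilin (\<lambda>x y z. b x y z + c x y z)"
  using assms by (simp add: trilin_def linear_compose_add)

lemma alt3_add:
  assumes "alt3 b" "alt3 c" shows "alt3 (\<lambda>x y z. b x y z + c x y z)"
  unfolding alt3_def
proof (intro conjI allI)
  show "b y x z + c y x z = - (b x y z + c x y z)" for x y z
    by (simp add: alt3_swap12[OF assms(1), of y x] alt3_swap12[OF assms(2), of y x])
  show "b x z y + c x z y = - (b x y z + c x y z)" for x y z
    by (simp add: alt3_swap23[OF assms(1), of x z y] alt3_swap23[OF assms(2), of x z y])
qed (rule trilin_add[OF assms[THEN alt3_trilin]])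

lemma trilin_scaleR:
  assumes "trilin b" shows "trilin (\<lambda>x y z. r *\<^sub>R b x y z)"
  using assms by (simp add: trilin_def linear_compose_scale_right)

lemma alt3_scaleR:
  assumes "alt3 b" shows "alt3 (\<lambda>x y z. r *\<^sub>R b x y z)"
  unfolding alt3_def
proof (intro conjI allI)
  show "r *\<^sub>R b y x z = - (r *\<^sub>R b x y z)" for x y z
    by (simp add: alt3_swap12[OF assms(1), of y x])
  show "r *\<^sub>R b x z y = - (r *\<^sub>R b x y z)" for x y z
    by (simp add: alt3_swap23[OF assms(1), of x z y])
qed (rule trilin_scaleR[OF assms[THEN alt3_trilin]])

lemma ctr_add: "ctr A (\<lambda>x y z. b x y z + c x y z) x = ctr A b x + ctr A c x"
  by (simp add: ctr_def sum.distrib)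

lemma ctr_scaleR: "ctr A (\<lambda>x y z. r *\<^sub>R b x y z) x = r *\<^sub>R ctr A b x"
  by (simp add: ctr_def scaleR_sum_right)

lemma linear_ctr: "trilin b \<Longrightarrow> linear (ctr A b)"
  unfolding ctr_def by (intro linear_compose_sum ballI) (simp add: trilinD)

context adapted
begin

lemma orth: "orthogonal_transformation I" "orthogonal_transformation J" "orthogonal_transformation K"
  by (simp_all add: orthogonal_transformation_def lin)

lemma Lq_add: "Lq (\<lambda>x y z. b x y z + c x y z) x y z = Lq b x y z + Lq c x y z"
  by (simp add: Lq_def algebra_simps)

lemma Lq_scaleR: "Lq (\<lambda>x y z. r *\<^sub>R b x y z) x y z = r *\<^sub>R Lq b x y z"
  by (simp add: Lq_def algebra_simps)

lemma alt3_Lq: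
  assumes "alt3 b" shows "alt3 (Lq b)"
proof -
  have t: "trilin b" by (rule alt3_trilin[OF assms])
  have "trilin (Lq b)" unfolding trilin_def
    by (intro conjI allI; rule linearI) (simp_all add: Lq_def trilin_simps[OF t] algebra_simps)
  moreover have "Lq b y x z = - Lq b x y z" "Lq b x z y = - Lq b x y z" for x y z
    by (simp_all add: Lq_def alt3_swap12[OF assms, of _ x] alt3_swap12[OF assms, of _ "I x"]
      alt3_swap12[OF assms, of _ "J x"] alt3_swap12[OF assms, of _ "K x"]
      alt3_swap23[OF assms, of _ _ y] alt3_swap23[OF assms, of _ _ "I y"]
      alt3_swap23[OF assms, of _ _ "J y"] alt3_swap23[OF assms, of _ _ "K y"])
  ultimately show ?thesis unfolding alt3_def by blast
qed

lemma trace_substitution: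
  assumes "\<And>y. linear (\<lambda>x. h x y)" "\<And>x. linear (\<lambda>y. h x y)"
  shows "(\<Sum>u\<in>Basis. h (I u) (I u)) = (\<Sum>u\<in>Basis. h u u)"
    "(\<Sum>u\<in>Basis. h (J u) (J u)) = (\<Sum>u\<in>Basis. h u u)"
    "(\<Sum>u\<in>Basis. h (K u) (K u)) = (\<Sum>u\<in>Basis. h u u)"
  by (rule trace_orthogonal[OF orth(1) assms] trace_orthogonal[OF orth(2) assms]
      trace_orthogonal[OF orth(3) assms]; simp)+

lemma trilin_linear2:
  assumes "trilin b" "linear A" "linear B"
  shows "linear (\<lambda>u. b x (A u) v)" "linear (\<lambda>u. b x v (A u))"
  using linear_compose[OF assms(2) trilinD(2)[OF assms(1)]] linear_compose[OF assms(2) trilinD(3)[OF assms(1)]]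
  by (simp_all add: o_def)

lemma trace_trilin:
  assumes t: "trilin b" and A: "linear A" "linear B"
  shows "(\<Sum>u\<in>Basis. b x (A (I u)) (B (I u))) = (\<Sum>u\<in>Basis. b x (A u) (B u))"
    "(\<Sum>u\<in>Basis. b x (A (J u)) (B (J u))) = (\<Sum>u\<in>Basis. b x (A u) (B u))"
    "(\<Sum>u\<in>Basis. b x (A (K u)) (B (K u))) = (\<Sum>u\<in>Basis. b x (A u) (B u))"
  using trilin_linear2[OF t A(1) A(1)] trilin_linear2[OF t A(2) A(2)]
  by (auto intro!: trace_substitution[of "\<lambda>u v. b x (A u) (B v)"])

text \<open>Contract the identity of \<open>pair_of_Lq3\<close> for one element of the basis with
  the form of another one. As traces are invariant under orthogonal substitutions, two of the three
  terms agree and the third is the negative of the right-hand side. In terms of \<open>contr\<close>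
  the result says that all three contractions coincide.\<close>

lemma ctr_of_Lq3:
  assumes t: "trilin b" and L: "\<And>x y z. Lq b x y z = 3 *\<^sub>R b x y z"
  shows "ctr I b (I x) = ctr J b (J x)" "ctr K b (K x) = ctr J b (J x)"
proof -
  note s = trilin_simps[OF t]
  have cJ: "ctr J b x = ctr K b (I x)" for x
  proof -
    have "(\<Sum>u\<in>Basis. b (I x) (I u) (J u) + b (I x) u (I (J u)) + b x (I u) (I (J u))) = ctr J b x"
      unfolding ctr_def by (intro sum.cong refl, rule pair_of_Lq3[OF t L, of I]) simp
    moreover have "(\<Sum>u\<in>Basis. b (I x) (I u) (J u)) = ctr K b (I x)"
      using trace_trilin(1)[OF t lin(1) lin(2), of "I x"] by (simp add: ctr_def s)
    moreover have "(\<Sum>u\<in>Basis. b x (I u) (K u)) = - ctr J b x"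
      using trace_trilin(1)[OF t lin(1) lin(3), of x] by (simp add: ctr_def s sum_negf)
    ultimately have "2 *\<^sub>R ctr K b (I x) = 2 *\<^sub>R ctr J b x"
      by (simp add: sum.distrib ctr_def scaleR_2 algebra_simps)
    then show ?thesis by simp
  qed
  have cK: "ctr K b x = ctr I b (J x)" for x
  proof -
    have "(\<Sum>u\<in>Basis. b (J x) (J u) (K u) + b (J x) u (J (K u)) + b x (J u) (J (K u))) = ctr K b x"
      unfolding ctr_def by (intro sum.cong refl, rule pair_of_Lq3[OF t L, of J]) simp
    moreover have "(\<Sum>u\<in>Basis. b (J x) (J u) (K u)) = ctr I b (J x)"
      using trace_trilin(2)[OF t lin(2) lin(3), of "J x"] by (simp add: ctr_def s)
    moreover have "(\<Sum>u\<in>Basis. b x (J u) (I u)) = - ctr K b x"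
      using trace_trilin(2)[OF t lin(2) lin(1), of x] by (simp add: ctr_def s sum_negf)
    ultimately have "2 *\<^sub>R ctr I b (J x) = 2 *\<^sub>R ctr K b x"
      by (simp add: sum.distrib ctr_def scaleR_2 algebra_simps)
    then show ?thesis by simp
  qed
  show "ctr K b (K x) = ctr J b (J x)" by (simp add: cJ)
  show "ctr I b (I x) = ctr J b (J x)" using cK[of "K x"] by (simp add: cJ)
qed

text \<open>Contract the identity for \<open>A\<close> acting on the first two slots with the form
  of \<open>I\<close>. The summand \<open>A = I\<close> contains \<open>b x u u\<close> and drops
  out; the other two are contractions with the forms of \<open>K\<close> and \<open>J\<close>.
  Consequently \<xi> vanishes on the eigenspace of \<open>- 3\<close>.\<close>

lemma ctr_of_Lq_minus3:
  assumes a: "alt3 b" and L: "\<And>x y z. Lq b x y z = - 3 *\<^sub>R b x y z"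
  shows "ctr I b (I x) + ctr J b (J x) + ctr K b (K x) = 0"
proof -
  have t: "trilin b" by (rule alt3_trilin[OF a])
  note s = trilin_simps[OF t]
  have X: "b (I x) (I y) z + b (J x) (J y) z + b (K x) (K y) z = - b x y z" for x y z
    using Lq23_of_Lq_minus3[OF t L, of z x y] alt3_swap13[OF a] alt3_swap12[OF a]
    by (metis (no_types, lifting) minus_add_distrib minus_equation_iff)
  have "(\<Sum>u\<in>Basis. b (I x) (I u) (I u) + b (J x) (J u) (I u) + b (K x) (K u) (I u)) = - ctr I b x" for x
    unfolding ctr_def sum_negf[symmetric] by (rule sum.cong) (auto simp: X)
  moreover have "b x u u = 0" for x u
    using alt3_swap23[OF a, of x u u] by (simp add: eq_neg_iff_add_eq_0 flip: scaleR_2)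
  moreover have "(\<Sum>u\<in>Basis. b (J x) (J u) (I u)) = - ctr K b (J x)" for x
    using trace_trilin(2)[OF t lin(2) lin(1), of "J x"] by (simp add: ctr_def s sum_negf)
  moreover have "(\<Sum>u\<in>Basis. b (K x) (K u) (I u)) = ctr J b (K x)" for x
    using trace_trilin(3)[OF t lin(3) lin(1), of "K x"] by (simp add: ctr_def s sum_negf)
  ultimately have "- ctr K b (J x) + ctr J b (K x) = - ctr I b x" for x
    by (simp add: sum.distrib)
  from this[of "I x"] show ?thesis
    by (simp add: linear_neg[OF linear_ctr[OF t]] algebra_simps eq_neg_iff_add_eq_0)
qed

definition WD :: "('a \<Rightarrow> 'b::real_vector) \<Rightarrow> ('a \<Rightarrow> 'b) \<Rightarrow> ('a \<Rightarrow> 'b) \<Rightarrow> 'a \<Rightarrow> 'a \<Rightarrow> 'a \<Rightarrow> 'b" where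
  "WD p q r x y z = wd p I x y z + wd q J x y z + wd r K x y z"

lemma alt3_WD: "linear p \<Longrightarrow> linear q \<Longrightarrow> linear r \<Longrightarrow> alt3 (WD p q r)"
  unfolding WD_def by (intro alt3_add alt3_wd lin) simp_all

lemma Lq_WD_EH:
  assumes "linear \<beta>"
  shows "Lq (WD (\<lambda>x. \<beta> (I x)) (\<lambda>x. \<beta> (J x)) (\<lambda>x. \<beta> (K x))) x y z =
    3 *\<^sub>R WD (\<lambda>x. \<beta> (I x)) (\<lambda>x. \<beta> (J x)) (\<lambda>x. \<beta> (K x)) x y z"
  by (simp add: Lq_def WD_def wd_def linear_neg[OF assms] scaleR_numerals algebra_simps del: scaleR_scaleR)

lemma Lq_WD_ES:
  assumes "linear p" "linear q" "linear r" and "\<And>x. p (I x) + q (J x) + r (K x) = 0"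
  shows "Lq (WD p q r) x y z = - 3 *\<^sub>R WD p q r x y z"
proof -
  \<comment> \<open>The hypothesis at \<open>I x\<close> is solved for \<open>p\<close>; after
    substitution the claim is an identity in the free one-forms \<open>q\<close> and
    \<open>r\<close>.\<close>
  have "p x = r (J x) - q (K x)" for x
    using assms(4)[of "I x"] by (simp add: linear_neg[OF assms(1)] linear_neg[OF assms(2)] linear_neg[OF assms(3)] algebra_simps)
  then have p: "p = (\<lambda>x. r (J x) - q (K x))" by blast
  show ?thesis unfolding p
    by (simp add: Lq_def WD_def wd_def linear_neg[OF assms(3)] linear_neg[OF assms(2)] scaleR_numerals
        algebra_simps del: scaleR_scaleR)
qed

end

locale quaternionic = adapted +
  fixes n :: nat
  assumes dim: "DIM('a) = 4 * n" and n_gt_1: "n > 1"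
begin

lemma ctr_WD:
  assumes "linear p" "linear q" "linear r"
  shows "ctr I (WD p q r) x = (2 - 4 * real n) *\<^sub>R p x - 2 *\<^sub>R q (K x) + 2 *\<^sub>R r (J x)"
    "ctr J (WD p q r) x = (2 - 4 * real n) *\<^sub>R q x - 2 *\<^sub>R r (I x) + 2 *\<^sub>R p (K x)"
    "ctr K (WD p q r) x = (2 - 4 * real n) *\<^sub>R r x - 2 *\<^sub>R p (J x) + 2 *\<^sub>R q (I x)"
  unfolding WD_def using dim
  by (simp_all add: ctr_add ctr_wd assms lin linear_neg[OF assms(1)] linear_neg[OF assms(2)]
      linear_neg[OF assms(3)] sum_negf algebra_simps)

end

section \<open>Models of the four submodules by linear conditions\<close>

context adapted
begin

definition mKH :: "('a \<Rightarrow> 'a \<Rightarrow> 'a \<Rightarrow> 'b::real_vector) \<Rightarrow> bool" where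
  "mKH b \<longleftrightarrow> alt3 b \<and> (\<forall>x y z. Lq b x y z = 3 *\<^sub>R b x y z) \<and> (\<forall>A\<in>{I, J, K}. \<forall>x. ctr A b x = 0)"

definition mLS :: "('a \<Rightarrow> 'a \<Rightarrow> 'a \<Rightarrow> 'b::real_vector) \<Rightarrow> bool" where
  "mLS b \<longleftrightarrow> alt3 b \<and> (\<forall>x y z. Lq b x y z = - 3 *\<^sub>R b x y z) \<and> (\<forall>A\<in>{I, J, K}. \<forall>x. ctr A b x = 0)"

text \<open>A triple of one-forms is an element of
  \<open>V \<otimes> S^2 H = E H \<otimes> S^2 H = E H + E S^3 H\<close>, and \<open>WD\<close> maps
  it to a three-form. \<open>mEH\<close> is the image of the equivariant embedding of V into
  triples, and \<open>mES\<close> that of the kernel of the equivariant contraction of triples to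
  V.\<close>

definition mEH :: "('a \<Rightarrow> 'a \<Rightarrow> 'a \<Rightarrow> 'b::real_vector) \<Rightarrow> bool" where
  "mEH b \<longleftrightarrow> (\<exists>\<beta>. linear \<beta> \<and> b = WD (\<lambda>x. \<beta> (I x)) (\<lambda>x. \<beta> (J x)) (\<lambda>x. \<beta> (K x)))"

definition mES :: "('a \<Rightarrow> 'a \<Rightarrow> 'a \<Rightarrow> 'b::real_vector) \<Rightarrow> bool" where
  "mES b \<longleftrightarrow> (\<exists>p q r. linear p \<and> linear q \<and> linear r \<and>
     (\<forall>x. p (I x) + q (J x) + r (K x) = 0) \<and> b = WD p q r)"

lemma linear_comp_IJK: "linear f \<Longrightarrow> linear (\<lambda>x. f (I x))" "linear f \<Longrightarrow> linear (\<lambda>x. f (J x))"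
  "linear f \<Longrightarrow> linear (\<lambda>x. f (K x))"
  using linear_compose[OF lin(1)] linear_compose[OF lin(2)] linear_compose[OF lin(3)]
  by (auto simp: o_def)

lemma mKH_alt3: "mKH b \<Longrightarrow> alt3 b" by (simp add: mKH_def)
lemma mLS_alt3: "mLS b \<Longrightarrow> alt3 b" by (simp add: mLS_def)
lemma mEH_alt3: "mEH b \<Longrightarrow> alt3 b" by (auto simp: mEH_def intro!: alt3_WD linear_comp_IJK)
lemma mES_alt3: "mES b \<Longrightarrow> alt3 b" by (auto simp: mES_def intro!: alt3_WD)

lemma mKH_Lq: "mKH b \<Longrightarrow> Lq b x y z = 3 *\<^sub>R b x y z" by (simp add: mKH_def)
lemma mLS_Lq: "mLS b \<Longrightarrow> Lq b x y z = - 3 *\<^sub>R b x y z" by (simp add: mLS_def)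
lemma mEH_Lq: "mEH b \<Longrightarrow> Lq b x y z = 3 *\<^sub>R b x y z" by (auto simp: mEH_def Lq_WD_EH)
lemma mES_Lq: "mES b \<Longrightarrow> Lq b x y z = - 3 *\<^sub>R b x y z" by (auto simp: mES_def Lq_WD_ES)

lemma contr_eq:
  assumes t: "trilin b" and A: "A \<in> {I, J, K}"
  shows "contr A b x = - ctr A b (A x) / 2"
proof -
  have sk: "A u \<bullet> v = - (u \<bullet> A v)" for u v using A by auto
  have "(\<Sum>u\<in>Basis. \<Sum>v\<in>Basis. b (A x) u v * (u \<bullet> A v)) = (\<Sum>v\<in>Basis. \<Sum>u\<in>Basis. (A v \<bullet> u) *\<^sub>R b (A x) u v)"
    by (subst sum.swap) (simp add: inner_commute mult.commute)
  also have "\<dots> = (\<Sum>v\<in>Basis. b (A x) (A v) v)"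
    by (simp only: sum_Basis_linear[OF trilinD(2)[OF t]])
  also have "\<dots> = - ctr A b (A x)"
  proof -
    have "(\<Sum>v\<in>Basis. b (A x) (A (A v)) (A v)) = (\<Sum>v\<in>Basis. b (A x) (A v) v)"
      using A trace_trilin[OF t _ linear_ident, of A "A x"] lin by auto
    moreover have "A (A v) = - v" for v using A by auto
    ultimately show ?thesis by (simp add: ctr_def trilin_simps[OF t] sum_negf)
  qed
  finally show ?thesis by (simp add: contr_def inner2_def omega_def)
qed

lemma contr_add: "contr A (\<lambda>x y z. b x y z + c x y z) x = contr A b x + contr A c x"
  by (simp add: contr_def inner2_def sum.distrib algebra_simps)

lemma contr_scale: "contr A (\<lambda>x y z. r * b x y z) x = r * contr A b x"
  by (simp add: contr_def inner2_def sum_distrib_left algebra_simps)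

lemma contr_zero: "contr A (\<lambda>x y z. 0) x = 0"
  by (simp add: contr_def inner2_def)

lemma ctr_zero_iff:
  assumes t: "trilin b" and A: "A \<in> {I, J, K}"
  shows "(\<forall>x. ctr A b x = 0) \<longleftrightarrow> (\<forall>x. contr A b x = 0)"
proof -
  have "A (- A x) = x" for x using A by auto
  then show ?thesis unfolding contr_eq[OF t A]
    by (metis div_0 divide_eq_0_iff neg_equal_0_iff_equal zero_neq_numeral)
qed

lemma linear_contr:
  assumes t: "trilin b" and A: "A \<in> {I, J, K}"
  shows "linear (contr A b)"
proof -
  have "linear (\<lambda>x. - ctr A b (A x) / 2)"
    using linear_compose_scale_right[of "\<lambda>x. ctr A b (A x)" "-1/2"]
      linear_comp_IJK[OF linear_ctr[OF t, of A]] A by auto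
  then show ?thesis by (simp add: contr_eq[OF t A, abs_def])
qed

end

section \<open>The one-forms \<xi> and the projections onto the four models\<close>

context quaternionic
begin

abbreviation "\<xi> \<equiv> xi I J K n"
abbreviation "\<xi>A \<equiv> xiA I J K n"

lemma linear_xi:
  assumes "trilin b" shows "linear (\<xi> b)"
proof -
  have "linear (\<lambda>x. contr I b x + contr J b x + contr K b x)"
    using linear_contr[OF assms] by (intro linear_compose_add) simp_all
  from linear_compose_scale_right[OF this, of "- 1 / (6 * (2 * real n + 1))"]
  show ?thesis unfolding xi_def[abs_def] real_scaleR_def .
qed

lemma linear_xiA:
  assumes "trilin b" "A \<in> {I, J, K}"
  shows "linear (\<xi>A A b)"
proof -
  have "linear (\<lambda>x. (- 3 / (2 * (real n - 1))) *\<^sub>R \<xi> b x - (1 / (4 * (real n - 1))) *\<^sub>R contr A b x)"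
    by (intro linear_compose_sub linear_compose_scale_right linear_xi linear_contr assms)
  then show ?thesis unfolding xiA_def[abs_def] real_scaleR_def .
qed

text \<open>Contracting the square of a two-form with a vector gives twice the resulting one-form
  wedged with the two-form, so \<open>xi_Omega\<close> has the diagonal shape required by
  \<open>mEH\<close>.\<close>

lemma xi_Omega_eq:
  assumes t: "trilin b"
  shows "xi_Omega I J K n b = WD (\<lambda>x. 2 * \<xi> b (I x)) (\<lambda>x. 2 * \<xi> b (J x)) (\<lambda>x. 2 * \<xi> b (K x))"
proof -
  have s: "sharp (\<xi> b) \<bullet> y = \<xi> b y" for y
    unfolding sum_Basis_linear[OF linear_xi[OF t], of y, symmetric]
    by (simp add: sharp_def inner_sum_left inner_commute[of y] mult.commute)
  show ?thesis
    by (simp add: fun_eq_iff xi_Omega_def Omega4_def wedge22_def omega_def WD_def wd_def s algebra_simps)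
qed

lemma xi_omega_eq:
  "-2 * xi_omega I J K n b x y z =
    WD (\<lambda>x. 2 * \<xi>A I b (I x)) (\<lambda>x. 2 * \<xi>A J b (J x)) (\<lambda>x. 2 * \<xi>A K b (K x)) x y z"
  by (simp add: xi_omega_def add3_def WD_def wedge12_omega actA_def wd_def algebra_simps)

text \<open>This is the origin of the constants in \<open>xi\<close> and \<open>xiA\<close>. For the
  diagonal triple of \<beta> the bracket is \<open>- 3 \<beta>\<close> and each contraction is
  \<open>- (2 n + 1) \<beta>\<close>; for a triple from \<open>mES\<close> the bracket vanishes and
  only the factor \<open>2 n - 2\<close> is left, which is nonzero as \<open>n > 1\<close>.\<close>

lemma contr_WD:
  assumes "linear p" "linear q" "linear r"
  shows "contr I (WD p q r) x = (2 * real n - 2) * p (I x) + (p (I x) + q (J x) + r (K x))"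
    "contr J (WD p q r) x = (2 * real n - 2) * q (J x) + (p (I x) + q (J x) + r (K x))"
    "contr K (WD p q r) x = (2 * real n - 2) * r (K x) + (p (I x) + q (J x) + r (K x))"
  by (simp_all add: contr_eq[OF alt3_trilin[OF alt3_WD[OF assms]]] ctr_WD[OF assms] linear_neg[OF assms(1)] linear_neg[OF assms(2)] linear_neg[OF assms(3)] field_simps)

lemma contr_of_Lq3:
  assumes "trilin b" and "\<And>x y z. Lq b x y z = 3 *\<^sub>R b x y z" "A \<in> {I, J, K}"
  shows "contr A b x = - (4 * real n + 2) * \<xi> b x"
proof -
  have "2 * real n + 1 \<noteq> 0" by linarith
  moreover have "contr I b x = contr J b x" "contr K b x = contr J b x"
    using ctr_of_Lq3[OF assms(1,2), of x] contr_eq[OF assms(1)] by simp_all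
  ultimately show ?thesis using assms(3) by (auto simp: xi_def field_simps)
qed

lemma xi_of_Lq_minus3:
  assumes "alt3 b" and "\<And>x y z. Lq b x y z = - 3 *\<^sub>R b x y z"
  shows "\<xi> b x = 0"
  using ctr_of_Lq_minus3[OF assms, of x]
  by (simp add: xi_def contr_eq[OF alt3_trilin[OF assms(1)]] field_simps)

text \<open>The indices 0, 1, 2, 3 stand for KH, EH, \<Lambda>_0^3 E S^3 H and E S^3 H. From the
  eigenprojections \<open>(3 + L) / 6\<close> and \<open>(3 - L) / 6\<close> the trace parts
  \<open>P 1\<close> and \<open>P 3\<close> are removed, so the four add up to the identity by
  construction.\<close>

definition P :: "nat \<Rightarrow> 'a form3 \<Rightarrow> 'a form3" where
  "P i b = (\<lambda>x y z.
     if i = 0 then (Lq b x y z + 3 * b x y z) / 6 - xi_Omega I J K n b x y z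
     else if i = 1 then xi_Omega I J K n b x y z
     else if i = 2 then (3 * b x y z - Lq b x y z) / 6 + 2 * xi_omega I J K n b x y z + xi_Omega I J K n b x y z
     else - 2 * xi_omega I J K n b x y z - xi_Omega I J K n b x y z)"

lemma P_sum: "P 0 b x y z + P 1 b x y z + P 2 b x y z + P 3 b x y z = b x y z"
  by (simp add: P_def field_simps)

lemma P1_mEH: assumes t: "trilin b" shows "mEH (P 1 b)"
proof -
  have "P 1 b = WD (\<lambda>x. (\<lambda>x. 2 * \<xi> b x) (I x)) (\<lambda>x. (\<lambda>x. 2 * \<xi> b x) (J x)) (\<lambda>x. (\<lambda>x. 2 * \<xi> b x) (K x))"
    by (simp add: P_def xi_Omega_eq[OF t])
  then show ?thesis unfolding mEH_def using linear_compose_scale_right[OF linear_xi[OF t], of 2] by auto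
qed

text \<open>As \<xi> is the mean of the three one-forms, their differences from \<xi> satisfy the
  relation that defines \<open>mES\<close>.\<close>

lemma sum_xiA: "\<xi>A I b x + \<xi>A J b x + \<xi>A K b x = 3 * \<xi> b x"
proof -
  have "real n - 1 \<noteq> 0" "2 * real n + 1 \<noteq> 0" using n_gt_1 by auto
  then show ?thesis by (simp add: xiA_def xi_def divide_simps) (simp add: algebra_simps)
qed

lemma contr_xiA: "contr A b x = - (4 * (real n - 1)) * \<xi>A A b x - 6 * \<xi> b x"
proof -
  have "real n - 1 \<noteq> 0" using n_gt_1 by auto
  then show ?thesis by (simp add: xiA_def divide_simps) (simp add: algebra_simps)
qed

lemma P3_WD:
  assumes t: "trilin b"
  shows "P 3 b = WD (\<lambda>x. 2 * (\<xi>A I b (I x) - \<xi> b (I x))) (\<lambda>x. 2 * (\<xi>A J b (J x) - \<xi> b (J x)))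
     (\<lambda>x. 2 * (\<xi>A K b (K x) - \<xi> b (K x)))"
proof (intro ext)
  fix x y z
  show "P 3 b x y z = WD (\<lambda>x. 2 * (\<xi>A I b (I x) - \<xi> b (I x))) (\<lambda>x. 2 * (\<xi>A J b (J x) - \<xi> b (J x)))
     (\<lambda>x. 2 * (\<xi>A K b (K x) - \<xi> b (K x))) x y z"
    using xi_omega_eq[of b x y z] by (simp add: P_def xi_Omega_eq[OF t] WD_def wd_def algebra_simps)
qed

lemma linear_P3:
  assumes t: "trilin b" and A: "A \<in> {I, J, K}"
  shows "linear (\<lambda>x. 2 * (\<xi>A A b (A x) - \<xi> b (A x)))"
proof -
  have l: "linear (\<lambda>x. 2 * (\<xi>A A b x - \<xi> b x))"
    using linear_compose_scale_right[OF linear_compose_sub[OF linear_xiA[OF t A] linear_xi[OF t]], of 2]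
    by simp
  show ?thesis
    using A linear_comp_IJK[OF l] by (elim insertE emptyE) (simp_all only:)
qed

lemma P3_mES:
  assumes t: "trilin b" shows "mES (P 3 b)"
  unfolding mES_def
proof (intro exI conjI allI)
  show "P 3 b = WD (\<lambda>x. 2 * (\<xi>A I b (I x) - \<xi> b (I x))) (\<lambda>x. 2 * (\<xi>A J b (J x) - \<xi> b (J x)))
     (\<lambda>x. 2 * (\<xi>A K b (K x) - \<xi> b (K x)))" by (rule P3_WD[OF t])
  show "2 * (\<xi>A I b (I (I x)) - \<xi> b (I (I x))) + 2 * (\<xi>A J b (J (J x)) - \<xi> b (J (J x))) +
      2 * (\<xi>A K b (K (K x)) - \<xi> b (K (K x))) = 0" for x
    using sum_xiA[of b "- x"] by simp
qed (use linear_P3[OF t] in auto)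

lemma contr_P1:
  assumes t: "trilin b" and A: "A \<in> {I, J, K}"
  shows "contr A (P 1 b) x = - (4 * real n + 2) * \<xi> b x"
proof -
  have l: "linear (\<lambda>x. 2 * \<xi> b x)" using linear_compose_scale_right[OF linear_xi[OF t], of 2] by simp
  show ?thesis using A
    by (auto simp: P_def xi_Omega_eq[OF t] contr_WD linear_comp_IJK[OF l] linear_neg[OF linear_xi[OF t]] field_simps)
qed

lemma contr_P3:
  assumes t: "trilin b" and A: "A \<in> {I, J, K}"
  shows "contr A (P 3 b) x = contr A b x + (4 * real n + 2) * \<xi> b x"
proof -
  have s: "\<xi>A I b x = 3 * \<xi> b x - \<xi>A J b x - \<xi>A K b x" for x
    using sum_xiA[of b x] by simp
  note l = linear_P3[OF t, of I] linear_P3[OF t, of J] linear_P3[OF t, of K]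
  note neg = linear_neg[OF linear_xi[OF t]] linear_neg[OF linear_xiA[OF t, of I]]
     linear_neg[OF linear_xiA[OF t, of J]] linear_neg[OF linear_xiA[OF t, of K]]
  have "contr I (P 3 b) x = contr I b x + (4 * real n + 2) * \<xi> b x"
    "contr J (P 3 b) x = contr J b x + (4 * real n + 2) * \<xi> b x"
    "contr K (P 3 b) x = contr K b x + (4 * real n + 2) * \<xi> b x"
    unfolding P3_WD[OF t] contr_xiA[of _ b] using l
    by (simp_all add: contr_WD neg s[of x] algebra_simps)
  then show ?thesis using A by (elim insertE emptyE) (simp_all only:)
qed

lemma xi_add: "\<xi> (\<lambda>x y z. b x y z + c x y z) x = \<xi> b x + \<xi> c x"
  by (simp only: xi_def contr_add distrib_left add_ac)

text \<open>What has to be seen is that removing the trace parts removes all contractions. On the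
  3-eigenpart every contraction is the same multiple of \<xi> as for \<open>P 1 b\<close>, and \<xi>
  does not see the other eigenpart; the contractions of \<open>P 3 b\<close> are exactly what
  remains.\<close>

lemma P_mKH_mLS:
  assumes a: "alt3 b" shows "mKH (P 0 b)" "mLS (P 2 b)"
proof -
  have t: "trilin b" by (rule alt3_trilin[OF a])
  define p where "p = (\<lambda>x y z. (1/6) *\<^sub>R (Lq b x y z + 3 *\<^sub>R b x y z))"
  define m where "m = (\<lambda>x y z. (1/6) *\<^sub>R (3 *\<^sub>R b x y z + (-1) *\<^sub>R Lq b x y z))"
  have ap: "alt3 p" and am: "alt3 m"
    unfolding p_def m_def by (intro alt3_scaleR alt3_add alt3_Lq a)+
  have Lp: "Lq p x y z = 3 *\<^sub>R p x y z" for x y z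
    unfolding p_def Lq_scaleR Lq_add Lq_Lq[OF t] by (simp add: field_simps)
  have Lm: "Lq m x y z = - 3 *\<^sub>R m x y z" for x y z
    unfolding m_def Lq_scaleR Lq_add Lq_Lq[OF t] by (simp add: field_simps)
  have "b = (\<lambda>x y z. p x y z + m x y z)" by (simp add: p_def m_def fun_eq_iff field_simps)
  then have cb: "contr A b x = contr A p x + contr A m x" and xb: "\<xi> b x = \<xi> p x + \<xi> m x" for A x
    using contr_add[of A p m x] xi_add[of p m x] by auto
  have xm: "\<xi> m x = 0" for x by (rule xi_of_Lq_minus3[OF am Lm])
  have P0: "P 0 b = (\<lambda>x y z. p x y z + (-1) *\<^sub>R P 1 b x y z)"
    by (simp add: P_def p_def fun_eq_iff field_simps)
  have P2: "P 2 b = (\<lambda>x y z. m x y z + (-1) *\<^sub>R P 3 b x y z)"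
    by (simp add: P_def m_def fun_eq_iff field_simps)
  have a0: "alt3 (P 0 b)" unfolding P0 by (intro alt3_add alt3_scaleR ap mEH_alt3 P1_mEH t)
  have a2: "alt3 (P 2 b)" unfolding P2 by (intro alt3_add alt3_scaleR am mES_alt3 P3_mES t)
  have "contr A (P 0 b) x = 0" if "A \<in> {I, J, K}" for A x
    unfolding P0 contr_add real_scaleR_def contr_scale contr_P1[OF t that] contr_of_Lq3[OF alt3_trilin[OF ap] Lp that]
    by (simp add: xb xm algebra_simps)
  moreover have "Lq (P 0 b) x y z = 3 *\<^sub>R P 0 b x y z" for x y z
    unfolding P0 Lq_add Lq_scaleR Lp mEH_Lq[OF P1_mEH[OF t]] by (simp add: algebra_simps)
  ultimately show "mKH (P 0 b)" using a0 ctr_zero_iff[OF alt3_trilin[OF a0]] by (simp add: mKH_def)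
  have "contr A (P 2 b) x = 0" if "A \<in> {I, J, K}" for A x
    unfolding P2 contr_add real_scaleR_def contr_scale contr_P3[OF t that] cb contr_of_Lq3[OF alt3_trilin[OF ap] Lp that]
    by (simp add: xb xm algebra_simps)
  moreover have "Lq (P 2 b) x y z = - 3 *\<^sub>R P 2 b x y z" for x y z
    unfolding P2 Lq_add Lq_scaleR Lm mES_Lq[OF P3_mES[OF t]] by (simp add: algebra_simps)
  ultimately show "mLS (P 2 b)" using a2 ctr_zero_iff[OF alt3_trilin[OF a2]] by (simp add: mLS_def)
qed

text \<open>Only the trace parts contribute to the contractions. Therefore \<xi> recovers \<beta>
  and the differences \<open>\<xi>A - \<xi>\<close> recover \<open>p\<close>, \<open>q\<close>,
  \<open>r\<close>; this fixes \<open>P 1 b\<close> and \<open>P 3 b\<close>, and the eigenvalues of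
  \<open>L\<close> fix the other two.\<close>

lemma P_unique:
  assumes k: "mKH k" and e: "mEH e" and l: "mLS l" and s: "mES s"
    and b: "b = (\<lambda>x y z. k x y z + e x y z + l x y z + s x y z)"
  shows "P 0 b = k" "P 1 b = e" "P 2 b = l" "P 3 b = s"
proof -
  note t = mKH_alt3[OF k, THEN alt3_trilin] mEH_alt3[OF e, THEN alt3_trilin]
     mLS_alt3[OF l, THEN alt3_trilin] mES_alt3[OF s, THEN alt3_trilin]
  have tb: "trilin b" unfolding b by (intro trilin_add t)
  have n: "real n - 1 \<noteq> 0" "2 * real n + 1 \<noteq> 0" using n_gt_1 by auto
  have z: "contr A k x = 0" "contr A l x = 0" if "A \<in> {I, J, K}" for A x
    using ctr_zero_iff[OF t(1) that] ctr_zero_iff[OF t(3) that] k l that unfolding mKH_def mLS_def by blast+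
  obtain \<beta> where \<beta>: "linear \<beta>" and e': "e = WD (\<lambda>x. \<beta> (I x)) (\<lambda>x. \<beta> (J x)) (\<lambda>x. \<beta> (K x))"
    using e unfolding mEH_def by blast
  obtain p q r where pqr: "linear p" "linear q" "linear r" and \<sigma>: "\<And>x. p (I x) + q (J x) + r (K x) = 0"
    and s': "s = WD p q r" using s unfolding mES_def by blast
  have ce: "contr A e x = - (2 * real n + 1) * \<beta> x" if "A \<in> {I, J, K}" for A x
    using that by (auto simp: e' contr_WD linear_comp_IJK \<beta> linear_neg[OF \<beta>] algebra_simps)
  have cs: "contr I s x = (2 * real n - 2) * p (I x)" "contr J s x = (2 * real n - 2) * q (J x)"
     "contr K s x = (2 * real n - 2) * r (K x)" for x
    by (simp_all add: s' contr_WD pqr \<sigma>)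
  have cb: "contr A b x = contr A e x + contr A s x" if "A \<in> {I, J, K}" for A x
    unfolding b contr_add z[OF that] by simp
  have X: "\<xi> b x = \<beta> x / 2" for x
  proof -
    have "contr I b x + contr J b x + contr K b x = - 3 * (2 * real n + 1) * \<beta> x + (2 * real n - 2) * (p (I x) + q (J x) + r (K x))"
      by (simp add: cb ce cs algebra_simps)
    then have *: "contr I b x + contr J b x + contr K b x = - 3 * (2 * real n + 1) * \<beta> x"
      unfolding \<sigma> by simp
    show ?thesis unfolding xi_def * using n(2) by (simp add: field_simps)
  qed
  show P1: "P 1 b = e"
    by (simp add: P_def xi_Omega_eq[OF tb] X e')
  have xAs: "\<xi>A I b x = (\<beta> x - p (I x)) / 2" "\<xi>A J b x = (\<beta> x - q (J x)) / 2"
    "\<xi>A K b x = (\<beta> x - r (K x)) / 2" for x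
  proof -
    define m where "m = real n - 1"
    then have m: "real n = m + 1" and "m \<noteq> 0" using n(1) by simp_all
    then show "\<xi>A I b x = (\<beta> x - p (I x)) / 2" "\<xi>A J b x = (\<beta> x - q (J x)) / 2"
      "\<xi>A K b x = (\<beta> x - r (K x)) / 2"
      unfolding xiA_def X by (simp_all add: cb ce cs m field_simps)
  qed
  show P3: "P 3 b = s"
    unfolding P3_WD[OF tb] X xAs s'
    by (simp add: linear_neg[OF pqr(1)] linear_neg[OF pqr(2)] linear_neg[OF pqr(3)] diff_divide_distrib
        add_divide_distrib)
  have Lb: "Lq b x y z = 3 * k x y z + 3 * e x y z - 3 * l x y z - 3 * s x y z" for x y z
    unfolding b Lq_add mKH_Lq[OF k] mEH_Lq[OF e] mLS_Lq[OF l] mES_Lq[OF s] by simp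
  show "P 0 b = k"
  proof (intro ext)
    fix x y z
    show "P 0 b x y z = k x y z" using fun_cong[OF fun_cong[OF fun_cong[OF P1]], of x y z]
      unfolding P_def Lb by (simp add: b field_simps)
  qed
  show "P 2 b = l"
  proof (intro ext)
    fix x y z
    show "P 2 b x y z = l x y z" using fun_cong[OF fun_cong[OF fun_cong[OF P3]], of x y z]
      unfolding P_def Lb by (simp add: b field_simps)
  qed
qed

lemma P_add:
  assumes "alt3 b" "alt3 c"
  shows "P i (\<lambda>x y z. b x y z + c x y z) x y z = P i b x y z + P i c x y z"
proof -
  note t = assms[THEN alt3_trilin] trilin_add[OF assms[THEN alt3_trilin]]
  have xA: "\<xi>A A (\<lambda>x y z. b x y z + c x y z) x = \<xi>A A b x + \<xi>A A c x" for A x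
    unfolding xiA_def xi_add contr_add distrib_left by (simp only: algebra_simps)
  have 1: "xi_Omega I J K n (\<lambda>x y z. b x y z + c x y z) x y z = xi_Omega I J K n b x y z + xi_Omega I J K n c x y z"
    by (simp add: xi_Omega_eq t xi_add WD_def wd_def algebra_simps)
  have 2: "xi_omega I J K n (\<lambda>x y z. b x y z + c x y z) x y z = xi_omega I J K n b x y z + xi_omega I J K n c x y z"
    by (simp add: xi_omega_def add3_def wedge12_omega actA_def wd_def xA algebra_simps)
  show ?thesis unfolding P_def Lq_add 1 2 by (simp add: field_simps)
qed

section \<open>The sixteen submodules and their criteria\<close>

definition "mods i b \<longleftrightarrow> (if i = 0 then mKH b else if i = 1 then mEH b else if i = 2 then mLS b else mES b)"

lemma P_mods: "alt3 b \<Longrightarrow> mods i (P i b)"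
  using P_mKH_mLS[of b] P1_mEH[of b] P3_mES[of b] alt3_trilin[of b]
  by (auto simp: mods_def P_def)

lemma mods_alt3: "mods i b \<Longrightarrow> alt3 b"
  by (auto simp: mods_def mKH_alt3 mEH_alt3 mLS_alt3 mES_alt3 split: if_splits)

lemma mKH_zero: "mKH (\<lambda>x y z. 0)" and mLS_zero: "mLS (\<lambda>x y z. 0)"
  by (simp_all add: mKH_def mLS_def alt3_def trilin_def linear_zero Lq_def ctr_def)

lemma mEH_zero: "mEH (\<lambda>x y z. 0 :: 'b::real_vector)"
  unfolding mEH_def by (intro exI[of _ "\<lambda>x. 0"]) (simp add: linear_zero WD_def wd_def fun_eq_iff)

lemma mES_zero: "mES (\<lambda>x y z. 0 :: 'b::real_vector)"
  unfolding mES_def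
  by (intro exI[of _ "\<lambda>x. 0 :: 'b"]) (simp add: linear_zero WD_def wd_def fun_eq_iff)

lemma mods_zero: "mods i (\<lambda>x y z. 0)"
  by (simp add: mods_def mKH_zero mEH_zero mLS_zero mES_zero)

lemma P_of_sum:
  assumes "\<And>i. i < 4 \<Longrightarrow> mods i (m i)" and "i < 4"
  shows "P i (\<lambda>x y z. \<Sum>i<4. m i x y z) = m i"
proof -
  have "mKH (m 0)" "mEH (m 1)" "mLS (m 2)" "mES (m 3)"
    using assms(1)[of 0] assms(1)[of 1] assms(1)[of 2] assms(1)[of 3] by (simp_all add: mods_def)
  from P_unique[OF this refl] show ?thesis
    using assms(2) by (auto simp: eval_nat_numeral less_Suc_eq)
qed

lemma P_of_mods:
  assumes "mods i b" "i < 4" "j < 4"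
  shows "P j b = (if j = i then b else zero3)"
proof -
  define m where "m k = (if k = i then b else zero3)" for k :: nat
  have "b = (\<lambda>x y z. \<Sum>k<4. m k x y z)"
  proof (intro ext)
    fix x y z
    have "(\<Sum>k<4. m k x y z) = (\<Sum>k<4. if k = i then b x y z else 0)"
      by (rule sum.cong) (auto simp: m_def zero3_def)
    then show "b x y z = (\<Sum>k<4. m k x y z)" using assms(2) by simp
  qed
  moreover have "mods k (m k)" for k
    using assms(1) by (simp add: m_def zero3_def mods_zero)
  ultimately show ?thesis using P_of_sum[of m j] assms(3) by (simp add: m_def)
qed

lemma sum_P: "(\<Sum>i<4. P i b x y z) = b x y z"
  using P_sum[of b x y z] by (simp add: eval_nat_numeral)

text \<open>The set names the summands that are allowed to occur, so that the sixteen submodules are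
  handled uniformly.\<close>

definition Sel :: "nat set \<Rightarrow> 'a form3 set" where
  "Sel S = {b. alt3 b \<and> (\<forall>i<4. i \<notin> S \<longrightarrow> P i b = zero3)}"

lemma alt3_sum:
  fixes m :: "nat \<Rightarrow> 'a form3"
  assumes "finite S" "\<And>i. i \<in> S \<Longrightarrow> alt3 (m i)"
  shows "alt3 (\<lambda>x y z. \<Sum>i\<in>S. m i x y z)"
  using assms
proof (induction S rule: finite_induct)
  case empty then show ?case using mods_alt3[OF mods_zero] by simp
next
  case (insert a S) then show ?case using alt3_add[of "m a" "\<lambda>x y z. \<Sum>i\<in>S. m i x y z"] by simp
qed

lemma sum3_Sel: "sum3 (Sel S) (Sel T) = Sel (S \<union> T)"
proof (intro set_eqI iffI)
  fix b assume "b \<in> sum3 (Sel S) (Sel T)"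
  then obtain s t where "s \<in> Sel S" "t \<in> Sel T" and b: "b = add3 s t" by (auto simp: sum3_def)
  then show "b \<in> Sel (S \<union> T)"
    unfolding b by (auto simp: Sel_def add3_def alt3_add zero3_def P_add fun_eq_iff)
next
  fix b assume b: "b \<in> Sel (S \<union> T)"
  then have a: "alt3 b" by (simp add: Sel_def)
  define f where "f U = (\<lambda>x y z. \<Sum>i<4. (if i \<in> U then P i b else zero3) x y z)" for U
  have m: "mods i (if i \<in> U then P i b else zero3)" for i U
    using P_mods[OF a] by (simp add: zero3_def mods_zero)
  have "f U \<in> Sel U" for U
    unfolding Sel_def f_def using m P_of_sum[OF m]
    by (auto intro!: alt3_sum[of "{..<4}"] mods_alt3[OF m])
  \<comment> \<open>The second part uses \<open>T - S\<close>, as a component with index in both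
    sets would otherwise be counted twice.\<close>
  moreover have "b = add3 (f S) (f (T - S))"
  proof (intro ext)
    fix x y z
    have "b x y z = (\<Sum>i<4. P i b x y z)" by (simp add: sum_P)
    also have "\<dots> = (\<Sum>i<4. (if i \<in> S then P i b else zero3) x y z + (if i \<in> T - S then P i b else zero3) x y z)"
      using b by (intro sum.cong refl) (auto simp: Sel_def zero3_def)
    finally show "b x y z = add3 (f S) (f (T - S)) x y z"
      by (simp add: add3_def f_def sum.distrib)
  qed
  moreover have "Sel (T - S) \<subseteq> Sel T" by (auto simp: Sel_def)
  ultimately show "b \<in> sum3 (Sel S) (Sel T)" unfolding sum3_def by blast
qed

lemma mods_Sel:
  assumes i: "i < 4" shows "{b. mods i b} = Sel {i}"
proof (intro set_eqI iffI)
  fix b :: "'a form3" assume b: "b \<in> {b. mods i b}"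
  then show "b \<in> Sel {i}" using P_of_mods[of i b] mods_alt3[of i b] i by (auto simp: Sel_def)
next
  fix b assume b: "b \<in> Sel {i}"
  have "P i b = b"
  proof (intro ext)
    fix x y z
    have "b x y z = (\<Sum>j<4. if j = i then P i b x y z else 0)"
      unfolding sum_P[of b x y z, symmetric] using b by (intro sum.cong refl) (auto simp: Sel_def zero3_def)
    then show "P i b x y z = b x y z" using i by simp
  qed
  then show "b \<in> {b. mods i b}" using P_mods[of b i] b by (simp add: Sel_def)
qed

lemma linear_scale: "linear f \<Longrightarrow> linear (\<lambda>x. (r::real) * f x)"
  using linear_compose_scale_right[of f r] by simp

lemma mods_scale:
  fixes b :: "'a form3"
  assumes "mods i b" shows "mods i (\<lambda>x y z. r * b x y z)"
proof -
  have 1: "mKH (\<lambda>x y z. r * b x y z)" if "mKH b"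
    using that alt3_scaleR[of b r] Lq_scaleR[of r b] ctr_scaleR[of _ r b] by (simp add: mKH_def)
  have 2: "mLS (\<lambda>x y z. r * b x y z)" if "mLS b"
    using that alt3_scaleR[of b r] Lq_scaleR[of r b] ctr_scaleR[of _ r b] by (simp add: mLS_def)
  have s: "(\<lambda>x y z. r * WD p q t x y z) = WD (\<lambda>x. r * p x) (\<lambda>x. r * q x) (\<lambda>x. r * t x)" for p q t
    by (simp add: fun_eq_iff WD_def wd_def algebra_simps)
  have 3: "mEH (\<lambda>x y z. r * b x y z)" if "mEH b"
  proof -
    obtain \<beta> where \<beta>: "linear \<beta>" "b = WD (\<lambda>x. \<beta> (I x)) (\<lambda>x. \<beta> (J x)) (\<lambda>x. \<beta> (K x))"
      using \<open>mEH b\<close> unfolding mEH_def by blast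
    then show ?thesis unfolding mEH_def using s linear_scale[OF \<beta>(1), of r]
      by (intro exI[of _ "\<lambda>x. r * \<beta> x"]) simp
  qed
  have 4: "mES (\<lambda>x y z. r * b x y z)" if "mES b"
  proof -
    obtain p q t where *: "linear p" "linear q" "linear t" "\<And>x. p (I x) + q (J x) + t (K x) = 0" "b = WD p q t"
      using \<open>mES b\<close> unfolding mES_def by blast
    show ?thesis unfolding mES_def
      by (rule exI[of _ "\<lambda>x. r * p x"], rule exI[of _ "\<lambda>x. r * q x"], rule exI[of _ "\<lambda>x. r * t x"])
        (simp add: linear_scale *(1-3), simp add: *(4,5) s flip: distrib_left)
  qed
  show ?thesis using assms 1 2 3 4 by (auto simp: mods_def)
qed

text \<open>Multiples of components stay in their submodules, and the sum of the submodules is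
  direct. Hence the nonzero coefficients of a vanishing combination mark the components that are
  forced to vanish.\<close>

lemma P_lincomb:
  assumes a: "alt3 b"
  shows "(\<forall>x y z. c 0 * P 0 b x y z + c 1 * P 1 b x y z + c 2 * P 2 b x y z + c 3 * P 3 b x y z = 0) \<longleftrightarrow>
    (\<forall>i<4. c i \<noteq> 0 \<longrightarrow> P i b = zero3)" (is "?L \<longleftrightarrow> ?R")
proof
  assume L: ?L
  show ?R
  proof (intro allI impI)
    fix i assume i: "i < (4::nat)" "c i \<noteq> 0"
    have "(\<lambda>x y z. \<Sum>i<4. c i * P i b x y z) = zero3"
      using L by (simp add: eval_nat_numeral zero3_def)
    moreover have "P i (\<lambda>x y z. \<Sum>i<4. c i * P i b x y z) = (\<lambda>x y z. c i * P i b x y z)"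
      using P_of_sum[OF mods_scale[OF P_mods[OF a]] i(1)] by simp
    moreover have "P i zero3 = zero3"
      using P_of_mods[OF mods_zero i(1) i(1)] by (simp add: zero3_def)
    ultimately show "P i b = zero3" using i(2) by (simp add: zero3_def fun_eq_iff)
  qed
next
  assume ?R
  then have *: "c i * P i b x y z = 0" if "i < 4" for i x y z
    using that by (cases "c i = 0") (auto simp: zero3_def)
  have zs: "c 0 * P 0 b x y z = 0" "c 1 * P 1 b x y z = 0" "c 2 * P 2 b x y z = 0" "c 3 * P 3 b x y z = 0" for x y z
    by (rule *, simp)+
  show ?L by (intro allI) (simp only: zs add_0)
qed

lemma all_less_4: "(\<forall>i<4. Q i) \<longleftrightarrow> Q 0 \<and> Q 1 \<and> Q 2 \<and> Q (3::nat)"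
  by (auto simp: eval_nat_numeral less_Suc_eq)

lemma P1_zero_iff:
  assumes a: "alt3 b" shows "P 1 b = zero3 \<longleftrightarrow> \<xi> b = (\<lambda>x. 0)"
proof
  assume "P 1 b = zero3"
  then have "(4 * real n + 2) * \<xi> b x = 0" for x
    using contr_P1[OF alt3_trilin[OF a], of I x] contr_zero[of I x] by (simp add: zero3_def)
  moreover have "4 * real n + 2 \<noteq> 0" by linarith
  ultimately show "\<xi> b = (\<lambda>x. 0)" by auto
next
  assume "\<xi> b = (\<lambda>x. 0)"
  then show "P 1 b = zero3"
    by (simp add: P_def xi_Omega_eq[OF alt3_trilin[OF a]] zero3_def WD_def wd_def fun_eq_iff)
qed

lemma P3_zero_iff:
  assumes a: "alt3 b" shows "P 3 b = zero3 \<longleftrightarrow> \<xi>A I b = \<xi>A J b \<and> \<xi>A J b = \<xi>A K b"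
proof
  assume "P 3 b = zero3"
  then have "contr A b x = - (4 * real n + 2) * \<xi> b x" if "A \<in> {I, J, K}" for A x
    using contr_P3[OF alt3_trilin[OF a] that, of x] contr_zero[of A x] by (simp add: zero3_def algebra_simps)
  then show "\<xi>A I b = \<xi>A J b \<and> \<xi>A J b = \<xi>A K b" by (simp add: fun_eq_iff xiA_def)
next
  assume "\<xi>A I b = \<xi>A J b \<and> \<xi>A J b = \<xi>A K b"
  then have e: "\<xi>A J b x = \<xi>A I b x" "\<xi>A K b x = \<xi>A I b x" for x by simp_all
  then have "\<xi>A I b x = \<xi> b x" for x using sum_xiA[of b x] by simp
  then show "P 3 b = zero3"
    unfolding P3_WD[OF alt3_trilin[OF a]] e by (simp add: zero3_def WD_def wd_def fun_eq_iff)
qed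

lemma P13_zero_iff:
  assumes a: "alt3 b"
  shows "P 1 b = zero3 \<and> P 3 b = zero3 \<longleftrightarrow> (\<forall>A\<in>{I, J, K}. \<xi>A A b = (\<lambda>x. 0))"
  unfolding P1_zero_iff[OF a] P3_zero_iff[OF a]
proof (intro iffI conjI ballI)
  assume *: "\<xi> b = (\<lambda>x. 0) \<and> \<xi>A I b = \<xi>A J b \<and> \<xi>A J b = \<xi>A K b"
  fix A assume "A \<in> {I, J, K}"
  then have "\<xi>A A b x = \<xi>A I b x" for x using * by auto
  moreover have "\<xi>A I b x = 0" for x using sum_xiA[of b x] * by simp
  ultimately show "\<xi>A A b = (\<lambda>x. 0)" by auto
next
  assume *: "\<forall>A\<in>{I, J, K}. \<xi>A A b = (\<lambda>x. 0)"
  have "\<xi> b x = 0" for x using sum_xiA[of b x] * by simp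
  then show "\<xi> b = (\<lambda>x. 0)" by auto
  show "\<xi>A I b = \<xi>A J b" "\<xi>A J b = \<xi>A K b" using * by auto
qed

lemma Lq_P: "Lq b x y z = 3 * P 0 b x y z + 3 * P 1 b x y z - 3 * P 2 b x y z - 3 * P 3 b x y z"
  by (simp add: P_def field_simps)

lemma xi_omega_P: "- 2 * xi_omega I J K n b x y z = P 1 b x y z + P 3 b x y z"
  by (simp add: P_def)

lemma xi_Omega_P: "xi_Omega I J K n b = P 1 b"
  by (simp add: P_def)

lemma Lq3_iff:
  assumes a: "alt3 b" shows "L_op I J K b = scale3 3 b \<longleftrightarrow> (\<forall>A\<in>{I, J, K}. pair_op A b = b)"
proof
  assume "L_op I J K b = scale3 3 b"
  then have "Lq b x y z = 3 *\<^sub>R b x y z" for x y z by (simp add: L_op_eq scale3_def)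
  from pair_of_Lq3[OF alt3_trilin[OF a] this] show "\<forall>A\<in>{I, J, K}. pair_op A b = b"
    by (simp add: pair_op_apply fun_eq_iff)
next
  assume *: "\<forall>A\<in>{I, J, K}. pair_op A b = b"
  have "Lq b x y z = pair_op I b x y z + pair_op J b x y z + pair_op K b x y z" for x y z
    by (simp add: Lq_def pair_op_apply)
  then show "L_op I J K b = scale3 3 b" using * by (simp add: L_op_eq scale3_def fun_eq_iff)
qed

lemma Lq_minus3_iff:
  assumes a: "alt3 b" shows "L_op I J K b = scale3 (- 3) b \<longleftrightarrow> L23_op I J K b = scale3 (- 1) b"
proof
  assume "L_op I J K b = scale3 (- 3) b"
  then have "Lq b x y z = - 3 *\<^sub>R b x y z" for x y z by (simp add: L_op_eq scale3_def)
  from Lq23_of_Lq_minus3[OF alt3_trilin[OF a] this] show "L23_op I J K b = scale3 (- 1) b"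
    by (simp add: L23_op_apply fun_eq_iff scale3_def)
next
  assume "L23_op I J K b = scale3 (- 1) b"
  then have X: "b x (I y) (I z) + b x (J y) (J z) + b x (K y) (K z) = - b x y z" for x y z
    by (simp add: L23_op_apply fun_eq_iff scale3_def)
  have "Lq b x y z = - 3 * b x y z" for x y z
    using X[of x y z] X[of y x z] X[of z x y]
      alt3_swap12[OF a, of "I x" y "I z"] alt3_swap12[OF a, of "J x" y "J z"] alt3_swap12[OF a, of "K x" y "K z"]
      alt3_swap12[OF a, of "I x" z "I y"] alt3_swap12[OF a, of "J x" z "J y"] alt3_swap12[OF a, of "K x" z "K y"]
      alt3_swap23[OF a, of "I x" z "I y"] alt3_swap23[OF a, of "J x" z "J y"] alt3_swap23[OF a, of "K x" z "K y"]
      alt3_swap12[OF a, of x y z] alt3_swap12[OF a, of x z y] alt3_swap23[OF a, of x z y]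
    by (simp add: Lq_def)
  then show "L_op I J K b = scale3 (- 3) b" by (simp add: L_op_eq scale3_def fun_eq_iff)
qed

lemma bij_decomposition:
  "bij_betw (\<lambda>(a, b, c, d). add3 a (add3 b (add3 c d)))
     ({b. mKH b} \<times> {b. mEH b} \<times> {b. mLS b} \<times> {b. mES b}) Lambda3"
proof (rule bij_betw_byWitness[where f' = "\<lambda>b. (P 0 b, P 1 b, P 2 b, P 3 b)"])
  let ?f = "\<lambda>(a, b, c, d). add3 a (add3 b (add3 c d))"
  let ?D = "{b. mKH b} \<times> {b. mEH b} \<times> {b. mLS b} \<times> {b. mES b}"
  have "(\<lambda>b. (P 0 b, P 1 b, P 2 b, P 3 b)) (?f (k, e, l, s)) = (k, e, l, s)"
    if "mKH k" "mEH e" "mLS l" "mES s" for k e l s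
    using P_unique[OF that refl] by (simp add: add3_def add.assoc)
  then show "\<forall>a\<in>?D. (\<lambda>b. (P 0 b, P 1 b, P 2 b, P 3 b)) (?f a) = a" by auto
  show "\<forall>b\<in>Lambda3. ?f (P 0 b, P 1 b, P 2 b, P 3 b) = b"
    using P_sum by (simp add: add3_def add.assoc fun_eq_iff)
  show "?f ` ?D \<subseteq> Lambda3"
    by (auto simp: Lambda3_alt3 add3_def alt3_add mKH_alt3 mEH_alt3 mLS_alt3 mES_alt3)
  show "(\<lambda>b. (P 0 b, P 1 b, P 2 b, P 3 b)) ` Lambda3 \<subseteq> ?D"
    using P_mKH_mLS P1_mEH P3_mES alt3_trilin unfolding Lambda3_alt3 by blast
qed

text \<open>\<open>b\<close>, \<open>L b\<close>, \<open>xi_Omega\<close> and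
  \<open>xi_omega\<close> are all combinations of the four components with constant coefficients.
  Each equation thus has the form treated in \<open>P_lincomb\<close>, and the conditions on \<xi>
  alone say that \<open>P 1 b\<close> or \<open>P 3 b\<close> or both vanish.\<close>

lemma classification:
  fixes b :: "'a form3"
  assumes b: "b \<in> Lambda3"
    and KH: "KH = {b. mKH b}" and EH: "EH = {b. mEH b}" and LS: "LS = {b. mLS b}" and ES: "ES = {b. mES b}"
  defines "L \<equiv> L_op I J K"
  shows
   "(b \<in> {zero3} \<longleftrightarrow> b = zero3) \<and>
    (b \<in> KH \<longleftrightarrow> L b = scale3 3 b \<and> \<xi> b = (\<lambda>x. 0)) \<and>
      (b \<in> KH \<longleftrightarrow> (\<forall>A\<in>{I, J, K}. pair_op A b = b) \<and> \<xi> b = (\<lambda>x. 0)) \<and>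
    (b \<in> EH \<longleftrightarrow> b = xi_Omega I J K n b) \<and>
    (b \<in> LS \<longleftrightarrow> L b = scale3 (- 3) b \<and> (\<forall>A\<in>{I, J, K}. \<xi>A A b = (\<lambda>x. 0))) \<and>
      (b \<in> LS \<longleftrightarrow> L23_op I J K b = scale3 (- 1) b \<and> (\<forall>A\<in>{I, J, K}. \<xi>A A b = (\<lambda>x. 0))) \<and>
    (b \<in> ES \<longleftrightarrow> b = scale3 (- 2) (xi_omega I J K n b) \<and> \<xi> b = (\<lambda>x. 0)) \<and>
    (b \<in> sum3 KH EH \<longleftrightarrow> L b = scale3 3 b) \<and>
      (b \<in> sum3 KH EH \<longleftrightarrow> (\<forall>A\<in>{I, J, K}. pair_op A b = b)) \<and>
    (b \<in> sum3 KH LS \<longleftrightarrow> (\<forall>A\<in>{I, J, K}. \<xi>A A b = (\<lambda>x. 0))) \<and>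
    (b \<in> sum3 KH ES \<longleftrightarrow> L b = add3 (scale3 3 b) (scale3 12 (xi_omega I J K n b))) \<and>
    (b \<in> sum3 EH LS \<longleftrightarrow>
        L b = add3 (scale3 (- 3) b) (scale3 6 (xi_Omega I J K n b)) \<and>
        \<xi>A I b = \<xi>A J b \<and> \<xi>A J b = \<xi>A K b) \<and>
    (b \<in> sum3 EH ES \<longleftrightarrow> b = scale3 (- 2) (xi_omega I J K n b)) \<and>
    (b \<in> sum3 LS ES \<longleftrightarrow> L b = scale3 (- 3) b) \<and>
      (b \<in> sum3 LS ES \<longleftrightarrow> L23_op I J K b = scale3 (- 1) b) \<and>
    (b \<in> sum3 (sum3 KH EH) LS \<longleftrightarrow> \<xi>A I b = \<xi>A J b \<and> \<xi>A J b = \<xi>A K b) \<and>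
    (b \<in> sum3 (sum3 KH EH) ES \<longleftrightarrow>
        L b = add3 (scale3 3 b)
          (add3 (scale3 6 (xi_Omega I J K n b)) (scale3 12 (xi_omega I J K n b)))) \<and>
    (b \<in> sum3 KH (sum3 LS ES) \<longleftrightarrow> \<xi> b = (\<lambda>x. 0)) \<and>
    (b \<in> sum3 EH (sum3 LS ES) \<longleftrightarrow>
        L b = add3 (scale3 (- 3) b) (scale3 6 (xi_Omega I J K n b))) \<and>
    b \<in> sum3 (sum3 KH EH) (sum3 LS ES)"
proof -
  have a: "alt3 b" using b by (simp add: Lambda3_alt3)
  let ?Z = "\<lambda>i. P i b = zero3"
  have sel: "KH = Sel {0}" "EH = Sel {1}" "LS = Sel {2}" "ES = Sel {3}"
    using mods_Sel[of 0] mods_Sel[of 1] mods_Sel[of 2] mods_Sel[of 3]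
    by (simp_all add: KH EH LS ES mods_def)
  have mem: "b \<in> Sel S \<longleftrightarrow> (0 \<notin> S \<longrightarrow> ?Z 0) \<and> (1 \<notin> S \<longrightarrow> ?Z 1) \<and> (2 \<notin> S \<longrightarrow> ?Z 2) \<and> (3 \<notin> S \<longrightarrow> ?Z 3)" for S
    using a unfolding Sel_def all_less_4 by simp
  have lc: "(\<forall>x y z. c0 * P 0 b x y z + c1 * P 1 b x y z + c2 * P 2 b x y z + c3 * P 3 b x y z = 0) \<longleftrightarrow>
    (c0 \<noteq> 0 \<longrightarrow> ?Z 0) \<and> (c1 \<noteq> 0 \<longrightarrow> ?Z 1) \<and> (c2 \<noteq> 0 \<longrightarrow> ?Z 2) \<and> (c3 \<noteq> 0 \<longrightarrow> ?Z 3)" for c0 c1 c2 c3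
    using P_lincomb[OF a, of "\<lambda>i. [c0, c1, c2, c3] ! i"] unfolding all_less_4 by simp
  have bP: "b x y z = P 0 b x y z + P 1 b x y z + P 2 b x y z + P 3 b x y z" for x y z
    using P_sum[of b x y z] by simp
  have o: "xi_omega I J K n b x y z = - (P 1 b x y z + P 3 b x y z) / 2" for x y z
    using xi_omega_P[of b x y z] by simp
  have pt: "f = g \<longleftrightarrow> R" if "(\<forall>x y z. h x y z = 0) \<longleftrightarrow> Q" "\<And>x y z. f x y z = g x y z \<longleftrightarrow> h x y z = (0::real)" "Q \<longleftrightarrow> R"
    for f g :: "'a form3" and h Q R using that by (simp add: fun_eq_iff)
  note ext = scale3_def add3_def L_op_eq L_def
  \<comment> \<open>In this and the following equations the four numbers given to \<open>lc\<close>
    are the coefficients of the difference of the two sides, up to a common factor.\<close>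
  have L3: "L b = scale3 3 b \<longleftrightarrow> ?Z 2 \<and> ?Z 3"
    by (rule pt[OF lc[of 0 0 1 1]], simp only: ext xi_Omega_P o Lq_P, subst bP, argo, simp)
  have Lm3: "L b = scale3 (- 3) b \<longleftrightarrow> ?Z 0 \<and> ?Z 1"
    by (rule pt[OF lc[of 1 1 0 0]], simp only: ext xi_Omega_P o Lq_P, subst bP, argo, simp)
  have c3: "b = xi_Omega I J K n b \<longleftrightarrow> ?Z 0 \<and> ?Z 2 \<and> ?Z 3"
    by (rule pt[OF lc[of 1 0 1 1]], simp only: ext xi_Omega_P o Lq_P, subst bP, argo, simp)
  have c5: "b = scale3 (- 2) (xi_omega I J K n b) \<longleftrightarrow> ?Z 0 \<and> ?Z 2"
    by (rule pt[OF lc[of 1 0 1 0]], simp only: ext xi_Omega_P o Lq_P, subst bP, argo, simp)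
  have c8: "L b = add3 (scale3 3 b) (scale3 12 (xi_omega I J K n b)) \<longleftrightarrow> ?Z 1 \<and> ?Z 2"
    by (rule pt[OF lc[of 0 1 "-1" 0]], simp only: ext xi_Omega_P o Lq_P, subst bP, argo, simp)
  have c9: "L b = add3 (scale3 (- 3) b) (scale3 6 (xi_Omega I J K n b)) \<longleftrightarrow> ?Z 0"
    by (rule pt[OF lc[of 1 0 0 0]], simp only: ext xi_Omega_P o Lq_P, subst bP, argo, simp)
  have c13: "L b = add3 (scale3 3 b)
          (add3 (scale3 6 (xi_Omega I J K n b)) (scale3 12 (xi_omega I J K n b))) \<longleftrightarrow> ?Z 2"
    by (rule pt[OF lc[of 0 0 1 0]], simp only: ext xi_Omega_P o Lq_P, subst bP, argo, simp)
  note L_op_iffs = Lq3_iff[OF a, folded L_def] Lq_minus3_iff[OF a, folded L_def]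
  show ?thesis
    unfolding sel sum3_Sel mem L_op_iffs[symmetric] L3 Lm3 c3 c5 c8 c9 c13 P1_zero_iff[OF a, symmetric]
      P3_zero_iff[OF a, symmetric] P13_zero_iff[OF a, symmetric]
    by (simp add: conj_ac)
qed

end

section \<open>Quaternionic frames, elements of Sp(n) and the normalizer of the quaternionic
  structure\<close>

context adapted
begin

definition qk :: "nat \<Rightarrow> 'a \<Rightarrow> 'a" where
  "qk k x = (if k = 0 then x else if k = 1 then I x else if k = 2 then J x else K x)"

definition fam :: "(nat \<Rightarrow> 'a) \<Rightarrow> nat \<times> nat \<Rightarrow> 'a" where
  "fam e i = qk (snd i) (e (fst i))"

abbreviation "frame k e \<equiv> quaternionic_unitary_basis I J K k e"

text \<open>The vanishing of the quaternion-valued Hermitian product, that is, orthogonality of the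
  quaternionic lines through \<open>x\<close> and \<open>y\<close>.\<close>

definition horth :: "'a \<Rightarrow> 'a \<Rightarrow> bool" where
  "horth x y \<longleftrightarrow> x \<bullet> y = 0 \<and> x \<bullet> I y = 0 \<and> x \<bullet> J y = 0 \<and> x \<bullet> K y = 0"

lemma horth_sym: "horth x y \<Longrightarrow> horth y x"
  using inner_flip[of y x] inner_commute[of y x] by (simp add: horth_def)

lemma frame_iff:
  "frame k e \<longleftrightarrow> (\<forall>r<k. e r \<bullet> e r = 1) \<and> (\<forall>r<k. \<forall>s<k. r \<noteq> s \<longrightarrow> horth (e r) (e s))"
  unfolding quaternionic_unitary_basis_def horth_def by auto

lemma sum_lessThan_4: "(\<Sum>k<4. f k) = f 0 + f 1 + f 2 + f (3::nat)" for f :: "nat \<Rightarrow> 'c::comm_monoid_add"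
  by (simp add: eval_nat_numeral)

lemma sum_fam: "(\<Sum>i\<in>{..<m}\<times>{..<4}. g i) = (\<Sum>r<m. g (r, 0) + g (r, 1) + g (r, 2) + g (r, 3))"
  for g :: "nat \<times> nat \<Rightarrow> 'c::comm_monoid_add"
  using sum.cartesian_product[of "\<lambda>r k. g (r, k)" "{..<4}" "{..<m}"] by (simp add: sum_lessThan_4)

lemma fam_simps [simp]: "fam e (r, 0) = e r" "fam e (r, 1) = I (e r)" "fam e (r, Suc 0) = I (e r)"
  "fam e (r, 2) = J (e r)" "fam e (r, 3) = K (e r)"
  by (simp_all add: fam_def qk_def)

lemma fam_inner:
  assumes "frame m e" "i \<in> {..<m} \<times> {..<4}" "j \<in> {..<m} \<times> {..<4}"
  shows "fam e i \<bullet> fam e j = (if i = j then 1 else 0)"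
proof -
  obtain r k s l where ij: "i = (r, k)" "j = (s, l)" by fastforce
  have rs: "r < m" "s < m" and k: "k \<in> {0, 1, 2, 3}" and l: "l \<in> {0, 1, 2, 3}"
    using assms(2,3) by (auto simp: ij eval_nat_numeral less_Suc_eq)
  have "e r \<bullet> e s = (if r = s then 1 else 0)" "e r \<bullet> I (e s) = 0" "e r \<bullet> J (e s) = 0" "e r \<bullet> K (e s) = 0"
    using assms(1) rs unfolding quaternionic_unitary_basis_def by auto
  then show ?thesis using k l unfolding ij by (elim insertE emptyE) auto
qed

lemma fam_independent:
  assumes e: "frame m e"
  shows "independent (fam e ` ({..<m} \<times> {..<4}))" "card (fam e ` ({..<m} \<times> {..<4})) = 4 * m"
proof -
  let ?A = "{..<m}\<times>{..<4::nat}"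
  note ip = fam_inner[OF e]
  have inj: "inj_on (fam e) ?A"
  proof (rule inj_onI)
    fix i j assume ij: "i \<in> ?A" "j \<in> ?A" "fam e i = fam e j"
    then have "(if i = j then 1 else 0) = (1::real)" using ip[OF ij(1,2)] ip[OF ij(1,1)] by simp
    then show "i = j" by (simp split: if_splits)
  qed
  show "card (fam e ` ?A) = 4 * m" using card_image[OF inj] by simp
  have "pairwise orthogonal (fam e ` ?A)" using ip by (auto simp: pairwise_def orthogonal_def)
  moreover have "0 \<notin> fam e ` ?A"
  proof
    assume "0 \<in> fam e ` ?A"
    then obtain i where i: "i \<in> ?A" "fam e i = 0" by auto
    show False using ip[OF i(1) i(1)] i(2) by simp
  qed
  ultimately show "independent (fam e ` ?A)" by (rule pairwise_orthogonal_independent)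
qed

lemma frame_extend_step:
  assumes e: "frame k e" and k: "4 * k < DIM('a)"
  shows "\<exists>v. frame (Suc k) (e(k := v))"
proof -
  let ?S = "fam e ` ({..<k} \<times> {..<4})"
  have "dim ?S \<le> card ({..<k} \<times> {..<4::nat})"
    by (rule order_trans[OF dim_le_card' card_image_le]) auto
  then have "dim ?S < DIM('a)" using k by simp
  then obtain v where v: "v \<noteq> 0" "\<And>y. y \<in> span ?S \<Longrightarrow> orthogonal v y"
    using orthogonal_to_subspace_exists[of ?S] by blast
  define w where "w = v /\<^sub>R norm v"
  have *: "w \<bullet> fam e (r, l) = 0" if "r < k" "l < 4" for r l
    using v(2)[OF span_base[of "fam e (r, l)"]] that by (simp add: w_def orthogonal_def)
  then have "horth w (e r)" if "r < k" for r
    using *[of r 0] *[of r 1] *[of r 2] *[of r 3] that by (simp add: horth_def)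
  moreover have "w \<bullet> w = 1" using v(1) by (simp add: w_def dot_square_norm power2_eq_square)
  ultimately have "frame (Suc k) (e(k := w))"
    using e by (auto simp: frame_iff less_Suc_eq intro: horth_sym)
  then show ?thesis ..
qed

text \<open>The quaternion-linear map that takes the frame \<open>e\<close> to \<open>f\<close>. All
  special elements of Sp(n) arise in this way: sign changes, torus elements and maps carrying one
  pair of vectors to another.\<close>

definition gmap :: "nat \<Rightarrow> (nat \<Rightarrow> 'a) \<Rightarrow> (nat \<Rightarrow> 'a) \<Rightarrow> 'a \<Rightarrow> 'a" where
  "gmap m e f x = (\<Sum>i\<in>{..<m}\<times>{..<4}. (x \<bullet> fam e i) *\<^sub>R fam f i)"

lemma gmap_eq: "gmap m e f x = (\<Sum>r<m. (x \<bullet> e r) *\<^sub>R f r + (x \<bullet> I (e r)) *\<^sub>R I (f r) +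
    (x \<bullet> J (e r)) *\<^sub>R J (f r) + (x \<bullet> K (e r)) *\<^sub>R K (f r))"
  unfolding gmap_def sum_fam by simp

lemma gmap_comm: "gmap m e f (I x) = I (gmap m e f x)" "gmap m e f (J x) = J (gmap m e f x)"
  "gmap m e f (K x) = K (gmap m e f x)"
  unfolding gmap_eq by (simp_all add: linear_sum lin algebra_simps)

text \<open>Indexing by the type \<open>3\<close> turns a change of the adapted basis into a matrix
  and the sums over the three structures into sums over \<open>UNIV\<close>.\<close>

definition qA :: "3 \<Rightarrow> 'a \<Rightarrow> 'a" where
  "qA a = (if a = 1 then I else if a = 2 then J else K)"

lemma qA_simps [simp]: "qA 1 = I" "qA 2 = J" "qA 3 = K"
  by (auto simp: qA_def)

lemma qA_mem: "A \<in> {I, J, K} \<Longrightarrow> \<exists>a. A = qA a"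
  using qA_simps by (metis empty_iff insert_iff)

lemma lin_qA: "linear (qA a)"
  by (simp add: qA_def lin)

lemma qA_anticomm: "qA a (qA b x) + qA b (qA a x) = (if a = b then - 2 *\<^sub>R x else 0)"
  using exhaust_3[of a] exhaust_3[of b] by (auto simp: scaleR_2)

lemma qA_skew: "qA a x \<bullet> y = - (x \<bullet> qA a y)"
  using exhaust_3[of a] by auto

text \<open>\<open>T\<close> normalizes the span of \<open>I, J, K\<close>.\<close>

definition nrm :: "('a \<Rightarrow> 'a) \<Rightarrow> bool" where
  "nrm T \<longleftrightarrow> orthogonal_transformation T \<and>
     (\<exists>R :: real^3^3. orthogonal_matrix R \<and> (\<forall>a x. T (qA a x) = (\<Sum>b\<in>UNIV. R $ a $ b *\<^sub>R qA b (T x))))"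

text \<open>Orthogonality of the matrix is automatic: conjugation by \<open>T\<close> preserves the
  anticommutation relations of \<open>I\<close>, \<open>J\<close>, \<open>K\<close>, and comparing
  coefficients gives that the rows are orthonormal.\<close>

lemma nrmI:
  assumes T: "orthogonal_transformation T"
    and R: "\<And>a x. T (qA a x) = (\<Sum>b\<in>UNIV. R a b *\<^sub>R qA b (T x))"
  shows "nrm T"
proof -
  note lT = orthogonal_transformation_linear[OF T]
  define M :: "real^3^3" where "M = (\<chi> a b. R a b)"
  have TT: "T (qA a (qA a' x)) = (\<Sum>b\<in>UNIV. \<Sum>c\<in>UNIV. (R a b * R a' c) *\<^sub>R qA b (qA c (T x)))" for a a' x
    by (simp add: R linear_sum[OF lin_qA] linear_cmul[OF lin_qA] scaleR_sum_right)
  obtain u :: 'a where u: "u \<in> Basis" using nonempty_Basis by blast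
  obtain x where x: "T x = u" using orthogonal_transformation_surj[OF T] by (metis surjD)
  have "(\<Sum>b\<in>UNIV. R a b * R a' b) = (if a = a' then 1 else 0)" for a a'
  proof -
    have "(if a = a' then - 2 *\<^sub>R u else 0) = T (qA a (qA a' x)) + T (qA a' (qA a x))"
      using qA_anticomm[of a a' x] linear_add[OF lT, of "qA a (qA a' x)" "qA a' (qA a x)"]
      by (simp add: x linear_neg[OF lT] linear_0[OF lT] linear_cmul[OF lT] split: if_splits)
    also have "\<dots> = (\<Sum>b\<in>UNIV. \<Sum>c\<in>UNIV. (R a b * R a' c) *\<^sub>R qA b (qA c u)) +
        (\<Sum>c\<in>UNIV. \<Sum>b\<in>UNIV. (R a' b * R a c) *\<^sub>R qA b (qA c u))"
      unfolding TT x by (subst (2) sum.swap) simp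
    also have "\<dots> = (\<Sum>b\<in>UNIV. \<Sum>c\<in>UNIV. (R a b * R a' c) *\<^sub>R (qA b (qA c u) + qA c (qA b u)))"
      by (simp add: sum.distrib scaleR_right_distrib mult.commute)
    also have "\<dots> = (\<Sum>b\<in>UNIV. \<Sum>c\<in>UNIV. if b = c then (R a b * R a' b) *\<^sub>R (- 2 *\<^sub>R u) else 0)"
      by (intro sum.cong refl) (simp add: qA_anticomm)
    also have "\<dots> = (- 2 * (\<Sum>b\<in>UNIV. R a b * R a' b)) *\<^sub>R u"
      by (simp add: scaleR_sum_left sum_distrib_left sum_negf mult_ac)
    finally have "(- 2 * (\<Sum>b\<in>UNIV. R a b * R a' b)) *\<^sub>R u = (if a = a' then - 2 else 0) *\<^sub>R u"
      by (simp split: if_splits)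
    then show ?thesis using nonzero_Basis[OF u] by (simp split: if_splits)
  qed
  then have "M ** transpose M = mat 1"
    by (simp add: M_def matrix_matrix_mult_def transpose_def mat_def vec_eq_iff)
  then have "orthogonal_matrix M" using orthogonal_matrix_def matrix_left_right_inverse by blast
  moreover have "\<forall>a x. T (qA a x) = (\<Sum>b\<in>UNIV. M $ a $ b *\<^sub>R qA b (T x))" by (simp add: R M_def)
  ultimately show ?thesis using T unfolding nrm_def by blast
qed

lemma orthogonal_matrix_sum:
  fixes h :: "3 \<Rightarrow> 3 \<Rightarrow> 'b::real_vector"
  assumes "orthogonal_matrix (R :: real^3^3)"
  shows "(\<Sum>a\<in>UNIV. \<Sum>b\<in>UNIV. \<Sum>c\<in>UNIV. (R $ a $ b * R $ a $ c) *\<^sub>R h b c) = (\<Sum>b\<in>UNIV. h b b)"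
proof -
  have "transpose R ** R = mat 1" using assms by (simp add: orthogonal_matrix_def)
  then have R: "(\<Sum>a\<in>UNIV. R $ a $ b * R $ a $ c) = (if b = c then 1 else 0)" for b c
    by (simp add: matrix_matrix_mult_def transpose_def mat_def vec_eq_iff)
  have "(\<Sum>a\<in>UNIV. \<Sum>b\<in>UNIV. \<Sum>c\<in>UNIV. (R $ a $ b * R $ a $ c) *\<^sub>R h b c) =
      (\<Sum>b\<in>UNIV. \<Sum>a\<in>UNIV. \<Sum>c\<in>UNIV. (R $ a $ b * R $ a $ c) *\<^sub>R h b c)"
    by (rule sum.swap)
  also have "\<dots> = (\<Sum>b\<in>UNIV. \<Sum>c\<in>UNIV. (\<Sum>a\<in>UNIV. R $ a $ b * R $ a $ c) *\<^sub>R h b c)"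
    unfolding scaleR_sum_left by (rule sum.cong[OF refl], rule sum.swap)
  also have "\<dots> = (\<Sum>b\<in>UNIV. \<Sum>c\<in>UNIV. if b = c then h b b else 0)"
    unfolding R by (intro sum.cong refl) auto
  finally show ?thesis by simp
qed

text \<open>The tensor \<open>\<Sum> A \<otimes> A\<close> is invariant under orthogonal changes of
  the basis. This makes \<open>L\<close> commute with the group, while the operator of a single
  \<open>A\<close> need not.\<close>

lemma nrm_sum:
  assumes T: "nrm T" and h: "\<And>v. linear (\<lambda>u. h u v)" "\<And>u. linear (\<lambda>v. h u v)"
  shows "(\<Sum>a\<in>UNIV. h (T (qA a x)) (T (qA a y))) = (\<Sum>a\<in>UNIV. h (qA a (T x)) (qA a (T y)))"
proof -
  obtain R :: "real^3^3" where R: "orthogonal_matrix R"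
    "\<And>a x. T (qA a x) = (\<Sum>b\<in>UNIV. R $ a $ b *\<^sub>R qA b (T x))"
    using T unfolding nrm_def by blast
  have "(\<Sum>a\<in>UNIV. h (T (qA a x)) (T (qA a y))) =
      (\<Sum>a\<in>UNIV. \<Sum>b\<in>UNIV. \<Sum>c\<in>UNIV. (R $ a $ b * R $ a $ c) *\<^sub>R h (qA c (T x)) (qA b (T y)))"
    unfolding R(2) linear_sum[OF h(1)] linear_sum[OF h(2)] linear_cmul[OF h(1)] linear_cmul[OF h(2)]
    by (simp add: scaleR_sum_right mult.commute)
  also have "\<dots> = (\<Sum>a\<in>UNIV. h (qA a (T x)) (qA a (T y)))"
    by (rule orthogonal_matrix_sum[OF R(1)])
  finally show ?thesis .
qed

end

context quaternionic
begin

lemma frame_extend: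
  assumes "frame k e" "k \<le> n"
  shows "\<exists>e'. frame n e' \<and> (\<forall>r<k. e' r = e r)"
  using assms
proof (induction "n - k" arbitrary: k e)
  case 0 then show ?case by auto
next
  case (Suc d)
  then have "k < n" "d = n - Suc k" by arith+
  then obtain v where v: "frame (Suc k) (e(k := v))"
    using frame_extend_step[OF Suc.prems(1)] dim by auto
  from Suc(1)[OF \<open>d = n - Suc k\<close> v] \<open>k < n\<close> obtain e' where
    "frame n e'" "\<forall>r<Suc k. e' r = (e(k := v)) r" by auto
  then show ?case by (intro exI[of _ e']) auto
qed

lemma frame_complete:
  assumes e: "frame n e"
  shows "(\<Sum>i\<in>{..<n}\<times>{..<4}. (x \<bullet> fam e i) *\<^sub>R fam e i) = x"
proof -
  let ?A = "{..<n}\<times>{..<4::nat}"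
  let ?B = "fam e ` ?A"
  note ip = fam_inner[OF e]
  have "independent ?B" "card ?B = DIM('a)"
    using fam_independent[OF e] dim by auto
  then have sp: "span ?B = UNIV"
    using card_ge_dim_independent[of ?B UNIV] by auto
  define y where "y = x - (\<Sum>i\<in>?A. (x \<bullet> fam e i) *\<^sub>R fam e i)"
  have "y \<bullet> fam e j = 0" if j: "j \<in> ?A" for j
  proof -
    have "(\<Sum>i\<in>?A. (x \<bullet> fam e i) * (fam e i \<bullet> fam e j)) = (\<Sum>i\<in>?A. if i = j then x \<bullet> fam e i else 0)"
      by (rule sum.cong) (use ip j in auto)
    then show ?thesis using j by (simp add: y_def inner_diff_left inner_sum_left)
  qed
  then have "orthogonal y z" if "z \<in> ?B" for z using that by (auto simp: orthogonal_def)
  then have "orthogonal y y" using orthogonal_to_span[of y ?B y] sp by auto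
  then show ?thesis by (simp add: y_def orthogonal_def)
qed

lemma gmap_Spn:
  assumes e: "frame n e" and f: "frame n f"
  shows "gmap n e f \<in> Spn I J K" "r < n \<Longrightarrow> gmap n e f (e r) = f r"
proof -
  let ?A = "{..<n}\<times>{..<4::nat}"
  have l: "linear (gmap n e f)"
    unfolding gmap_def by (rule linearI) (simp_all add: inner_simps sum.distrib scaleR_sum_right scaleR_left_distrib)
  have "gmap n e f x \<bullet> gmap n e f y = x \<bullet> y" for x y
  proof -
    have "gmap n e f x \<bullet> gmap n e f y = (\<Sum>j\<in>?A. \<Sum>i\<in>?A. (x \<bullet> fam e i) * (y \<bullet> fam e j) * (fam f i \<bullet> fam f j))"
      unfolding gmap_def inner_sum_left inner_sum_right by (simp add: mult_ac)
    also have "\<dots> = (\<Sum>j\<in>?A. \<Sum>i\<in>?A. if i = j then (x \<bullet> fam e i) * (y \<bullet> fam e i) else 0)"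
      by (intro sum.cong refl) (simp add: fam_inner[OF f] del: mem_Sigma_iff)
    also have "\<dots> = (\<Sum>i\<in>?A. (x \<bullet> fam e i) * (fam e i \<bullet> y))"
      by (intro sum.cong refl) (simp add: inner_commute)
    also have "\<dots> = x \<bullet> y"
      by (subst (2) frame_complete[OF e, symmetric]) (simp add: inner_sum_left)
    finally show ?thesis .
  qed
  then show "gmap n e f \<in> Spn I J K"
    unfolding Spn_def orthogonal_transformation_def using l gmap_comm by auto
  show "gmap n e f (e r) = f r" if "r < n"
  proof -
    have "gmap n e f (e r) = (\<Sum>i\<in>?A. if i = (r, 0) then f r else 0)"
      unfolding gmap_def
    proof (rule sum.cong[OF refl])
      fix i assume i: "i \<in> ?A"
      have "fam e (r, 0) \<bullet> fam e i = (if (r, 0) = i then 1 else 0)"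
        using fam_inner[OF e, of "(r, 0)" i] that i by simp
      then show "(e r \<bullet> fam e i) *\<^sub>R fam f i = (if i = (r, 0) then f r else 0)" by auto
    qed
    then show ?thesis using that by simp
  qed
qed

lemma frame2: "x \<bullet> x = 1 \<Longrightarrow> y \<bullet> y = 1 \<Longrightarrow> horth x y \<Longrightarrow> frame 2 (\<lambda>i. if i = 0 then x else y)"
  using horth_sym[of x y] by (auto simp: frame_iff)

lemma frame3: "x \<bullet> x = 1 \<Longrightarrow> y \<bullet> y = 1 \<Longrightarrow> z \<bullet> z = 1 \<Longrightarrow> horth x y \<Longrightarrow> horth x z \<Longrightarrow> horth y z \<Longrightarrow>
   frame 3 (\<lambda>i. if i = 0 then x else if i = 1 then y else z)"
  using horth_sym[of x y] horth_sym[of x z] horth_sym[of y z]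
  by (auto simp: frame_iff eval_nat_numeral less_Suc_eq)

text \<open>Such vectors generate twelve independent ones in a space of dimension
  \<open>4 n\<close>. This provides frames starting with a given triple, and for
  \<open>n = 2\<close> it makes every statement about such triples vacuous.\<close>

lemma horth3_le: "x \<bullet> x = 1 \<Longrightarrow> y \<bullet> y = 1 \<Longrightarrow> z \<bullet> z = 1 \<Longrightarrow> horth x y \<Longrightarrow> horth x z \<Longrightarrow> horth y z \<Longrightarrow> 3 \<le> n"
proof -
  assume a: "x \<bullet> x = 1" "y \<bullet> y = 1" "z \<bullet> z = 1" "horth x y" "horth x z" "horth y z"
  let ?e = "\<lambda>i. if i = (0::nat) then x else if i = 1 then y else z"
  have "independent (fam ?e ` ({..<3}\<times>{..<4}))" "card (fam ?e ` ({..<3}\<times>{..<4})) = 12"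
    using fam_independent[OF frame3[OF a]] by auto
  then show "3 \<le> n" using independent_bound[of "fam ?e ` ({..<3}\<times>{..<4})"] dim by auto
qed

end

section \<open>Contraction with \<Omega>, and the elements of Sp(n) and Sp(1)\<close>

lemma sum_Basis_bilinear:
  fixes \<beta> :: "'a::euclidean_space \<Rightarrow> 'a \<Rightarrow> real"
  assumes "\<And>v. linear (\<lambda>u. \<beta> u v)" "\<And>u. linear (\<lambda>v. \<beta> u v)"
  shows "(\<Sum>u\<in>Basis. \<Sum>v\<in>Basis. (p \<bullet> u) * (q \<bullet> v) * \<beta> u v) = \<beta> p q"
proof -
  have "(\<Sum>v\<in>Basis. (p \<bullet> u) * (q \<bullet> v) * \<beta> u v) = (p \<bullet> u) * \<beta> u q" for u
    using sum_Basis_linear[OF assms(2), of q u] by (simp add: sum_distrib_left[symmetric] mult.assoc)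
  then show ?thesis using sum_Basis_linear[OF assms(1), of p q] by simp
qed

lemma double_trace_orthogonal:
  fixes f \<beta> :: "'a::euclidean_space \<Rightarrow> 'a \<Rightarrow> real"
  assumes T: "orthogonal_transformation (T :: 'a \<Rightarrow> 'a)"
    and f: "\<And>v. linear (\<lambda>u. f u v)" "\<And>u. linear (\<lambda>v. f u v)"
    and \<beta>: "\<And>v. linear (\<lambda>u. \<beta> u v)" "\<And>u. linear (\<lambda>v. \<beta> u v)"
  shows "(\<Sum>u\<in>Basis. \<Sum>v\<in>Basis. f (T u) (T v) * \<beta> (T u) (T v)) = (\<Sum>u\<in>Basis. \<Sum>v\<in>Basis. f u v * \<beta> u v)"
proof -
  have lm: "linear (\<lambda>x. c * g x)" "linear (\<lambda>x. g x * c)" if "linear g" for g :: "'a \<Rightarrow> real" and c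
    using linear_compose_scale_right[OF that, of c] by (simp_all add: mult.commute)
  have "(\<Sum>u\<in>Basis. \<Sum>v\<in>Basis. f (T u) (T v) * \<beta> (T u) (T v)) =
      (\<Sum>u\<in>Basis. \<Sum>v\<in>Basis. f (T u) v * \<beta> (T u) v)"
    by (rule sum.cong[OF refl], rule trace_orthogonal[OF T, of "\<lambda>v w. f _ v * \<beta> _ w"]) (intro lm f \<beta>)+
  also have "\<dots> = (\<Sum>v\<in>Basis. \<Sum>u\<in>Basis. f (T u) v * \<beta> (T u) v)" by (rule sum.swap)
  also have "\<dots> = (\<Sum>v\<in>Basis. \<Sum>u\<in>Basis. f u v * \<beta> u v)"
    by (rule sum.cong[OF refl], rule trace_orthogonal[OF T, of "\<lambda>v w. f v _ * \<beta> w _"]) (intro lm f \<beta>)+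
  also have "\<dots> = (\<Sum>u\<in>Basis. \<Sum>v\<in>Basis. f u v * \<beta> u v)" by (rule sum.swap)
  finally show ?thesis .
qed

context adapted
begin

lemma Omega4_eq: "Omega4 I J K x y u v = 2 * (\<Sum>b\<in>UNIV.
   (x \<bullet> qA b y) * (u \<bullet> qA b v) - (x \<bullet> qA b u) * (y \<bullet> qA b v) + (x \<bullet> qA b v) * (y \<bullet> qA b u))"
  by (simp add: Omega4_def wedge22_def omega_def sum_3 algebra_simps)

lemma linear_inner_qA: "linear (\<lambda>u. u \<bullet> qA b v)" "linear (\<lambda>u. v \<bullet> qA b u)"
  by (rule linearI; simp add: linear_add[OF lin_qA] linear_cmul[OF lin_qA] inner_simps)+

lemma linear_Omega4: "linear (\<lambda>u. Omega4 I J K x y u v)" "linear (\<lambda>v. Omega4 I J K x y u v)"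
proof -
  have lm: "linear (\<lambda>x. c * g x)" "linear (\<lambda>x. g x * c)" if "linear g" for g :: "'a \<Rightarrow> real" and c
    using linear_compose_scale_right[OF that, of c] by (simp_all add: mult.commute)
  show "linear (\<lambda>u. Omega4 I J K x y u v)" "linear (\<lambda>v. Omega4 I J K x y u v)"
    unfolding Omega4_eq
    by (intro lm linear_compose_sum ballI linear_compose_add linear_compose_sub linear_inner_qA)+
qed

text \<open>\<Omega> read as an endomorphism of two-forms: a multiple of the projection to the span
  of the three \<omega>'s, minus four times the Casimir sum
  \<open>\<Sum> \<beta> (A x) (A y)\<close>.\<close>

lemma Omega4_contract:
  fixes \<beta> :: "'a \<Rightarrow> 'a \<Rightarrow> real"
  assumes \<beta>: "\<And>v. linear (\<lambda>u. \<beta> u v)" "\<And>u. linear (\<lambda>v. \<beta> u v)" and sk: "\<And>u v. \<beta> v u = - \<beta> u v"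
  shows "(\<Sum>u\<in>Basis. \<Sum>v\<in>Basis. Omega4 I J K x y u v * \<beta> u v) =
    (\<Sum>b\<in>UNIV. 2 * (x \<bullet> qA b y) * (\<Sum>u\<in>Basis. \<Sum>v\<in>Basis. (u \<bullet> qA b v) * \<beta> u v) - 4 * \<beta> (qA b x) (qA b y))"
proof -
  have 1: "(\<Sum>u\<in>Basis. \<Sum>v\<in>Basis. (x \<bullet> qA b u) * (y \<bullet> qA b v) * \<beta> u v) = \<beta> (qA b x) (qA b y)" for b
    using sum_Basis_bilinear[OF \<beta>, of "qA b x" "qA b y"] by (simp add: qA_skew)
  have 2: "(\<Sum>u\<in>Basis. \<Sum>v\<in>Basis. (x \<bullet> qA b v) * (y \<bullet> qA b u) * \<beta> u v) = - \<beta> (qA b x) (qA b y)" for b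
    using sum_Basis_bilinear[OF \<beta>, of "qA b y" "qA b x"] sk[of "qA b x" "qA b y"] by (simp add: qA_skew mult.commute)
  have "(\<Sum>u\<in>Basis. \<Sum>v\<in>Basis. Omega4 I J K x y u v * \<beta> u v) =
    (\<Sum>u\<in>Basis. \<Sum>v\<in>Basis. \<Sum>b\<in>UNIV. 2 * (x \<bullet> qA b y) * ((u \<bullet> qA b v) * \<beta> u v)
      - 2 * ((x \<bullet> qA b u) * (y \<bullet> qA b v) * \<beta> u v) + 2 * ((x \<bullet> qA b v) * (y \<bullet> qA b u) * \<beta> u v))"
    unfolding Omega4_eq by (simp add: sum_distrib_left sum_distrib_right algebra_simps)
  also have "\<dots> = (\<Sum>u\<in>Basis. \<Sum>b\<in>UNIV. \<Sum>v\<in>Basis. 2 * (x \<bullet> qA b y) * ((u \<bullet> qA b v) * \<beta> u v)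
      - 2 * ((x \<bullet> qA b u) * (y \<bullet> qA b v) * \<beta> u v) + 2 * ((x \<bullet> qA b v) * (y \<bullet> qA b u) * \<beta> u v))"
    by (rule sum.cong[OF refl], rule sum.swap)
  also have "\<dots> = (\<Sum>b\<in>UNIV. \<Sum>u\<in>Basis. \<Sum>v\<in>Basis. 2 * (x \<bullet> qA b y) * ((u \<bullet> qA b v) * \<beta> u v)
      - 2 * ((x \<bullet> qA b u) * (y \<bullet> qA b v) * \<beta> u v) + 2 * ((x \<bullet> qA b v) * (y \<bullet> qA b u) * \<beta> u v))"
    by (rule sum.swap)
  also have "\<dots> = (\<Sum>b\<in>UNIV. 2 * (x \<bullet> qA b y) * (\<Sum>u\<in>Basis. \<Sum>v\<in>Basis. (u \<bullet> qA b v) * \<beta> u v) - 4 * \<beta> (qA b x) (qA b y))"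
  proof (rule sum.cong[OF refl])
    fix b :: 3
    let ?t = "\<Sum>u\<in>Basis. \<Sum>v\<in>Basis. (u \<bullet> qA b v) * \<beta> u v"
    have "(\<Sum>u\<in>Basis. \<Sum>v\<in>Basis. 2 * (x \<bullet> qA b y) * ((u \<bullet> qA b v) * \<beta> u v)
      - 2 * ((x \<bullet> qA b u) * (y \<bullet> qA b v) * \<beta> u v) + 2 * ((x \<bullet> qA b v) * (y \<bullet> qA b u) * \<beta> u v)) =
      2 * (x \<bullet> qA b y) * ?t - 2 * (\<Sum>u\<in>Basis. \<Sum>v\<in>Basis. (x \<bullet> qA b u) * (y \<bullet> qA b v) * \<beta> u v)
      + 2 * (\<Sum>u\<in>Basis. \<Sum>v\<in>Basis. (x \<bullet> qA b v) * (y \<bullet> qA b u) * \<beta> u v)"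
      by (simp add: sum.distrib sum_subtractf sum_distrib_left)
    then show "(\<Sum>u\<in>Basis. \<Sum>v\<in>Basis. 2 * (x \<bullet> qA b y) * ((u \<bullet> qA b v) * \<beta> u v)
      - 2 * ((x \<bullet> qA b u) * (y \<bullet> qA b v) * \<beta> u v) + 2 * ((x \<bullet> qA b v) * (y \<bullet> qA b u) * \<beta> u v)) =
      2 * (x \<bullet> qA b y) * ?t - 4 * \<beta> (qA b x) (qA b y)"
      unfolding 1 2 by simp
  qed
  finally show ?thesis .
qed

lemma sum_qA_bilinear: "(\<Sum>b\<in>UNIV. qA b x \<bullet> qA a (qA b y)) = - (x \<bullet> qA a y)"
  using exhaust_3[of a] by (auto simp: sum_3)

lemma Spn_mem: "g \<in> Spn I J K \<longleftrightarrow> orthogonal_transformation g \<and> (\<forall>a x. g (qA a x) = qA a (g x))"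
  unfolding Spn_def by (auto simp: qA_def) (metis qA_simps)+

lemma Spn_orth: "g \<in> Spn I J K \<Longrightarrow> orthogonal_transformation g"
  by (simp add: Spn_def)

lemma Spn_comm: "g \<in> Spn I J K \<Longrightarrow> g (I x) = I (g x)" "g \<in> Spn I J K \<Longrightarrow> g (J x) = J (g x)"
    "g \<in> Spn I J K \<Longrightarrow> g (K x) = K (g x)"
  by (auto simp: Spn_def)

lemma orth_bij: "orthogonal_transformation T \<Longrightarrow> bij (T :: 'a \<Rightarrow> 'a)"
  using orthogonal_transformation_bij by blast

lemma orth_inv: "orthogonal_transformation T \<Longrightarrow> orthogonal_transformation (inv T :: 'a \<Rightarrow> 'a)"
  by (rule orthogonal_transformation_inv)

lemma orth_inv_apply:
  "orthogonal_transformation T \<Longrightarrow> T (inv T x) = (x :: 'a)"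
  "orthogonal_transformation T \<Longrightarrow> inv T (T x) = (x :: 'a)"
  using orth_bij[of T] by (auto simp: bij_def surj_f_inv_f inv_f_f)

lemma Spn_inv:
  assumes g: "g \<in> Spn I J K" shows "inv g \<in> Spn I J K"
proof -
  note o = Spn_orth[OF g]
  have "inv g (A x) = A (inv g x)" if "\<And>x. g (A x) = A (g x)" for A x
    using that[of "inv g x"] orth_inv_apply[OF o] by metis
  then show ?thesis using Spn_comm[OF g] orth_inv[OF o] by (simp add: Spn_def)
qed

lemma Spn_id: "id \<in> Spn I J K"
  by (simp add: Spn_def orthogonal_transformation_def linear_id[unfolded id_def] id_def)

lemma inv_comp_orth: "orthogonal_transformation g \<Longrightarrow> orthogonal_transformation h \<Longrightarrow> inv (g \<circ> h) = inv h \<circ> inv g"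
  for g h :: "'a \<Rightarrow> 'a"
  by (simp add: o_inv_distrib orth_bij)

lemma nrm_orth: "nrm T \<Longrightarrow> orthogonal_transformation T"
  by (simp add: nrm_def)

lemma nrm_Spn: "g \<in> Spn I J K \<Longrightarrow> nrm g"
  by (rule nrmI[of g "\<lambda>a b. if a = b then 1 else 0"]) (auto simp: Spn_mem if_distrib[of "\<lambda>c. c *\<^sub>R _"] cong: if_cong)

lemma nrm_comp:
  assumes "nrm S" "nrm T" shows "nrm (S \<circ> T)"
proof -
  obtain R :: "real^3^3" where R: "\<And>a x. S (qA a x) = (\<Sum>b\<in>UNIV. R $ a $ b *\<^sub>R qA b (S x))"
    using assms(1) unfolding nrm_def by blast
  obtain Q :: "real^3^3" where Q: "\<And>a x. T (qA a x) = (\<Sum>b\<in>UNIV. Q $ a $ b *\<^sub>R qA b (T x))"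
    using assms(2) unfolding nrm_def by blast
  note l = orthogonal_transformation_linear[OF nrm_orth[OF assms(1)]]
  show ?thesis
  proof (rule nrmI)
    show "orthogonal_transformation (S \<circ> T)" by (intro orthogonal_transformation_compose nrm_orth assms)
    show "(S \<circ> T) (qA a x) = (\<Sum>c\<in>UNIV. (\<Sum>b\<in>UNIV. Q $ a $ b * R $ b $ c) *\<^sub>R qA c ((S \<circ> T) x))" for a x
    proof -
      have "(S \<circ> T) (qA a x) = (\<Sum>b\<in>UNIV. \<Sum>c\<in>UNIV. (Q $ a $ b * R $ b $ c) *\<^sub>R qA c (S (T x)))"
        by (simp add: Q linear_sum[OF l] linear_cmul[OF l] R scaleR_sum_right)
      also have "\<dots> = (\<Sum>c\<in>UNIV. \<Sum>b\<in>UNIV. (Q $ a $ b * R $ b $ c) *\<^sub>R qA c (S (T x)))"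
        by (rule sum.swap)
      finally show ?thesis by (simp add: scaleR_sum_left)
    qed
  qed
qed

definition qq :: "real \<Rightarrow> real \<Rightarrow> real \<Rightarrow> real \<Rightarrow> 'a \<Rightarrow> 'a" where
  "qq a b c d x = a *\<^sub>R x + b *\<^sub>R I x + c *\<^sub>R J x + d *\<^sub>R K x"

lemma qq_conj: "qq a b c d (qq a (- b) (- c) (- d) x) = (a\<^sup>2 + b\<^sup>2 + c\<^sup>2 + d\<^sup>2) *\<^sub>R x"
  by (simp add: qq_def algebra_simps power2_eq_square)

lemma orth_qq:
  assumes "a\<^sup>2 + b\<^sup>2 + c\<^sup>2 + d\<^sup>2 = 1" shows "orthogonal_transformation (qq a b c d)"
  unfolding orthogonal_transformation_def
proof (intro conjI allI)
  show "linear (qq a b c d)" by (rule linearI) (simp_all add: qq_def algebra_simps)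
  have "qq a b c d x \<bullet> qq a b c d y = (a\<^sup>2 + b\<^sup>2 + c\<^sup>2 + d\<^sup>2) * (x \<bullet> y)" for x y
    by (simp add: qq_def inner_simps algebra_simps power2_eq_square)
  then show "qq a b c d x \<bullet> qq a b c d y = x \<bullet> y" for x y using assms by simp
qed

lemma nrm_qq:
  assumes 1: "a\<^sup>2 + b\<^sup>2 + c\<^sup>2 + d\<^sup>2 = 1" shows "nrm (qq a b c d)"
proof (rule nrmI[OF orth_qq[OF 1]])
  \<comment> \<open>Row \<open>i\<close> of the Euler-Rodrigues matrix: the coordinates of the
    conjugate of the \<open>i\<close>-th imaginary unit by the quaternion with the coefficients
    \<open>a, b, c, d\<close>.\<close>
  define R :: "3 \<Rightarrow> 3 \<Rightarrow> real" where "R i j =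
    (if i = 1 then if j = 1 then a\<^sup>2 + b\<^sup>2 - c\<^sup>2 - d\<^sup>2 else if j = 2 then (b * c + a * d) + (b * c + a * d) else (b * d - a * c) + (b * d - a * c)
     else if i = 2 then if j = 1 then (b * c - a * d) + (b * c - a * d) else if j = 2 then a\<^sup>2 - b\<^sup>2 + c\<^sup>2 - d\<^sup>2 else (c * d + a * b) + (c * d + a * b)
     else if j = 1 then (b * d + a * c) + (b * d + a * c) else if j = 2 then (c * d - a * b) + (c * d - a * b) else a\<^sup>2 - b\<^sup>2 - c\<^sup>2 + d\<^sup>2)" for i j
  have R: "(\<Sum>j\<in>UNIV. R i j *\<^sub>R qA j (qq a b c d x)) = (a\<^sup>2 + b\<^sup>2 + c\<^sup>2 + d\<^sup>2) *\<^sub>R qq a b c d (qA i x)" for i x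
  proof -
    have dbl: "(p * (q * (r * 2))) *\<^sub>R v = (p * (q * r)) *\<^sub>R v + (p * (q * r)) *\<^sub>R v" for p q r and v :: 'a
      by (simp add: scaleR_left_distrib[symmetric])
    show ?thesis
      using exhaust_3[of i] by (auto simp: sum_3 R_def qq_def power2_eq_square algebra_simps dbl)
  qed
  show "qq a b c d (qA i x) = (\<Sum>j\<in>UNIV. R i j *\<^sub>R qA j (qq a b c d x))" for i x
    unfolding R 1 by simp
qed

lemma quat_qq: "quat I J K U = qq (Re (U $ 1 $ 1)) (Im (U $ 1 $ 1)) (Re (U $ 1 $ 2)) (Im (U $ 1 $ 2))"
  by (simp add: fun_eq_iff quat_def qq_def)

lemma inv_qq:
  assumes "a\<^sup>2 + b\<^sup>2 + c\<^sup>2 + d\<^sup>2 = 1" shows "inv (qq a b c d) = qq a (- b) (- c) (- d)"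
  using qq_conj[of a b c d] qq_conj[of a "- b" "- c" "- d"] assms
  by (intro inv_unique_comp) (simp_all add: fun_eq_iff)

lemma Sp1_entries:
  assumes "U \<in> Sp1"
  shows "U $ 2 $ 2 = cnj (U $ 1 $ 1)" "U $ 2 $ 1 = - cnj (U $ 1 $ 2)"
    "(Re (U $ 1 $ 1))\<^sup>2 + (Im (U $ 1 $ 1))\<^sup>2 + (Re (U $ 1 $ 2))\<^sup>2 + (Im (U $ 1 $ 2))\<^sup>2 = 1"
proof -
  let ?a = "U $ 1 $ 1" and ?b = "U $ 1 $ 2" and ?c = "U $ 2 $ 1" and ?d = "U $ 2 $ 2"
  have m: "U ** (\<chi> i j. cnj (U $ j $ i)) = mat 1" and dt: "det U = 1" using assms by (auto simp: Sp1_def)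
  have e: "(U ** (\<chi> i j. cnj (U $ j $ i))) $ i $ j = (mat 1 :: complex^2^2) $ i $ j" for i j
    using m by simp
  have 1: "?a * cnj ?a + ?b * cnj ?b = 1" using e[of 1 1]
    by (simp add: matrix_matrix_mult_def sum_2 mat_def)
  have 2: "?c * cnj ?a + ?d * cnj ?b = 0" using e[of 2 1]
    by (simp add: matrix_matrix_mult_def sum_2 mat_def)
  have 3: "?a * ?d - ?b * ?c = 1" using dt by (simp add: det_2)
  have "cnj ?a = cnj ?a * (?a * ?d - ?b * ?c)" using 3 by simp
  also have "\<dots> = (?a * cnj ?a + ?b * cnj ?b) * ?d - ?b * (?c * cnj ?a + ?d * cnj ?b)" by (simp add: algebra_simps)
  finally show "?d = cnj ?a" using 1 2 by simp
  have "cnj ?b = cnj ?b * (?a * ?d - ?b * ?c)" using 3 by simp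
  also have "\<dots> = - (?a * cnj ?a + ?b * cnj ?b) * ?c + ?a * (?c * cnj ?a + ?d * cnj ?b)" by (simp add: algebra_simps)
  finally show "?c = - cnj ?b" using 1 2 by simp
  show "(Re ?a)\<^sup>2 + (Im ?a)\<^sup>2 + (Re ?b)\<^sup>2 + (Im ?b)\<^sup>2 = 1"
    using arg_cong[OF 1, of Re] by (simp add: complex_mult_cnj power2_eq_square)
qed

lemma nrm_Spn_quat:
  assumes "g \<in> Spn I J K" "U \<in> Sp1" shows "nrm (g \<circ> quat I J K U)"
  unfolding quat_qq by (intro nrm_comp nrm_Spn nrm_qq assms Sp1_entries)

lemma nrm_inv:
  assumes T: "nrm T" shows "nrm (inv T)"
proof -
  note o = nrm_orth[OF T]
  obtain R :: "real^3^3" where R: "orthogonal_matrix R" "\<And>a x. T (qA a x) = (\<Sum>b\<in>UNIV. R $ a $ b *\<^sub>R qA b (T x))"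
    using T unfolding nrm_def by blast
  have R': "(\<Sum>a\<in>UNIV. R $ a $ b * R $ a $ c) = (if b = c then 1 else 0)" for b c
    using R(1) by (simp add: orthogonal_matrix_def matrix_matrix_mult_def transpose_def mat_def vec_eq_iff)
  have "T (\<Sum>a\<in>UNIV. R $ a $ b *\<^sub>R qA a (inv T x)) = qA b x" for b x
  proof -
    have "T (\<Sum>a\<in>UNIV. R $ a $ b *\<^sub>R qA a (inv T x)) = (\<Sum>a\<in>UNIV. \<Sum>c\<in>UNIV. (R $ a $ b * R $ a $ c) *\<^sub>R qA c x)"
      by (simp add: linear_sum[OF orthogonal_transformation_linear[OF o]] linear_cmul[OF orthogonal_transformation_linear[OF o]]
        R(2) orth_inv_apply[OF o] scaleR_sum_right)
    also have "\<dots> = (\<Sum>c\<in>UNIV. (\<Sum>a\<in>UNIV. R $ a $ b * R $ a $ c) *\<^sub>R qA c x)"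
      unfolding scaleR_sum_left by (rule sum.swap)
    also have "\<dots> = qA b x" unfolding R' by (simp add: if_distrib[of "\<lambda>c. c *\<^sub>R _"] cong: if_cong)
    finally show ?thesis .
  qed
  then have "inv T (qA b x) = (\<Sum>a\<in>UNIV. R $ a $ b *\<^sub>R qA a (inv T x))" for b x
    by (metis orth_inv_apply(2)[OF o])
  then show ?thesis by (rule nrmI[OF orth_inv[OF o], of "\<lambda>b a. R $ a $ b"])
qed

end

section \<open>Invariance\<close>

definition pre :: "('a \<Rightarrow> 'a) \<Rightarrow> ('a \<Rightarrow> 'a \<Rightarrow> 'a \<Rightarrow> 'b) \<Rightarrow> 'a \<Rightarrow> 'a \<Rightarrow> 'a \<Rightarrow> 'b" where
  "pre T b x y z = b (T x) (T y) (T z)"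

lemma trilin_pre:
  assumes "trilin b" "linear T" shows "trilin (pre T b)"
  unfolding trilin_def pre_def
  using linear_compose[OF assms(2) trilinD(1)[OF assms(1)]] linear_compose[OF assms(2) trilinD(2)[OF assms(1)]]
    linear_compose[OF assms(2) trilinD(3)[OF assms(1)]] by (simp add: o_def)

lemma alt3_pre:
  assumes "alt3 b" "linear T" shows "alt3 (pre T b)"
proof -
  have "pre T b y x z = - pre T b x y z" "pre T b x z y = - pre T b x y z" for x y z
    unfolding pre_def by (rule alt3_swap12[OF assms(1)], rule alt3_swap23[OF assms(1)])
  then show ?thesis using trilin_pre[OF alt3_trilin[OF assms(1)] assms(2)] unfolding alt3_def by blast
qed

context adapted
begin

lemma Lq_qA: "Lq b x y z = (\<Sum>a\<in>UNIV. b (qA a x) (qA a y) z) + (\<Sum>a\<in>UNIV. b (qA a x) y (qA a z)) +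
    (\<Sum>a\<in>UNIV. b x (qA a y) (qA a z))"
  by (simp add: Lq_def sum_3 algebra_simps)

lemma Lq_pre:
  assumes T: "nrm T" and b: "trilin b"
  shows "Lq (pre T b) x y z = Lq b (T x) (T y) (T z)"
proof -
  note t = trilinD[OF b]
  show ?thesis unfolding Lq_qA pre_def
    using nrm_sum[OF T, of "\<lambda>u v. b u v (T z)" x y] nrm_sum[OF T, of "\<lambda>u v. b u (T y) v" x z]
      nrm_sum[OF T, of "\<lambda>u v. b (T x) u v" y z] t by simp
qed

text \<open>\<open>T\<close> mixes the three contractions by its matrix, so only their simultaneous
  vanishing is invariant.\<close>

lemma ctr_pre:
  assumes T: "nrm T" and b: "trilin b" and 0: "\<And>A x. A \<in> {I, J, K} \<Longrightarrow> ctr A b x = 0" and A: "A \<in> {I, J, K}"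
  shows "ctr A (pre T b) x = 0"
proof -
  obtain R :: "real^3^3" where R: "\<And>a x. T (qA a x) = (\<Sum>b\<in>UNIV. R $ a $ b *\<^sub>R qA b (T x))"
    using T unfolding nrm_def by blast
  obtain a where a: "A = qA a" using qA_mem[OF A] by blast
  have "ctr A (pre T b) x = (\<Sum>u\<in>Basis. \<Sum>c\<in>UNIV. R $ a $ c *\<^sub>R b (T x) (T u) (qA c (T u)))"
    by (simp add: ctr_def pre_def a R linear_sum[OF trilinD(3)[OF b]] linear_cmul[OF trilinD(3)[OF b]])
  also have "\<dots> = (\<Sum>c\<in>UNIV. \<Sum>u\<in>Basis. R $ a $ c *\<^sub>R b (T x) (T u) (qA c (T u)))"
    by (rule sum.swap)
  also have "\<dots> = (\<Sum>c\<in>UNIV. R $ a $ c *\<^sub>R (\<Sum>u\<in>Basis. b (T x) (T u) (qA c (T u))))"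
    by (simp add: scaleR_sum_right)
  also have "\<dots> = (\<Sum>c\<in>UNIV. R $ a $ c *\<^sub>R ctr (qA c) b (T x))"
    unfolding ctr_def
    by (intro sum.cong refl arg_cong[of _ _ "\<lambda>v. _ *\<^sub>R v"] trace_orthogonal[OF nrm_orth[OF T], of "\<lambda>u v. b (T x) u (qA _ v)"]
        trilinD[OF b] trilin_linear2(2)[OF b lin_qA lin_qA])
  also have "\<dots> = 0"
    by (simp add: 0 qA_def)
  finally show ?thesis .
qed

lemma
  assumes T: "nrm T"
  shows mKH_pre: "mKH b \<Longrightarrow> mKH (pre T b)" and mLS_pre: "mLS b \<Longrightarrow> mLS (pre T b)"
proof -
  have "\<forall>A\<in>{I, J, K}. \<forall>x. ctr A (pre T b) x = 0" if "trilin b" "\<forall>A\<in>{I, J, K}. \<forall>x. ctr A b x = 0"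
    using ctr_pre[OF T that(1)] that(2) by blast
  then show "mKH b \<Longrightarrow> mKH (pre T b)" "mLS b \<Longrightarrow> mLS (pre T b)"
    unfolding mKH_def mLS_def using alt3_pre[of b T] Lq_pre[OF T, of b] alt3_trilin[of b]
      orthogonal_transformation_linear[OF nrm_orth[OF T]] by (simp_all add: pre_def del: ball_simps insert_iff)
qed

lemma WD_qA: "WD p q r x y z = (\<Sum>a\<in>UNIV. wd (if a = 1 then p else if a = 2 then q else r) (qA a) x y z)"
  by (simp add: WD_def sum_3)

lemma WD_EH_qA: "WD (\<lambda>x. \<beta> (I x)) (\<lambda>x. \<beta> (J x)) (\<lambda>x. \<beta> (K x)) x y z = (\<Sum>a\<in>UNIV. wd (\<lambda>x. \<beta> (qA a x)) (qA a) x y z)"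
  by (simp add: WD_def sum_3)

lemma pre_WD_EH:
  fixes \<beta> :: "'a \<Rightarrow> 'b::real_vector"
  assumes T: "nrm T" and \<beta>: "linear \<beta>"
  shows "pre T (WD (\<lambda>x. \<beta> (I x)) (\<lambda>x. \<beta> (J x)) (\<lambda>x. \<beta> (K x))) =
    WD (\<lambda>x. \<beta> (T (I x))) (\<lambda>x. \<beta> (T (J x))) (\<lambda>x. \<beta> (T (K x)))"
proof (intro ext)
  fix x y z
  have oT: "T u \<bullet> T v = u \<bullet> v" for u v using nrm_orth[OF T] by (simp add: orthogonal_transformation_def)
  have l: "linear (\<lambda>v. (p \<bullet> v) *\<^sub>R q)" for p :: 'a and q :: 'b
    by (rule linearI) (simp_all add: inner_simps scaleR_left_distrib)
  have l': "linear (\<lambda>v. (p :: real) *\<^sub>R \<beta> v)" for p by (rule linear_compose_scale_right[OF \<beta>])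
  have s: "(\<Sum>a\<in>UNIV. (u \<bullet> qA a v) *\<^sub>R \<beta> (T (qA a w))) = (\<Sum>a\<in>UNIV. (T u \<bullet> qA a (T v)) *\<^sub>R \<beta> (qA a (T w)))" for u v w
    using nrm_sum[OF T, of "\<lambda>p q. (T u \<bullet> p) *\<^sub>R \<beta> q" v w, OF l l'] by (simp add: oT)
  show "pre T (WD (\<lambda>x. \<beta> (I x)) (\<lambda>x. \<beta> (J x)) (\<lambda>x. \<beta> (K x))) x y z =
    WD (\<lambda>x. \<beta> (T (I x))) (\<lambda>x. \<beta> (T (J x))) (\<lambda>x. \<beta> (T (K x))) x y z"
    using WD_EH_qA[of "\<lambda>x. \<beta> (T x)" x y z]
    unfolding pre_def WD_EH_qA by (simp add: wd_def sum.distrib sum_subtractf s)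
qed

lemma mEH_pre:
  assumes "nrm T" "mEH b" shows "mEH (pre T b)"
proof -
  obtain \<beta> where \<beta>: "linear \<beta>" "b = WD (\<lambda>x. \<beta> (I x)) (\<lambda>x. \<beta> (J x)) (\<lambda>x. \<beta> (K x))"
    using assms(2) unfolding mEH_def by blast
  have "linear (\<lambda>x. \<beta> (T x))"
    using linear_compose[OF orthogonal_transformation_linear[OF nrm_orth[OF assms(1)]] \<beta>(1)] by (simp add: o_def)
  then show ?thesis unfolding mEH_def \<beta>(2) pre_WD_EH[OF assms(1) \<beta>(1)] by blast
qed

lemma mES_pre:
  fixes b :: "'a \<Rightarrow> 'a \<Rightarrow> 'a \<Rightarrow> 'b::real_vector"
  assumes T: "nrm T" and b: "mES b" shows "mES (pre T b)"
proof -
  obtain p q r where l: "linear p" "linear q" "linear r" and 0: "\<And>x. p (I x) + q (J x) + r (K x) = 0"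
    and b: "b = WD p q r" using b unfolding mES_def by blast
  define \<zeta> :: "3 \<Rightarrow> 'a \<Rightarrow> 'b" where "\<zeta> a = (if a = 1 then p else if a = 2 then q else r)" for a
  have l\<zeta>: "linear (\<zeta> a)" for a by (simp add: \<zeta>_def l)
  have 0: "(\<Sum>a\<in>UNIV. \<zeta> a (qA a x)) = 0" for x using 0[of x] by (simp add: \<zeta>_def sum_3)
  obtain R :: "real^3^3" where R: "orthogonal_matrix R" "\<And>a x. T (qA a x) = (\<Sum>b\<in>UNIV. R $ a $ b *\<^sub>R qA b (T x))"
    using T unfolding nrm_def by blast
  note lT = orthogonal_transformation_linear[OF nrm_orth[OF T]]
  have oT: "T u \<bullet> T v = u \<bullet> v" for u v using nrm_orth[OF T] by (simp add: orthogonal_transformation_def)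
  \<comment> \<open>The one-forms are combined by the same orthogonal matrix as the two-forms, which
    leaves the sum of their wedge products invariant.\<close>
  define \<eta> where "\<eta> a x = (\<Sum>b\<in>UNIV. R $ a $ b *\<^sub>R \<zeta> b (T x))" for a x
  have l\<eta>: "linear (\<eta> a)" for a
    unfolding \<eta>_def
    using linear_compose[OF lT l\<zeta>] by (intro linear_compose_sum ballI linear_compose_scale_right) (simp add: o_def)
  have s: "(\<Sum>a\<in>UNIV. (u \<bullet> qA a v) *\<^sub>R \<eta> a w) = (\<Sum>a\<in>UNIV. (T u \<bullet> qA a (T v)) *\<^sub>R \<zeta> a (T w))" for u v w
  proof -
    have "u \<bullet> qA a v = (\<Sum>c\<in>UNIV. R $ a $ c * (T u \<bullet> qA c (T v)))" for a
      using oT[of u "qA a v"] by (simp add: R(2) inner_sum_right)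
    then have "(\<Sum>a\<in>UNIV. (u \<bullet> qA a v) *\<^sub>R \<eta> a w) =
       (\<Sum>a\<in>UNIV. \<Sum>b\<in>UNIV. \<Sum>c\<in>UNIV. (R $ a $ b * R $ a $ c) *\<^sub>R (T u \<bullet> qA c (T v)) *\<^sub>R \<zeta> b (T w))"
      by (simp add: \<eta>_def scaleR_sum_left scaleR_sum_right sum_distrib_left mult_ac)
    then show ?thesis using orthogonal_matrix_sum[OF R(1), of "\<lambda>b c. (T u \<bullet> qA c (T v)) *\<^sub>R \<zeta> b (T w)"] by simp
  qed
  have "pre T b = WD (\<eta> 1) (\<eta> 2) (\<eta> 3)"
  proof (intro ext)
    fix x y z
    have "pre T b x y z = (\<Sum>a\<in>UNIV. wd (\<zeta> a) (qA a) (T x) (T y) (T z))"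
      unfolding pre_def b WD_qA \<zeta>_def ..
    also have "\<dots> = (\<Sum>a\<in>UNIV. wd (\<eta> a) (qA a) x y z)"
      by (simp add: wd_def sum.distrib sum_subtractf s)
    finally show "pre T b x y z = WD (\<eta> 1) (\<eta> 2) (\<eta> 3) x y z" by (simp add: WD_def sum_3)
  qed
  moreover have "\<eta> 1 (I x) + \<eta> 2 (J x) + \<eta> 3 (K x) = 0" for x
  proof -
    have "(\<Sum>a\<in>UNIV. \<eta> a (qA a x)) = (\<Sum>a\<in>UNIV. \<Sum>b\<in>UNIV. \<Sum>c\<in>UNIV. (R $ a $ b * R $ a $ c) *\<^sub>R \<zeta> b (qA c (T x)))"
      by (simp add: \<eta>_def R(2) linear_sum[OF l\<zeta>] linear_cmul[OF l\<zeta>] scaleR_sum_right)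
    also have "\<dots> = 0" using orthogonal_matrix_sum[OF R(1), of "\<lambda>b c. \<zeta> b (qA c (T x))"] 0 by simp
    finally show ?thesis by (simp add: sum_3)
  qed
  ultimately show ?thesis unfolding mES_def using l\<eta> by blast
qed

end

context quaternionic
begin

text \<open>The form of \<open>qA a\<close> is an eigenvector of the contraction with \<Omega>, so
  its pullback \<alpha> under \<open>T^-1\<close> is one for the same eigenvalue. Together with the
  quadratic equation of the Casimir sum this forces \<alpha> to equal
  \<open>\<theta> / (4 n)\<close>, an element of the span of the three \<omega>'s; translated back,
  \<open>T\<close> conjugates \<open>qA a\<close> into the span of \<open>I\<close>,
  \<open>J\<close>, \<open>K\<close>.\<close>

lemma nrm_SpnSp1:
  assumes T: "T \<in> SpnSp1 I J K" shows "nrm T"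
proof -
  define S where "S = inv T"
  have oT: "orthogonal_transformation T" and \<Omega>T: "\<And>x y z w. Omega4 I J K (T x) (T y) (T z) (T w) = Omega4 I J K x y z w"
    using T by (auto simp: SpnSp1_def)
  have oS: "orthogonal_transformation S" unfolding S_def by (rule orth_inv[OF oT])
  have TS: "T (S x) = x" "S (T x) = x" for x unfolding S_def by (rule orth_inv_apply[OF oT])+
  have \<Omega>S: "Omega4 I J K (S x) (S y) (S z) (S w) = Omega4 I J K x y z w" for x y z w
    using \<Omega>T[of "S x" "S y" "S z" "S w"] by (simp add: TS)
  note lS = orthogonal_transformation_linear[OF oS]
  have "\<exists>c. \<forall>y. T (qA a (S y)) = (\<Sum>b\<in>UNIV. c b *\<^sub>R qA b y)" for a
  proof -
    define \<alpha> where "\<alpha> x y = S x \<bullet> qA a (S y)" for x y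
    have l\<omega>: "linear (\<lambda>u. u \<bullet> qA a v)" "linear (\<lambda>v. u \<bullet> qA a v)" for u v by (rule linear_inner_qA)+
    have l\<alpha>: "linear (\<lambda>u. \<alpha> u v)" "linear (\<lambda>v. \<alpha> u v)" for u v
      using linear_compose[OF lS l\<omega>(1)] linear_compose[OF lS l\<omega>(2)] unfolding \<alpha>_def by (simp_all add: o_def)
    have sk\<omega>: "v \<bullet> qA a u = - (u \<bullet> qA a v)" for u v by (metis qA_skew inner_commute)
    have sk\<alpha>: "\<alpha> v u = - \<alpha> u v" for u v unfolding \<alpha>_def by (rule sk\<omega>)
    define t where "t b = (\<Sum>u\<in>Basis. \<Sum>v\<in>Basis. (u \<bullet> qA b v) * \<alpha> u v)" for b
    define \<theta> where "\<theta> x y = (\<Sum>b\<in>UNIV. t b * (x \<bullet> qA b y))" for x y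
    \<comment> \<open>The eigenvalue is composed of \<open>8 n\<close> from the trace term and 4
      from the Casimir sum, on which the form of \<open>qA a\<close> has the eigenvalue
      \<open>- 1\<close>.\<close>
    have D\<omega>: "(\<Sum>u\<in>Basis. \<Sum>v\<in>Basis. Omega4 I J K x y u v * (u \<bullet> qA a v)) = (8 * real n + 4) * (x \<bullet> qA a y)" for x y
    proof -
      have "(\<Sum>u\<in>Basis. \<Sum>v\<in>Basis. (u \<bullet> qA b v) * (u \<bullet> qA a v)) = (if b = a then 4 * real n else 0)" for b
      proof -
        have "(\<Sum>u\<in>Basis. \<Sum>v\<in>Basis. (u \<bullet> qA b v) * (u \<bullet> qA a v)) = (\<Sum>v\<in>Basis. \<Sum>u\<in>Basis. (qA b v \<bullet> u) * (qA a v \<bullet> u))"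
          by (subst sum.swap) (simp add: inner_commute)
        also have "\<dots> = (\<Sum>v\<in>Basis. qA b v \<bullet> qA a v)"
          by (simp add: euclidean_inner[symmetric])
        also have "\<dots> = (if b = a then 4 * real n else 0)"
          using dim exhaust_3[of a] exhaust_3[of b] by auto
        finally show ?thesis .
      qed
      then have "(\<Sum>u\<in>Basis. \<Sum>v\<in>Basis. Omega4 I J K x y u v * (u \<bullet> qA a v)) =
         (\<Sum>b\<in>UNIV. (if b = a then 8 * real n * (x \<bullet> qA a y) else 0) - 4 * (qA b x \<bullet> qA a (qA b y)))"
        unfolding Omega4_contract[OF l\<omega> sk\<omega>] by (intro sum.cong refl) auto
      also have "\<dots> = 8 * real n * (x \<bullet> qA a y) - 4 * (\<Sum>b\<in>UNIV. qA b x \<bullet> qA a (qA b y))"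
        by (simp add: sum_subtractf sum_distrib_left)
      finally show ?thesis unfolding sum_qA_bilinear by (simp add: algebra_simps)
    qed
    have Q: "(\<Sum>b\<in>UNIV. \<alpha> (qA b x) (qA b y)) = \<theta> x y / 2 - (2 * real n + 1) * \<alpha> x y" for x y
    proof -
      have "(8 * real n + 4) * \<alpha> x y = (\<Sum>u\<in>Basis. \<Sum>v\<in>Basis. Omega4 I J K (S x) (S y) (S u) (S v) * (S u \<bullet> qA a (S v)))"
        unfolding \<alpha>_def D\<omega>[symmetric]
        by (rule double_trace_orthogonal[OF oS linear_Omega4 l\<omega>, symmetric])
      also have "\<dots> = (\<Sum>u\<in>Basis. \<Sum>v\<in>Basis. Omega4 I J K x y u v * \<alpha> u v)"
        unfolding \<Omega>S \<alpha>_def ..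
      also have "\<dots> = 2 * \<theta> x y - 4 * (\<Sum>b\<in>UNIV. \<alpha> (qA b x) (qA b y))"
        unfolding Omega4_contract[OF l\<alpha> sk\<alpha>] t_def[symmetric] \<theta>_def
        by (simp add: sum_subtractf sum_distrib_left mult_ac)
      finally show ?thesis by (simp add: field_simps)
    qed
    have Q\<theta>: "(\<Sum>b\<in>UNIV. \<theta> (qA b x) (qA b y)) = - \<theta> x y" for x y
      unfolding \<theta>_def by (subst sum.swap) (simp add: sum_distrib_left[symmetric] sum_qA_bilinear sum_negf)
    \<comment> \<open>With equal indices the two substitutions cancel, and with different ones they
      give the third structure, each twice. The Casimir sum thus satisfies
      \<open>q^2 = 2 q + 3\<close>, so its eigenvalues are 3 and \<open>- 1\<close>.\<close>
    have QQ: "(\<Sum>b\<in>UNIV. \<Sum>c\<in>UNIV. \<alpha> (qA c (qA b x)) (qA c (qA b y))) = 2 * (\<Sum>b\<in>UNIV. \<alpha> (qA b x) (qA b y)) + 3 * \<alpha> x y" for x y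
      by (simp add: sum_3 linear_neg[OF l\<alpha>(1)] linear_neg[OF l\<alpha>(2)])
    have "\<alpha> x y = \<theta> x y / (4 * real n)" for x y
    proof -
      have "(\<Sum>b\<in>UNIV. \<Sum>c\<in>UNIV. \<alpha> (qA c (qA b x)) (qA c (qA b y))) =
         (\<Sum>b\<in>UNIV. \<theta> (qA b x) (qA b y)) / 2 - (2 * real n + 1) * (\<Sum>b\<in>UNIV. \<alpha> (qA b x) (qA b y))"
        by (simp only: Q sum_subtractf sum_divide_distrib[symmetric] sum_distrib_left[symmetric])
      from trans[OF QQ[symmetric] this] have "2 * (\<theta> x y / 2 - (2 * real n + 1) * \<alpha> x y) + 3 * \<alpha> x y =
         - \<theta> x y / 2 - (2 * real n + 1) * (\<theta> x y / 2 - (2 * real n + 1) * \<alpha> x y)"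
        unfolding Q Q\<theta> by simp
      then have "(real n + 2) * (4 * real n * \<alpha> x y - \<theta> x y) = 0" by (simp add: algebra_simps)
      then have "4 * real n * \<alpha> x y = \<theta> x y" by (simp add: add_eq_0_iff)
      then show ?thesis using n_gt_1 by (simp add: field_simps)
    qed
    then have "x \<bullet> T (qA a (S y)) = x \<bullet> (\<Sum>b\<in>UNIV. (t b / (4 * real n)) *\<^sub>R qA b y)" for x y
    proof -
      have "x \<bullet> T (qA a (S y)) = T (S x) \<bullet> T (qA a (S y))" by (simp add: TS)
      also have "\<dots> = \<alpha> x y" using oT by (simp add: \<alpha>_def orthogonal_transformation_def)
      also have "\<dots> = x \<bullet> (\<Sum>b\<in>UNIV. (t b / (4 * real n)) *\<^sub>R qA b y)"
        unfolding \<open>\<alpha> x y = \<theta> x y / (4 * real n)\<close> \<theta>_def by (simp add: inner_sum_right sum_divide_distrib)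
      finally show ?thesis .
    qed
    then have "T (qA a (S y)) = (\<Sum>b\<in>UNIV. (t b / (4 * real n)) *\<^sub>R qA b y)" for y
      using vector_eq_ldot by blast
    then show ?thesis by (intro exI[of _ "\<lambda>b. t b / (4 * real n)"] allI)
  qed
  then obtain R where "\<And>a y. T (qA a (S y)) = (\<Sum>b\<in>UNIV. R a b *\<^sub>R qA b y)" by metis
  from this[of _ "T _"] show ?thesis unfolding TS by (rule nrmI[OF oT])
qed

lemma mods_pre: "nrm T \<Longrightarrow> mods i b \<Longrightarrow> mods i (pre T b)"
  by (auto simp: mods_def mKH_pre mLS_pre mEH_pre mES_pre split: if_splits)

lemma mods_add:
  fixes i :: nat and b c :: "'a form3"
  assumes "i < 4" "mods i b" "mods i c" shows "mods i (\<lambda>x y z. b x y z + c x y z)"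
proof -
  have "b \<in> Sel {i}" "c \<in> Sel {i}" using assms mods_Sel[OF assms(1)] by auto
  then have "add3 b c \<in> Sel ({i} \<union> {i})" unfolding sum3_Sel[symmetric] sum3_def by blast
  then show ?thesis using mods_Sel[OF assms(1)] by (auto simp: add3_def)
qed

lemma submodule3_mods:
  fixes i :: nat
  assumes "i < 4" shows "submodule3 I J K {b. mods i b}"
  unfolding submodule3_def
proof (intro conjI ballI allI)
  show "{b. mods i b} \<subseteq> Lambda3" using mods_alt3 by (auto simp: Lambda3_alt3)
  show "zero3 \<in> {b. mods i b}" using mods_zero by (simp add: zero3_def)
  show "add3 a b \<in> {b. mods i b}" if "a \<in> {b. mods i b}" "b \<in> {b. mods i b}" for a b
    using that mods_add[OF assms] by (simp add: add3_def)
  show "scale3 c b \<in> {b. mods i b}" if "b \<in> {b. mods i b}" for c b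
    using that mods_scale by (simp add: scale3_def)
  show "(\<lambda>x y z. b (inv T x) (inv T y) (inv T z)) \<in> {b. mods i b}" if "T \<in> SpnSp1 I J K" "b \<in> {b. mods i b}" for T b
    using mods_pre[OF nrm_inv[OF nrm_SpnSp1[OF that(1)]], of i b] that(2) by (simp add: pre_def[abs_def])
qed

end

section \<open>Spaces of complex-valued functions\<close>

lemma cspaceD:
  assumes "cspace S"
  shows "(\<lambda>x. 0) \<in> S" "f \<in> S \<Longrightarrow> h \<in> S \<Longrightarrow> (\<lambda>x. f x + h x) \<in> S" "f \<in> S \<Longrightarrow> (\<lambda>x. c * f x) \<in> S"
    "f \<in> S \<Longrightarrow> h \<in> S \<Longrightarrow> (\<lambda>x. f x - h x) \<in> S"
proof -
  show *: "(\<lambda>x. 0) \<in> S" "f \<in> S \<Longrightarrow> h \<in> S \<Longrightarrow> (\<lambda>x. f x + h x) \<in> S" "f \<in> S \<Longrightarrow> (\<lambda>x. c * f x) \<in> S" for f h c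
    using assms by (auto simp: cspace_def)
  show "(\<lambda>x. f x - h x) \<in> S" if "f \<in> S" "h \<in> S"
    using *(2)[OF that(1) *(3)[OF that(2), of "- 1"]] by simp
qed

lemma cspace_sum:
  assumes "cspace S" "finite A" "\<And>i. i \<in> A \<Longrightarrow> f i \<in> S"
  shows "(\<lambda>x. \<Sum>i\<in>A. f i x) \<in> S"
  using assms(2,3)
proof (induction A rule: finite_induct)
  case empty then show ?case using cspaceD(1)[OF assms(1)] by simp
next
  case (insert a A) then show ?case using cspaceD(2)[OF assms(1), of "f a" "\<lambda>x. \<Sum>i\<in>A. f i x"] by simp
qed

text \<open>On all functions this is only semidefinite; it is definite on a space whose members are
  determined by their values on \<open>X\<close>, such as trilinear forms with
  \<open>X = XB\<close>.\<close>

definition cip :: "'x set \<Rightarrow> ('x \<Rightarrow> complex) \<Rightarrow> ('x \<Rightarrow> complex) \<Rightarrow> complex" where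
  "cip X f h = (\<Sum>p\<in>X. f p * cnj (h p))"

lemma cip_simps:
  "cip X (\<lambda>p. f p - h p) k = cip X f k - cip X h k" "cip X (\<lambda>p. f p + h p) k = cip X f k + cip X h k"
  "cip X (\<lambda>p. c * f p) k = c * cip X f k"
  "cip X k (\<lambda>p. f p - h p) = cip X k f - cip X k h" "cip X k (\<lambda>p. f p + h p) = cip X k f + cip X k h"
  "cip X k (\<lambda>p. c * f p) = cnj c * cip X k f"
  by (simp_all add: cip_def sum.distrib sum_subtractf sum_distrib_left algebra_simps)

lemma cip_sum: "cip X k (\<lambda>p. \<Sum>i\<in>A. f i p) = (\<Sum>i\<in>A. cip X k (f i))"
  unfolding cip_def by (simp add: sum_distrib_left) (rule sum.swap)

lemma cip_self_zero:
  assumes "finite X" "cip X f f = 0" "p \<in> X" shows "f p = 0"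
proof -
  have "complex_of_real (\<Sum>p\<in>X. (cmod (f p))\<^sup>2) = 0"
    using assms(2) by (simp add: cip_def complex_norm_square[symmetric] flip: of_real_power)
  then have "(\<Sum>p\<in>X. (cmod (f p))\<^sup>2) = 0" using of_real_eq_0_iff by blast
  then show ?thesis using assms(1,3) by (simp add: sum_nonneg_eq_0_iff)
qed

lemma orthogonal_projection:
  assumes X: "finite X" and B: "finite B"
  shows "\<exists>c. \<forall>b\<in>B. cip X (\<lambda>p. F p - (\<Sum>h\<in>B. c h * h p)) b = 0"
  using B
proof (induction B arbitrary: F rule: finite_induct)
  case empty then show ?case by simp
next
  case (insert b B)
  obtain c where c: "\<And>h. h \<in> B \<Longrightarrow> cip X (\<lambda>p. F p - (\<Sum>h\<in>B. c h * h p)) h = 0"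
    using insert.IH[of F] by blast
  obtain d where d: "\<And>h. h \<in> B \<Longrightarrow> cip X (\<lambda>p. b p - (\<Sum>h\<in>B. d h * h p)) h = 0"
    using insert.IH[of b] by blast
  define F1 where "F1 = (\<lambda>p. F p - (\<Sum>h\<in>B. c h * h p))"
  define D where "D = (\<lambda>p. \<Sum>h\<in>B. d h * h p)"
  define b1 where "b1 = (\<lambda>p. b p - D p)"
  \<comment> \<open>If the denominator is 0, the quotient is 0 by convention; this is harmless, as
    \<open>b1\<close> then vanishes on \<open>X\<close>.\<close>
  define a where "a = cip X F1 b1 / cip X b1 b1"
  define F2 where "F2 = (\<lambda>p. F1 p - a * b1 p)"
  have F2b1: "cip X F2 b1 = 0"
  proof (cases "cip X b1 b1 = 0")
    case True
    then have "cip X F1 b1 = 0" unfolding cip_def using cip_self_zero[OF X True] by simp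
    then show ?thesis using True by (simp add: F2_def cip_simps)
  next
    case False then show ?thesis by (simp only: F2_def cip_simps) (simp add: a_def)
  qed
  have F2B: "cip X F2 h = 0" if "h \<in> B" for h
    unfolding F2_def cip_simps(1,3) by (simp only: F1_def b1_def D_def c[OF that] d[OF that]) simp
  have "cip X F2 D = 0"
    unfolding D_def cip_sum cip_simps by (simp add: F2B)
  moreover have "b = (\<lambda>p. b1 p + D p)" by (simp add: b1_def)
  ultimately have F2b: "cip X F2 b = 0" using F2b1 by (metis add_0 cip_simps(5))
  have "F2 = (\<lambda>p. F p - (\<Sum>h\<in>insert b B. (if h = b then a else c h - a * d h) * h p))"
  proof
    fix p
    have "(\<Sum>h\<in>insert b B. (if h = b then a else c h - a * d h) * h p) = a * b p + (\<Sum>h\<in>B. (c h - a * d h) * h p)"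
      using insert.hyps by (simp add: sum.insert) (rule sum.cong, auto)
    then show "F2 p = F p - (\<Sum>h\<in>insert b B. (if h = b then a else c h - a * d h) * h p)"
      by (simp add: F2_def F1_def b1_def D_def sum_subtractf sum_distrib_left algebra_simps)
  qed
  then show ?case using F2B F2b by (intro exI[of _ "\<lambda>h. if h = b then a else c h - a * d h"]) (metis insert_iff)
qed

text \<open>Induction on the points: requiring the value 0 at one more point lowers the dimension by
  at most one, and a function \<open>k\<close> nonzero there completes the generating set.\<close>

lemma finite_dim_of_points:
  assumes "finite X" "cspace S" "\<And>f. f \<in> S \<Longrightarrow> (\<And>p. p \<in> X \<Longrightarrow> f p = 0) \<Longrightarrow> f = (\<lambda>x. 0)"
  shows "cfinite_dim S"
  using assms
proof (induction X arbitrary: S rule: finite_induct)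
  case empty
  then show ?case unfolding cfinite_dim_def by (intro exI[of _ "{}"]) auto
next
  case (insert q X)
  define S0 where "S0 = {f \<in> S. f q = 0}"
  have "cspace S0" using insert.prems(1) unfolding cspace_def S0_def by auto
  moreover have "f = (\<lambda>x. 0)" if "f \<in> S0" "\<And>p. p \<in> X \<Longrightarrow> f p = 0" for f
    using that insert.prems(2)[of f] by (auto simp: S0_def)
  ultimately have "cfinite_dim S0" by (rule insert.IH)
  then obtain B where B: "finite B" "B \<subseteq> S0" "\<And>f. f \<in> S0 \<Longrightarrow> \<exists>c. f = (\<lambda>x. \<Sum>h\<in>B. c h * h x)"
    unfolding cfinite_dim_def by blast
  show ?case
  proof (cases "S0 = S")
    case True then show ?thesis using \<open>cfinite_dim S0\<close> by simp
  next
    case False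
    then obtain k where k: "k \<in> S" "k q \<noteq> 0" by (auto simp: S0_def)
    then have kB: "k \<notin> B" using B(2) by (auto simp: S0_def)
    show ?thesis unfolding cfinite_dim_def
    proof (intro exI[of _ "insert k B"] conjI ballI)
      show "finite (insert k B)" "insert k B \<subseteq> S" using B k by (auto simp: S0_def)
      fix f assume f: "f \<in> S"
      have "(\<lambda>x. f x - f q / k q * k x) \<in> S0"
        using cspaceD(4)[OF insert.prems(1) f cspaceD(3)[OF insert.prems(1) k(1), of "f q / k q"]] k(2) by (simp add: S0_def)
      then obtain c where c: "(\<lambda>x. f x - f q / k q * k x) = (\<lambda>x. \<Sum>h\<in>B. c h * h x)" using B(3) by blast
      have "f x = (\<Sum>h\<in>insert k B. (c(k := f q / k q)) h * h x)" for x
      proof -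
        have "(\<Sum>h\<in>insert k B. (c(k := f q / k q)) h * h x) = f q / k q * k x + (\<Sum>h\<in>B. c h * h x)"
          using B(1) kB by (simp add: sum.insert) (rule sum.cong, auto)
        then show ?thesis using fun_cong[OF c, of x] by (simp add: algebra_simps)
      qed
      then show "\<exists>c. f = (\<lambda>x. \<Sum>h\<in>insert k B. c h * h x)" by blast
    qed
  qed
qed

lemma orthogonal_decomposition:
  assumes X: "finite X" and W: "cspace W" "cfinite_dim W"
  obtains P where "P \<in> W" "\<And>w. w \<in> W \<Longrightarrow> cip X (\<lambda>p. F p - P p) w = 0"
proof -
  obtain B where B: "finite B" "B \<subseteq> W" "\<And>f. f \<in> W \<Longrightarrow> \<exists>c. f = (\<lambda>x. \<Sum>h\<in>B. c h * h x)"
    using W(2) unfolding cfinite_dim_def by blast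
  obtain c where c: "\<And>b. b \<in> B \<Longrightarrow> cip X (\<lambda>p. F p - (\<Sum>h\<in>B. c h * h p)) b = 0"
    using orthogonal_projection[OF X B(1), of F] by blast
  show ?thesis
  proof (rule that[of "\<lambda>p. \<Sum>h\<in>B. c h * h p"])
    show "(\<lambda>p. \<Sum>h\<in>B. c h * h p) \<in> W"
      by (rule cspace_sum[OF W(1) B(1)]) (use B(2) cspaceD(3)[OF W(1)] in blast)
    fix w assume "w \<in> W"
    then obtain d where d: "w = (\<lambda>x. \<Sum>h\<in>B. d h * h x)" using B(3) by blast
    show "cip X (\<lambda>p. F p - (\<Sum>h\<in>B. c h * h p)) w = 0"
      unfolding d cip_sum cip_simps(6) using c by simp
  qed
qed

text \<open>Used to show that an explicit set generates a module without counting dimensions. When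
  the generators represent evaluations, the hypothesis \<open>perp\<close> says that a form
  vanishing at certain vectors is zero.\<close>

lemma orthogonal_complement_zero:
  assumes X: "finite X" and S: "cspace S" "\<And>f. f \<in> S \<Longrightarrow> (\<And>p. p \<in> X \<Longrightarrow> f p = 0) \<Longrightarrow> f = (\<lambda>x. 0)"
    and W: "cspace W" "W \<subseteq> S" and perp: "\<And>f. f \<in> S \<Longrightarrow> (\<And>w. w \<in> W \<Longrightarrow> cip X f w = 0) \<Longrightarrow> f = (\<lambda>x. 0)"
  shows "W = S"
proof
  show "S \<subseteq> W"
  proof
    fix f assume f: "f \<in> S"
    have "cfinite_dim W" using finite_dim_of_points[OF X W(1)] S(2) W(2) by blast
    then obtain P where P: "P \<in> W" "\<And>w. w \<in> W \<Longrightarrow> cip X (\<lambda>p. f p - P p) w = 0"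
      using orthogonal_decomposition[OF X W(1)] by blast
    have "(\<lambda>p. f p - P p) = (\<lambda>x. 0)" using perp P cspaceD(4)[OF S(1) f] W(2) by blast
    then have "f = P" by (metis (no_types, lifting) eq_iff_diff_eq_0 ext)
    then show "f \<in> W" using P(1) by simp
  qed
qed (rule W(2))

definition cspan :: "('x \<Rightarrow> complex) set \<Rightarrow> ('x \<Rightarrow> complex) set" where
  "cspan A = \<Inter>{S. cspace S \<and> A \<subseteq> S}"

lemma cspace_cspan: "cspace (cspan A)"
  unfolding cspan_def cspace_def by blast

lemma cspan_superset: "A \<subseteq> cspan A"
  unfolding cspan_def by blast

lemma cspan_minimal: "cspace S \<Longrightarrow> A \<subseteq> S \<Longrightarrow> cspan A \<subseteq> S"
  unfolding cspan_def by blast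

lemma sum_fun_apply: "(\<Sum>i\<in>A. f i) x = (\<Sum>i\<in>A. f i x)" for f :: "'i \<Rightarrow> 'x \<Rightarrow> complex"
  by (induction A rule: infinite_finite_induct) auto

interpretation cfun: vector_space "\<lambda>(c::complex) f x. c * f x"
  by unfold_locales (auto simp: fun_eq_iff algebra_simps plus_fun_def)

text \<open>An injective map sends a basis to an independent set of the same size; a vector of the
  space outside its span would give more independent vectors than the basis has.\<close>

lemma inj_endo_surj:
  assumes S: "cspace S" "cfinite_dim S"
    and \<theta>: "clinear_on S \<theta>" "inj_on \<theta> S" "\<theta> ` S \<subseteq> S"
  shows "\<theta> ` S = S"
proof -
  have sub: "cfun.subspace S" using cspaceD[OF S(1)]
    by (auto simp: cfun.subspace_def zero_fun_def plus_fun_def)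
  obtain F where F: "finite F" "F \<subseteq> S" "\<And>f. f \<in> S \<Longrightarrow> \<exists>c. f = (\<lambda>x. \<Sum>h\<in>F. c h * h x)"
    using S(2) unfolding cfinite_dim_def by blast
  have SF: "S \<subseteq> cfun.span F"
  proof
    fix f assume "f \<in> S"
    then obtain c where "f = (\<lambda>x. \<Sum>h\<in>F. c h * h x)" using F(3) by blast
    then have "f = (\<Sum>h\<in>F. (\<lambda>x. c h * h x))" by (simp add: fun_eq_iff sum_fun_apply)
    then show "f \<in> cfun.span F" by (simp add: cfun.span_sum cfun.span_scale cfun.span_base)
  qed
  obtain B where B: "B \<subseteq> S" "cfun.independent B" "S \<subseteq> cfun.span B"
    by (rule cfun.basis_exists[of S])
  have fB: "finite B" "card B \<le> card F"
    using cfun.independent_span_bound[OF F(1) B(2)] B(1) SF by auto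
  have \<theta>add: "\<theta> (f + h) = \<theta> f + \<theta> h" "\<theta> (\<lambda>x. c * f x) = (\<lambda>x. c * \<theta> f x)" if "f \<in> S" "h \<in> S" for f h c
    using \<theta>(1)[unfolded clinear_on_def, THEN conjunct1, rule_format, OF that]
      \<theta>(1)[unfolded clinear_on_def, THEN conjunct2, rule_format, OF that(1)]
    by (simp_all add: plus_fun_def)
  have \<theta>sum: "\<theta> (\<Sum>b\<in>A. (\<lambda>x. c b * b x)) = (\<Sum>b\<in>A. (\<lambda>x. c b * \<theta> b x)) \<and> (\<Sum>b\<in>A. (\<lambda>x. c b * b x)) \<in> S"
    if "A \<subseteq> S" "finite A" for A c
    using that(2,1)
  proof (induction A rule: finite_induct)
    case empty
    have 0: "(\<lambda>x. 0) \<in> S" by (rule cspaceD(1)[OF S(1)])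
    show ?case using \<theta>add(2)[OF 0 0, of 0] 0 by (simp add: zero_fun_def)
  next
    case (insert a A)
    then have aS: "a \<in> S" and IH: "\<theta> (\<Sum>b\<in>A. (\<lambda>x. c b * b x)) = (\<Sum>b\<in>A. (\<lambda>x. c b * \<theta> b x))"
      "(\<Sum>b\<in>A. (\<lambda>x. c b * b x)) \<in> S" by auto
    have caS: "(\<lambda>x. c a * a x) \<in> S" by (rule cspaceD(3)[OF S(1) aS])
    show ?case
      unfolding sum.insert[OF insert.hyps(1,2)] \<theta>add(1)[OF caS IH(2)] \<theta>add(2)[OF aS aS] IH(1)
      using cfun.subspace_add[OF sub caS IH(2)] by blast
  qed
  have "cfun.independent (\<theta> ` B)"
  proof (rule cfun.independent_if_scalars_zero)
    show "finite (\<theta> ` B)" using fB by simp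
    fix u h assume u: "(\<Sum>h\<in>\<theta> ` B. (\<lambda>x. u h * h x)) = 0" and h: "h \<in> \<theta> ` B"
    have inj: "inj_on \<theta> B" using \<theta>(2) B(1) by (rule inj_on_subset)
    have 0: "(\<lambda>x. 0) \<in> S" by (rule cspaceD(1)[OF S(1)])
    have "(\<Sum>b\<in>B. (\<lambda>x. u (\<theta> b) * \<theta> b x)) = 0" using u by (simp add: sum.reindex[OF inj])
    then have "\<theta> (\<Sum>b\<in>B. (\<lambda>x. u (\<theta> b) * b x)) = \<theta> (\<lambda>x. 0)"
      using \<theta>sum[OF B(1) fB(1), of "\<lambda>b. u (\<theta> b)"] \<theta>add(2)[OF 0 0, of 0] by (simp add: zero_fun_def)
    then have "(\<Sum>b\<in>B. (\<lambda>x. u (\<theta> b) * b x)) = (\<lambda>x. 0)"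
      using \<theta>sum[OF B(1) fB(1), of "\<lambda>b. u (\<theta> b)"] 0 inj_onD[OF \<theta>(2)] by blast
    then show "u h = 0" using h cfun.independentD[OF B(2) fB(1) order_refl, of "\<lambda>b. u (\<theta> b)"] by (auto simp: zero_fun_def)
  qed
  moreover have "card (\<theta> ` B) = card B" using \<theta>(2) B(1) by (meson card_image inj_on_subset)
  ultimately have "S \<subseteq> cfun.span (\<theta> ` B)"
  proof -
    assume *: "cfun.independent (\<theta> ` B)" "card (\<theta> ` B) = card B"
    show "S \<subseteq> cfun.span (\<theta> ` B)"
    proof (rule ccontr)
      assume "\<not> S \<subseteq> cfun.span (\<theta> ` B)"
      then obtain f where f: "f \<in> S" "f \<notin> cfun.span (\<theta> ` B)" by blast
      then have "cfun.independent (insert f (\<theta> ` B))" using *(1) by (simp add: cfun.independent_insert)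
      moreover have "insert f (\<theta> ` B) \<subseteq> cfun.span B" using f(1) B(1,3) \<theta>(3) by blast
      ultimately have "card (insert f (\<theta> ` B)) \<le> card B" by (rule cfun.independent_span_bound[OF fB(1), THEN conjunct2])
      moreover have "f \<notin> \<theta> ` B" using f(2) cfun.span_base by blast
      ultimately show False using * fB(1) by simp
    qed
  qed
  moreover have "cfun.span (\<theta> ` B) \<subseteq> \<theta> ` S"
  proof (rule cfun.span_minimal)
    show "\<theta> ` B \<subseteq> \<theta> ` S" using B(1) by blast
    show "cfun.subspace (\<theta> ` S)"
      unfolding cfun.subspace_def
    proof (intro conjI ballI allI)
      have 0: "(\<lambda>x. 0) \<in> S" by (rule cspaceD(1)[OF S(1)])
      have "\<theta> (\<lambda>x. 0) = 0" using \<theta>add(2)[OF 0 0, of 0] by (simp add: zero_fun_def)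
      then show "0 \<in> \<theta> ` S" using 0 by (metis imageI)
      show "x + y \<in> \<theta> ` S" if xy: "x \<in> \<theta> ` S" "y \<in> \<theta> ` S" for x y
      proof -
        obtain f h where fh: "f \<in> S" "h \<in> S" and e: "x = \<theta> f" "y = \<theta> h" using xy by blast
        show ?thesis unfolding e \<theta>add(1)[OF fh, symmetric] by (rule imageI[OF cfun.subspace_add[OF sub fh]])
      qed
      show "(\<lambda>t. c * x t) \<in> \<theta> ` S" if x: "x \<in> \<theta> ` S" for c x
      proof -
        obtain f where f: "f \<in> S" and e: "x = \<theta> f" using x by blast
        show ?thesis unfolding e \<theta>add(2)[OF f f, symmetric] by (rule imageI[OF cspaceD(3)[OF S(1) f]])
      qed
    qed
  qed
  ultimately show ?thesis using \<theta>(3) by blast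
qed

section \<open>Complex-linear forms on \<open>(V, I)\<close>\<close>

lemma alt3_diag:
  fixes F :: "'a::real_vector \<Rightarrow> 'a \<Rightarrow> 'a \<Rightarrow> complex"
  assumes "alt3 F" shows "F x x y = 0" "F x y x = 0" "F y x x = 0"
proof -
  show "F x x y = 0" "F y x x = 0" for x y
    using alt3_swap12[OF assms, of x x y] alt3_swap23[OF assms, of y x x] by simp_all
  show "F x y x = 0" using alt3_swap13[OF assms, of x y x] by simp
qed

context adapted
begin

text \<open>The elements of \<open>E \<otimes> E \<otimes> E\<close>, with E realized by
  complex-linear forms on \<open>(V, I)\<close>.\<close>

definition etri :: "('a \<Rightarrow> 'a \<Rightarrow> 'a \<Rightarrow> complex) \<Rightarrow> bool" where
  "etri F \<longleftrightarrow> trilin F \<and> (\<forall>x y z. F (I x) y z = \<i> * F x y z \<and> F x (I y) z = \<i> * F x y z \<and> F x y (I z) = \<i> * F x y z)"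

lemma etri_trilin: "etri F \<Longrightarrow> trilin F"
  by (simp add: etri_def)

lemma etri_I: "etri F \<Longrightarrow> F (I x) y z = \<i> * F x y z" "etri F \<Longrightarrow> F x (I y) z = \<i> * F x y z"
    "etri F \<Longrightarrow> F x y (I z) = \<i> * F x y z"
  by (simp_all add: etri_def)

lemma E_mod_etri: "etri F \<Longrightarrow> (\<lambda>x. F x y z) \<in> E_mod I" "etri F \<Longrightarrow> (\<lambda>y. F x y z) \<in> E_mod I"
    "etri F \<Longrightarrow> (\<lambda>z. F x y z) \<in> E_mod I"
  by (simp_all add: E_mod_def etri_def trilinD)

lemma etri_iff: "etri F \<longleftrightarrow> (\<forall>y z. (\<lambda>x. F x y z) \<in> E_mod I) \<and> (\<forall>x z. (\<lambda>y. F x y z) \<in> E_mod I) \<and>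
    (\<forall>x y. (\<lambda>z. F x y z) \<in> E_mod I)"
  by (auto simp: E_mod_def etri_def trilin_def)

abbreviation cur :: "('a \<times> 'a \<times> 'a \<Rightarrow> complex) \<Rightarrow> 'a \<Rightarrow> 'a \<Rightarrow> 'a \<Rightarrow> complex" where
  "cur F \<equiv> \<lambda>x y z. F (x, y, z)"

lemma L3E_iff: "F \<in> L3E_mod I \<longleftrightarrow> etri (cur F) \<and> alt3 (cur F)"
proof -
  have "F \<in> L3E_mod I \<longleftrightarrow> etri (cur F) \<and> (\<forall>x y z. F (y, x, z) = - F (x, y, z)) \<and> (\<forall>x y z. F (x, z, y) = - F (x, y, z))"
    unfolding L3E_mod_def etri_iff by blast
  then show ?thesis unfolding alt3_def using etri_trilin[of "cur F"] by blast
qed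

text \<open>The complex-linear form that represents evaluation at \<open>x\<close>: by
  \<open>sum_eps\<close> the Hermitian product of \<open>f\<close> with it is \<open>2 f x\<close>.
  The factor 2 arises because the sum runs over a real basis.\<close>

definition eps :: "'a \<Rightarrow> 'a \<Rightarrow> complex" where
  "eps x p = complex_of_real (x \<bullet> p) - \<i> * complex_of_real (x \<bullet> I p)"

lemma eps_E: "eps x \<in> E_mod I"
  by (simp add: E_mod_def eps_def linear_iff algebra_simps inner_simps scaleR_conv_of_real)

lemma eps_linear_left: "eps (x + y) p = eps x p + eps y p" "eps (c *\<^sub>R x) p = of_real c * eps x p"
    "eps (- x) p = - eps x p" "eps (I x) p = - \<i> * eps x p"
  by (simp_all add: eps_def inner_simps algebra_simps)

lemma eps_I: "eps x (I p) = \<i> * eps x p"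
  by (simp add: eps_def algebra_simps)

lemma eps_horth:
  assumes "horth x y" shows "eps x y = 0" "eps x (J y) = 0" "eps x (K y) = 0"
  using assms by (simp_all add: eps_def horth_def)

lemma eps_self: "eps x (J x) = 0" "eps x (K x) = 0" "eps x x = of_real (x \<bullet> x)"
  by (simp_all add: eps_def)

lemma sum_eps:
  assumes "f \<in> E_mod I" shows "(\<Sum>p\<in>Basis. f p * cnj (eps x p)) = 2 * f x"
proof -
  have l: "linear f" and fI: "f (I x) = \<i> * f x" using assms by (auto simp: E_mod_def)
  have "(\<Sum>p\<in>Basis. f p * cnj (eps x p)) = (\<Sum>p\<in>Basis. (x \<bullet> p) *\<^sub>R f p) + \<i> * (\<Sum>p\<in>Basis. (x \<bullet> I p) *\<^sub>R f p)"
    by (simp add: eps_def sum.distrib sum_distrib_left scaleR_conv_of_real algebra_simps)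
  also have "(\<Sum>p\<in>Basis. (x \<bullet> I p) *\<^sub>R f p) = - f (I x)"
    using sum_Basis_linear[OF l, of "I x"] by (simp add: sum_negf minus_equation_iff[of "sum _ _"] eq_commute)
  finally show ?thesis using sum_Basis_linear[OF l, of x] by (simp add: fI)
qed

lemma horth_simps:
  "horth x y \<Longrightarrow> horth x z \<Longrightarrow> horth x (y + z)" "horth x y \<Longrightarrow> horth x z \<Longrightarrow> horth x (y - z)"
  "horth x y \<Longrightarrow> horth x (J y)" "horth x y \<Longrightarrow> horth (J x) y" "horth x y \<Longrightarrow> horth (c *\<^sub>R x) (d *\<^sub>R y)"
  "horth x y \<Longrightarrow> horth z y \<Longrightarrow> horth (x + z) y" "horth x y \<Longrightarrow> horth x (- y)" "horth x y \<Longrightarrow> horth (- x) y"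
  by (auto simp: horth_def inner_simps)

lemma horth_sum_diff:
  assumes "horth a b" "a \<bullet> a = b \<bullet> b" shows "horth (a + b) (a - b)"
  using assms inner_flip[of b a] by (simp add: horth_def inner_simps inner_commute)

text \<open>The vectors \<open>e r\<close> and \<open>J (e r)\<close> form a complex basis of
  \<open>(V, I)\<close> consisting of weight vectors of the torus.\<close>

definition lab :: "(nat \<Rightarrow> 'a) \<Rightarrow> nat \<Rightarrow> bool \<Rightarrow> 'a" where
  "lab e r j = (if j then J (e r) else e r)"

lemma frame_horth: "frame k e \<Longrightarrow> r < k \<Longrightarrow> s < k \<Longrightarrow> r \<noteq> s \<Longrightarrow> horth (e r) (e s)"
  by (simp add: frame_iff)

lemma frame_unit: "frame k e \<Longrightarrow> r < k \<Longrightarrow> e r \<bullet> e r = 1"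
  by (simp add: frame_iff)

lemma lab_horth: "frame k e \<Longrightarrow> r < k \<Longrightarrow> s < k \<Longrightarrow> r \<noteq> s \<Longrightarrow> horth (lab e r i) (lab e s j)"
  by (simp add: lab_def frame_horth horth_simps)

text \<open>Replacing one member by its image under \<open>J\<close> gives a frame again. Statements
  about components with first label \<open>e s\<close> thereby extend to the label
  \<open>J (e s)\<close>.\<close>

lemma frame_upd_lab:
  assumes "frame k e" "s < k" shows "frame k (e(s := lab e s j))"
proof -
  have "horth (lab e s j) (e r)" "horth (e r) (lab e s j)" if "r < k" "r \<noteq> s" for r
    using lab_horth[OF assms(1), of s r j False] lab_horth[OF assms(1), of r s False j] assms that by (simp_all add: lab_def)
  moreover have "lab e s j \<bullet> lab e s j = 1" using frame_unit[OF assms] by (simp add: lab_def)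
  ultimately show ?thesis using assms by (simp add: frame_iff)
qed

end

section \<open>Trace-free forms are determined on quaternionically orthogonal vectors\<close>

context quaternionic
begin

text \<open>Each quaternionic line contributes four real vectors, but by complex linearity their
  terms agree in pairs. The result is twice the contraction with the complex symplectic form in a
  symplectic basis.\<close>

lemma ctr_J_frame:
  assumes F: "etri F" and e: "frame n e"
  shows "ctr J F x = (\<Sum>r<n. 2 * (F x (e r) (J (e r)) - F x (J (e r)) (e r)))"
    "(\<Sum>u\<in>Basis. F u x (J u)) = (\<Sum>r<n. 2 * (F (e r) x (J (e r)) - F (J (e r)) x (e r)))"
proof -
  note t = etri_trilin[OF F]
  have K: "K y = I (J y)" for y by simp
  have JK: "J (I y) = - (I (J y))" for y by simp
  have 1: "linear (\<lambda>u. F x u (J v))" "linear (\<lambda>v. F x u (J v))" "linear (\<lambda>u. F u x (J v))" "linear (\<lambda>v. F u x (J v))" for u v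
    using t linear_comp_IJK(2)[OF trilinD(3)[OF t]] by (simp_all add: trilinD)
  show "ctr J F x = (\<Sum>r<n. 2 * (F x (e r) (J (e r)) - F x (J (e r)) (e r)))"
    unfolding ctr_def trace_tight_frame[OF frame_complete[OF e], of "\<lambda>u v. F x u (J v)", OF 1(1,2), symmetric] sum_fam
    by (rule sum.cong) (simp_all add: trilin_simps[OF t] etri_I[OF F] K del: quat_mult(4))
  show "(\<Sum>u\<in>Basis. F u x (J u)) = (\<Sum>r<n. 2 * (F (e r) x (J (e r)) - F (J (e r)) x (e r)))"
    unfolding trace_tight_frame[OF frame_complete[OF e], of "\<lambda>u v. F u x (J v)", OF 1(3,4), symmetric] sum_fam
    by (rule sum.cong) (simp_all add: trilin_simps[OF t] etri_I[OF F] K del: quat_mult(4))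
qed

lemma E_mod_ext:
  assumes f: "f \<in> E_mod I" and e: "frame n e" and 0: "\<And>r j. r < n \<Longrightarrow> f (lab e r j) = 0"
  shows "f x = 0"
proof -
  have l: "linear f" and fI: "\<And>x. f (I x) = \<i> * f x" using f by (auto simp: E_mod_def)
  have z: "f (e r) = 0" "f (J (e r)) = 0" "f (I (e r)) = 0" "f (K (e r)) = 0" if "r < n" for r
    using 0[OF that, of False] 0[OF that, of True] fI[of "e r"] fI[of "J (e r)"] by (simp_all add: lab_def)
  have "f x = (\<Sum>i\<in>{..<n}\<times>{..<4}. (x \<bullet> fam e i) *\<^sub>R f (fam e i))"
    by (subst frame_complete[OF e, symmetric]) (simp add: linear_sum[OF l] linear_cmul[OF l])
  also have "\<dots> = 0" unfolding sum_fam by (simp add: z)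
  finally show ?thesis .
qed

lemma etri_ext:
  assumes F: "etri F" and e: "frame n e"
    and 0: "\<And>r s t i j k. r < n \<Longrightarrow> s < n \<Longrightarrow> t < n \<Longrightarrow> F (lab e r i) (lab e s j) (lab e t k) = 0"
  shows "F x y z = 0"
proof -
  have "F x (lab e s j) (lab e t k) = 0" if "s < n" "t < n" for x s t j k
    using E_mod_ext[OF E_mod_etri(1)[OF F] e] 0 that by blast
  then have "F x y (lab e t k) = 0" if "t < n" for x y t k
    using E_mod_ext[OF E_mod_etri(2)[OF F] e] that by blast
  then show ?thesis using E_mod_ext[OF E_mod_etri(3)[OF F] e] by blast
qed

lemma frame_exists: "\<exists>e. frame n e"
  using frame_extend[of 0 "\<lambda>_. 0"] by (auto simp: frame_iff)

text \<open>The components left open by the hypothesis are \<open>F (e s) (e r) (J (e r))\<close>.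
  By polarization they do not depend on \<open>r \<noteq> s\<close>, and the trace is a nonzero
  multiple of their sum, \<open>n - 1\<close> times the common value. Changing the frame by
  \<open>frame_upd_lab\<close> covers the remaining labels.\<close>

lemma L03E_determined:
  assumes F: "etri F" and a: "alt3 F" and tr: "\<And>x. ctr J F x = 0"
    and h: "\<And>x y z. horth x y \<Longrightarrow> horth x z \<Longrightarrow> horth y z \<Longrightarrow> F x y z = 0"
  shows "F x y z = 0"
proof -
  note t = trilin_simps[OF etri_trilin[OF F]]
  note dg = alt3_diag[OF a]
  have \<phi>0: "F (e s) (e r) (J (e r)) = 0" if e: "frame n e" and sr: "s < n" "r < n" "r \<noteq> s" for e s r
  proof -
    define \<phi> where "\<phi> t = F (e s) (e t) (J (e t))" for t
    have eq: "\<phi> q = \<phi> r" if q: "q < n" "q \<noteq> s" for q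
    proof (cases "q = r")
      case False
      note ho = frame_horth[OF e]
      \<comment> \<open>Sum and difference of orthogonal vectors of equal length are again
        orthogonal in the quaternionic sense; expanding \<open>F\<close> on this pair compares the
        components for \<open>r\<close> and \<open>q\<close>.\<close>
      have "horth (e r + e q) (J (e r - e q))"
        by (intro horth_simps horth_sum_diff ho) (use sr q False frame_unit[OF e] in auto)
      moreover have "horth (e s) (e r + e q)" "horth (e s) (J (e r - e q))"
        by (intro horth_simps ho; use sr q in auto)+
      ultimately have "F (e s) (e r + e q) (J (e r - e q)) = 0" by (intro h)
      moreover have "F (e s) (e r) (J (e q)) = 0" "F (e s) (e q) (J (e r)) = 0"
        by (intro h horth_simps ho; use sr q False in auto)+
      ultimately show ?thesis by (simp add: t \<phi>_def)
    qed simp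
    have "F (e s) (J (e q)) (e q) = - \<phi> q" for q unfolding \<phi>_def by (rule alt3_swap23[OF a])
    then have "(\<Sum>q<n. \<phi> q) = 0" using tr[of "e s"] unfolding ctr_J_frame(1)[OF F e]
      by (simp add: \<phi>_def[symmetric] flip: sum_distrib_left)
    \<comment> \<open>The summand with index \<open>s\<close> vanishes since \<open>F\<close>
      alternates, which leaves \<open>n - 1\<close> equal summands.\<close>
    moreover have "(\<Sum>q<n. \<phi> q) = (\<Sum>q\<in>{..<n} - {s}. \<phi> q)"
      using sr(1) by (subst sum.remove[of _ s]) (auto simp: \<phi>_def dg)
    moreover have "\<dots> = of_nat (n - 1) * \<phi> r"
      using eq sr(1) by simp
    ultimately show ?thesis using n_gt_1 by (simp add: \<phi>_def)
  qed
  obtain e where e: "frame n e" using frame_exists by blast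
  have \<phi>1: "F (lab e s i) (e r) (J (e r)) = 0" if "s < n" "r < n" "r \<noteq> s" for s r i
    using \<phi>0[OF frame_upd_lab[OF e that(1), of i] that] that by simp
  have two: "F x (lab e r j) (lab e r k) = 0" if "x = lab e s i" "s < n" "r < n" for x s r i j k
  proof (cases "s = r")
    case True then show ?thesis using that dg by (cases i; cases j; cases k) (auto simp: lab_def)
  next
    case False
    then show ?thesis using \<phi>1[of s r i] alt3_swap23[OF a, of x "J (e r)" "e r"] that dg
      by (cases j; cases k) (auto simp: lab_def)
  qed
  show ?thesis
  proof (rule etri_ext[OF F e])
    fix r s q i j k assume *: "r < n" "s < n" "q < n"
    consider "s = q" | "r = q" | "r = s" | "r \<noteq> s" "r \<noteq> q" "s \<noteq> q" by blast
    then show "F (lab e r i) (lab e s j) (lab e q k) = 0"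
    proof cases
      case 1 then show ?thesis using two * by blast
    next
      case 2 then show ?thesis using two[OF refl *(2,1), of j i k] alt3_swap12[OF a, of "lab e s j" "lab e r i"] by simp
    next
      case 3 then show ?thesis using two[OF refl *(3,1), of k i j] alt3_swap13[OF a, of "lab e q k" "lab e s j" "lab e r i"]
        alt3_swap23[OF a, of "lab e q k" "lab e s j" "lab e r i"] by simp
    next
      case 4 then show ?thesis using lab_horth[OF e] * by (intro h) auto
    qed
  qed
qed

text \<open>The symmetric model of the Schur functor of type (2,1). Polarization shows that
  \<open>c = F a a (J a)\<close> equals \<open>2 F a b (J b)\<close> for every other member
  \<open>b\<close> of the frame. In the trace at \<open>a\<close> the line of \<open>a\<close>
  itself contributes \<open>3 c\<close> and each other line \<open>2 c\<close>, so
  \<open>(2 n + 1) c = 0\<close>.\<close>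

lemma K_determined_sym:
  assumes F: "etri F" and sy: "\<And>x y z. F y x z = F x y z" and cyc: "\<And>x y z. F x y z + F y z x + F z x y = 0"
    and tr: "\<And>y. (\<Sum>u\<in>Basis. F u y (J u)) = 0"
    and h: "\<And>x x' y. horth x y \<Longrightarrow> horth x' y \<Longrightarrow> F x x' y = 0"
  shows "F x y z = 0"
proof -
  note t = trilin_simps[OF etri_trilin[OF F]]
  have h2: "F a b c = - F a c b" if "horth b a" "horth c a" for a b c
    using cyc[of a b c] h[OF that] sy[of a c b] by (simp add: add_eq_0_iff)
  have c0: "F (e s) (e s) (J (e s)) = 0 \<and> (\<forall>r<n. r \<noteq> s \<longrightarrow> F (e s) (e r) (J (e r)) = 0)" if e: "frame n e" and s: "s < n" for e s
  proof -
    let ?a = "e s"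
    define c where "c = F ?a ?a (J ?a)"
    have \<phi>: "c = 2 * F ?a (e r) (J (e r))" if r: "r < n" "r \<noteq> s" for r
    proof -
      let ?b = "e r"
      have ab: "horth ?a ?b" "horth ?b ?a" using frame_horth[OF e] s r by auto
      have u: "?a \<bullet> ?a = ?b \<bullet> ?b" using frame_unit[OF e] s r by simp
      have 1: "horth (?a + ?b) (J (?a - ?b))" by (intro horth_simps horth_sum_diff ab u)
      have 2: "horth (?a - ?b) (J (?a + ?b))"
        by (rule horth_simps(3)[OF horth_sym[OF horth_sum_diff[OF ab(1) u]]])
      \<comment> \<open>In the sum of these two values all terms with an odd number of
        \<open>?b\<close> cancel.\<close>
      have "F (?a + ?b) (?a + ?b) (J (?a - ?b)) = 0" "F (?a - ?b) (?a - ?b) (J (?a + ?b)) = 0"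
        by (rule h[OF 1 1], rule h[OF 2 2])
      moreover have "F (?a + ?b) (?a + ?b) (J (?a - ?b)) + F (?a - ?b) (?a - ?b) (J (?a + ?b)) =
        2 * F ?a ?a (J ?a) - 2 * F ?a ?b (J ?b) - 2 * F ?b ?a (J ?b) + 2 * F ?b ?b (J ?a)"
        by (simp add: t)
      ultimately have "2 * F ?a ?a (J ?a) - 2 * F ?a ?b (J ?b) - 2 * F ?b ?a (J ?b) + 2 * F ?b ?b (J ?a) = 0"
        by simp
      moreover have "F ?b ?b (J ?a) = 0" by (intro h horth_simps ab)
      ultimately show ?thesis using sy[of ?a ?b "J ?b"] by (simp add: c_def)
    qed
    have term_r: "F (e r) ?a (J (e r)) - F (J (e r)) ?a (e r) = c" if r: "r < n" "r \<noteq> s" for r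
    proof -
      have "horth (e r) ?a" using frame_horth[OF e] s r by auto
      then have "F ?a (J (e r)) (e r) = - F ?a (e r) (J (e r))"
        using h2[of "J (e r)" ?a "e r"] horth_simps(4) by blast
      then show ?thesis using \<phi>[OF r] sy[of ?a "e r" "J (e r)"] sy[of ?a "J (e r)" "e r"] by simp
    qed
    have FJ: "2 * F (J ?a) ?a ?a = - c" using cyc[of ?a ?a "J ?a"] sy[of ?a "J ?a" ?a]
      by (simp add: c_def eq_neg_iff_add_eq_0 add_ac)
    have term_s: "2 * (F ?a ?a (J ?a) - F (J ?a) ?a ?a) = 3 * c"
      unfolding right_diff_distrib FJ unfolding c_def by simp
    have "0 = (\<Sum>r<n. 2 * (F (e r) ?a (J (e r)) - F (J (e r)) ?a (e r)))"
      using tr[of ?a] ctr_J_frame(2)[OF F e, of ?a] by simp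
    also have "\<dots> = 3 * c + (\<Sum>r\<in>{..<n} - {s}. 2 * (F (e r) ?a (J (e r)) - F (J (e r)) ?a (e r)))"
      using s by (subst sum.remove[of _ s]) (auto simp: term_s[unfolded right_diff_distrib])
    also have "\<dots> = 3 * c + of_nat (n - 1) * (2 * c)"
      using s by (simp add: term_r)
    also have "\<dots> = of_nat (2 * n + 1) * c"
      using n_gt_1 by (simp add: of_nat_diff algebra_simps)
    finally have "c = 0" using of_nat_eq_0_iff[of "2 * n + 1", where 'a = complex] by (simp del: of_nat_add of_nat_mult of_nat_Suc)
    then show ?thesis using \<phi> by (auto simp: c_def)
  qed
  obtain e where e: "frame n e" using frame_exists by blast
  have c1: "F (lab e s i) (lab e s i) (J (lab e s i)) = 0" if "s < n" for s i
    using c0[OF frame_upd_lab[OF e that, of i] that] by simp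
  have \<phi>1: "F (lab e s i) (e r) (J (e r)) = 0" if "s < n" "r < n" "r \<noteq> s" for s r i
    using c0[OF frame_upd_lab[OF e that(1), of i] that(1)] that by simp
  have two: "F x (lab e r j) (lab e r k) = 0" if x: "x = lab e s i" "s < n" "r < n" for x s r i j k
  proof (cases "s = r")
    case False
    then have ho: "horth (lab e r m) x" for m using lab_horth[OF e] x by blast
    have "F x (lab e r j) (lab e r j) = 0" using h2[OF ho ho, of j j] by simp
    moreover have "F x (J (e r)) (e r) = - F x (e r) (J (e r))"
      using h2[OF ho ho, of True False] by (simp add: lab_def)
    ultimately show ?thesis using \<phi>1[of s r i] x False by (cases j; cases k) (auto simp: lab_def)
  next
    case True
    have d: "F u u u = 0" for u using cyc[of u u u] by simp
    have 1: "F (e r) (e r) (J (e r)) = 0" "F (J (e r)) (J (e r)) (e r) = 0"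
      using c1[of r False] c1[of r True] x by (simp_all add: lab_def t)
    have *: "F u v u = 0 \<and> F v u u = 0" if "F u u v = 0" for u v
      using cyc[of u u v] sy[of u v u] that by simp
    have x': "x = lab e r i" using x(1) True by simp
    show ?thesis unfolding x' lab_def
      by (cases i; cases j; cases k) (simp_all only: if_True if_False d 1 *[OF 1(1)] *[OF 1(2)])
  qed
  show ?thesis
  proof (rule etri_ext[OF F e])
    fix r s q i j k assume *: "r < n" "s < n" "q < n"
    consider "s = q" | "r = q" | "r \<noteq> q" "s \<noteq> q" by blast
    then show "F (lab e r i) (lab e s j) (lab e q k) = 0"
    proof cases
      case 1 then show ?thesis using two * by blast
    next
      case 2 then show ?thesis using two[OF refl *(2,1), of j i k] sy[of "lab e s j" "lab e r i"] by simp
    next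
      case 3 then show ?thesis using lab_horth[OF e] * by (intro h) auto
    qed
  qed
qed

end

section \<open>The module \<Lambda>_0^3 E: generators, maps to and from E, the invariant
  complement\<close>

context adapted
begin

definition wE :: "('a \<Rightarrow> complex) \<Rightarrow> 'a \<Rightarrow> 'a \<Rightarrow> 'a \<Rightarrow> complex" where
  "wE f = wedge12 f (omega_E J K)"

lemma omega_E_skew: "omega_E J K y x = - omega_E J K x y"
  by (simp add: omega_E_def omega_def inner_flip[of y x])

lemma omega_E_I: "omega_E J K x (I y) = \<i> * omega_E J K x y" "omega_E J K (I x) y = \<i> * omega_E J K x y"
  by (simp_all add: omega_E_def omega_def algebra_simps)

lemma linear_omega_E: "linear (\<lambda>x. omega_E J K x y)" "linear (\<lambda>y. omega_E J K x y)"
  by (rule linearI; simp add: omega_E_def omega_def inner_simps algebra_simps scaleR_conv_of_real)+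

lemma E_mod_simps:
  assumes "f \<in> E_mod I"
  shows "f (x + y) = f x + f y" "f (c *\<^sub>R x) = of_real c * f x" "f (- x) = - f x" "f (I x) = \<i> * f x" "f 0 = 0"
    "f (x - y) = f x - f y"
proof -
  have l: "linear f" using assms by (simp add: E_mod_def)
  show "f (x + y) = f x + f y" "f (c *\<^sub>R x) = of_real c * f x" "f (- x) = - f x" "f (I x) = \<i> * f x" "f 0 = 0"
    "f (x - y) = f x - f y"
    using assms by (simp_all add: linear_add[OF l] linear_cmul[OF l] linear_neg[OF l] linear_0[OF l] linear_diff[OF l]
        scaleR_conv_of_real E_mod_def)
qed

lemma etri_wE: assumes f: "f \<in> E_mod I" shows "etri (wE f)"
proof -
  note o = linear_add[OF linear_omega_E(1)] linear_add[OF linear_omega_E(2)]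
    linear_cmul[OF linear_omega_E(1)] linear_cmul[OF linear_omega_E(2)]
  have "trilin (wE f)"
    unfolding trilin_def wE_def wedge12_def
    by (intro conjI allI; rule linearI) (simp_all add: E_mod_simps[OF f] o scaleR_conv_of_real algebra_simps)
  then show ?thesis by (simp add: etri_def wE_def wedge12_def E_mod_simps[OF f] omega_E_I algebra_simps)
qed

lemma alt3_wE: assumes f: "f \<in> E_mod I" shows "alt3 (wE f)"
proof -
  have "wE f y x z = - wE f x y z" "wE f x z y = - wE f x y z" for x y z
    unfolding wE_def wedge12_def using omega_E_skew[of x y] omega_E_skew[of y z] by (simp_all add: algebra_simps)
  then show ?thesis unfolding alt3_def using etri_trilin[OF etri_wE[OF f]] by blast
qed

text \<open>The exterior product of the three forms \<open>eps x\<close>, \<open>eps y\<close>,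
  \<open>eps z\<close>.\<close>

definition w3 :: "'a \<Rightarrow> 'a \<Rightarrow> 'a \<Rightarrow> 'a \<times> 'a \<times> 'a \<Rightarrow> complex" where
  "w3 x y z = (\<lambda>(p, q, r).
     eps x p * eps y q * eps z r - eps y p * eps x q * eps z r - eps x p * eps z q * eps y r
     - eps z p * eps y q * eps x r + eps y p * eps z q * eps x r + eps z p * eps x q * eps y r)"

definition XB :: "('a \<times> 'a \<times> 'a) set" where
  "XB = Basis \<times> Basis \<times> Basis"

lemma finite_XB: "finite XB"
  by (simp add: XB_def)

lemma sum_XB: "(\<Sum>p\<in>XB. h p) = (\<Sum>u\<in>Basis. \<Sum>v\<in>Basis. \<Sum>w\<in>Basis. h (u, v, w))" for h :: "'a \<times> 'a \<times> 'a \<Rightarrow> complex"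
  unfolding XB_def by (simp add: sum.cartesian_product case_prod_beta)

text \<open>One application of \<open>sum_eps\<close> per slot, hence the factor \<open>2^3\<close>.
  In \<open>cip_w3\<close> the six permutations raise it to 48.\<close>

lemma cip_eps3:
  assumes F: "etri (cur F)"
  shows "cip XB F (\<lambda>(p, q, r). eps x p * eps y q * eps z r) = 8 * F (x, y, z)"
proof -
  have 1: "(\<Sum>w\<in>Basis. F (u, v, w) * cnj (eps x u * eps y v * eps z w)) = cnj (eps x u) * cnj (eps y v) * (2 * F (u, v, z))" for u v
  proof -
    have "(\<Sum>w\<in>Basis. F (u, v, w) * cnj (eps x u * eps y v * eps z w)) =
        cnj (eps x u) * cnj (eps y v) * (\<Sum>w\<in>Basis. F (u, v, w) * cnj (eps z w))"
      by (simp add: sum_distrib_left mult_ac)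
    then show ?thesis using sum_eps[OF E_mod_etri(3)[OF F], of u v z] by simp
  qed
  have 2: "(\<Sum>v\<in>Basis. cnj (eps x u) * cnj (eps y v) * (2 * F (u, v, z))) = cnj (eps x u) * (4 * F (u, y, z))" for u
  proof -
    have "(\<Sum>v\<in>Basis. cnj (eps x u) * cnj (eps y v) * (2 * F (u, v, z))) =
        cnj (eps x u) * (2 * (\<Sum>v\<in>Basis. F (u, v, z) * cnj (eps y v)))"
      by (simp add: sum_distrib_left mult_ac)
    then show ?thesis using sum_eps[OF E_mod_etri(2)[OF F], of u z y] by simp
  qed
  have "cip XB F (\<lambda>(p, q, r). eps x p * eps y q * eps z r) = (\<Sum>u\<in>Basis. cnj (eps x u) * (4 * F (u, y, z)))"
    unfolding cip_def sum_XB by (simp only: prod.case 1 2)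
  also have "\<dots> = 4 * (\<Sum>u\<in>Basis. F (u, y, z) * cnj (eps x u))"
    by (simp add: sum_distrib_left mult_ac)
  finally show ?thesis unfolding sum_eps[OF E_mod_etri(1)[OF F]] by simp
qed

lemma etri_XB:
  assumes "etri (cur F)" "\<And>p. p \<in> XB \<Longrightarrow> F p = 0" shows "F = (\<lambda>p. 0)"
proof
  fix p :: "'a \<times> 'a \<times> 'a"
  obtain x y z where p: "p = (x, y, z)" by (cases p)
  show "F p = 0" using cip_eps3[OF assms(1), of x y z] assms(2) by (simp add: cip_def p)
qed

lemma cip_w3:
  assumes F: "etri (cur F)" "alt3 (cur F)"
  shows "cip XB F (w3 x y z) = 48 * F (x, y, z)"
proof -
  let ?e = "\<lambda>x y z. (\<lambda>(p, q, r). eps x p * eps y q * eps z r)"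
  have "w3 x y z = (\<lambda>p. ?e x y z p - ?e y x z p - ?e x z y p - ?e z y x p + ?e y z x p + ?e z x y p)"
    by (auto simp: w3_def fun_eq_iff)
  then have "cip XB F (w3 x y z) = 8 * F (x, y, z) - 8 * F (y, x, z) - 8 * F (x, z, y) - 8 * F (z, y, x) + 8 * F (y, z, x) + 8 * F (z, x, y)"
    by (simp only: cip_simps cip_eps3[OF F(1)])
  moreover have "F (y, x, z) = - F (x, y, z)" "F (x, z, y) = - F (x, y, z)" "F (z, y, x) = - F (x, y, z)"
    "F (y, z, x) = - F (y, x, z)" "F (z, x, y) = - F (x, z, y)"
    by (rule alt3_swap12[OF F(2)] alt3_swap13[OF F(2)] alt3_swap23[OF F(2)])+
  ultimately show ?thesis by simp
qed

lemma etri_eps3: "etri (\<lambda>p q r. eps x p * eps y q * eps z r)"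
proof -
  have "trilin (\<lambda>p q r. eps x p * eps y q * eps z r)"
    unfolding trilin_def
    by (intro conjI allI; rule linearI) (simp_all add: E_mod_simps[OF eps_E] scaleR_conv_of_real algebra_simps)
  then show ?thesis unfolding etri_def by (simp add: eps_I mult.left_commute)
qed

lemma etri_add: "etri F \<Longrightarrow> etri G \<Longrightarrow> etri (\<lambda>x y z. F x y z + G x y z)"
  by (simp add: etri_def trilin_add algebra_simps)

lemma trilin_cmult:
  fixes F :: "'a \<Rightarrow> 'a \<Rightarrow> 'a \<Rightarrow> complex"
  assumes "trilin F" shows "trilin (\<lambda>x y z. (c::complex) * F x y z)"
proof -
  have "linear (\<lambda>x. c * f x)" if "linear f" for f :: "'a \<Rightarrow> complex"
    using linear_compose[OF that bounded_linear.linear[OF bounded_linear_mult_right[of c]]] by (simp add: o_def)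
  then show ?thesis unfolding trilin_def using trilinD[OF assms] by presburger
qed

lemma etri_cmult: "etri F \<Longrightarrow> etri (\<lambda>x y z. c * F x y z)"
  using trilin_cmult[of F c] by (simp add: etri_def)

lemma etri_diff: "etri F \<Longrightarrow> etri G \<Longrightarrow> etri (\<lambda>x y z. F x y z - G x y z)"
  using etri_add[of F "\<lambda>x y z. - 1 * G x y z"] etri_cmult[of G "- 1"] by simp

lemma etri_pre: "etri F \<Longrightarrow> g \<in> Spn I J K \<Longrightarrow> etri (pre g F)"
  using trilin_pre[of F g] by (simp add: etri_def pre_def[abs_def] Spn_comm orthogonal_transformation_linear[OF Spn_orth])

lemma ctr_eps3: "ctr J (\<lambda>p q r. eps x p * eps y q * eps z r) p = - 2 * eps x p * eps y (J z)"
proof -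
  have l: "linear (eps y)" using eps_E[of y] by (simp add: E_mod_def)
  have e: "eps z (J u) = of_real (z \<bullet> J u) - \<i> * of_real (z \<bullet> K u)" for u by (simp add: eps_def)
  have 1: "(\<Sum>u\<in>Basis. (z \<bullet> J u) *\<^sub>R eps y u) = - eps y (J z)"
    unfolding sum_Basis_linear[OF l, of "J z", symmetric] by (simp add: sum_negf)
  have 2: "(\<Sum>u\<in>Basis. (z \<bullet> K u) *\<^sub>R eps y u) = - eps y (K z)"
    unfolding sum_Basis_linear[OF l, of "K z", symmetric] by (simp add: sum_negf)
  have K: "eps y (K z) = \<i> * eps y (J z)" using eps_I[of y "J z"] by simp
  have "(\<Sum>u\<in>Basis. eps y u * eps z (J u)) = (\<Sum>u\<in>Basis. (z \<bullet> J u) *\<^sub>R eps y u) - \<i> * (\<Sum>u\<in>Basis. (z \<bullet> K u) *\<^sub>R eps y u)"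
    unfolding e by (simp only: right_diff_distrib sum_subtractf sum_distrib_left scaleR_conv_of_real mult_ac)
  then have S: "(\<Sum>u\<in>Basis. eps y u * eps z (J u)) = - 2 * eps y (J z)"
    unfolding 1 2 K by (simp add: mult.assoc[symmetric])
  have "ctr J (\<lambda>p q r. eps x p * eps y q * eps z r) p = eps x p * (\<Sum>u\<in>Basis. eps y u * eps z (J u))"
    unfolding ctr_def sum_distrib_left by (simp only: mult.assoc)
  then show ?thesis unfolding S by (simp only: mult_ac)
qed

lemma act3_w3: "g \<in> Spn I J K \<Longrightarrow> act3 g (w3 x y z) = w3 (g x) (g y) (g z)"
  and eps_inv: "g \<in> Spn I J K \<Longrightarrow> eps x (inv g p) = eps (g x) p"
proof -
  show eps: "eps x (inv g p) = eps (g x) p" if g: "g \<in> Spn I J K" for x p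
  proof -
    have "g x \<bullet> p = x \<bullet> inv g p" for x p
    proof -
      have "g x \<bullet> g (inv g p) = x \<bullet> inv g p"
        using Spn_orth[OF g] by (simp add: orthogonal_transformation_def)
      then show ?thesis by (simp add: orth_inv_apply[OF Spn_orth[OF g]])
    qed
    then show ?thesis using Spn_comm(1)[OF Spn_inv[OF g]] by (simp add: eps_def)
  qed
  show "act3 g (w3 x y z) = w3 (g x) (g y) (g z)" if "g \<in> Spn I J K"
    by (simp add: fun_eq_iff act3_def w3_def eps[OF that])
qed

text \<open>The kernel of the contraction with the symplectic form; on complex-trilinear forms
  \<open>ctr J\<close> is that contraction up to a factor.\<close>

definition C0 :: "('a \<times> 'a \<times> 'a \<Rightarrow> complex) set" where
  "C0 = {F \<in> L3E_mod I. \<forall>x. ctr J (cur F) x = 0}"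

lemma C0_iff: "F \<in> C0 \<longleftrightarrow> etri (cur F) \<and> alt3 (cur F) \<and> (\<forall>x. ctr J (cur F) x = 0)"
  by (simp add: C0_def L3E_iff conj_assoc)

lemma w3_C0:
  assumes "horth x y" "horth x z" "horth y z" shows "w3 x y z \<in> C0"
proof -
  let ?e = "\<lambda>x y z p q r. eps x p * eps y q * eps z r"
  have e: "cur (w3 x y z) = (\<lambda>p q r. ?e x y z p q r - ?e y x z p q r - ?e x z y p q r - ?e z y x p q r + ?e y z x p q r + ?e z x y p q r)"
    by (simp add: w3_def fun_eq_iff)
  have et: "etri (cur (w3 x y z))" unfolding e by (intro etri_add etri_diff etri_eps3)
  have "cur (w3 x y z) q p r = - cur (w3 x y z) p q r" "cur (w3 x y z) p r q = - cur (w3 x y z) p q r" for p q r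
    by (simp_all add: w3_def algebra_simps)
  then have al: "alt3 (cur (w3 x y z))" unfolding alt3_def using etri_trilin[OF et] by blast
  have "ctr J (cur (w3 x y z)) p = ctr J (?e x y z) p - ctr J (?e y x z) p - ctr J (?e x z y) p - ctr J (?e z y x) p
      + ctr J (?e y z x) p + ctr J (?e z x y) p" for p
    unfolding e by (simp add: ctr_def sum.distrib sum_subtractf)
  then have "ctr J (cur (w3 x y z)) p = 0" for p
    using assms[THEN eps_horth(2)] assms[THEN horth_sym, THEN eps_horth(2)] by (simp add: ctr_eps3)
  then show ?thesis using et al by (simp add: C0_iff)
qed

lemma cspace_C0: "cspace C0"
proof -
  have "(\<lambda>x. 0) \<in> C0"
    by (simp add: C0_iff etri_def alt3_def trilin_def linear_zero ctr_def)
  moreover have "(\<lambda>x. F x + G x) \<in> C0" if "F \<in> C0" "G \<in> C0" for F G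
    using that etri_add[of "cur F" "cur G"] alt3_add[of "cur F" "cur G"] ctr_add[of J "cur F" "cur G"] by (simp add: C0_iff)
  moreover have "(\<lambda>x. c * F x) \<in> C0" if "F \<in> C0" for F c
  proof -
    have "alt3 (\<lambda>x y z. c * F (x, y, z))"
      unfolding alt3_def
    proof (intro conjI allI)
      show "trilin (\<lambda>x y z. c * F (x, y, z))" using that trilin_cmult[OF etri_trilin, of "cur F" c] by (simp add: C0_iff)
      have a: "alt3 (cur F)" using that by (simp add: C0_iff)
      show "c * F (y, x, z) = - (c * F (x, y, z))" "c * F (x, z, y) = - (c * F (x, y, z))" for x y z
        using alt3_swap12[OF a, of y x z] alt3_swap23[OF a, of x z y] by simp_all
    qed
    then show ?thesis
      using that etri_cmult[of "cur F" c] by (simp add: C0_iff ctr_def flip: sum_distrib_left)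
  qed
  ultimately show ?thesis unfolding cspace_def by blast
qed

lemma ctr_J_pre:
  assumes F: "trilin F" and g: "g \<in> Spn I J K"
  shows "ctr J (pre g F) x = ctr J F (g x)"
  unfolding ctr_def pre_def Spn_comm(2)[OF g]
  by (rule trace_orthogonal[OF Spn_orth[OF g], of "\<lambda>u v. F (g x) u (J v)"])
    (use trilinD[OF F] linear_comp_IJK(2)[OF trilinD(3)[OF F]] in simp_all)

lemma cur_act3: "cur (act3 g F) = pre (inv g) (cur F)"
  by (simp add: fun_eq_iff act3_def pre_def)

lemma act3_C0: "g \<in> Spn I J K \<Longrightarrow> F \<in> C0 \<Longrightarrow> act3 g F \<in> C0"
  unfolding C0_iff cur_act3
  by (simp add: etri_pre Spn_inv alt3_pre ctr_J_pre etri_trilin orthogonal_transformation_linear[OF Spn_orth])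

end

context quaternionic
begin

lemma unit_horth:
  assumes "\<And>x y z. x \<bullet> x = 1 \<Longrightarrow> y \<bullet> y = 1 \<Longrightarrow> z \<bullet> z = 1 \<Longrightarrow> horth x y \<Longrightarrow> horth x z \<Longrightarrow> horth y z \<Longrightarrow> F x y z = 0"
    and F: "trilin F" and h: "horth x y" "horth x z" "horth y z"
  shows "F x y z = (0::complex)"
proof (cases "x = 0 \<or> y = 0 \<or> z = 0")
  case True then show ?thesis by (auto simp: trilin_simps[OF F])
next
  case False
  have "F (inverse (norm x) *\<^sub>R x) (inverse (norm y) *\<^sub>R y) (inverse (norm z) *\<^sub>R z) = 0"
    by (rule assms(1)) (use False h in \<open>simp_all add: horth_simps dot_square_norm power2_eq_square\<close>)
  then show ?thesis using False by (simp add: trilin_simps[OF F])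
qed

text \<open>Being orthogonal to all generators means, by \<open>cip_w3\<close>, vanishing on
  quaternionically orthogonal unit triples, and \<open>L03E_determined\<close> applies.\<close>

lemma cspan_w3: "cspan {w3 x y z |x y z. x \<bullet> x = 1 \<and> y \<bullet> y = 1 \<and> z \<bullet> z = 1 \<and> horth x y \<and> horth x z \<and> horth y z} = C0"
  (is "cspan ?W = C0")
proof (rule orthogonal_complement_zero[OF finite_XB cspace_C0])
  show "f = (\<lambda>x. 0)" if "f \<in> C0" "\<And>p. p \<in> XB \<Longrightarrow> f p = 0" for f
    using that etri_XB[of f] by (simp add: C0_iff)
  show "cspace (cspan ?W)" by (rule cspace_cspan)
  show "cspan ?W \<subseteq> C0" by (rule cspan_minimal[OF cspace_C0]) (auto intro: w3_C0)
  show "f = (\<lambda>x. 0)" if f: "f \<in> C0" and 0: "\<And>w. w \<in> cspan ?W \<Longrightarrow> cip XB f w = 0" for f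
  proof -
    have e: "etri (cur f)" "alt3 (cur f)" "\<And>x. ctr J (cur f) x = 0" using f by (auto simp: C0_iff)
    have "cur f x y z = 0" if "x \<bullet> x = 1" "y \<bullet> y = 1" "z \<bullet> z = 1" "horth x y" "horth x z" "horth y z" for x y z
    proof -
      have "w3 x y z \<in> cspan ?W" using that cspan_superset[of ?W] by blast
      then show ?thesis using 0 cip_w3[OF e(1,2), of x y z] by simp
    qed
    note * = unit_horth[OF this etri_trilin[OF e(1)]]
    have "cur f x y z = 0" for x y z by (rule L03E_determined[OF e *])
    then show ?thesis by (auto simp: fun_eq_iff)
  qed
qed

text \<open>The element of Sp(n) that is \<open>- 1\<close> on the quaternionic line of
  \<open>e r\<close> and the identity on the other lines of the frame.\<close>

definition flip :: "(nat \<Rightarrow> 'a) \<Rightarrow> nat \<Rightarrow> 'a \<Rightarrow> 'a" where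
  "flip e r = gmap n e (e(r := - e r))"

lemma flip_frame:
  assumes "frame n e" shows "frame n (e(r := - e r))"
  using assms by (auto simp: frame_iff horth_simps)

lemma flip_Spn: "frame n e \<Longrightarrow> flip e r \<in> Spn I J K"
  unfolding flip_def by (rule gmap_Spn(1)[OF _ flip_frame])

lemma flip_apply: "frame n e \<Longrightarrow> s < n \<Longrightarrow> flip e r (e s) = (if s = r then - e r else e s)"
  unfolding flip_def using gmap_Spn(2)[OF _ flip_frame, where e=e and r=s] by simp

lemma inv_fix: "g \<in> Spn I J K \<Longrightarrow> g x = y \<Longrightarrow> inv g y = x"
  using orth_inv_apply(2)[OF Spn_orth] by blast

text \<open>The product \<open>(1 - g) (1 - h)\<close> annihilates E. The first factor is supported
  on the line of \<open>e a\<close>, and \<open>h\<close> fixes both \<open>e a\<close> and its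
  image under \<open>g^-1\<close>, because that image stays in the complex line of
  \<open>e a\<close>.\<close>

lemma E_commutator:
  assumes e: "frame n e" and f: "f \<in> E_mod I" and g: "g \<in> Spn I J K" "h \<in> Spn I J K"
    and fix_g: "\<And>t. t < n \<Longrightarrow> t \<noteq> a \<Longrightarrow> g (e t) = e t" and fix_h: "h (e a) = e a"
    and g_a: "inv g (e a) = c *\<^sub>R e a + d *\<^sub>R I (e a)"
  shows "f v - f (inv g v) - f (inv h v) + f (inv h (inv g v)) = 0"
proof -
  define k where "k v = f v - f (inv g v) - f (inv h v) + f (inv h (inv g v))" for v
  note l = orthogonal_transformation_linear[OF Spn_orth[OF Spn_inv[OF g(1)]]]
    orthogonal_transformation_linear[OF Spn_orth[OF Spn_inv[OF g(2)]]]
  note c = Spn_comm[OF Spn_inv[OF g(1)]] Spn_comm[OF Spn_inv[OF g(2)]]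
  note lc = linear_add[OF l(1)] linear_add[OF l(2)] linear_cmul[OF l(1)] linear_cmul[OF l(2)]
  have k: "k \<in> E_mod I"
    unfolding E_mod_def k_def
    by (simp add: linear_iff E_mod_simps[OF f] lc c scaleR_conv_of_real algebra_simps)
  have "k (lab e t j) = 0" if t: "t < n" for t j
  proof (cases "t = a")
    case False
    then have "inv g (e t) = e t" using inv_fix[OF g(1)] fix_g t by blast
    then have "inv g (lab e t j) = lab e t j" by (simp add: lab_def c)
    then show ?thesis by (simp add: k_def)
  next
    case True
    have ha: "inv h (e a) = e a" using inv_fix[OF g(2) fix_h] .
    then have "inv h (inv g (e a)) = inv g (e a)" by (simp add: g_a lc c)
    then show ?thesis using ha True by (simp add: k_def lab_def c)
  qed
  then show ?thesis using E_mod_ext[OF k e] by (simp add: k_def)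
qed

text \<open>An equivariant map carries the relation of \<open>E_commutator\<close> to every form in
  its image.\<close>

lemma Hom_E_commutator:
  assumes \<psi>: "\<And>f h. f \<in> E_mod I \<Longrightarrow> h \<in> E_mod I \<Longrightarrow> \<psi> (\<lambda>x. f x + h x) = (\<lambda>p. \<psi> f p + \<psi> h p)"
    "\<And>c f. f \<in> E_mod I \<Longrightarrow> \<psi> (\<lambda>x. c * f x) = (\<lambda>p. c * \<psi> f p)"
    and eq: "\<And>g f. g \<in> Spn I J K \<Longrightarrow> f \<in> E_mod I \<Longrightarrow> \<psi> (act1 g f) = act3 g (\<psi> f)"
    and f: "f \<in> E_mod I" and e: "frame n e"
    and gh: "g \<in> Spn I J K" "h \<in> Spn I J K"
    and fix_g: "\<And>t. t < n \<Longrightarrow> t \<noteq> a \<Longrightarrow> g (e t) = e t" and fix_h: "h (e a) = e a"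
    and g_a: "inv g (e a) = c *\<^sub>R e a + d *\<^sub>R I (e a)"
  shows "\<psi> f p - act3 g (\<psi> f) p - act3 h (\<psi> f) p + act3 g (act3 h (\<psi> f)) p = 0"
proof -
  have aE: "act1 k u \<in> E_mod I" if "k \<in> Spn I J K" "u \<in> E_mod I" for k u
  proof -
    note l = orthogonal_transformation_linear[OF Spn_orth[OF Spn_inv[OF that(1)]]]
    show ?thesis using that(2) unfolding E_mod_def act1_def
      by (simp add: linear_iff linear_add[OF l] linear_cmul[OF l] Spn_comm[OF Spn_inv[OF that(1)]])
  qed
  have mE: "(\<lambda>x. c * u x) \<in> E_mod I" "(\<lambda>x. u x + v x) \<in> E_mod I" if "u \<in> E_mod I" "v \<in> E_mod I" for c u v
    using that unfolding E_mod_def by (simp_all add: linear_iff algebra_simps)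
  let ?k = "\<lambda>x. f x + - 1 * act1 g f x + - 1 * act1 h f x + act1 g (act1 h f) x"
  note m = aE[OF gh(1) f] aE[OF gh(2) f] aE[OF gh(1) aE[OF gh(2) f]]
  have "\<psi> ?k = (\<lambda>p. \<psi> f p + - 1 * act3 g (\<psi> f) p + - 1 * act3 h (\<psi> f) p + act3 g (act3 h (\<psi> f)) p)"
    using m f by (simp only: \<psi> mE eq gh aE)
  moreover have "?k = (\<lambda>x. 0 * f x)"
    using E_commutator[OF e f gh fix_g fix_h g_a] by (simp add: act1_def fun_eq_iff)
  moreover have "\<psi> (\<lambda>x. 0 * f x) = (\<lambda>p. 0)" using \<psi>(2)[OF f, of 0] by simp
  ultimately show ?thesis by (metis (no_types, lifting) diff_conv_add_uminus mult_minus1)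
qed

lemma inv_flip:
  assumes e: "frame n e" and s: "s < n" shows "inv (flip e r) (e s) = (if s = r then - e r else e s)"
proof (rule inv_fix[OF flip_Spn[OF e]])
  have "linear (flip e r)" by (rule orthogonal_transformation_linear[OF Spn_orth[OF flip_Spn[OF e]]])
  then show "flip e r (if s = r then - e r else e s) = e s"
    using s flip_apply[OF e] by (auto simp: linear_neg)
qed

text \<open>The flips of the lines of \<open>x\<close> and of \<open>y\<close> both change the sign
  of the component at \<open>(x, y, z)\<close>. On it \<open>(1 - g) (1 - h)\<close> is therefore
  multiplication by 4, and at the same time it is 0.\<close>

lemma Hom_E_C0:
  assumes \<psi>: "\<And>f h. f \<in> E_mod I \<Longrightarrow> h \<in> E_mod I \<Longrightarrow> \<psi> (\<lambda>x. f x + h x) = (\<lambda>p. \<psi> f p + \<psi> h p)"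
    "\<And>c f. f \<in> E_mod I \<Longrightarrow> \<psi> (\<lambda>x. c * f x) = (\<lambda>p. c * \<psi> f p)"
    and eq: "\<And>g f. g \<in> Spn I J K \<Longrightarrow> f \<in> E_mod I \<Longrightarrow> \<psi> (act1 g f) = act3 g (\<psi> f)"
    and C0: "\<And>f. f \<in> E_mod I \<Longrightarrow> \<psi> f \<in> C0" and f: "f \<in> E_mod I"
  shows "\<psi> f = (\<lambda>p. 0)"
proof -
  have F: "etri (cur (\<psi> f))" "alt3 (cur (\<psi> f))" "\<And>x. ctr J (cur (\<psi> f)) x = 0" using C0[OF f] by (auto simp: C0_iff)
  note t = trilin_simps[OF etri_trilin[OF F(1)]]
  have "cur (\<psi> f) x y z = 0"
    if xyz: "x \<bullet> x = 1" "y \<bullet> y = 1" "z \<bullet> z = 1" "horth x y" "horth x z" "horth y z" for x y z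
  proof -
    have n3: "3 \<le> n" by (rule horth3_le[OF xyz])
    obtain e where e: "frame n e" and e': "\<And>r. r < 3 \<Longrightarrow> e r = (if r = 0 then x else if r = 1 then y else z)"
      using frame_extend[OF frame3[OF xyz] n3] by metis
    have e0: "e 0 = x" "e 1 = y" "e 2 = z" using e'[of 0] e'[of 1] e'[of 2] by auto
    have i0: "inv (flip e 0) x = - x" "inv (flip e 0) y = y" "inv (flip e 0) z = z"
      using inv_flip[OF e, of 0 0] inv_flip[OF e, of 1 0] inv_flip[OF e, of 2 0] e0 n3 by auto
    have i1: "inv (flip e 1) x = x" "inv (flip e 1) y = - y" "inv (flip e 1) z = z"
      using inv_flip[OF e, of 0 1] inv_flip[OF e, of 1 1] inv_flip[OF e, of 2 1] e0 n3 by auto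
    have l: "linear (inv (flip e 1))" by (intro orthogonal_transformation_linear Spn_orth Spn_inv flip_Spn e)
    have "\<psi> f (x, y, z) - act3 (flip e 0) (\<psi> f) (x, y, z) - act3 (flip e 1) (\<psi> f) (x, y, z)
      + act3 (flip e 0) (act3 (flip e 1) (\<psi> f)) (x, y, z) = 0"
      by (rule Hom_E_commutator[OF \<psi> eq f e, where a = 0 and c = "-1" and d = 0])
        (use flip_Spn[OF e] flip_apply[OF e] i0(1) e0 n3 in auto)
    then show ?thesis using t(7,8) by (simp add: act3_def i0 i1[unfolded One_nat_def] linear_neg[OF l[unfolded One_nat_def]])
  qed
  note * = unit_horth[OF this etri_trilin[OF F(1)]]
  have "cur (\<psi> f) x y z = 0" for x y z by (rule L03E_determined[OF F *])
  then show ?thesis by (auto simp: fun_eq_iff)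
qed

text \<open>It suffices to treat the generators. Each of the flips 0 and 1 reverses
  \<open>w3 x y z\<close>, so its image is odd under both of them; but every line of the frame is
  fixed pointwise by at least one of the two.\<close>

lemma Hom_C0_dual:
  assumes \<psi>: "\<And>F G. F \<in> C0 \<Longrightarrow> G \<in> C0 \<Longrightarrow> \<psi> (\<lambda>p. F p + G p) = (\<lambda>x. \<psi> F x + \<psi> G x)"
    "\<And>c F. F \<in> C0 \<Longrightarrow> \<psi> (\<lambda>p. c * F p) = (\<lambda>x. c * \<psi> F x)"
    and eq: "\<And>g F. g \<in> Spn I J K \<Longrightarrow> F \<in> C0 \<Longrightarrow> \<psi> (act3 g F) = (\<lambda>x. \<psi> F (inv g x))"
    and l: "\<And>F. F \<in> C0 \<Longrightarrow> linear (\<psi> F)" and F: "F \<in> C0"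
  shows "\<psi> F = (\<lambda>x. 0 :: complex)"
proof -
  let ?N = "{F \<in> C0. \<psi> F = (\<lambda>x. 0)}"
  have z: "(\<lambda>p. 0) \<in> C0" by (rule cspaceD(1)[OF cspace_C0])
  have "cspace ?N"
    unfolding cspace_def
  proof (intro conjI ballI allI)
    show "(\<lambda>x. 0) \<in> ?N" using z \<psi>(2)[OF z, of 0] by simp
    show "(\<lambda>x. f x + h x) \<in> ?N" if "f \<in> ?N" "h \<in> ?N" for f h
      using that \<psi>(1)[of f h] cspaceD(2)[OF cspace_C0] by auto
    show "(\<lambda>x. c * f x) \<in> ?N" if "f \<in> ?N" for c f
      using that \<psi>(2)[of f c] cspaceD(3)[OF cspace_C0] by auto
  qed
  moreover have "w3 x y z \<in> ?N"
    if xyz: "x \<bullet> x = 1" "y \<bullet> y = 1" "z \<bullet> z = 1" "horth x y" "horth x z" "horth y z" for x y z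
  proof -
    have n3: "3 \<le> n" by (rule horth3_le[OF xyz])
    obtain e where e: "frame n e" and e': "\<And>r. r < 3 \<Longrightarrow> e r = (if r = 0 then x else if r = 1 then y else z)"
      using frame_extend[OF frame3[OF xyz] n3] by metis
    have e0: "e 0 = x" "e 1 = y" "e 2 = z" using e'[of 0] e'[of 1] e'[of 2] by auto
    have w: "w3 x y z \<in> C0" by (rule w3_C0[OF xyz(4-6)])
    have m: "\<psi> (w3 x y z) (inv (flip e r) v) = - \<psi> (w3 x y z) v" if r: "r = 0 \<or> r = 1" for r v
    proof -
      have "act3 (flip e r) (w3 x y z) = w3 (flip e r x) (flip e r y) (flip e r z)"
        by (rule act3_w3[OF flip_Spn]) (rule e)
      also have "\<dots> = (\<lambda>p. - 1 * w3 x y z p)"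
        using r flip_apply[OF e, of 0 r] flip_apply[OF e, of 1 r] flip_apply[OF e, of 2 r] e0 n3
        by (auto simp: w3_def eps_linear_left fun_eq_iff)
      finally have "\<psi> (act3 (flip e r) (w3 x y z)) = \<psi> (\<lambda>p. - 1 * w3 x y z p)" by (rule arg_cong)
      then show ?thesis unfolding eq[OF flip_Spn[OF e] w] \<psi>(2)[OF w] by (simp add: fun_eq_iff)
    qed
    have fz: "\<psi> (w3 x y z) (fam e (s, k)) = 0" if s: "s < n" for s k
    proof -
      \<comment> \<open>A flip, among those of index 0 and 1, that does not move the line of
        \<open>e s\<close>.\<close>
      define r :: nat where "r = (if s = 0 then 1 else 0)"
      have r: "r = 0 \<or> r = 1" "s \<noteq> r" by (auto simp: r_def)
      have "inv (flip e r) (fam e (s, k)) = fam e (s, k)"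
        using inv_flip[OF e s, of r] r(2) Spn_comm[OF Spn_inv[OF flip_Spn[OF e]]] by (simp add: fam_def qk_def)
      then show ?thesis using m[OF r(1), of "fam e (s, k)"] by simp
    qed
    have "\<psi> (w3 x y z) v = 0" for v
    proof -
      have "\<psi> (w3 x y z) v = (\<Sum>i\<in>{..<n}\<times>{..<4}. (v \<bullet> fam e i) *\<^sub>R \<psi> (w3 x y z) (fam e i))"
        by (subst frame_complete[OF e, symmetric]) (simp add: linear_sum[OF l[OF w]] linear_cmul[OF l[OF w]])
      then show ?thesis using fz by (auto intro!: sum.neutral)
    qed
    then show ?thesis using w by auto
  qed
  ultimately have "cspan {w3 x y z |x y z. x \<bullet> x = 1 \<and> y \<bullet> y = 1 \<and> z \<bullet> z = 1 \<and> horth x y \<and> horth x z \<and> horth y z} \<subseteq> ?N"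
    by (intro cspan_minimal) blast+
  then show ?thesis using F unfolding cspan_w3 by blast
qed

lemma ctr_wE:
  assumes f: "f \<in> E_mod I" shows "ctr J (wE f) x = (4 - 4 * of_nat n) * f x"
proof -
  have l: "linear f" "linear (\<lambda>u. f (J u))" using f linear_comp_IJK(2)[of f] by (auto simp: E_mod_def)
  note fs = E_mod_simps[OF f]
  have e: "wE f x u (J u) = - of_real (u \<bullet> u) * f x + ((x \<bullet> u) *\<^sub>R f u + \<i> * ((x \<bullet> I u) *\<^sub>R f u))
      + ((x \<bullet> J u) *\<^sub>R f (J u) + \<i> * ((x \<bullet> K u) *\<^sub>R f (J u)))" for u
    by (simp add: wE_def wedge12_def omega_E_def omega_def scaleR_conv_of_real algebra_simps)
  have 1: "(\<Sum>u\<in>Basis. (x \<bullet> I u) *\<^sub>R f u) = - \<i> * f x"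
    using sum_Basis_linear[OF l(1), of "I x"] by (simp add: sum_negf fs minus_equation_iff[of "sum _ _"] eq_commute)
  have 2: "(\<Sum>u\<in>Basis. (x \<bullet> J u) *\<^sub>R f (J u)) = f x"
    using sum_Basis_linear[OF l(2), of "J x"] by (simp add: sum_negf fs)
  have 3: "(\<Sum>u\<in>Basis. (x \<bullet> K u) *\<^sub>R f (J u)) = - \<i> * f x"
    using sum_Basis_linear[OF l(2), of "K x"] by (simp add: sum_negf fs minus_equation_iff[of "sum _ _"] eq_commute)
  have 4: "(\<Sum>u\<in>Basis. - of_real ((u::'a) \<bullet> u) * f x) = - 4 * of_nat n * f x" using dim by simp
  have "ctr J (wE f) x = - 4 * of_nat n * f x + (f x + \<i> * (- \<i> * f x)) + (f x + \<i> * (- \<i> * f x))"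
    unfolding ctr_def e sum.distrib sum_distrib_left[symmetric] 1 2 3 4 sum_Basis_linear[OF l(1)] ..
  then show ?thesis by (simp add: algebra_simps)
qed

lemma n_complex: "(4 - 4 * of_nat n :: complex) \<noteq> 0"
  using n_gt_1 by (metis eq_iff_diff_eq_0 less_irrefl mult_cancel_left1 of_nat_1 of_nat_eq_iff zero_neq_numeral)

lemma omegaE_wedge_iff: "D \<in> omegaE_wedge_E I J K \<longleftrightarrow> (\<exists>f\<in>E_mod I. cur D = wE f)"
  unfolding omegaE_wedge_E_def wE_def by (auto simp: fun_eq_iff)

lemma cspace_E: "cspace (E_mod I)"
  unfolding cspace_def E_mod_def
  by (auto simp: linear_zero linear_compose_add algebra_simps linear_iff)

lemma ctr_E_mod:
  assumes F: "etri F" shows "ctr J F \<in> E_mod I"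
  using linear_ctr[OF etri_trilin[OF F], of J]
  by (simp add: E_mod_def) (simp add: ctr_def etri_I[OF F] sum_distrib_left)

text \<open>The form \<open>f\<close> for which subtracting \<open>wE f\<close> makes
  \<open>F\<close> trace-free; the denominator is the factor from \<open>ctr_wE\<close> and is
  nonzero since \<open>n > 1\<close>.\<close>

definition tr0 :: "('a \<Rightarrow> 'a \<Rightarrow> 'a \<Rightarrow> complex) \<Rightarrow> 'a \<Rightarrow> complex" where
  "tr0 F x = ctr J F x / (4 - 4 * of_nat n)"

lemma tr0_E: "etri F \<Longrightarrow> tr0 F \<in> E_mod I"
  using cspaceD(3)[OF cspace_E ctr_E_mod, of F "inverse (4 - 4 * of_nat n)"]
  by (simp add: tr0_def[abs_def] divide_inverse mult.commute)

lemma tr0_wE: "f \<in> E_mod I \<Longrightarrow> tr0 (wE f) = f"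
  using n_complex by (simp add: tr0_def fun_eq_iff ctr_wE)

lemma L3E_decomp:
  assumes F: "etri F" "alt3 F"
  shows "(\<lambda>(x, y, z). F x y z - wE (tr0 F) x y z) \<in> C0"
proof -
  note t = tr0_E[OF F(1)]
  have "alt3 (\<lambda>x y z. F x y z + (-1) *\<^sub>R wE (tr0 F) x y z)"
    by (intro alt3_add alt3_scaleR F alt3_wE t)
  moreover have "ctr J (\<lambda>x y z. F x y z - wE (tr0 F) x y z) x = 0" for x
  proof -
    have "ctr J (\<lambda>x y z. F x y z - wE (tr0 F) x y z) x = ctr J F x - ctr J (wE (tr0 F)) x"
      by (simp add: ctr_def sum_subtractf)
    then show ?thesis unfolding ctr_wE[OF t] using n_complex by (simp add: tr0_def)
  qed
  ultimately show ?thesis by (simp add: C0_iff etri_diff F etri_wE t)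
qed

lemma act1_E: "g \<in> Spn I J K \<Longrightarrow> f \<in> E_mod I \<Longrightarrow> act1 g f \<in> E_mod I"
  using linear_compose[of "inv g" f] Spn_comm(1)[OF Spn_inv, of g]
    orthogonal_transformation_linear[OF Spn_orth[OF Spn_inv, of g]]
  by (simp add: E_mod_def act1_def o_def)

lemma act3_wE:
  assumes "g \<in> Spn I J K"
  shows "act3 g (\<lambda>(x, y, z). wE f x y z) = (\<lambda>(x, y, z). wE (act1 g f) x y z)"
proof -
  have "omega_E J K (inv g x) (inv g y) = omega_E J K x y" for x y
    using Spn_orth[OF Spn_inv[OF assms]] Spn_comm[OF Spn_inv[OF assms]]
    by (simp add: omega_E_def omega_def orthogonal_transformation_def flip: Spn_comm(2,3)[OF Spn_inv[OF assms]])
  then show ?thesis by (simp add: fun_eq_iff act3_def wE_def wedge12_def act1_def)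
qed

lemma wE_add: "wE (\<lambda>x. f x + h x) x y z = wE f x y z + wE h x y z"
  and wE_mult: "wE (\<lambda>x. c * f x) x y z = c * wE f x y z"
  and wE_zero: "wE (\<lambda>x. 0) x y z = 0"
  by (simp_all add: wE_def wedge12_def algebra_simps)

lemma invariant_complement_C0: "invariant_complement I J K C0"
  unfolding invariant_complement_def
proof (intro conjI ballI)
  show "C0 \<subseteq> L3E_mod I" by (auto simp: C0_def)
  show "cspace C0" by (rule cspace_C0)
  show "act3 g F \<in> C0" if "g \<in> Spn I J K" "F \<in> C0" for g F using act3_C0 that by blast
  show "C0 \<inter> omegaE_wedge_E I J K = {\<lambda>p. 0}"
  proof (intro equalityI subsetI)
    fix F assume F: "F \<in> C0 \<inter> omegaE_wedge_E I J K"
    then obtain f where f: "f \<in> E_mod I" "cur F = wE f" by (auto simp: omegaE_wedge_iff)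
    have "f x = 0" for x using F n_complex ctr_wE[OF f(1), of x] by (simp add: C0_iff f(2))
    then have f0: "f = (\<lambda>x. 0)" by blast
    have "F (x, y, z) = 0" for x y z
      using fun_cong[OF fun_cong[OF fun_cong[OF f(2), of x], of y], of z] by (simp add: f0 wE_zero)
    then show "F \<in> {\<lambda>p. 0}" by auto
  next
    fix F :: "'a \<times> 'a \<times> 'a \<Rightarrow> complex" assume "F \<in> {\<lambda>p. 0}"
    then have F0: "F = (\<lambda>p. 0)" by simp
    have "(\<lambda>x. 0) \<in> E_mod I" by (rule cspaceD(1)[OF cspace_E])
    then show "F \<in> C0 \<inter> omegaE_wedge_E I J K"
      unfolding F0 using cspaceD(1)[OF cspace_C0] by (auto simp: omegaE_wedge_iff fun_eq_iff wE_zero intro!: bexI[of _ "\<lambda>x. 0"])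
  qed
  fix F assume "F \<in> L3E_mod I"
  then have F: "etri (cur F)" "alt3 (cur F)" by (auto simp: L3E_iff)
  show "\<exists>G\<in>C0. \<exists>D\<in>omegaE_wedge_E I J K. F = (\<lambda>p. G p + D p)"
    by (intro bexI[OF _ L3E_decomp[OF F]] bexI[of _ "\<lambda>(x, y, z). wE (tr0 (cur F)) x y z"])
      (auto simp: omegaE_wedge_iff intro!: bexI[OF _ tr0_E[OF F(1)]])
qed

text \<open>Splitting the elements of \<open>C0\<close> along another complement gives an
  equivariant map from \<open>C0\<close> to E, which vanishes by \<open>Hom_C0_dual\<close>. Hence
  \<open>C0\<close> lies in that complement, and equality follows since a trace part inside the
  complement must be zero.\<close>

lemma invariant_complement_unique:
  assumes C: "invariant_complement I J K C" shows "C = C0"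
proof -
  have sub: "C \<subseteq> L3E_mod I" and cC: "cspace C" and inv: "\<And>g F. g \<in> Spn I J K \<Longrightarrow> F \<in> C \<Longrightarrow> act3 g F \<in> C"
    and int: "C \<inter> omegaE_wedge_E I J K = {\<lambda>p. 0}"
    and dec: "\<And>F. F \<in> L3E_mod I \<Longrightarrow> \<exists>G\<in>C. \<exists>D\<in>omegaE_wedge_E I J K. F = (\<lambda>p. G p + D p)"
    using C unfolding invariant_complement_def by blast+
  let ?w = "\<lambda>f. (\<lambda>(x, y, z). wE f x y z)"
  define Q where "Q F f \<longleftrightarrow> f \<in> E_mod I \<and> (\<lambda>p. F p - ?w f p) \<in> C" for F f
  have wC: "f = (\<lambda>x. 0)" if "f \<in> E_mod I" "?w f \<in> C" for f
  proof -
    have "?w f \<in> omegaE_wedge_E I J K" using that(1) by (auto simp: omegaE_wedge_iff)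
    then have w0: "?w f = (\<lambda>p. 0)" using int that(2) by blast
    have "wE f x y z = 0" for x y z using fun_cong[OF w0, of "(x, y, z)"] by simp
    then have "tr0 (wE f) = (\<lambda>x. 0)" by (simp add: tr0_def ctr_def fun_eq_iff)
    then show ?thesis using tr0_wE[OF that(1)] by simp
  qed
  have uniq: "f = h" if "Q F f" "Q F h" for F f h
  proof -
    have "(\<lambda>p. (F p - ?w f p) - (F p - ?w h p)) \<in> C" by (rule cspaceD(4)[OF cC]) (use that in \<open>simp_all add: Q_def\<close>)
    moreover have "(\<lambda>p. (F p - ?w f p) - (F p - ?w h p)) = ?w (\<lambda>x. h x + - 1 * f x)"
      by (simp only: fun_eq_iff split_paired_all prod.case wE_add wE_mult) simp
    moreover have "(\<lambda>x. h x + - 1 * f x) \<in> E_mod I"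
      using that cspaceD(2)[OF cspace_E _ cspaceD(3)[OF cspace_E], of h f "- 1"] by (simp add: Q_def)
    ultimately have "(\<lambda>x. h x + - 1 * f x) = (\<lambda>x. 0)" using wC by simp
    then show ?thesis by (simp add: fun_eq_iff)
  qed
  have ex: "\<exists>f. Q F f" if FL: "F \<in> L3E_mod I" for F
  proof -
    obtain G D where GD: "G \<in> C" "D \<in> omegaE_wedge_E I J K" "F = (\<lambda>p. G p + D p)" using dec[OF FL] by blast
    then obtain f where f: "f \<in> E_mod I" "cur D = wE f" by (auto simp: omegaE_wedge_iff)
    then have "D = ?w f" by (auto simp: fun_eq_iff)
    then have "(\<lambda>p. F p - ?w f p) = G" using GD(3) by simp
    then show ?thesis using f GD(1) unfolding Q_def by metis
  qed
  \<comment> \<open>The choice is in fact unique by \<open>uniq\<close>, and that is how additivity,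
    homogeneity and equivariance are obtained.\<close>
  define \<psi> where "\<psi> F = (SOME f. Q F f)" for F
  have Q\<psi>: "Q F (\<psi> F)" if "F \<in> L3E_mod I" for F unfolding \<psi>_def by (rule someI_ex[OF ex[OF that]])
  have C0L: "F \<in> L3E_mod I" if "F \<in> C0" for F using that by (simp add: C0_def)
  have "\<psi> F = (\<lambda>x. 0)" if "F \<in> C0" for F
  proof (rule Hom_C0_dual[OF _ _ _ _ that])
    fix F G assume FG: "F \<in> C0" "G \<in> C0"
    have "(\<lambda>p. (F p - ?w (\<psi> F) p) + (G p - ?w (\<psi> G) p)) \<in> C"
      by (rule cspaceD(2)[OF cC]) (use Q\<psi>[OF C0L[OF FG(1)]] Q\<psi>[OF C0L[OF FG(2)]] in \<open>simp_all add: Q_def\<close>)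
    moreover have "(\<lambda>p. (F p - ?w (\<psi> F) p) + (G p - ?w (\<psi> G) p)) = (\<lambda>p. (F p + G p) - ?w (\<lambda>x. \<psi> F x + \<psi> G x) p)"
      by (simp only: fun_eq_iff split_paired_all prod.case wE_add) simp
    ultimately have "Q (\<lambda>p. F p + G p) (\<lambda>x. \<psi> F x + \<psi> G x)"
      using Q\<psi>[OF C0L[OF FG(1)]] Q\<psi>[OF C0L[OF FG(2)]] cspaceD(2)[OF cspace_E] by (simp add: Q_def)
    then show "\<psi> (\<lambda>p. F p + G p) = (\<lambda>x. \<psi> F x + \<psi> G x)"
      using uniq Q\<psi>[OF C0L[OF cspaceD(2)[OF cspace_C0 FG]]] by blast
  next
    fix c F assume F: "F \<in> C0"
    have "(\<lambda>p. c * (F p - ?w (\<psi> F) p)) \<in> C" by (rule cspaceD(3)[OF cC]) (use Q\<psi>[OF C0L[OF F]] in \<open>simp add: Q_def\<close>)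
    moreover have "(\<lambda>p. c * (F p - ?w (\<psi> F) p)) = (\<lambda>p. c * F p - ?w (\<lambda>x. c * \<psi> F x) p)"
      by (simp only: fun_eq_iff split_paired_all prod.case wE_mult right_diff_distrib) simp
    ultimately have "Q (\<lambda>p. c * F p) (\<lambda>x. c * \<psi> F x)"
      using Q\<psi>[OF C0L[OF F]] cspaceD(3)[OF cspace_E] by (simp add: Q_def)
    then show "\<psi> (\<lambda>p. c * F p) = (\<lambda>x. c * \<psi> F x)"
      using uniq Q\<psi>[OF C0L[OF cspaceD(3)[OF cspace_C0 F]]] by blast
  next
    fix g F assume g: "g \<in> Spn I J K" and F: "F \<in> C0"
    have "act3 g (\<lambda>p. F p - ?w (\<psi> F) p) \<in> C" using Q\<psi>[OF C0L[OF F]] inv[OF g] by (simp add: Q_def)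
    moreover have "act3 g (\<lambda>p. F p - ?w (\<psi> F) p) = (\<lambda>p. act3 g F p - ?w (act1 g (\<psi> F)) p)"
      unfolding act3_wE[OF g, symmetric] by (auto simp: act3_def fun_eq_iff)
    ultimately have "Q (act3 g F) (act1 g (\<psi> F))"
      using Q\<psi>[OF C0L[OF F]] act1_E[OF g] by (simp add: Q_def)
    then show "\<psi> (act3 g F) = (\<lambda>x. \<psi> F (inv g x))"
      using uniq Q\<psi>[OF C0L[OF act3_C0[OF g F]]] unfolding act1_def by blast
  next
    fix F assume "F \<in> C0" then show "linear (\<psi> F)" using Q\<psi>[OF C0L] by (simp add: Q_def E_mod_def)
  qed
  then have \<psi>0: "\<psi> F = (\<lambda>x. 0)" if "F \<in> C0" for F using that by blast
  have C0C: "C0 \<subseteq> C"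
  proof
    fix F assume F: "F \<in> C0"
    show "F \<in> C" using Q\<psi>[OF C0L[OF F]] unfolding Q_def \<psi>0[OF F] by (simp add: wE_zero case_prod_beta)
  qed
  show ?thesis
  proof (intro equalityI C0C subsetI)
    fix F assume F: "F \<in> C"
    then have e: "etri (cur F)" "alt3 (cur F)" using sub by (auto simp: L3E_iff)
    have "(\<lambda>p. F p - (\<lambda>(x, y, z). F (x, y, z) - wE (tr0 (cur F)) x y z) p) \<in> C"
      using F C0C L3E_decomp[OF e] by (intro cspaceD(4)[OF cC]) auto
    moreover have "(\<lambda>p. F p - (\<lambda>(x, y, z). F (x, y, z) - wE (tr0 (cur F)) x y z) p) = ?w (tr0 (cur F))"
      by (simp add: fun_eq_iff)
    ultimately have t0: "tr0 (cur F) = (\<lambda>x. 0)" using wC[OF tr0_E[OF e(1)]] by simp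
    have "(\<lambda>(x, y, z). F (x, y, z) - wE (tr0 (cur F)) x y z) = F" unfolding t0 by (simp add: fun_eq_iff wE_zero)
    then show "F \<in> C0" using L3E_decomp[OF e] by simp
  qed
qed

lemma L03E_eq: "L03E_mod I J K = C0"
  unfolding L03E_mod_def by (rule the_equality) (fact invariant_complement_C0, rule invariant_complement_unique)

lemma C0_dim8:
  assumes "n = 2" shows "C0 = {\<lambda>p. 0}"
proof -
  have "F = (\<lambda>p. 0)" if F: "F \<in> C0" for F
  proof -
    have e: "etri (cur F)" "alt3 (cur F)" "\<And>x. ctr J (cur F) x = 0" using F by (auto simp: C0_iff)
    have "cur F x y z = 0"
      if "x \<bullet> x = 1" "y \<bullet> y = 1" "z \<bullet> z = 1" "horth x y" "horth x z" "horth y z" for x y z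
      using horth3_le[OF that] assms by simp
    note * = unit_horth[OF this etri_trilin[OF e(1)]]
    have "cur F x y z = 0" for x y z by (rule L03E_determined[OF e *])
    then show ?thesis by (auto simp: fun_eq_iff)
  qed
  then show ?thesis using cspaceD(1)[OF cspace_C0] by blast
qed

end

section \<open>The module K: a model, its weights and its irreducibility\<close>

context adapted
begin

text \<open>The trace-free part of the Schur functor of type (2,1) applied to E, in the model that
  is skew in the first two slots and satisfies the cyclic identity.\<close>

definition Kmod :: "('a \<times> 'a \<times> 'a \<Rightarrow> complex) set" where
  "Kmod = {G. etri (cur G) \<and> (\<forall>x y z. G (y, x, z) = - G (x, y, z)) \<and>
     (\<forall>x y z. G (x, y, z) + G (y, z, x) + G (z, x, y) = 0) \<and> (\<forall>x. ctr J (cur G) x = 0)}"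

lemma KmodD:
  assumes "G \<in> Kmod"
  shows "etri (cur G)" "G (y, x, z) = - G (x, y, z)" "G (x, y, z) + G (y, z, x) + G (z, x, y) = 0" "ctr J (cur G) x = 0"
  using assms unfolding Kmod_def mem_Collect_eq by blast+

lemma KmodI:
  assumes "etri (cur G)" "\<And>x y z. G (y, x, z) = - G (x, y, z)" "\<And>x y z. G (x, y, z) + G (y, z, x) + G (z, x, y) = 0"
    "\<And>x. ctr J (cur G) x = 0"
  shows "G \<in> Kmod"
  using assms unfolding Kmod_def mem_Collect_eq by blast

lemma etri_perm:
  assumes "etri F" shows "etri (\<lambda>x y z. F x z y)" "etri (\<lambda>x y z. F y z x)" "etri (\<lambda>x y z. F y x z)"
  using assms unfolding etri_iff by simp_all

lemma cspace_Kmod: "cspace Kmod"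
  unfolding cspace_def
proof (intro conjI ballI allI)
  show "(\<lambda>x. 0) \<in> Kmod"
    by (rule KmodI) (simp_all add: etri_def trilin_def linear_zero ctr_def)
  fix F G assume FG: "F \<in> Kmod" "G \<in> Kmod"
  show "(\<lambda>x. F x + G x) \<in> Kmod"
  proof (rule KmodI)
    show "etri (\<lambda>x y z. F (x, y, z) + G (x, y, z))" by (intro etri_add KmodD FG)
    show "F (y, x, z) + G (y, x, z) = - (F (x, y, z) + G (x, y, z))" for x y z
      using KmodD(2)[OF FG(1), of y x z] KmodD(2)[OF FG(2), of y x z] by simp
    show "F (x, y, z) + G (x, y, z) + (F (y, z, x) + G (y, z, x)) + (F (z, x, y) + G (z, x, y)) = 0" for x y z
      using KmodD(3)[OF FG(1), of x y z] KmodD(3)[OF FG(2), of x y z] by (simp add: algebra_simps add_eq_0_iff)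
    show "ctr J (\<lambda>x y z. F (x, y, z) + G (x, y, z)) x = 0" for x
      by (simp add: ctr_add KmodD(4)[OF FG(1)] KmodD(4)[OF FG(2)])
  qed
next
  fix c F assume F: "F \<in> Kmod"
  show "(\<lambda>x. c * F x) \<in> Kmod"
  proof (rule KmodI)
    show "etri (\<lambda>x y z. c * F (x, y, z))" by (intro etri_cmult KmodD F)
    show "c * F (y, x, z) = - (c * F (x, y, z))" for x y z
      using KmodD(2)[OF F, of y x z] by simp
    show "c * F (x, y, z) + c * F (y, z, x) + c * F (z, x, y) = 0" for x y z
      using KmodD(3)[OF F, of x y z] by (simp flip: distrib_left)
    show "ctr J (\<lambda>x y z. c * F (x, y, z)) x = 0" for x
      using KmodD(4)[OF F, of x] by (simp add: ctr_def flip: sum_distrib_left)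
  qed
qed

lemma act3_Kmod:
  assumes g: "g \<in> Spn I J K" and F: "F \<in> Kmod" shows "act3 g F \<in> Kmod"
proof (rule KmodI)
  show "etri (cur (act3 g F))" unfolding cur_act3 by (intro etri_pre KmodD F Spn_inv g)
  show "act3 g F (y, x, z) = - act3 g F (x, y, z)" for x y z
    unfolding act3_def prod.case by (rule KmodD(2)[OF F])
  show "act3 g F (x, y, z) + act3 g F (y, z, x) + act3 g F (z, x, y) = 0" for x y z
    unfolding act3_def prod.case by (rule KmodD(3)[OF F])
  show "ctr J (cur (act3 g F)) x = 0" for x
    unfolding cur_act3 ctr_J_pre[OF etri_trilin[OF KmodD(1)[OF F]] Spn_inv[OF g]] by (rule KmodD(4)[OF F])
qed

text \<open>The tensor \<open>(eps x \<and> eps y) \<otimes> eps x\<close>; for quaternionically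
  orthogonal unit vectors it is a highest weight vector with respect to a suitable frame.\<close>

definition w2 :: "'a \<Rightarrow> 'a \<Rightarrow> 'a \<times> 'a \<times> 'a \<Rightarrow> complex" where
  "w2 x y = (\<lambda>(p, q, r). eps x p * eps y q * eps x r - eps y p * eps x q * eps x r)"

lemma w2_Kmod: assumes "horth x y" shows "w2 x y \<in> Kmod"
proof (rule KmodI)
  have e: "cur (w2 x y) = (\<lambda>p q r. eps x p * eps y q * eps x r - eps y p * eps x q * eps x r)"
    by (simp add: w2_def)
  show "etri (cur (w2 x y))" unfolding e by (intro etri_diff etri_eps3)
  show "w2 x y (q, p, r) = - w2 x y (p, q, r)" for p q r by (simp add: w2_def)
  show "w2 x y (p, q, r) + w2 x y (q, r, p) + w2 x y (r, p, q) = 0" for p q r by (simp add: w2_def mult_ac)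
  have "ctr J (cur (w2 x y)) p = ctr J (\<lambda>p q r. eps x p * eps y q * eps x r) p - ctr J (\<lambda>p q r. eps y p * eps x q * eps x r) p" for p
    unfolding e by (simp add: ctr_def sum_subtractf)
  then show "ctr J (cur (w2 x y)) p = 0" for p
    using eps_horth(2)[OF horth_sym[OF assms]] by (simp add: ctr_eps3 eps_self)
qed

lemma cip_w2:
  assumes F: "F \<in> Kmod" shows "cip XB F (w2 x y) = 16 * F (x, y, x)"
proof -
  have "w2 x y = (\<lambda>p. (\<lambda>(p, q, r). eps x p * eps y q * eps x r) p - (\<lambda>(p, q, r). eps y p * eps x q * eps x r) p)"
    by (auto simp: w2_def fun_eq_iff)
  then have "cip XB F (w2 x y) = 8 * F (x, y, x) - 8 * F (y, x, x)"
    by (simp only: cip_simps cip_eps3[OF KmodD(1)[OF F]])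
  then show ?thesis using KmodD(2)[OF F, of y x x] by simp
qed

lemma act3_w2: "g \<in> Spn I J K \<Longrightarrow> act3 g (w2 x y) = w2 (g x) (g y)"
  by (simp add: fun_eq_iff act3_def w2_def eps_inv)

lemma Kmod_XB: "F \<in> Kmod \<Longrightarrow> (\<And>p. p \<in> XB \<Longrightarrow> F p = 0) \<Longrightarrow> F = (\<lambda>x. 0)"
  by (rule etri_XB[OF KmodD(1)])

text \<open>Sp(n) acts unitarily. The substitution is removed slot by slot, each time by invariance
  of the trace in one variable.\<close>

lemma cip_act3:
  assumes g: "g \<in> Spn I J K" and F: "etri (cur F)" and G: "etri (cur G)"
  shows "cip XB (act3 g F) (act3 g G) = cip XB F G"
proof -
  let ?h = "inv g"
  note o = Spn_orth[OF Spn_inv[OF g]]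
  have l: "(\<Sum>u\<in>Basis. f (?h u) * cnj (k (?h u))) = (\<Sum>u\<in>Basis. f u * cnj (k u))" if "f \<in> E_mod I" "k \<in> E_mod I" for f k
    by (rule trace_orthogonal[OF o, of "\<lambda>u v. f u * cnj (k v)"])
      (simp_all add: linear_iff E_mod_simps[OF that(1)] E_mod_simps[OF that(2)] scaleR_conv_of_real algebra_simps)
  have "cip XB (act3 g F) (act3 g G) = (\<Sum>u\<in>Basis. \<Sum>v\<in>Basis. \<Sum>w\<in>Basis. F (?h u, ?h v, ?h w) * cnj (G (?h u, ?h v, ?h w)))"
    by (simp add: cip_def sum_XB act3_def)
  also have "\<dots> = (\<Sum>u\<in>Basis. \<Sum>v\<in>Basis. \<Sum>w\<in>Basis. F (?h u, ?h v, w) * cnj (G (?h u, ?h v, w)))"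
    by (intro sum.cong refl l[OF E_mod_etri(3)[OF F] E_mod_etri(3)[OF G]])
  also have "\<dots> = (\<Sum>u\<in>Basis. \<Sum>w\<in>Basis. \<Sum>v\<in>Basis. F (?h u, ?h v, w) * cnj (G (?h u, ?h v, w)))"
    by (rule sum.cong[OF refl], rule sum.swap)
  also have "\<dots> = (\<Sum>u\<in>Basis. \<Sum>w\<in>Basis. \<Sum>v\<in>Basis. F (?h u, v, w) * cnj (G (?h u, v, w)))"
    by (intro sum.cong refl l[OF E_mod_etri(2)[OF F] E_mod_etri(2)[OF G]])
  also have "\<dots> = (\<Sum>w\<in>Basis. \<Sum>u\<in>Basis. \<Sum>v\<in>Basis. F (?h u, v, w) * cnj (G (?h u, v, w)))"
    by (rule sum.swap)
  also have "\<dots> = (\<Sum>w\<in>Basis. \<Sum>v\<in>Basis. \<Sum>u\<in>Basis. F (?h u, v, w) * cnj (G (?h u, v, w)))"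
    by (rule sum.cong[OF refl], rule sum.swap)
  also have "\<dots> = (\<Sum>w\<in>Basis. \<Sum>v\<in>Basis. \<Sum>u\<in>Basis. F (u, v, w) * cnj (G (u, v, w)))"
    by (intro sum.cong refl l[OF E_mod_etri(1)[OF F] E_mod_etri(1)[OF G]])
  also have "\<dots> = (\<Sum>w\<in>Basis. \<Sum>u\<in>Basis. \<Sum>v\<in>Basis. F (u, v, w) * cnj (G (u, v, w)))"
    by (rule sum.cong[OF refl], rule sum.swap)
  also have "\<dots> = (\<Sum>u\<in>Basis. \<Sum>w\<in>Basis. \<Sum>v\<in>Basis. F (u, v, w) * cnj (G (u, v, w)))"
    by (rule sum.swap)
  also have "\<dots> = (\<Sum>u\<in>Basis. \<Sum>v\<in>Basis. \<Sum>w\<in>Basis. F (u, v, w) * cnj (G (u, v, w)))"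
    by (rule sum.cong[OF refl], rule sum.swap)
  finally show ?thesis by (simp add: cip_def sum_XB)
qed

definition torus :: "nat \<Rightarrow> (nat \<Rightarrow> 'a) \<Rightarrow> (nat \<Rightarrow> real) \<Rightarrow> ('a \<Rightarrow> 'a) \<Rightarrow> bool" where
  "torus m e \<theta> g \<longleftrightarrow> g \<in> Spn I J K \<and> (\<forall>r<m. g (e r) = cos (\<theta> r) *\<^sub>R e r + sin (\<theta> r) *\<^sub>R I (e r))"

text \<open>The sign is positive for \<open>J (e r)\<close> and negative for \<open>e r\<close>,
  opposite to the weights of these vectors, because the module consists of forms.\<close>

definition sg :: "bool \<Rightarrow> int" where
  "sg j = (if j then 1 else - 1)"

lemma inv_torus:
  assumes g: "torus m e \<theta> g" and r: "r < m" and f: "f \<in> E_mod I"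
  shows "f (inv g (lab e r j)) = cis (of_int (sg j) * \<theta> r) * f (lab e r j)"
proof -
  have gS: "g \<in> Spn I J K" and ge: "g (e r) = cos (\<theta> r) *\<^sub>R e r + sin (\<theta> r) *\<^sub>R I (e r)" using g r by (auto simp: torus_def)
  have l: "linear g" by (rule orthogonal_transformation_linear[OF Spn_orth[OF gS]])
  have "g (cos (\<theta> r) *\<^sub>R e r - sin (\<theta> r) *\<^sub>R I (e r)) = (cos (\<theta> r) * cos (\<theta> r)) *\<^sub>R e r + (sin (\<theta> r) * sin (\<theta> r)) *\<^sub>R e r"
    by (simp add: linear_diff[OF l] linear_cmul[OF l] Spn_comm[OF gS] ge algebra_simps)
  also have "\<dots> = e r" by (simp flip: scaleR_left_distrib)
  finally have "g (cos (\<theta> r) *\<^sub>R e r - sin (\<theta> r) *\<^sub>R I (e r)) = e r" .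
  then have i: "inv g (e r) = cos (\<theta> r) *\<^sub>R e r - sin (\<theta> r) *\<^sub>R I (e r)"
    using orth_inv_apply(2)[OF Spn_orth[OF gS]] by metis
  have "inv g (J (e r)) = cos (\<theta> r) *\<^sub>R J (e r) + sin (\<theta> r) *\<^sub>R I (J (e r))"
    unfolding Spn_comm(2)[OF Spn_inv[OF gS]] i by simp
  then show ?thesis using i
    by (cases j) (simp_all only: lab_def sg_def if_True if_False E_mod_simps[OF f], simp_all add: complex_eq_iff algebra_simps)
qed

lemma torus_component:
  assumes g: "torus m e \<theta> g" and F: "etri F" and "r < m" "s < m" "t < m"
  shows "F (inv g (lab e r i)) (inv g (lab e s j)) (inv g (lab e t k)) =
    cis (of_int (sg i) * \<theta> r + of_int (sg j) * \<theta> s + of_int (sg k) * \<theta> t) * F (lab e r i) (lab e s j) (lab e t k)"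
  by (simp add: inv_torus[OF g assms(3) E_mod_etri(1)[OF F]] inv_torus[OF g assms(4) E_mod_etri(2)[OF F]]
      inv_torus[OF g assms(5) E_mod_etri(3)[OF F]] cis_mult[symmetric] mult.assoc)

definition wt :: "nat \<Rightarrow> bool \<Rightarrow> nat \<Rightarrow> bool \<Rightarrow> nat \<Rightarrow> bool \<Rightarrow> nat \<Rightarrow> int" where
  "wt r i s j t k q = (if q = r then sg i else 0) + (if q = s then sg j else 0) + (if q = t then sg k else 0)"

end

context quaternionic
begin

lemma torus_exists:
  assumes e: "frame n e" shows "\<exists>g. torus n e \<theta> g"
proof -
  let ?f = "\<lambda>r. cos (\<theta> r) *\<^sub>R e r + sin (\<theta> r) *\<^sub>R I (e r)"
  have hI: "horth x (I y)" "horth (I x) y" if "horth x y" for x y using that by (simp_all add: horth_def)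
  have hs: "horth (c *\<^sub>R x) y" "horth x (c *\<^sub>R y)" if "horth x y" for x y c using that by (simp_all add: horth_def)
  have "frame n ?f"
    unfolding frame_iff
  proof (intro conjI allI impI)
    fix r assume r: "r < n"
    show "?f r \<bullet> ?f r = 1" by (simp add: inner_simps frame_unit[OF e r])
    fix s assume s: "s < n" "r \<noteq> s"
    show "horth (?f r) (?f s)" by (intro horth_simps(1,6) hs hI frame_horth[OF e r s])
  qed
  then show ?thesis using gmap_Spn[OF e] by (auto simp: torus_def)
qed

lemma weight_component:
  assumes e: "frame n e" and F: "etri F"
    and w: "\<And>g \<theta> x y z. torus n e \<theta> g \<Longrightarrow> F (inv g x) (inv g y) (inv g z) = cis (\<Sum>r<n. of_int (\<mu> r) * \<theta> r) * F x y z"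
    and b: "r < n" "s < n" "t < n" and nz: "F (lab e r i) (lab e s j) (lab e t k) \<noteq> 0" and q: "q < n"
  shows "\<mu> q = wt r i s j t k q"
proof (rule ccontr)
  assume ne: "\<mu> q \<noteq> wt r i s j t k q"
  define d where "d = \<mu> q - wt r i s j t k q"
  \<comment> \<open>With this angle the two characters would differ by \<open>cis pi = - 1\<close>
    on the chosen torus element.\<close>
  define \<phi> where "\<phi> = pi / of_int d"
  define \<theta> where "\<theta> p = (if p = q then \<phi> else 0)" for p
  obtain g where g: "torus n e \<theta> g" using torus_exists[OF e] by blast
  have "cis (\<Sum>r<n. of_int (\<mu> r) * \<theta> r) = cis (of_int (sg i) * \<theta> r + of_int (sg j) * \<theta> s + of_int (sg k) * \<theta> t)"
    using torus_component[OF g F b, of i j k] w[OF g] nz by simp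
  moreover have "(\<Sum>r<n. of_int (\<mu> r) * \<theta> r) = of_int (\<mu> q) * \<phi>"
    using q by (simp add: \<theta>_def if_distrib[of "\<lambda>x. _ * x"] cong: if_cong)
  moreover have "of_int (sg i) * \<theta> r + of_int (sg j) * \<theta> s + of_int (sg k) * \<theta> t = of_int (wt r i s j t k q) * \<phi>"
    by (simp add: \<theta>_def wt_def algebra_simps)
  ultimately have "cis (of_int (\<mu> q) * \<phi>) = cis (of_int (wt r i s j t k q) * \<phi>)" by simp
  then have "cis (of_int (\<mu> q) * \<phi> - of_int (wt r i s j t k q) * \<phi>) = 1"
    by (simp add: cis_divide[symmetric])
  moreover have "of_int (\<mu> q) * \<phi> - of_int (wt r i s j t k q) * \<phi> = of_int d * \<phi>"
    by (simp add: d_def left_diff_distrib)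
  moreover have "of_int d * \<phi> = pi" using ne by (simp add: \<phi>_def) (simp add: d_def)
  ultimately show False by simp
qed

abbreviation \<kappa> :: "nat \<Rightarrow> int" where
  "\<kappa> \<equiv> (\<lambda>r. if r = 0 then 2 else if r = 1 then 1 else 0)"

text \<open>The weight (2,1,0,...) leaves only labels \<open>J (e 0)\<close>,
  \<open>J (e 0)\<close>, \<open>J (e 1)\<close> in some order, and skewness in the first two slots
  leaves one free component among the three orders.\<close>

lemma highest_component_unique:
  assumes e: "frame n e" and F: "etri F" and sk: "\<And>x y z. F y x z = - F x y z"
    and w: "\<And>g \<theta> x y z. torus n e \<theta> g \<Longrightarrow> F (inv g x) (inv g y) (inv g z) = cis (\<Sum>r<n. of_int (\<kappa> r) * \<theta> r) * F x y z"
    and 0: "F (J (e 0)) (J (e 1)) (J (e 0)) = 0"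
  shows "F x y z = 0"
proof (rule etri_ext[OF F e])
  fix r s t i j k assume b: "r < n" "s < n" "t < n"
  show "F (lab e r i) (lab e s j) (lab e t k) = 0"
  proof (rule ccontr)
    assume nz: "F (lab e r i) (lab e s j) (lab e t k) \<noteq> 0"
    note wc = weight_component[OF e F w b nz]
    have 1: "2 = wt r i s j t k 0" "1 = wt r i s j t k 1" using wc[of 0] wc[of 1] n_gt_1 by auto
    have "(r = 0 \<and> i \<and> s = 0 \<and> j \<and> t = 1 \<and> k) \<or> (r = 0 \<and> i \<and> s = 1 \<and> j \<and> t = 0 \<and> k) \<or> (r = 1 \<and> i \<and> s = 0 \<and> j \<and> t = 0 \<and> k)"
      using 1 by (auto simp: wt_def sg_def split: if_splits)
    moreover have "F a a b = 0" for a b using sk[of a a b] by simp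
    moreover have "F (J (e 1)) (J (e 0)) (J (e 0)) = 0" using sk[of "J (e 1)" "J (e 0)" "J (e 0)"] 0 by simp
    ultimately show False using nz 0 by (auto simp: lab_def)
  qed
qed

text \<open>The passage to the symmetric model: the hypothesis, polarized in \<open>x\<close>, says
  precisely that \<open>F x x' y\<close> vanishes when both \<open>x\<close> and \<open>x'\<close>
  are quaternionically orthogonal to \<open>y\<close>.\<close>

lemma K_determined:
  assumes G: "G \<in> Kmod" and h: "\<And>x y. x \<bullet> x = 1 \<Longrightarrow> y \<bullet> y = 1 \<Longrightarrow> horth x y \<Longrightarrow> G (x, y, x) = 0"
  shows "G = (\<lambda>p. 0)"
proof -
  note e = KmodD(1)[OF G] and sk = KmodD(2)[OF G] and cyc = KmodD(3)[OF G] and tr = KmodD(4)[OF G]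
  note t = etri_trilin[OF e]
  note ts = trilin_simps[OF t]
  have h1: "G (x, y, x) = 0" if "horth x y" for x y
  proof (cases "x = 0 \<or> y = 0")
    case True then show ?thesis using ts(13,14) by auto
  next
    case False
    have "G (inverse (norm x) *\<^sub>R x, inverse (norm y) *\<^sub>R y, inverse (norm x) *\<^sub>R x) = 0"
      by (rule h) (use False that in \<open>simp_all add: horth_simps dot_square_norm power2_eq_square\<close>)
    then show ?thesis using False by (simp add: ts)
  qed
  define F where "F x y z = G (x, z, y) + G (y, z, x)" for x y z
  have eF: "etri F"
    unfolding F_def by (rule etri_add[OF etri_perm(1)[OF e] etri_perm(2)[OF e]])
  have F0: "F x y z = 0" for x y z
  proof (rule K_determined_sym[OF eF])
    show "F y x z = F x y z" for x y z by (simp add: F_def)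
    show "F x y z + F y z x + F z x y = 0" for x y z
      using sk[of x y z] sk[of y z x] sk[of z x y] by (simp add: F_def)
    show "F x x' y = 0" if "horth x y" "horth x' y" for x x' y
      using h1[OF horth_simps(6)[OF that]] h1[OF that(1)] h1[OF that(2)] by (simp add: F_def ts add.commute)
    show "(\<Sum>u\<in>Basis. F u y (J u)) = 0" for y
    proof -
      have "(\<Sum>u\<in>Basis. G (y, J (J u), J u)) = (\<Sum>u\<in>Basis. G (y, J u, u))"
        using trace_trilin(2)[OF t lin(2) linear_ident, of y] by simp
      then have s: "(\<Sum>u\<in>Basis. G (y, J u, u)) = 0"
        using tr[of y] by (simp add: ts sum_negf ctr_def)
      have "F u y (J u) = 2 * G (y, J u, u) - G (y, u, J u)" for u
        using cyc[of u "J u" y] sk[of "J u" y u] by (simp add: F_def add_eq_0_iff)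
      then show ?thesis using s tr[of y] by (simp add: sum_subtractf sum_distrib_left[symmetric] ctr_def)
    qed
  qed
  \<comment> \<open>Since \<open>F = 0\<close>, the form \<open>G\<close> is skew in all slots, and
    the cyclic identity becomes \<open>3 G = 0\<close>.\<close>
  have "G (x, y, z) = 0" for x y z
  proof -
    have "G (y, z, x) = G (x, y, z)" "G (z, x, y) = G (x, y, z)"
      using F0[of x y z] F0[of z x y] F0[of y z x] F0[of z y x] sk[of x y z] sk[of y z x] sk[of z x y] by (simp_all add: F_def add_eq_0_iff)
    then show ?thesis using cyc[of x y z] by simp
  qed
  then show ?thesis by (auto simp: fun_eq_iff)
qed

lemma cspan_w2: "cspan {w2 x y |x y. x \<bullet> x = 1 \<and> y \<bullet> y = 1 \<and> horth x y} = Kmod"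
  (is "cspan ?W = Kmod")
proof (rule orthogonal_complement_zero[OF finite_XB cspace_Kmod])
  show "f = (\<lambda>x. 0)" if "f \<in> Kmod" "\<And>p. p \<in> XB \<Longrightarrow> f p = 0" for f by (rule Kmod_XB[OF that])
  show "cspace (cspan ?W)" by (rule cspace_cspan)
  show "cspan ?W \<subseteq> Kmod" by (rule cspan_minimal[OF cspace_Kmod]) (auto intro: w2_Kmod)
  show "f = (\<lambda>x. 0)" if f: "f \<in> Kmod" and 0: "\<And>w. w \<in> cspan ?W \<Longrightarrow> cip XB f w = 0" for f
  proof (rule K_determined[OF f])
    fix x y :: 'a assume "x \<bullet> x = 1" "y \<bullet> y = 1" "horth x y"
    then have "w2 x y \<in> cspan ?W" using cspan_superset[of ?W] by blast
    then show "f (x, y, x) = 0" using 0 cip_w2[OF f, of x y] by simp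
  qed
qed

text \<open>A flip of the line of \<open>x\<close> has no effect on the component at
  \<open>(x, y, x)\<close>, where \<open>x\<close> occurs twice. A quarter turn of that line
  contributes the square of \<open>- \<i>\<close>, which restores the sign \<open>- 1\<close> and
  again produces the factor 4.\<close>

lemma Hom_E_K:
  assumes \<psi>: "\<And>f h. f \<in> E_mod I \<Longrightarrow> h \<in> E_mod I \<Longrightarrow> \<psi> (\<lambda>x. f x + h x) = (\<lambda>p. \<psi> f p + \<psi> h p)"
    "\<And>c f. f \<in> E_mod I \<Longrightarrow> \<psi> (\<lambda>x. c * f x) = (\<lambda>p. c * \<psi> f p)"
    and eq: "\<And>g f. g \<in> Spn I J K \<Longrightarrow> f \<in> E_mod I \<Longrightarrow> \<psi> (act1 g f) = act3 g (\<psi> f)"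
    and Km: "\<And>f. f \<in> E_mod I \<Longrightarrow> \<psi> f \<in> Kmod" and f: "f \<in> E_mod I"
  shows "\<psi> f = (\<lambda>p. 0)"
proof (rule K_determined[OF Km[OF f]])
  fix x y :: 'a assume xy: "x \<bullet> x = 1" "y \<bullet> y = 1" "horth x y"
  note eG = KmodD(1)[OF Km[OF f]]
  note ts = trilin_simps[OF etri_trilin[OF eG]]
  obtain e where e: "frame n e" and e': "\<And>r. r < 2 \<Longrightarrow> e r = (if r = 0 then x else y)"
    using frame_extend[OF frame2[OF xy]] n_gt_1 by (metis Suc_1 Suc_leI)
  have e0: "e 0 = x" "e 1 = y" using e'[of 0] e'[of 1] by auto
  obtain g where g: "torus n e (\<lambda>r. if r = 0 then pi / 2 else 0) g" using torus_exists[OF e] by blast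
  have gS: "g \<in> Spn I J K" and gr: "\<And>r. r < n \<Longrightarrow> g (e r) = (if r = 0 then I (e r) else e r)"
    using g by (auto simp: torus_def)
  have lg: "linear g" by (rule orthogonal_transformation_linear[OF Spn_orth[OF gS]])
  have ig: "inv g x = - I x" "inv g y = y"
    using gr[of 0] gr[of 1] n_gt_1 by (auto intro!: inv_fix[OF gS] simp: linear_neg[OF lg] Spn_comm[OF gS] e0 e0[unfolded One_nat_def])
  have i1: "inv (flip e 1) x = x" "inv (flip e 1) y = - y"
    using inv_flip[OF e, of 0 1] inv_flip[OF e, of 1 1] e0 n_gt_1 by auto
  have l: "linear (inv (flip e 1))" by (intro orthogonal_transformation_linear Spn_orth Spn_inv flip_Spn e)
  have c: "inv (flip e 1) (I v) = I (inv (flip e 1) v)" for v by (rule Spn_comm(1)[OF Spn_inv[OF flip_Spn[OF e]]])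
  have "\<psi> f (x, y, x) - act3 g (\<psi> f) (x, y, x) - act3 (flip e 1) (\<psi> f) (x, y, x)
      + act3 g (act3 (flip e 1) (\<psi> f)) (x, y, x) = 0"
    by (rule Hom_E_commutator[OF \<psi> eq f e, where a = 0 and c = 0 and d = "-1"])
      (use flip_Spn[OF e] flip_apply[OF e] ig(1) gS gr e0 n_gt_1 in auto)
  then show "\<psi> f (x, y, x) = 0"
    unfolding act3_def prod.case ig i1 linear_neg[OF l] c ts(7-9) etri_I[OF eG]
    by (simp add: etri_I[OF eG] algebra_simps)
qed

lemma w2_torus:
  assumes g: "torus n e \<theta> g" shows "act3 g (w2 (J (e 0)) (J (e 1))) = (\<lambda>p. cis (\<Sum>r<n. of_int (\<kappa> r) * \<theta> r) * w2 (J (e 0)) (J (e 1)) p)"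
proof -
  have gS: "g \<in> Spn I J K" using g by (simp add: torus_def)
  have "eps (g (J (e r))) p = cis (\<theta> r) * eps (J (e r)) p" if "r < n" for r p
  proof -
    have "g (J (e r)) = cos (\<theta> r) *\<^sub>R J (e r) + sin (\<theta> r) *\<^sub>R - I (J (e r))"
      using g that by (simp add: torus_def Spn_comm)
    then show ?thesis by (simp only: eps_linear_left) (simp add: complex_eq_iff algebra_simps)
  qed
  note * = this[of 0] this[of 1]
  have s: "(\<Sum>r<n. of_int (\<kappa> r) * \<theta> r) = \<theta> 0 + \<theta> 1 + \<theta> 0"
  proof -
    have "(\<Sum>r<n. of_int (\<kappa> r) * \<theta> r) = (\<Sum>r<n. (if r = 0 then 2 * \<theta> 0 else 0) + (if r = 1 then \<theta> 1 else 0))"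
      by (rule sum.cong) auto
    then show ?thesis using n_gt_1 by (simp add: sum.distrib)
  qed
  have h: "eps (g (J (e 0))) p = cis (\<theta> 0) * eps (J (e 0)) p" "eps (g (J (e 1))) p = cis (\<theta> 1) * eps (J (e 1)) p" for p
    using * n_gt_1 by auto
  show ?thesis unfolding act3_w2[OF gS] s
    by (rule ext) (simp only: w2_def case_prod_beta h cis_mult[symmetric] right_diff_distrib mult_ac)
qed

lemma transitive_pairs:
  assumes "x \<bullet> x = 1" "y \<bullet> y = 1" "horth x y" "x' \<bullet> x' = 1" "y' \<bullet> y' = 1" "horth x' y'"
  shows "\<exists>g\<in>Spn I J K. g x = x' \<and> g y = y'"
proof -
  have n2: "2 \<le> n" using n_gt_1 by simp
  obtain e where e: "frame n e" "\<And>r. r < 2 \<Longrightarrow> e r = (if r = 0 then x else y)"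
    using frame_extend[OF frame2[OF assms(1-3)] n2] by metis
  obtain f where f: "frame n f" "\<And>r. r < 2 \<Longrightarrow> f r = (if r = 0 then x' else y')"
    using frame_extend[OF frame2[OF assms(4-6)] n2] by metis
  show ?thesis
    using gmap_Spn(1)[OF e(1) f(1)] gmap_Spn(2)[OF e(1) f(1), of 0] gmap_Spn(2)[OF e(1) f(1), of 1] e(2)[of 0] e(2)[of 1]
      f(2)[of 0] f(2)[of 1] n2 by auto
qed

text \<open>The orthogonal projection of \<open>w2 x y\<close> to an invariant subspace has the same
  weight, so it is a multiple of \<open>w2 x y\<close>. Thus each such vector lies in the subspace
  or is orthogonal to it. In the first case transitivity on orthonormal pairs gives everything, and
  in the other \<open>K_determined\<close> gives zero.\<close>

lemma Kmod_irreducible: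
  assumes W: "cspace W" "W \<subseteq> Kmod" and inv: "\<And>g F. g \<in> Spn I J K \<Longrightarrow> F \<in> W \<Longrightarrow> act3 g F \<in> W"
  shows "W = {\<lambda>x. 0} \<or> W = Kmod"
proof -
  have n2: "2 \<le> n" using n_gt_1 by simp
  have fin: "cfinite_dim W"
    using finite_dim_of_points[OF finite_XB W(1)] W(2) Kmod_XB by blast
  have alt: "w2 x y \<in> W \<or> (\<forall>F\<in>W. cip XB (w2 x y) F = 0)" if xy: "x \<bullet> x = 1" "y \<bullet> y = 1" "horth x y" for x y
  proof -
    let ?w = "w2 x y"
    \<comment> \<open>The frame starts with \<open>- J x\<close> and \<open>- J y\<close>, so that
      applying \<open>J\<close> to its first two members gives \<open>x\<close> and
      \<open>y\<close>.\<close>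
    have fr: "frame 2 (\<lambda>i. if i = 0 then - J x else - J y)"
      by (rule frame2) (use xy in \<open>simp_all add: horth_simps\<close>)
    obtain e where e: "frame n e" and e': "\<forall>r<2. e r = (if r = 0 then - J x else - J y)"
      using frame_extend[OF fr n2] by blast
    have e0: "J (e 0) = x" "J (e 1) = y" using e' by auto
    have wK: "?w \<in> Kmod" by (rule w2_Kmod[OF xy(3)])
    obtain P where P: "P \<in> W" "\<And>F. F \<in> W \<Longrightarrow> cip XB (\<lambda>p. ?w p - P p) F = 0"
      using orthogonal_decomposition[OF finite_XB W(1) fin] by blast
    define Q where "Q = (\<lambda>p. ?w p - P p)"
    have PK: "P \<in> Kmod" using P(1) W(2) by blast
    have QK: "Q \<in> Kmod" unfolding Q_def by (rule cspaceD(4)[OF cspace_Kmod wK PK])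
    have gP: "act3 g P = (\<lambda>p. cis (\<Sum>r<n. of_int (\<kappa> r) * \<theta> r) * P p)" if g: "torus n e \<theta> g" for g \<theta>
    proof -
      have gS: "g \<in> Spn I J K" using g by (simp add: torus_def)
      let ?c = "cis (\<Sum>r<n. of_int (\<kappa> r) * \<theta> r)"
      \<comment> \<open>Since \<open>Q\<close> and its translates are orthogonal to
        \<open>W\<close>, this element of \<open>W\<close> is orthogonal to itself; hence the
        projection has the weight of \<open>?w\<close>.\<close>
      define R where "R = (\<lambda>p. act3 g P p - ?c * P p)"
      have RW: "R \<in> W" unfolding R_def by (intro cspaceD(4)[OF W(1)] cspaceD(3)[OF W(1)] inv gS P(1))
      have "act3 g ?w = (\<lambda>p. ?c * ?w p)" using w2_torus[OF g] unfolding e0 .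
      then have "R p = ?c * Q p - act3 g Q p" for p
        by (cases p) (simp add: R_def Q_def act3_def fun_eq_iff algebra_simps)
      then have R: "R = (\<lambda>p. ?c * Q p - act3 g Q p)" by blast
      have "cip XB (act3 g Q) F = 0" if F: "F \<in> W" for F
      proof -
        have gF: "act3 (inv g) F \<in> W" by (rule inv[OF Spn_inv[OF gS] F])
        have "act3 g (act3 (inv g) F) = F"
          using orth_inv_apply[OF Spn_orth[OF gS]] inv_inv_eq[OF orth_bij[OF Spn_orth[OF gS]]]
          by (simp add: act3_def fun_eq_iff)
        then have "cip XB (act3 g Q) F = cip XB Q (act3 (inv g) F)"
          using cip_act3[OF gS KmodD(1)[OF QK] KmodD(1)[of "act3 (inv g) F"]] gF W(2) by auto
        also have "\<dots> = 0" using P(2)[OF gF] by (simp add: Q_def)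
        finally show ?thesis .
      qed
      then have "cip XB R R = 0" using RW P(2)[OF RW, folded Q_def]
        by (subst (1) R) (simp only: cip_simps, simp)
      then have "R p = 0" if "p \<in> XB" for p using cip_self_zero[OF finite_XB _ that] by blast
      then have "R = (\<lambda>p. 0)" using Kmod_XB RW W(2) by blast
      then show ?thesis by (simp add: R_def fun_eq_iff)
    qed
    define c where "c = P (x, y, x)"
    let ?F = "\<lambda>p. P p - c * ?w p"
    have FK: "?F \<in> Kmod" by (intro cspaceD(4)[OF cspace_Kmod] cspaceD(3)[OF cspace_Kmod] PK wK)
    have "(\<lambda>x y z. ?F (x, y, z)) x' y' z' = 0" for x' y' z'
    proof (rule highest_component_unique[OF e KmodD(1)[OF FK] KmodD(2)[OF FK]])
      fix g \<theta> x' y' z' assume g: "torus n e \<theta> g"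
      have gS: "g \<in> Spn I J K" using g by (simp add: torus_def)
      show "?F (inv g x', inv g y', inv g z') = cis (\<Sum>r<n. of_int (\<kappa> r) * \<theta> r) * ?F (x', y', z')"
        using fun_cong[OF gP[OF g], of "(x', y', z')"] fun_cong[OF w2_torus[OF g, unfolded e0], of "(x', y', z')"]
        by (simp add: act3_def right_diff_distrib)
    next
      show "?F (J (e 0), J (e 1), J (e 0)) = 0"
        unfolding e0 using xy eps_horth(1)[OF xy(3)] by (simp add: c_def w2_def eps_self)
    qed
    then have Pc: "P = (\<lambda>p. c * ?w p)" by (auto simp: fun_eq_iff)
    show ?thesis
    proof (cases "c = 0")
      case True
      then have "Q = ?w" by (simp add: Q_def Pc)
      then show ?thesis using P(2) by (simp add: Q_def)
    next
      case False
      have "(\<lambda>p. inverse c * P p) \<in> W" by (rule cspaceD(3)[OF W(1) P(1)])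
      then show ?thesis using False by (simp add: Pc)
    qed
  qed
  show ?thesis
  proof (cases "\<exists>x y. x \<bullet> x = 1 \<and> y \<bullet> y = 1 \<and> horth x y \<and> w2 x y \<in> W")
    case True
    then obtain x y where xy: "x \<bullet> x = 1" "y \<bullet> y = 1" "horth x y" and w: "w2 x y \<in> W" by blast
    have "w2 x' y' \<in> W" if "x' \<bullet> x' = 1" "y' \<bullet> y' = 1" "horth x' y'" for x' y'
      using transitive_pairs[OF xy that] inv[OF _ w] act3_w2 by metis
    then have "Kmod \<subseteq> W" unfolding cspan_w2[symmetric] by (intro cspan_minimal[OF W(1)]) blast
    then show ?thesis using W(2) by blast
  next
    case False
    have "F = (\<lambda>x. 0)" if F: "F \<in> W" for F
    proof (rule K_determined)
      show FK: "F \<in> Kmod" using F W(2) by blast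
      fix x y :: 'a assume "x \<bullet> x = 1" "y \<bullet> y = 1" "horth x y"
      then have "cip XB (w2 x y) F = 0" using alt False F by blast
      moreover have "cip XB F (w2 x y) = cnj (cip XB (w2 x y) F)" by (simp add: cip_def mult.commute)
      ultimately show "F (x, y, x) = 0" using cip_w2[OF FK, of x y] by simp
    qed
    then show ?thesis using cspaceD(1)[OF W(1)] by blast
  qed
qed

text \<open>The coefficients with respect to the simple roots are the partial sums of
  \<open>\<kappa> - \<mu>\<close>, except that the last one is halved. They are nonnegative because
  three equal labels are excluded, and the last sum is even because it is 3 minus a sum of three
  signs.\<close>

lemma Kmod_weight_bound:
  assumes e: "frame n e" and f: "f \<in> Kmod" "f \<noteq> (\<lambda>x. 0)"
    and w: "\<And>g \<theta>. torus n e \<theta> g \<Longrightarrow> act3 g f = (\<lambda>p. cis (\<Sum>r<n. of_int (\<mu> r) * \<theta> r) * f p)"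
  shows "\<exists>c :: nat \<Rightarrow> nat. \<forall>r<n. \<kappa> r - \<mu> r = (\<Sum>k<n. int (c k) * simple_root n k r)"
proof -
  note F = KmodD(1)[OF f(1)]
  obtain p where "f p \<noteq> 0" using f(2) by blast
  then obtain x y z where "f (x, y, z) \<noteq> 0" by (cases p) auto
  then obtain r s t i j k where b: "r < n" "s < n" "t < n" and nz: "f (lab e r i, lab e s j, lab e t k) \<noteq> 0"
    using etri_ext[OF F e] by blast
  have w': "f (inv g x, inv g y, inv g z) = cis (\<Sum>r<n. of_int (\<mu> r) * \<theta> r) * f (x, y, z)" if "torus n e \<theta> g" for g \<theta> x y z
    using fun_cong[OF w[OF that], of "(x, y, z)"] by (simp add: act3_def)
  have \<mu>: "\<mu> q = wt r i s j t k q" if "q < n" for q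
    by (rule weight_component[OF e F w' b nz that])
  \<comment> \<open>The cyclic identity kills components with three equal labels; a weight such as
    \<open>3 \<epsilon>_0\<close> would make the first partial sum negative.\<close>
  have neq: "\<not> (r = s \<and> s = t \<and> i = j \<and> j = k)"
  proof
    assume *: "r = s \<and> s = t \<and> i = j \<and> j = k"
    then have "lab e s j = lab e r i" "lab e t k = lab e r i" by simp_all
    then show False using nz KmodD(3)[OF f(1), of "lab e r i" "lab e r i" "lab e r i"] by simp
  qed
  define S where "S m = (\<Sum>q\<le>m. \<kappa> q - \<mu> q)" for m
  have Sw: "S m = (if m = 0 then 2 else 3) - ((if r \<le> m then sg i else 0) + (if s \<le> m then sg j else 0) + (if t \<le> m then sg k else 0))" if "m < n" for m
  proof -
    have "S m = (\<Sum>q\<le>m. \<kappa> q - wt r i s j t k q)"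
      unfolding S_def by (rule sum.cong) (use \<mu> that in auto)
    moreover have "(\<Sum>q\<le>m. \<kappa> q) = (if m = 0 then 2 else 3)"
    proof -
      have "(\<Sum>q\<le>m. \<kappa> q) = (\<Sum>q\<le>m. (if q = 0 then 2 else 0) + (if q = 1 then 1 else 0))"
        by (rule sum.cong) auto
      then show ?thesis by (simp add: sum.distrib)
    qed
    ultimately show ?thesis by (simp add: wt_def sum_subtractf sum.distrib)
  qed
  have Spos: "0 \<le> S m" if "m < n" for m
    unfolding Sw[OF that] using neq by (auto simp: sg_def)
  have Seven: "even (S (n - 1))"
    using Sw[of "n - 1"] b n_gt_1 by (auto simp: sg_def)
  \<comment> \<open>The last simple root is \<open>2 \<epsilon>_(n-1)\<close>, whence the
    halving.\<close>
  define c where "c m = nat (if Suc m = n then S m div 2 else S m)" for m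
  have step: "\<kappa> q - \<mu> q = S q - (if q = 0 then 0 else S (q - 1))" for q
    by (cases q) (simp_all add: S_def)
  have "\<kappa> q - \<mu> q = (\<Sum>m<n. int (c m) * simple_root n m q)" if q: "q < n" for q
  proof -
    have "(\<Sum>m<n. int (c m) * simple_root n m q) = (\<Sum>m<n. (if m = q then S q else 0) - (if Suc m = q then S m else 0))"
    proof (rule sum.cong[OF refl])
      fix m assume m: "m \<in> {..<n}"
      show "int (c m) * simple_root n m q = (if m = q then S q else 0) - (if Suc m = q then S m else 0)"
        using Spos[of m] m q Seven by (auto simp: c_def simple_root_def)
    qed
    also have "\<dots> = S q - (if q = 0 then 0 else S (q - 1))"
    proof (cases q)
      case 0 then show ?thesis using q by (simp add: sum_subtractf)
    next
      case (Suc q') then show ?thesis using q by (simp add: sum_subtractf)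
    qed
    finally show ?thesis unfolding step[of q] by simp
  qed
  then show ?thesis by blast
qed

end

section \<open>The decomposition \<open>V\<^sup>* \<otimes> \<complex> = E \<otimes> H\<close>\<close>

context adapted
begin

text \<open>The element \<open>\<Sum>\<^sub>i f\<^sub>i \<otimes> h\<^sub>i\<close> of \<open>E \<otimes> H\<close>, with \<open>h\<^sub>1, h\<^sub>2\<close> the standard basis of \<open>H\<close>, corresponds to the
  form \<open>x \<mapsto> f\<^sub>1 (J x) - f\<^sub>2 x\<close>; \<open>prj i\<close> recovers \<open>f\<^sub>i\<close>.\<close>

definition kap :: "2 \<Rightarrow> 'a \<Rightarrow> 'a" where
  "kap i x = (if i = 1 then J x else - x)"

definition prj :: "2 \<Rightarrow> ('a \<Rightarrow> complex) \<Rightarrow> 'a \<Rightarrow> complex" where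
  "prj i \<beta> x = (if i = 1 then - (\<beta> (J x) + \<i> * \<beta> (K x)) / 2 else - (\<beta> x - \<i> * \<beta> (I x)) / 2)"

lemma kap_simps [simp]: "kap 1 x = J x" "kap 2 x = - x"
  by (simp_all add: kap_def)

lemma prj_simps: "prj 1 \<beta> x = - (\<beta> (J x) + \<i> * \<beta> (K x)) / 2" "prj 2 \<beta> x = - (\<beta> x - \<i> * \<beta> (I x)) / 2"
  by (simp_all add: prj_def)

lemma linear_kap: "linear (kap i)"
  by (rule linearI) (simp_all add: kap_def)

lemma prj_E:
  assumes "linear \<beta>" shows "prj i \<beta> \<in> E_mod I"
proof -
  note b = linear_add[OF assms] linear_cmul[OF assms] linear_neg[OF assms]
  show ?thesis using exhaust_2[of i]
    by (auto simp: E_mod_def linear_iff prj_def b field_simps scaleR_conv_of_real)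
qed

lemma prj_decomp: "linear \<beta> \<Longrightarrow> (\<Sum>i\<in>UNIV. prj i \<beta> (kap i x)) = \<beta> x"
  by (simp add: sum_2 prj_simps linear_neg field_simps)

lemma prj_unique:
  assumes "\<And>i. f i \<in> E_mod I" shows "prj i (\<lambda>x. \<Sum>j\<in>UNIV. f j (kap j x)) = f i"
proof -
  have K: "f j (K x) = \<i> * f j (J x)" for j x using E_mod_simps(4)[OF assms, of j "J x"] by simp
  show ?thesis
    using exhaust_2[of i] by (auto simp: fun_eq_iff sum_2 prj_simps E_mod_simps[OF assms] K field_simps)
qed

lemma E_sum_zero:
  assumes "\<And>i. f i \<in> E_mod I" "\<And>x. (\<Sum>j\<in>UNIV. f j (kap j x)) = 0" shows "f i x = 0"
  using fun_cong[OF prj_unique[of f i, OF assms(1)], of x] unfolding assms(2) by (simp add: prj_def split: if_splits)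

text \<open>Assembles a complex form from its eight components in
  \<open>E \<otimes> E \<otimes> E\<close>; \<open>Cmp\<close> is the inverse, by
  \<open>Kap_Cmp\<close> and \<open>Cmp_Kap\<close>.\<close>

definition Kap :: "(2 \<Rightarrow> 2 \<Rightarrow> 2 \<Rightarrow> 'a \<Rightarrow> 'a \<Rightarrow> 'a \<Rightarrow> complex) \<Rightarrow> 'a \<Rightarrow> 'a \<Rightarrow> 'a \<Rightarrow> complex" where
  "Kap t x y z = (\<Sum>i\<in>UNIV. \<Sum>j\<in>UNIV. \<Sum>k\<in>UNIV. t i j k (kap i x) (kap j y) (kap k z))"

definition Cmp :: "('a \<Rightarrow> 'a \<Rightarrow> 'a \<Rightarrow> complex) \<Rightarrow> 2 \<Rightarrow> 2 \<Rightarrow> 2 \<Rightarrow> 'a \<Rightarrow> 'a \<Rightarrow> 'a \<Rightarrow> complex" where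
  "Cmp B i j k x y z = prj i (\<lambda>x. prj j (\<lambda>y. prj k (\<lambda>z. B x y z) z) y) x"

lemma linear_prj:
  fixes h :: "'c::real_vector \<Rightarrow> 'a \<Rightarrow> complex"
  assumes "\<And>y. linear (\<lambda>x. h x y)" shows "linear (\<lambda>x. prj j (\<lambda>y. h x y) y)"
proof -
  note b = linear_add[OF assms] linear_cmul[OF assms]
  show ?thesis using exhaust_2[of j]
    by (auto simp: linear_iff prj_def b field_simps scaleR_conv_of_real)
qed

lemma prj_E_arg:
  assumes "\<And>y. (\<lambda>x. h x y) \<in> E_mod I" shows "(\<lambda>x. prj j (\<lambda>y. h x y) y) \<in> E_mod I"
proof -
  note b = E_mod_simps[OF assms]
  show ?thesis using exhaust_2[of j]
    by (auto simp: E_mod_def linear_iff prj_def b field_simps scaleR_conv_of_real)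
qed

lemma prj_comm: "prj i (\<lambda>x. prj j (\<lambda>y. h x y) y) x = prj j (\<lambda>y. prj i (\<lambda>x. h x y) x) y"
  using exhaust_2[of i] exhaust_2[of j] by (auto simp: prj_simps field_simps)

lemma etri_Cmp:
  assumes B: "trilin B" shows "etri (Cmp B i j k)"
  unfolding etri_iff
proof (intro conjI allI)
  fix x y z
  have 1: "linear (\<lambda>x. prj j (\<lambda>y. prj k (\<lambda>z. B x y z) z) y)" for y z by (intro linear_prj trilinD[OF B])
  show "(\<lambda>x. Cmp B i j k x y z) \<in> E_mod I" unfolding Cmp_def by (rule prj_E[OF 1])
  have 2: "linear (\<lambda>y. prj k (\<lambda>z. B x y z) z)" for x z by (intro linear_prj trilinD[OF B])
  show "(\<lambda>y. Cmp B i j k x y z) \<in> E_mod I" unfolding Cmp_def by (rule prj_E_arg[OF prj_E[OF 2]])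
  show "(\<lambda>z. Cmp B i j k x y z) \<in> E_mod I" unfolding Cmp_def
    by (rule prj_E_arg[where h = "\<lambda>z x. prj j (\<lambda>y. prj k (\<lambda>z. B x y z) z) y"],
        rule prj_E_arg[where h = "\<lambda>z y. prj k (\<lambda>z. B _ y z) z"], rule prj_E, rule trilinD[OF B])
qed

lemma Kap_Cmp:
  assumes B: "trilin B" shows "Kap (Cmp B) = B"
proof (intro ext)
  fix x y z
  have 1: "linear (\<lambda>x. prj j (\<lambda>y. prj k (\<lambda>z. B x y z) z) y)" for j k y z by (intro linear_prj trilinD[OF B])
  have 2: "linear (\<lambda>y. prj k (\<lambda>z. B x y z) z)" for k x z by (intro linear_prj trilinD[OF B])
  have "Kap (Cmp B) x y z = (\<Sum>j\<in>UNIV. \<Sum>i\<in>UNIV. \<Sum>k\<in>UNIV. Cmp B i j k (kap i x) (kap j y) (kap k z))"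
    unfolding Kap_def by (rule sum.swap)
  also have "\<dots> = (\<Sum>j\<in>UNIV. \<Sum>k\<in>UNIV. \<Sum>i\<in>UNIV. Cmp B i j k (kap i x) (kap j y) (kap k z))"
    by (rule sum.cong[OF refl], rule sum.swap)
  also have "\<dots> = (\<Sum>j\<in>UNIV. \<Sum>k\<in>UNIV. prj j (\<lambda>y. prj k (\<lambda>z. B x y z) (kap k z)) (kap j y))"
    unfolding Cmp_def by (simp only: prj_decomp[OF 1])
  also have "\<dots> = (\<Sum>k\<in>UNIV. \<Sum>j\<in>UNIV. prj j (\<lambda>y. prj k (\<lambda>z. B x y z) (kap k z)) (kap j y))"
    by (rule sum.swap)
  also have "\<dots> = (\<Sum>k\<in>UNIV. prj k (\<lambda>z. B x y z) (kap k z))"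
    by (simp only: prj_decomp[OF 2])
  also have "\<dots> = B x y z" by (rule prj_decomp[OF trilinD(3)[OF B]])
  finally show "Kap (Cmp B) x y z = B x y z" .
qed

lemma trilin_Kap:
  assumes t: "\<And>i j k. etri (t i j k)" shows "trilin (Kap t)"
proof -
  note e = etri_trilin[OF t]
  note l = linear_compose[OF linear_kap trilinD(1)[OF e], unfolded o_def] linear_compose[OF linear_kap trilinD(2)[OF e], unfolded o_def]
    linear_compose[OF linear_kap trilinD(3)[OF e], unfolded o_def]
  show ?thesis unfolding trilin_def Kap_def
    by (intro conjI allI linear_compose_sum ballI; rule l)
qed

lemma Cmp_Kap:
  assumes t: "\<And>i j k. etri (t i j k)" shows "Cmp (Kap t) i j k x y z = t i j k x y z"
proof -
  note E = E_mod_etri[OF t]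
  have cs: "(\<lambda>x. \<Sum>j\<in>UNIV. f j x) \<in> E_mod I" if "\<And>j. f j \<in> E_mod I" for f :: "2 \<Rightarrow> 'a \<Rightarrow> complex"
    using that by (simp add: sum_2 E_mod_def linear_compose_add algebra_simps)
  have sw: "Kap t x y z = (\<Sum>k\<in>UNIV. \<Sum>i\<in>UNIV. \<Sum>j\<in>UNIV. t i j k (kap i x) (kap j y) (kap k z))" for x y z
    unfolding Kap_def by (simp add: sum_2 algebra_simps)
  have 1: "prj k (\<lambda>z. Kap t x y z) z = (\<Sum>i\<in>UNIV. \<Sum>j\<in>UNIV. t i j k (kap i x) (kap j y) z)" for x y z k
    unfolding sw using prj_unique[of "\<lambda>k z. \<Sum>i\<in>UNIV. \<Sum>j\<in>UNIV. t i j k (kap i x) (kap j y) z" k] E(3) cs by (simp add: fun_eq_iff)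
  have sw2: "(\<Sum>i\<in>UNIV. \<Sum>j\<in>UNIV. t i j k (kap i x) (kap j y) z) = (\<Sum>j\<in>UNIV. \<Sum>i\<in>UNIV. t i j k (kap i x) (kap j y) z)" for x y z k
    by (rule sum.swap)
  have 2: "prj j (\<lambda>y. prj k (\<lambda>z. Kap t x y z) z) y = (\<Sum>i\<in>UNIV. t i j k (kap i x) y z)" for x y z j k
    unfolding 1 sw2 using prj_unique[of "\<lambda>j y. \<Sum>i\<in>UNIV. t i j k (kap i x) y z" j] E(2) cs by (simp add: fun_eq_iff)
  show ?thesis unfolding Cmp_def 2
    using prj_unique[of "\<lambda>i x. t i j k x y z" i] E(1) by (simp add: fun_eq_iff)
qed

lemma Cmp_perm:
  assumes "trilin B"
  shows "Cmp (\<lambda>x y z. B y x z) i j k x y z = Cmp B j i k y x z" "Cmp (\<lambda>x y z. B x z y) i j k x y z = Cmp B i k j x z y"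
proof -
  show "Cmp (\<lambda>x y z. B y x z) i j k x y z = Cmp B j i k y x z"
    unfolding Cmp_def by (rule prj_comm)
  show "Cmp (\<lambda>x y z. B x z y) i j k x y z = Cmp B i k j x z y"
    unfolding Cmp_def by (subst prj_comm) (rule refl)
qed

lemma Cmp_neg: "Cmp (\<lambda>x y z. - B x y z) i j k x y z = - Cmp B i j k x y z"
  using exhaust_2[of i] exhaust_2[of j] exhaust_2[of k]
  by (auto simp: Cmp_def prj_simps field_simps)

lemma Cmp_alt3:
  assumes B: "alt3 B"
  shows "Cmp B j i k y x z = - Cmp B i j k x y z" "Cmp B i k j x z y = - Cmp B i j k x y z"
proof -
  have 1: "(\<lambda>x y z. B y x z) = (\<lambda>x y z. - B x y z)" by (intro ext) (rule alt3_swap12[OF B])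
  have 2: "(\<lambda>x y z. B x z y) = (\<lambda>x y z. - B x y z)" by (intro ext) (rule alt3_swap23[OF B])
  show "Cmp B j i k y x z = - Cmp B i j k x y z"
    using Cmp_perm(1)[OF alt3_trilin[OF B], of i j k x y z] unfolding 1 Cmp_neg by simp
  show "Cmp B i k j x z y = - Cmp B i j k x y z"
    using Cmp_perm(2)[OF alt3_trilin[OF B], of i j k x y z] unfolding 2 Cmp_neg by simp
qed

lemma alt3_Kap:
  assumes t: "\<And>i j k. etri (t i j k)"
    and "\<And>i j k x y z. t j i k y x z = - t i j k x y z" "\<And>i j k x y z. t i k j x z y = - t i j k x y z"
  shows "alt3 (Kap t)"
proof -
  have "Kap t y x z = - Kap t x y z" for x y z
  proof -
    have "Kap t y x z = (\<Sum>j\<in>UNIV. \<Sum>i\<in>UNIV. \<Sum>k\<in>UNIV. t i j k (kap i y) (kap j x) (kap k z))"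
      unfolding Kap_def by (rule sum.swap)
    also have "\<dots> = (\<Sum>j\<in>UNIV. \<Sum>i\<in>UNIV. \<Sum>k\<in>UNIV. - t j i k (kap j x) (kap i y) (kap k z))"
      by (intro sum.cong refl) (rule assms(2))
    finally show ?thesis unfolding Kap_def by (simp add: sum_negf)
  qed
  moreover have "Kap t x z y = - Kap t x y z" for x y z
  proof -
    have "Kap t x z y = (\<Sum>i\<in>UNIV. \<Sum>k\<in>UNIV. \<Sum>j\<in>UNIV. t i j k (kap i x) (kap j z) (kap k y))"
      unfolding Kap_def by (rule sum.cong[OF refl], rule sum.swap)
    also have "\<dots> = (\<Sum>i\<in>UNIV. \<Sum>k\<in>UNIV. \<Sum>j\<in>UNIV. - t i k j (kap i x) (kap k y) (kap j z))"
      by (intro sum.cong refl) (rule assms(3))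
    finally show ?thesis unfolding Kap_def by (simp add: sum_negf)
  qed
  ultimately show ?thesis unfolding alt3_def using trilin_Kap[of t, OF t] by blast
qed

text \<open>On \<open>H \<otimes> H\<close> the sum of \<open>A \<otimes> A\<close> over the three
  structures is 1 minus twice the transposition: \<open>- 1\<close> on the symmetric tensors and 3
  on the skew ones.\<close>

lemma pair_casimir:
  fixes f :: "2 \<Rightarrow> 2 \<Rightarrow> 'a \<Rightarrow> 'a \<Rightarrow> complex"
  assumes f: "\<And>j k z. (\<lambda>y. f j k y z) \<in> E_mod I" "\<And>j k y. (\<lambda>z. f j k y z) \<in> E_mod I"
  defines "h \<equiv> \<lambda>y z. \<Sum>j\<in>UNIV. \<Sum>k\<in>UNIV. f j k (kap j y) (kap k z)"
  shows "h (I y) (I z) + h (J y) (J z) + h (K y) (K z) = (\<Sum>j\<in>UNIV. \<Sum>k\<in>UNIV. f j k (kap j y) (kap k z) - 2 * f k j (kap j y) (kap k z))"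
proof -
  have K: "f j k (K y) z = \<i> * f j k (J y) z" "f j k y (K z) = \<i> * f j k y (J z)" for j k y z
    using E_mod_simps(4)[OF f(1), of j k "J y" z] E_mod_simps(4)[OF f(2), of j k y "J z"] by simp_all
  show ?thesis
    unfolding h_def by (simp add: sum_2 E_mod_simps[OF f(1)] E_mod_simps[OF f(2)] K algebra_simps)
qed

lemma Lq_Kap:
  assumes t: "\<And>i j k. etri (t i j k)"
  shows "Lq (Kap t) x y z = Kap (\<lambda>i j k x y z. 3 * t i j k x y z - 2 * t j i k x y z - 2 * t i k j x y z - 2 * t k j i x y z) x y z"
proof -
  note E = E_mod_etri[OF t]
  have cs: "(\<lambda>x. \<Sum>j\<in>UNIV. f j x) \<in> E_mod I" if "\<And>j. f j \<in> E_mod I" for f :: "2 \<Rightarrow> 'a \<Rightarrow> complex"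
    using that by (simp add: sum_2 E_mod_def linear_compose_add algebra_simps)
  have 12: "Kap t x y z = (\<Sum>i\<in>UNIV. \<Sum>j\<in>UNIV. (\<lambda>x y. \<Sum>k\<in>UNIV. t i j k x y (kap k z)) (kap i x) (kap j y))" for x y z
    by (simp add: Kap_def)
  have 13: "Kap t x y z = (\<Sum>i\<in>UNIV. \<Sum>k\<in>UNIV. (\<lambda>x z. \<Sum>j\<in>UNIV. t i j k x (kap j y) z) (kap i x) (kap k z))" for x y z
    unfolding Kap_def by (rule sum.cong[OF refl], rule sum.swap)
  have 23: "Kap t x y z = (\<Sum>j\<in>UNIV. \<Sum>k\<in>UNIV. (\<lambda>y z. \<Sum>i\<in>UNIV. t i j k (kap i x) y z) (kap j y) (kap k z))" for x y z
    by (simp add: Kap_def sum_2 algebra_simps)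
  have c12: "Kap t (I x) (I y) z + Kap t (J x) (J y) z + Kap t (K x) (K y) z = Kap (\<lambda>i j k x y z. t i j k x y z - 2 * t j i k x y z) x y z"
    unfolding 12
    by (rule trans[OF pair_casimir[where f = "\<lambda>i j x y. \<Sum>k\<in>UNIV. t i j k x y (kap k z)"]], rule cs, rule E, rule cs, rule E)
      (simp add: Kap_def sum_2 algebra_simps)
  have c13: "Kap t (I x) y (I z) + Kap t (J x) y (J z) + Kap t (K x) y (K z) = Kap (\<lambda>i j k x y z. t i j k x y z - 2 * t k j i x y z) x y z"
    unfolding 13
    by (rule trans[OF pair_casimir[where f = "\<lambda>i k x z. \<Sum>j\<in>UNIV. t i j k x (kap j y) z"]], rule cs, rule E, rule cs, rule E)
      (simp add: Kap_def sum_2 algebra_simps)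
  have c23: "Kap t x (I y) (I z) + Kap t x (J y) (J z) + Kap t x (K y) (K z) = Kap (\<lambda>i j k x y z. t i j k x y z - 2 * t i k j x y z) x y z"
    unfolding 23
    by (rule trans[OF pair_casimir[where f = "\<lambda>j k y z. \<Sum>i\<in>UNIV. t i j k (kap i x) y z"]], rule cs, rule E, rule cs, rule E)
      (simp add: Kap_def sum_2 algebra_simps)
  have "Lq (Kap t) x y z = (Kap t (I x) (I y) z + Kap t (J x) (J y) z + Kap t (K x) (K y) z)
    + (Kap t (I x) y (I z) + Kap t (J x) y (J z) + Kap t (K x) y (K z))
    + (Kap t x (I y) (I z) + Kap t x (J y) (J z) + Kap t x (K y) (K z))"
    by (simp only: Lq_def add_ac)
  then show ?thesis unfolding c12 c13 c23 by (simp add: Kap_def sum_2 algebra_simps)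
qed

lemma ctr_sub:
  assumes F: "etri F"
  shows "(\<Sum>u\<in>Basis. F y u u) = 0" "(\<Sum>u\<in>Basis. F y (J u) (J u)) = 0" "(\<Sum>u\<in>Basis. F y (J u) u) = - ctr J F y"
proof -
  note t = etri_trilin[OF F]
  note s = trilin_simps[OF t] etri_I[OF F]
  have "(\<Sum>u\<in>Basis. F y (I u) (I u)) = (\<Sum>u\<in>Basis. F y u u)"
    by (rule trace_trilin(1)[OF t linear_ident linear_ident])
  then show 1: "(\<Sum>u\<in>Basis. F y u u) = 0" by (simp add: s sum_negf)
  show "(\<Sum>u\<in>Basis. F y (J u) (J u)) = 0"
    using trace_trilin(2)[OF t linear_ident linear_ident, of y] 1 by simp
  have "(\<Sum>u\<in>Basis. F y (J (J u)) (J u)) = (\<Sum>u\<in>Basis. F y (J u) u)"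
    by (rule trace_trilin(2)[OF t lin(2) linear_ident])
  then show "(\<Sum>u\<in>Basis. F y (J u) u) = - ctr J F y" by (simp add: s sum_negf ctr_def)
qed

text \<open>The forms of \<open>I\<close>, \<open>J\<close>, \<open>K\<close> are three independent
  elements of \<open>\<omega>_E \<otimes> S^2 H\<close>, so the contractions see exactly the part of
  the traces that is symmetric in the last two indices.\<close>

lemma ctr_Kap:
  assumes t: "\<And>i j k. etri (t i j k)"
  shows "ctr I (Kap t) x = (\<Sum>i\<in>UNIV. \<i> * (ctr J (t i 1 2) (kap i x) + ctr J (t i 2 1) (kap i x)))"
    "ctr J (Kap t) x = (\<Sum>i\<in>UNIV. ctr J (t i 1 1) (kap i x) + ctr J (t i 2 2) (kap i x))"
    "ctr K (Kap t) x = (\<Sum>i\<in>UNIV. \<i> * (ctr J (t i 2 2) (kap i x) - ctr J (t i 1 1) (kap i x)))"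
proof -
  have K: "F y u (K v) = \<i> * F y u (J v)" if "etri F" for F y u v
    using etri_I(3)[OF that, of y u "J v"] by simp
  have s: "ctr A (Kap t) x = (\<Sum>i\<in>UNIV. \<Sum>j\<in>UNIV. \<Sum>k\<in>UNIV. \<Sum>u\<in>Basis. t i j k (kap i x) (kap j u) (kap k (A u)))" for A
    unfolding ctr_def Kap_def by (simp add: sum_2 sum.distrib)
  note r = trilin_simps[OF etri_trilin[OF t]] etri_I[OF t] K[OF t] ctr_sub[OF t] sum_negf sum_distrib_left[symmetric]
  show "ctr I (Kap t) x = (\<Sum>i\<in>UNIV. \<i> * (ctr J (t i 1 2) (kap i x) + ctr J (t i 2 1) (kap i x)))"
    unfolding s by (simp add: sum_2 r) (simp add: ctr_def trilin_simps[OF etri_trilin[OF t]] sum_negf algebra_simps)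
  show "ctr J (Kap t) x = (\<Sum>i\<in>UNIV. ctr J (t i 1 1) (kap i x) + ctr J (t i 2 2) (kap i x))"
    unfolding s by (simp add: sum_2 r) (simp add: ctr_def trilin_simps[OF etri_trilin[OF t]] sum_negf algebra_simps)
  show "ctr K (Kap t) x = (\<Sum>i\<in>UNIV. \<i> * (ctr J (t i 2 2) (kap i x) - ctr J (t i 1 1) (kap i x)))"
    unfolding s by (simp add: sum_2 r) (simp add: ctr_def trilin_simps[OF etri_trilin[OF t]] sum_negf algebra_simps)
qed

lemma kap_Spn: "g \<in> Spn I J K \<Longrightarrow> kap i (g x) = g (kap i x)"
  using linear_neg[OF orthogonal_transformation_linear[OF Spn_orth]] by (simp add: kap_def Spn_comm)

text \<open>This fixes the choice of \<open>kap\<close>: the geometric action of a unit quaternion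
  becomes the standard action of the matrix on the index.\<close>

lemma kap_quat:
  assumes U: "U \<in> Sp1" and f: "f \<in> E_mod I"
  shows "f (kap a (inv (quat I J K U) x)) = (\<Sum>i\<in>UNIV. U $ i $ a * f (kap i x))"
proof -
  note e = Sp1_entries[OF U]
  have K: "f (K x) = \<i> * f (J x)" using E_mod_simps(4)[OF f, of "J x"] by simp
  have c: "U $ 1 $ 1 = Complex (Re (U $ 1 $ 1)) (Im (U $ 1 $ 1))" "U $ 1 $ 2 = Complex (Re (U $ 1 $ 2)) (Im (U $ 1 $ 2))"
    by simp_all
  show ?thesis
    unfolding quat_qq inv_qq[OF e(3)] qq_def sum_2 e(1,2)
    using exhaust_2[of a] by (auto simp: e(1,2) E_mod_simps[OF f] K complex_eq_iff algebra_simps)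
qed

definition rotS :: "complex^2^2 \<Rightarrow> (2 \<Rightarrow> 2 \<Rightarrow> 2 \<Rightarrow> 'a \<Rightarrow> 'a \<Rightarrow> 'a \<Rightarrow> complex) \<Rightarrow> 2 \<Rightarrow> 2 \<Rightarrow> 2 \<Rightarrow> 'a \<Rightarrow> 'a \<Rightarrow> 'a \<Rightarrow> complex" where
  "rotS U t i j k x y z = (\<Sum>a\<in>UNIV. \<Sum>b\<in>UNIV. \<Sum>c\<in>UNIV. U $ i $ a * U $ j $ b * U $ k $ c * t a b c x y z)"

lemma act3_Kap:
  assumes g: "g \<in> Spn I J K" and U: "U \<in> Sp1" and t: "\<And>i j k. etri (t i j k)"
  shows "act3 (g \<circ> quat I J K U) (\<lambda>(x, y, z). Kap t x y z) = (\<lambda>(x, y, z). Kap (\<lambda>i j k. pre (inv g) (rotS U t i j k)) x y z)"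
proof -
  let ?q = "quat I J K U"
  have iv: "inv (g \<circ> ?q) x = inv ?q (inv g x)" for x
    using inv_comp_orth[OF Spn_orth[OF g], of ?q] nrm_orth[OF nrm_qq] Sp1_entries(3)[OF U] unfolding quat_qq by simp
  note k = kap_quat[OF U E_mod_etri(1)[OF t]] kap_quat[OF U E_mod_etri(2)[OF t]] kap_quat[OF U E_mod_etri(3)[OF t]]
  have "Kap t (inv ?q x) (inv ?q y) (inv ?q z) = Kap (rotS U t) x y z" for x y z
  proof -
    have "Kap t (inv ?q x) (inv ?q y) (inv ?q z) = (\<Sum>a\<in>UNIV. \<Sum>b\<in>UNIV. \<Sum>c\<in>UNIV. \<Sum>k\<in>UNIV. U $ k $ c * (\<Sum>j\<in>UNIV. U $ j $ b * (\<Sum>i\<in>UNIV. U $ i $ a *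
        t a b c (kap i x) (kap j y) (kap k z))))"
      unfolding Kap_def by (simp only: k)
    then show ?thesis unfolding Kap_def rotS_def by (simp add: sum_2 algebra_simps)
  qed
  then show ?thesis
    by (simp add: fun_eq_iff act3_def iv) (simp add: Kap_def pre_def kap_Spn[OF Spn_inv[OF g]])
qed

end

section \<open>Complexified submodules and tensor products\<close>

abbreviation unc :: "('a \<Rightarrow> 'a \<Rightarrow> 'a \<Rightarrow> complex) \<Rightarrow> 'a \<times> 'a \<times> 'a \<Rightarrow> complex" where
  "unc B \<equiv> (\<lambda>(x, y, z). B x y z)"

lemma linear_complex_iff:
  fixes f :: "'a::real_vector \<Rightarrow> complex"
  shows "linear f \<longleftrightarrow> linear (\<lambda>x. Re (f x)) \<and> linear (\<lambda>x. Im (f x))"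
  by (auto simp: linear_iff complex_eq_iff)

lemma alt3_complex_iff:
  "alt3 B \<longleftrightarrow> alt3 (\<lambda>x y z. Re (B x y z)) \<and> alt3 (\<lambda>x y z. Im (B x y z))"
  unfolding alt3_def trilin_def complex_eq_iff linear_complex_iff[of "\<lambda>x. B x _ _"] linear_complex_iff[of "\<lambda>x. B _ x _"]
     linear_complex_iff[of "\<lambda>x. B _ _ x"] uminus_complex.simps all_conj_distrib
  by (simp only: conj_assoc conj_commute conj_left_commute)

lemma ctr_complex: "Re (ctr A B x) = ctr A (\<lambda>x y z. Re (B x y z)) x" "Im (ctr A B x) = ctr A (\<lambda>x y z. Im (B x y z)) x"
  by (simp_all add: ctr_def)

context adapted
begin

lemma Lq_complex: "Re (Lq B x y z) = Lq (\<lambda>x y z. Re (B x y z)) x y z" "Im (Lq B x y z) = Lq (\<lambda>x y z. Im (B x y z)) x y z"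
  by (simp_all add: Lq_def)

lemma WD_complex: "Re (WD p q r x y z) = WD (\<lambda>x. Re (p x)) (\<lambda>x. Re (q x)) (\<lambda>x. Re (r x)) x y z"
  "Im (WD p q r x y z) = WD (\<lambda>x. Im (p x)) (\<lambda>x. Im (q x)) (\<lambda>x. Im (r x)) x y z"
  by (simp_all add: WD_def wd_def)

lemma mKH_complex_iff: "mKH B \<longleftrightarrow> mKH (\<lambda>x y z. Re (B x y z)) \<and> mKH (\<lambda>x y z. Im (B x y z))"
  and mLS_complex_iff: "mLS B \<longleftrightarrow> mLS (\<lambda>x y z. Re (B x y z)) \<and> mLS (\<lambda>x y z. Im (B x y z))"
  unfolding mKH_def mLS_def alt3_complex_iff[of B] complex_eq_iff Lq_complex ctr_complex by auto

lemma complex_combine_linear: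
  assumes "linear f" "linear h" shows "linear (\<lambda>x. complex_of_real (f x) + \<i> * complex_of_real (h x))"
  using assms by (simp add: linear_complex_iff)

lemma mEH_complex_iff: "mEH B \<longleftrightarrow> mEH (\<lambda>x y z. Re (B x y z)) \<and> mEH (\<lambda>x y z. Im (B x y z))"
proof (intro iffI conjI)
  assume "mEH B"
  then obtain \<beta> where \<beta>: "linear \<beta>" "B = WD (\<lambda>x. \<beta> (I x)) (\<lambda>x. \<beta> (J x)) (\<lambda>x. \<beta> (K x))" unfolding mEH_def by blast
  show "mEH (\<lambda>x y z. Re (B x y z))" unfolding mEH_def
    by (rule exI[of _ "\<lambda>x. Re (\<beta> x)"]) (use \<beta> linear_complex_iff[of \<beta>] WD_complex in \<open>auto simp: fun_eq_iff\<close>)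
  show "mEH (\<lambda>x y z. Im (B x y z))" unfolding mEH_def
    by (rule exI[of _ "\<lambda>x. Im (\<beta> x)"]) (use \<beta> linear_complex_iff[of \<beta>] WD_complex in \<open>auto simp: fun_eq_iff\<close>)
next
  assume "mEH (\<lambda>x y z. Re (B x y z)) \<and> mEH (\<lambda>x y z. Im (B x y z))"
  then obtain \<beta> \<gamma> where \<beta>: "linear \<beta>" "(\<lambda>x y z. Re (B x y z)) = WD (\<lambda>x. \<beta> (I x)) (\<lambda>x. \<beta> (J x)) (\<lambda>x. \<beta> (K x))"
    and \<gamma>: "linear \<gamma>" "(\<lambda>x y z. Im (B x y z)) = WD (\<lambda>x. \<gamma> (I x)) (\<lambda>x. \<gamma> (J x)) (\<lambda>x. \<gamma> (K x))" unfolding mEH_def by blast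
  let ?d = "\<lambda>x. complex_of_real (\<beta> x) + \<i> * complex_of_real (\<gamma> x)"
  have "B = WD (\<lambda>x. ?d (I x)) (\<lambda>x. ?d (J x)) (\<lambda>x. ?d (K x))"
    using \<beta>(2) \<gamma>(2) by (simp add: fun_eq_iff complex_eq_iff WD_complex)
  then show "mEH B" unfolding mEH_def using complex_combine_linear[OF \<beta>(1) \<gamma>(1)] by (intro exI[of _ ?d] conjI)
qed

lemma mES_complex_iff: "mES B \<longleftrightarrow> mES (\<lambda>x y z. Re (B x y z)) \<and> mES (\<lambda>x y z. Im (B x y z))"
proof (intro iffI conjI)
  assume "mES B"
  then obtain p q r where *: "linear p" "linear q" "linear r" "\<And>x. p (I x) + q (J x) + r (K x) = 0" "B = WD p q r"
    unfolding mES_def by blast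
  have 0: "Re (p (I x)) + Re (q (J x)) + Re (r (K x)) = 0" "Im (p (I x)) + Im (q (J x)) + Im (r (K x)) = 0" for x
    using arg_cong[OF *(4)[of x], of Re] arg_cong[OF *(4)[of x], of Im] by simp_all
  show "mES (\<lambda>x y z. Re (B x y z))" unfolding mES_def
    by (rule exI[of _ "\<lambda>x. Re (p x)"], rule exI[of _ "\<lambda>x. Re (q x)"], rule exI[of _ "\<lambda>x. Re (r x)"])
      (use *(1-3) linear_complex_iff 0 in \<open>auto simp: fun_eq_iff *(5) WD_complex\<close>)
  show "mES (\<lambda>x y z. Im (B x y z))" unfolding mES_def
    by (rule exI[of _ "\<lambda>x. Im (p x)"], rule exI[of _ "\<lambda>x. Im (q x)"], rule exI[of _ "\<lambda>x. Im (r x)"])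
      (use *(1-3) linear_complex_iff 0 in \<open>auto simp: fun_eq_iff *(5) WD_complex\<close>)
next
  assume "mES (\<lambda>x y z. Re (B x y z)) \<and> mES (\<lambda>x y z. Im (B x y z))"
  then obtain p q r p' q' r' where *: "linear p" "linear q" "linear r" "\<And>x. p (I x) + q (J x) + r (K x) = 0" "(\<lambda>x y z. Re (B x y z)) = WD p q r"
    and **: "linear p'" "linear q'" "linear r'" "\<And>x. p' (I x) + q' (J x) + r' (K x) = 0" "(\<lambda>x y z. Im (B x y z)) = WD p' q' r'"
    unfolding mES_def by blast
  let ?c = "\<lambda>f g x. complex_of_real (f x) + \<i> * complex_of_real (g x)"
  have "B = WD (?c p p') (?c q q') (?c r r')"
    using *(5) **(5) by (simp add: fun_eq_iff complex_eq_iff WD_complex)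
  moreover have "?c p p' (I x) + ?c q q' (J x) + ?c r r' (K x) = 0" for x
    using *(4)[of x] **(4)[of x] by (simp add: complex_eq_iff)
  ultimately show "mES B" unfolding mES_def
    by (intro exI[of _ "?c p p'"] exI[of _ "?c q q'"] exI[of _ "?c r r'"] conjI complex_combine_linear * ** allI)
qed

end

lemma complexify_iff:
  "F \<in> complexify M \<longleftrightarrow> (\<lambda>x y z. Re (F (x, y, z))) \<in> M \<and> (\<lambda>x y z. Im (F (x, y, z))) \<in> M"
proof
  assume "F \<in> complexify M"
  then show "(\<lambda>x y z. Re (F (x, y, z))) \<in> M \<and> (\<lambda>x y z. Im (F (x, y, z))) \<in> M" unfolding complexify_def by auto
next
  assume "(\<lambda>x y z. Re (F (x, y, z))) \<in> M \<and> (\<lambda>x y z. Im (F (x, y, z))) \<in> M"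
  moreover have "F = (\<lambda>(x, y, z). complex_of_real (Re (F (x, y, z))) + \<i> * complex_of_real (Im (F (x, y, z))))"
    by (auto simp: fun_eq_iff complex_eq_iff)
  ultimately show "F \<in> complexify M" unfolding complexify_def mem_Collect_eq
    by (intro exI[of _ "\<lambda>x y z. Re (F (x, y, z))"] exI[of _ "\<lambda>x y z. Im (F (x, y, z))"]) blast
qed

context quaternionic
begin

lemma mods_complex_iff: "mods i B \<longleftrightarrow> mods i (\<lambda>x y z. Re (B x y z)) \<and> mods i (\<lambda>x y z. Im (B x y z))"
  unfolding mods_def using mKH_complex_iff[of B] mLS_complex_iff[of B] mEH_complex_iff[of B] mES_complex_iff[of B] by simp

lemma complexify_mods: "F \<in> complexify {b. mods i b} \<longleftrightarrow> mods i (cur F)"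
  unfolding complexify_iff mods_complex_iff[of _ "cur F"] by simp

end

lemma tensor_H:
  assumes A: "cspace A"
  shows "T \<in> tensor A H_mod \<longleftrightarrow> (\<forall>i. (\<lambda>x. T (x, i)) \<in> A)"
proof
  assume "T \<in> tensor A H_mod"
  then obtain m :: nat and f h where fh: "\<And>l. l < m \<Longrightarrow> f l \<in> A" "T = (\<lambda>p. \<Sum>l<m. outer (f l) (h l) p)"
    unfolding tensor_def by blast
  have "(\<lambda>x. \<Sum>l<m. h l i * f l x) \<in> A" for i
    by (rule cspace_sum[OF A]) (use fh(1) cspaceD(3)[OF A] in auto)
  then show "\<forall>i. (\<lambda>x. T (x, i)) \<in> A" by (simp add: fh(2) outer_def mult.commute)
next
  assume T: "\<forall>i. (\<lambda>x. T (x, i)) \<in> A"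
  let ?ix = "\<lambda>l. if l = (0::nat) then 1 else (2::2)"
  have "T = (\<lambda>p. \<Sum>l<(2::nat). outer (\<lambda>x. T (x, ?ix l)) (\<lambda>i. if i = ?ix l then 1 else 0) p)"
  proof
    fix p :: "'a \<times> 2"
    obtain x i where p: "p = (x, i)" by (cases p)
    show "T p = (\<Sum>l<(2::nat). outer (\<lambda>x. T (x, ?ix l)) (\<lambda>i. if i = ?ix l then 1 else 0) p)"
      using exhaust_2[of i] by (auto simp: p outer_def numeral_2_eq_2)
  qed
  moreover have "\<forall>l<(2::nat). (\<lambda>x. T (x, ?ix l)) \<in> A \<and> (\<lambda>i. if i = ?ix l then 1 else 0) \<in> (UNIV :: (2 \<Rightarrow> complex) set)"
    using T by blast
  ultimately show "T \<in> tensor A H_mod" unfolding tensor_def H_mod_def mem_Collect_eq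
    by (intro exI[of _ 2] exI[of _ "\<lambda>l x. T (x, ?ix l)"] exI[of _ "\<lambda>l i. if i = ?ix l then 1 else 0"] conjI)
qed

lemma tensor_S3H:
  assumes A: "cspace A"
  shows "T \<in> tensor A S3H_mod \<longleftrightarrow> (\<forall>i j k. (\<lambda>x. T (x, i, j, k)) \<in> A) \<and>
    (\<forall>x i j k. T (x, j, i, k) = T (x, i, j, k) \<and> T (x, i, k, j) = T (x, i, j, k))"
proof
  assume "T \<in> tensor A S3H_mod"
  then obtain m :: nat and f h where fh: "\<And>l. l < m \<Longrightarrow> f l \<in> A" "\<And>l. l < m \<Longrightarrow> h l \<in> S3H_mod" "T = (\<lambda>p. \<Sum>l<m. outer (f l) (h l) p)"
    unfolding tensor_def by blast
  have "(\<lambda>x. \<Sum>l<m. h l (i, j, k) * f l x) \<in> A" for i j k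
    by (rule cspace_sum[OF A]) (use fh(1) cspaceD(3)[OF A] in auto)
  moreover have "T (x, j, i, k) = T (x, i, j, k) \<and> T (x, i, k, j) = T (x, i, j, k)" for x i j k
    using fh(2) by (auto simp: fh(3) outer_def S3H_mod_def)
  ultimately show "(\<forall>i j k. (\<lambda>x. T (x, i, j, k)) \<in> A) \<and>
    (\<forall>x i j k. T (x, j, i, k) = T (x, i, j, k) \<and> T (x, i, k, j) = T (x, i, j, k))"
    by (simp add: fh(3) outer_def mult.commute)
next
  assume T: "(\<forall>i j k. (\<lambda>x. T (x, i, j, k)) \<in> A) \<and>
    (\<forall>x i j k. T (x, j, i, k) = T (x, i, j, k) \<and> T (x, i, k, j) = T (x, i, j, k))"
  \<comment> \<open>The number of indices equal to 2 determines an entry of a symmetric tensor, and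
    \<open>b\<close> chooses one index triple for each number.\<close>
  define c :: "2 \<times> 2 \<times> 2 \<Rightarrow> nat" where "c = (\<lambda>(i, j, k). (if i = 1 then 0 else 1) + (if j = 1 then 0 else 1) + (if k = 1 then 0 else 1))"
  define b :: "nat \<Rightarrow> 2 \<times> 2 \<times> 2" where "b l = (if l = 0 then (1, 1, 1) else if l = 1 then (1, 1, 2) else if l = 2 then (1, 2, 2) else (2, 2, 2))" for l
  have Tb: "T (x, s) = T (x, b (c s))" for x s
  proof -
    obtain i j k where s: "s = (i, j, k)" by (cases s)
    have sw: "T (x, j, i, k) = T (x, i, j, k)" "T (x, i, k, j) = T (x, i, j, k)" for i j k using T by blast+
    show ?thesis using exhaust_2[of i] exhaust_2[of j] exhaust_2[of k] sw(1)[of 1 2 1] sw(2)[of 1 2 1] sw(1)[of 1 2 2] sw(2)[of 2 2 1]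
      by (auto simp: s c_def b_def numeral_2_eq_2)
  qed
  have "T = (\<lambda>p. \<Sum>l<(4::nat). outer (\<lambda>x. T (x, b l)) (\<lambda>s. if c s = l then 1 else 0) p)"
  proof
    fix p :: "'a \<times> 2 \<times> 2 \<times> 2"
    obtain x s where p: "p = (x, s)" by (cases p)
    have "c s < 4" by (auto simp: c_def split: prod.split)
    have "(\<Sum>l<(4::nat). outer (\<lambda>x. T (x, b l)) (\<lambda>s. if c s = l then 1 else 0) p) = (\<Sum>l<4. if l = c s then T (x, b (c s)) else 0)"
      by (rule sum.cong) (auto simp: p outer_def)
    then show "T p = (\<Sum>l<(4::nat). outer (\<lambda>x. T (x, b l)) (\<lambda>s. if c s = l then 1 else 0) p)"
      using \<open>c s < 4\<close> Tb[of x s] by (simp add: p)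
  qed
  moreover have "(\<lambda>x. T (x, b l)) \<in> A" for l using T by (cases "b l") auto
  moreover have "(\<lambda>s. if c s = l then 1 else 0) \<in> S3H_mod" for l
    unfolding S3H_mod_def c_def by (auto simp: add_ac)
  ultimately show "T \<in> tensor A S3H_mod" unfolding tensor_def mem_Collect_eq
    by (intro exI[of _ 4] exI[of _ "\<lambda>l x. T (x, b l)"] exI[of _ "\<lambda>l s. if c s = l then 1 else 0"] conjI allI impI)
qed

section \<open>The four submodules exist\<close>

context quaternionic
begin

lemma Cmp_eqI:
  assumes "\<And>i j k. etri (t i j k)" "Kap t = Kap s" "\<And>i j k. etri (s i j k)"
  shows "t i j k x y z = s i j k x y z"
  using Cmp_Kap[of t, OF assms(1), of i j k x y z] Cmp_Kap[of s, OF assms(3), of i j k x y z] assms(2) by simp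

lemma Kap_cong: "(\<And>i j k x y z. t i j k x y z = s i j k x y z) \<Longrightarrow> Kap t = Kap s"
  by (simp add: fun_eq_iff Kap_def)

lemma Lq_Cmp_iff:
  assumes B: "trilin B"
  shows "(\<forall>x y z. Lq B x y z = c *\<^sub>R B x y z) \<longleftrightarrow>
    (\<forall>i j k x y z. 3 * Cmp B i j k x y z - 2 * Cmp B j i k x y z - 2 * Cmp B i k j x y z - 2 * Cmp B k j i x y z = of_real c * Cmp B i j k x y z)"
    (is "?L \<longleftrightarrow> ?R")
proof -
  let ?t = "Cmp B"
  let ?s = "\<lambda>i j k x y z. 3 * ?t i j k x y z - 2 * ?t j i k x y z - 2 * ?t i k j x y z - 2 * ?t k j i x y z"
  note e = etri_Cmp[OF B]
  have es: "etri (?s i j k)" "etri (\<lambda>x y z. of_real c * ?t i j k x y z)" for i j k by (intro etri_diff etri_cmult e)+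
  have "(\<lambda>x y z. c *\<^sub>R B x y z) = (\<lambda>x y z. c *\<^sub>R Kap ?t x y z)" unfolding Kap_Cmp[OF B] ..
  also have "\<dots> = Kap (\<lambda>i j k x y z. of_real c * ?t i j k x y z)"
    by (simp add: fun_eq_iff Kap_def sum_2 scaleR_conv_of_real algebra_simps)
  finally have c: "(\<lambda>x y z. c *\<^sub>R B x y z) = Kap (\<lambda>i j k x y z. of_real c * ?t i j k x y z)" .
  have "Lq B = Lq (Kap ?t)" unfolding Kap_Cmp[OF B] ..
  also have "\<dots> = Kap ?s" by (intro ext) (rule Lq_Kap[OF e])
  finally have "?L \<longleftrightarrow> Kap ?s = Kap (\<lambda>i j k x y z. of_real c * ?t i j k x y z)"
    unfolding c[symmetric] by (simp add: fun_eq_iff)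
  also have "\<dots> \<longleftrightarrow> ?R"
  proof
    assume k: "Kap ?s = Kap (\<lambda>i j k x y z. of_real c * ?t i j k x y z)"
    show ?R using Cmp_eqI[of ?s, OF es(1) k es(2)] by blast
  next
    assume ?R then show "Kap ?s = Kap (\<lambda>i j k x y z. of_real c * ?t i j k x y z)" by (intro Kap_cong) blast
  qed
  finally show ?thesis .
qed

text \<open>The equation says that the three transpositions have mean 1. As the indices take only
  two values, it suffices to solve two linear equations for each of the patterns 112 and
  122.\<close>

lemma sym_binary:
  assumes "\<And>i j k :: 2. 3 * t i j k - 2 * t j i k - 2 * t i k j - 2 * t k j i = - (3::complex) * t i j k"
  shows "t j i k = t i j k" "t i k j = t i j k"
proof -
  have 1: "t 1 2 1 = t 1 1 2" "t 2 1 1 = t 1 1 2" using assms[of 1 1 2] assms[of 1 2 1] by algebra+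
  have 2: "t 2 1 2 = t 1 2 2" "t 2 2 1 = t 1 2 2" using assms[of 1 2 2] assms[of 2 1 2] by algebra+
  show "t j i k = t i j k" "t i k j = t i j k"
    using exhaust_2[of i] exhaust_2[of j] exhaust_2[of k] by (auto simp: 1 2)
qed

lemma Lq_minus3_Cmp_iff:
  assumes B: "alt3 B"
  shows "(\<forall>x y z. Lq B x y z = - 3 *\<^sub>R B x y z) \<longleftrightarrow> (\<forall>i j k x y z. Cmp B j i k x y z = Cmp B i j k x y z \<and> Cmp B i k j x y z = Cmp B i j k x y z)"
proof -
  have sw: "t k j i = t i j k" if "\<And>i j k. t j i k = t i j k \<and> t i k j = t i j k" for t :: "2 \<Rightarrow> 2 \<Rightarrow> 2 \<Rightarrow> complex" and i j k
    using that by metis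
  show ?thesis
  unfolding Lq_Cmp_iff[OF alt3_trilin[OF B]]
  proof (intro iffI allI)
    fix i j k x y z
    assume "\<forall>i j k x y z. 3 * Cmp B i j k x y z - 2 * Cmp B j i k x y z - 2 * Cmp B i k j x y z - 2 * Cmp B k j i x y z = complex_of_real (- 3) * Cmp B i j k x y z"
    then have *: "\<And>i j k. 3 * Cmp B i j k x y z - 2 * Cmp B j i k x y z - 2 * Cmp B i k j x y z - 2 * Cmp B k j i x y z = - 3 * Cmp B i j k x y z" by simp
    show "Cmp B j i k x y z = Cmp B i j k x y z \<and> Cmp B i k j x y z = Cmp B i j k x y z"
      using sym_binary[of "\<lambda>i j k. Cmp B i j k x y z", OF *, of j i k] sym_binary[of "\<lambda>i j k. Cmp B i j k x y z", OF *, of i j k] by auto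
  next
    fix i j k x y z
    assume *: "\<forall>i j k x y z. Cmp B j i k x y z = Cmp B i j k x y z \<and> Cmp B i k j x y z = Cmp B i j k x y z"
    have "Cmp B k j i x y z = Cmp B i j k x y z"
      by (rule sw[of "\<lambda>i j k. Cmp B i j k x y z"]) (use * in blast)
    moreover have "Cmp B j i k x y z = Cmp B i j k x y z" "Cmp B i k j x y z = Cmp B i j k x y z" using * by blast+
    ultimately show "3 * Cmp B i j k x y z - 2 * Cmp B j i k x y z - 2 * Cmp B i k j x y z - 2 * Cmp B k j i x y z = complex_of_real (- 3) * Cmp B i j k x y z"
      by simp
  qed
qed

lemma Cmp_sym_alt3:
  assumes B: "alt3 B" and L: "\<forall>x y z. Lq B x y z = - 3 *\<^sub>R B x y z"
  shows "alt3 (Cmp B i j k)"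
proof -
  note s = L[unfolded Lq_minus3_Cmp_iff[OF B]]
  have "Cmp B i j k y x z = - Cmp B i j k x y z" "Cmp B i j k x z y = - Cmp B i j k x y z" for x y z
    using Cmp_alt3[OF B, where i=i and j=j and k=k and x=x and y=y and z=z] s by metis+
  then show ?thesis unfolding alt3_def using etri_trilin[OF etri_Cmp[OF alt3_trilin[OF B]]] by blast
qed

text \<open>Exchanging the last two slots of an alternating form exchanges indices with a sign, and
  the trace is skew in these slots. Hence the traces are symmetric in the last two indices and
  nothing escapes the three contractions.\<close>

lemma ctr_Cmp_zero:
  assumes B: "alt3 B"
  shows "(\<forall>A\<in>{I, J, K}. \<forall>x. ctr A B x = 0) \<longleftrightarrow> (\<forall>i j k x. ctr J (Cmp B i j k) x = 0)"
proof -
  let ?t = "Cmp B"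
  note tr = alt3_trilin[OF B]
  note e = etri_Cmp[OF tr]
  note c = ctr_Kap[of ?t, OF e, unfolded Kap_Cmp[OF tr]]
  have E: "ctr J (?t i j k) \<in> E_mod I" for i j k by (rule ctr_E_mod[OF e])
  have s21: "ctr J (?t i 2 1) x = ctr J (?t i 1 2) x" for i x
  proof -
    have "ctr J (?t i 2 1) x = (\<Sum>u\<in>Basis. - ?t i 1 2 x (J u) u)"
      unfolding ctr_def by (rule sum.cong[OF refl]) (rule Cmp_alt3(2)[OF B])
    also have "\<dots> = ctr J (?t i 1 2) x" using ctr_sub(3)[of "?t i 1 2", OF e, of x] by (simp add: sum_negf)
    finally show ?thesis .
  qed
  show ?thesis
  proof
    assume z: "\<forall>A\<in>{I, J, K}. \<forall>x. ctr A B x = 0"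
    have m: "(\<lambda>x. \<i> * (ctr J (?t i 1 2) x + ctr J (?t i 2 1) x)) \<in> E_mod I"
      "(\<lambda>x. ctr J (?t i 1 1) x + ctr J (?t i 2 2) x) \<in> E_mod I"
      "(\<lambda>x. \<i> * (ctr J (?t i 2 2) x - ctr J (?t i 1 1) x)) \<in> E_mod I" for i
      by (intro cspaceD(2-4)[OF cspace_E] E)+
    have 0: "\<i> * (ctr J (?t i 1 2) x + ctr J (?t i 2 1) x) = 0"
      "ctr J (?t i 1 1) x + ctr J (?t i 2 2) x = 0"
      "\<i> * (ctr J (?t i 2 2) x - ctr J (?t i 1 1) x) = 0" for i x
      using E_sum_zero[of "\<lambda>i x. \<i> * (ctr J (?t i 1 2) x + ctr J (?t i 2 1) x)", OF m(1)]
        E_sum_zero[of "\<lambda>i x. ctr J (?t i 1 1) x + ctr J (?t i 2 2) x", OF m(2)]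
        E_sum_zero[of "\<lambda>i x. \<i> * (ctr J (?t i 2 2) x - ctr J (?t i 1 1) x)", OF m(3)] z c by (simp_all del: mult_eq_0_iff)
    show "\<forall>i j k x. ctr J (?t i j k) x = 0"
    proof (intro allI)
      fix i j k x
      have "ctr J (?t i 1 2) x = 0" using 0(1)[of i x] by (simp add: s21)
      moreover have "ctr J (?t i 2 2) x = 0" "ctr J (?t i 1 1) x = 0" using 0(2,3)[of i x] by auto
      ultimately show "ctr J (?t i j k) x = 0"
        using exhaust_2[of j] exhaust_2[of k] by (auto simp: s21)
    qed
  next
    assume "\<forall>i j k x. ctr J (?t i j k) x = 0"
    then show "\<forall>A\<in>{I, J, K}. \<forall>x. ctr A B x = 0" by (simp add: c)
  qed
qed

lemma mLS_Cmp_iff: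
  "mLS B \<longleftrightarrow> alt3 B \<and> (\<forall>x y z. Lq B x y z = - 3 *\<^sub>R B x y z) \<and> (\<forall>i j k. (\<lambda>(x, y, z). Cmp B i j k x y z) \<in> C0)"
  unfolding mLS_def C0_iff using ctr_Cmp_zero[of B] Cmp_sym_alt3[of B] etri_Cmp[OF alt3_trilin, of B] by auto

text \<open>A family that is symmetric in its last two indices is contracted with
  \<open>\<omega>_E \<otimes> S^2 H\<close>, which produces the three real two-forms; the formulas
  give their one-form coefficients.\<close>

lemma Kap_wE:
  assumes f: "\<And>i j k. f i j k \<in> E_mod I" and s: "\<And>i j k. f j i k = f i j k" "\<And>i j k. f i k j = f i j k"
  shows "Kap (\<lambda>i j k. wE (f i j k)) = WD (\<lambda>x. \<Sum>i\<in>UNIV. 2 * \<i> * f i 1 2 (kap i x)) (\<lambda>x. \<Sum>i\<in>UNIV. f i 1 1 (kap i x) + f i 2 2 (kap i x))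
     (\<lambda>x. \<Sum>i\<in>UNIV. \<i> * (f i 2 2 (kap i x) - f i 1 1 (kap i x)))"
proof (intro ext)
  fix x y z
  let ?W = "\<lambda>s11 s12 s22 y z. 2 * \<i> * s12 * of_real (y \<bullet> I z) + (s11 + s22) * of_real (y \<bullet> J z) + \<i> * (s22 - s11) * of_real (y \<bullet> K z)"
  have w: "(\<Sum>j\<in>UNIV. \<Sum>k\<in>UNIV. s j k * omega_E J K (kap j y) (kap k z)) = ?W (s 1 1) (s 1 2) (s 2 2) y z"
    if "s 2 1 = s 1 2" for s :: "2 \<Rightarrow> 2 \<Rightarrow> complex" and y z
    by (simp add: sum_2 omega_E_def omega_def that algebra_simps)
  have 1: "(\<Sum>i\<in>UNIV. \<Sum>j\<in>UNIV. \<Sum>k\<in>UNIV. f i j k (kap i x) * omega_E J K (kap j y) (kap k z)) =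
     (\<Sum>i\<in>UNIV. ?W (f i 1 1 (kap i x)) (f i 1 2 (kap i x)) (f i 2 2 (kap i x)) y z)" for x y z
    by (rule sum.cong[OF refl], rule w) (simp add: s(2)[of _ 1 2])
  have "Kap (\<lambda>i j k. wE (f i j k)) x y z =
    (\<Sum>i\<in>UNIV. \<Sum>j\<in>UNIV. \<Sum>k\<in>UNIV. f i j k (kap i x) * omega_E J K (kap j y) (kap k z)) -
    (\<Sum>i\<in>UNIV. \<Sum>j\<in>UNIV. \<Sum>k\<in>UNIV. f i j k (kap i y) * omega_E J K (kap j x) (kap k z)) +
    (\<Sum>i\<in>UNIV. \<Sum>j\<in>UNIV. \<Sum>k\<in>UNIV. f i j k (kap i z) * omega_E J K (kap j x) (kap k y))"
    unfolding Kap_def wE_def wedge12_def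
    by (simp add: sum_2 s(1)[of 1 2] s(2)[of _ 1 2] algebra_simps)
  also have "\<dots> = WD (\<lambda>x. \<Sum>i\<in>UNIV. 2 * \<i> * f i 1 2 (kap i x)) (\<lambda>x. \<Sum>i\<in>UNIV. f i 1 1 (kap i x) + f i 2 2 (kap i x))
     (\<lambda>x. \<Sum>i\<in>UNIV. \<i> * (f i 2 2 (kap i x) - f i 1 1 (kap i x))) x y z"
    unfolding 1 by (simp add: WD_def wd_def sum_2 scaleR_conv_of_real algebra_simps)
  finally show "Kap (\<lambda>i j k. wE (f i j k)) x y z = WD (\<lambda>x. \<Sum>i\<in>UNIV. 2 * \<i> * f i 1 2 (kap i x)) (\<lambda>x. \<Sum>i\<in>UNIV. f i 1 1 (kap i x) + f i 2 2 (kap i x))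
     (\<lambda>x. \<Sum>i\<in>UNIV. \<i> * (f i 2 2 (kap i x) - f i 1 1 (kap i x))) x y z" .
qed

lemma mES_Kap_wE:
  assumes f: "\<And>i j k. f i j k \<in> E_mod I" and s: "\<And>i j k. f j i k = f i j k" "\<And>i j k. f i k j = f i j k"
  shows "mES (Kap (\<lambda>i j k. wE (f i j k)))"
proof -
  have l: "linear (\<lambda>x. g (kap i x))" if "g \<in> E_mod I" for g i
    using linear_compose[OF linear_kap, of g i] that by (simp add: E_mod_def o_def)
  have "linear (\<lambda>x. \<Sum>i\<in>UNIV. 2 * \<i> * f i 1 2 (kap i x))" "linear (\<lambda>x. \<Sum>i\<in>UNIV. f i 1 1 (kap i x) + f i 2 2 (kap i x))"
    "linear (\<lambda>x. \<Sum>i\<in>UNIV. \<i> * (f i 2 2 (kap i x) - f i 1 1 (kap i x)))"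
    by (intro linear_compose_sum ballI l[of "\<lambda>x. 2 * \<i> * f _ _ _ x"] l[of "\<lambda>x. f _ _ _ x + f _ _ _ x"] l[of "\<lambda>x. \<i> * (f _ _ _ x - f _ _ _ x)"]
        cspaceD(2-4)[OF cspace_E] f)+
  moreover have K: "f i j k (K x) = \<i> * f i j k (J x)" for i j k x using E_mod_simps(4)[OF f, of i j k "J x"] by simp
  have "(\<Sum>i\<in>UNIV. 2 * \<i> * f i 1 2 (kap i (I x))) + (\<Sum>i\<in>UNIV. f i 1 1 (kap i (J x)) + f i 2 2 (kap i (J x))) +
     (\<Sum>i\<in>UNIV. \<i> * (f i 2 2 (kap i (K x)) - f i 1 1 (kap i (K x)))) = 0" for x
    by (simp add: sum_2 E_mod_simps[OF f] K s(1)[of 1 2] s(2)[of _ 1 2] algebra_simps)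
  ultimately show ?thesis unfolding mES_def Kap_wE[of f, OF f s] by blast
qed

lemma mES_Cmp_iff:
  "mES B \<longleftrightarrow> alt3 B \<and> (\<forall>x y z. Lq B x y z = - 3 *\<^sub>R B x y z) \<and> (\<forall>i j k. \<exists>f\<in>E_mod I. Cmp B i j k = wE f)"
proof (intro iffI conjI)
  assume B: "mES B"
  show "alt3 B" by (rule mES_alt3[OF B])
  show "\<forall>x y z. Lq B x y z = - 3 *\<^sub>R B x y z" using mES_Lq[OF B] by simp
  obtain p q r where p: "linear p" "linear q" "linear r" "\<And>x. p (I x) + q (J x) + r (K x) = 0" "B = WD p q r"
    using B unfolding mES_def by blast
  note E = prj_E[OF p(1)] prj_E[OF p(2)] prj_E[OF p(3)]
  note ls = linear_neg[OF p(1)] linear_neg[OF p(2)] linear_neg[OF p(3)]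
  \<comment> \<open>The formulas of \<open>Kap_wE\<close> solved for the components. Two of the four
    are determined both by \<open>p\<close> and by \<open>q\<close>, \<open>r\<close>; the relation
    between the one-forms makes the two values agree, see \<open>rel\<close> and
    \<open>c'\<close>.\<close>
  define c where "c i j = (if j = (1::2) then (if i = (1::2) then (\<lambda>x. (prj 1 q x + \<i> * prj 1 r x) / 2) else (\<lambda>x. prj 1 p x / (2 * \<i>)))
     else (if i = 1 then (\<lambda>x. prj 2 p x / (2 * \<i>)) else (\<lambda>x. (prj 2 q x - \<i> * prj 2 r x) / 2)))" for i j
  define f where "f i j k = (if i = 1 then (if j = 1 then (if k = 1 then c 1 1 else c 2 1) else (if k = (1::2) then c 2 1 else c 1 2))
     else (if j = (1::2) then (if k = 1 then c 2 1 else c 1 2) else (if k = 1 then c 1 2 else c 2 2)))" for i j k :: 2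
  have half: "(\<lambda>x. g x / a) \<in> E_mod I" if "g \<in> E_mod I" for g a
    using cspaceD(3)[OF cspace_E that, of "1 / a"] by simp
  have cE: "c i j \<in> E_mod I" for i j
    unfolding c_def by (simp only: split: if_split) (intro conjI impI half cspaceD(2-4)[OF cspace_E] E)
  have fE: "f i j k \<in> E_mod I" for i j k unfolding f_def by (simp add: cE)
  have fs: "f j i k = f i j k" "f i k j = f i j k" for i j k
    using exhaust_2[of i] exhaust_2[of j] exhaust_2[of k] by (auto simp: f_def)
  have rel: "prj 1 q x - \<i> * prj 1 r x = prj 2 p x / \<i>" "prj 2 q x + \<i> * prj 2 r x = prj 1 p x / \<i>" for x
    using p(4)[of x] p(4)[of "I x"] p(4)[of "J x"] p(4)[of "K x"]
    by (simp_all add: prj_simps ls add_eq_0_iff field_simps)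
  have c': "c 1 2 = (\<lambda>x. (prj 1 q x - \<i> * prj 1 r x) / 2)" "c 2 1 = (\<lambda>x. (prj 2 q x + \<i> * prj 2 r x) / 2)"
    unfolding rel by (simp_all add: c_def fun_eq_iff)
  have "B = Kap (\<lambda>i j k. wE (f i j k))"
  proof -
    have "p x = (\<Sum>i\<in>UNIV. 2 * \<i> * f i 1 2 (kap i x))" for x
      using prj_decomp[OF p(1), of x] by (simp add: sum_2 f_def c_def)
    moreover have "q x = (\<Sum>i\<in>UNIV. f i 1 1 (kap i x) + f i 2 2 (kap i x))" for x
      unfolding prj_decomp[OF p(2), of x, symmetric] sum_2 by (simp add: f_def c') (simp add: c_def field_simps)
    moreover have "r x = (\<Sum>i\<in>UNIV. \<i> * (f i 2 2 (kap i x) - f i 1 1 (kap i x)))" for x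
      unfolding prj_decomp[OF p(3), of x, symmetric] sum_2 by (simp add: f_def c') (simp add: c_def field_simps)
    ultimately have "(\<lambda>x. \<Sum>i\<in>UNIV. 2 * \<i> * f i 1 2 (kap i x)) = p" "(\<lambda>x. \<Sum>i\<in>UNIV. f i 1 1 (kap i x) + f i 2 2 (kap i x)) = q"
      "(\<lambda>x. \<Sum>i\<in>UNIV. \<i> * (f i 2 2 (kap i x) - f i 1 1 (kap i x))) = r" by (simp_all only: fun_eq_iff) simp_all
    then show ?thesis unfolding Kap_wE[of f, OF fE fs] p(5) by (simp only:)
  qed
  then have "Cmp B i j k = wE (f i j k)" for i j k
    by (intro ext) (simp add: Cmp_Kap[of "\<lambda>i j k. wE (f i j k)", OF etri_wE[OF fE]])
  then show "\<forall>i j k. \<exists>f\<in>E_mod I. Cmp B i j k = wE f" using fE by blast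
next
  assume B: "alt3 B \<and> (\<forall>x y z. Lq B x y z = - 3 *\<^sub>R B x y z) \<and> (\<forall>i j k. \<exists>f\<in>E_mod I. Cmp B i j k = wE f)"
  then have B1: "alt3 B" "\<forall>x y z. Lq B x y z = - 3 *\<^sub>R B x y z" by blast+
  define f where "f i j k = tr0 (Cmp B i j k)" for i j k
  have f: "f i j k \<in> E_mod I" "Cmp B i j k = wE (f i j k)" for i j k
  proof -
    obtain h where "h \<in> E_mod I" "Cmp B i j k = wE h" using B by blast
    then show "f i j k \<in> E_mod I" "Cmp B i j k = wE (f i j k)" by (simp_all add: f_def tr0_wE)
  qed
  have s: "Cmp B j i k = Cmp B i j k" "Cmp B i k j = Cmp B i j k" for i j k
    using B1(2) unfolding Lq_minus3_Cmp_iff[OF B1(1)] by (simp_all add: fun_eq_iff)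
  have "B = Kap (\<lambda>i j k. wE (f i j k))" unfolding f(2)[symmetric] by (rule Kap_Cmp[OF alt3_trilin[OF B1(1)], symmetric])
  then show "mES B" using mES_Kap_wE[of f, OF f(1)] s unfolding f_def by simp
qed

text \<open>Both modules with factor S^3 H at once. An alternating form with components symmetric in
  the indices is an element of \<open>\<Lambda>^3 E \<otimes> S^3 H\<close>, and \<open>m\<close> is
  the embedding of \<open>A\<close> into \<Lambda>^3 E: currying for \<open>C0\<close>, the product
  with \<omega>_E for E.\<close>

lemma underlies_S3H:
  fixes A :: "('x \<Rightarrow> complex) set" and m :: "('x \<Rightarrow> complex) \<Rightarrow> 'a \<Rightarrow> 'a \<Rightarrow> 'a \<Rightarrow> complex"
  assumes A: "cspace A" and l: "l < (4::nat)"
    and m: "\<And>f. f \<in> A \<Longrightarrow> etri (m f)" "\<And>f. f \<in> A \<Longrightarrow> alt3 (m f)" "inj_on m A"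
    "\<And>f h x y z. f \<in> A \<Longrightarrow> h \<in> A \<Longrightarrow> m (\<lambda>x. f x + h x) x y z = m f x y z + m h x y z"
    "\<And>c f x y z. f \<in> A \<Longrightarrow> m (\<lambda>x. c * f x) x y z = c * m f x y z"
    and \<rho>: "\<And>g f. g \<in> Spn I J K \<Longrightarrow> f \<in> A \<Longrightarrow> \<rho> g f \<in> A" "\<And>g f. g \<in> Spn I J K \<Longrightarrow> f \<in> A \<Longrightarrow> m (\<rho> g f) = pre (inv g) (m f)"
    and M: "\<And>B. mods l B \<longleftrightarrow> alt3 B \<and> (\<forall>x y z. Lq B x y z = - 3 *\<^sub>R B x y z) \<and> (\<forall>i j k. \<exists>f\<in>A. Cmp B i j k = m f)"
  shows "underlies I J K {b. mods l b} A \<rho> S3H_mod S3H_act"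
proof -
  define t where "t T i j k = m (\<lambda>x. T (x, i, j, k))" for T :: "'x \<times> 2 \<times> 2 \<times> 2 \<Rightarrow> complex" and i j k
  define \<Phi> where "\<Phi> T = unc (Kap (t T))" for T
  define \<Psi> where "\<Psi> F = (\<lambda>(x, i, j, k). inv_into A m (Cmp (cur F) i j k) x)" for F
  have TA: "(\<lambda>x. T (x, i, j, k)) \<in> A" "T (x, j, i, k) = T (x, i, j, k)" "T (x, i, k, j) = T (x, i, j, k)" if "T \<in> tensor A S3H_mod" for T x i j k
    using that unfolding tensor_S3H[OF A] by blast+
  have te: "etri (t T i j k)" if "T \<in> tensor A S3H_mod" for T i j k
    unfolding t_def by (rule m(1)[OF TA(1)[OF that]])
  have ts: "t T j i k = t T i j k" "t T i k j = t T i j k" if "T \<in> tensor A S3H_mod" for T i j k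
    unfolding t_def TA(2)[OF that, of _ j i k] TA(3)[OF that, of _ i k j] by simp_all
  have C: "Cmp (Kap (t T)) i j k = t T i j k" if "T \<in> tensor A S3H_mod" for T i j k
    by (intro ext) (rule Cmp_Kap[of "t T", OF te[OF that]])
  have K: "mods l (Kap (t T))" if T: "T \<in> tensor A S3H_mod" for T
  proof -
    have a: "t T i j k y x z = - t T i j k x y z" "t T i j k x z y = - t T i j k x y z" for i j k x y z
      unfolding t_def using alt3_swap12[OF m(2)[OF TA(1)[OF T]]] alt3_swap23[OF m(2)[OF TA(1)[OF T]]] by blast+
    have "t T j i k y x z = - t T i j k x y z" "t T i k j x z y = - t T i j k x y z" for i j k x y z
      by (rule trans[OF ts(1)[OF T, THEN fun_cong, THEN fun_cong, THEN fun_cong] a(1)], rule trans[OF ts(2)[OF T, THEN fun_cong, THEN fun_cong, THEN fun_cong] a(2)])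
    then have al: "alt3 (Kap (t T))" by (intro alt3_Kap[of "t T", OF te[OF T]])
    have "\<forall>i j k x y z. t T j i k x y z = t T i j k x y z \<and> t T i k j x y z = t T i j k x y z"
      by (intro allI conjI) (rule ts(1)[OF T, THEN fun_cong, THEN fun_cong, THEN fun_cong], rule ts(2)[OF T, THEN fun_cong, THEN fun_cong, THEN fun_cong])
    moreover have "\<forall>i j k. \<exists>f\<in>A. t T i j k = m f" unfolding t_def using TA(1)[OF T] by blast
    ultimately show ?thesis unfolding M Lq_minus3_Cmp_iff[OF al] C[OF T] using al by blast
  qed
  have F: "mods l (cur F)" if "F \<in> complexify {b. mods l b}" for F using that unfolding complexify_mods .
  have \<Psi>: "\<Psi> F \<in> tensor A S3H_mod" "\<Phi> (\<Psi> F) = F" if "mods l (cur F)" for F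
  proof -
    have B: "alt3 (cur F)" "\<forall>x y z. Lq (cur F) x y z = - 3 *\<^sub>R cur F x y z" "\<And>i j k. Cmp (cur F) i j k \<in> m ` A"
      using that unfolding M by blast+
    have s: "Cmp (cur F) j i k = Cmp (cur F) i j k" "Cmp (cur F) i k j = Cmp (cur F) i j k" for i j k
      using B(2) unfolding Lq_minus3_Cmp_iff[OF B(1)] by (simp_all add: fun_eq_iff)
    show "\<Psi> F \<in> tensor A S3H_mod"
      unfolding tensor_S3H[OF A] using inv_into_into[OF B(3)] s by (simp add: \<Psi>_def)
    have "t (\<Psi> F) = Cmp (cur F)"
      unfolding t_def \<Psi>_def by (simp add: f_inv_into_f[OF B(3)])
    then show "\<Phi> (\<Psi> F) = F" unfolding \<Phi>_def using Kap_Cmp[OF alt3_trilin[OF B(1)]] by simp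
  qed
  have "bij_betw \<Phi> (tensor A S3H_mod) (complexify {b. mods l b})"
  proof (rule bij_betw_byWitness[where f' = \<Psi>])
    show "\<forall>T\<in>tensor A S3H_mod. \<Psi> (\<Phi> T) = T"
    proof
      fix T assume T: "T \<in> tensor A S3H_mod"
      have "inv_into A m (m (\<lambda>x. T (x, i, j, k))) = (\<lambda>x. T (x, i, j, k))" for i j k
        by (rule inv_into_f_f[OF m(3) TA(1)[OF T]])
      then show "\<Psi> (\<Phi> T) = T" unfolding \<Psi>_def \<Phi>_def by (auto simp: fun_eq_iff C[OF T] t_def)
    qed
    show "\<forall>F\<in>complexify {b. mods l b}. \<Phi> (\<Psi> F) = F" using \<Psi>(2) F by blast
    show "\<Phi> ` tensor A S3H_mod \<subseteq> complexify {b. mods l b}" using K by (auto simp: complexify_mods \<Phi>_def)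
    show "\<Psi> ` complexify {b. mods l b} \<subseteq> tensor A S3H_mod" using \<Psi>(1) F by blast
  qed
  moreover have "clinear_on (tensor A S3H_mod) \<Phi>"
    unfolding clinear_on_def \<Phi>_def Kap_def t_def using m(4)[OF TA(1) TA(1)] m(5)[OF TA(1)]
    by (simp add: fun_eq_iff sum.distrib sum_distrib_left)
  moreover have "\<Phi> (outer (\<rho> g f) (S3H_act U h)) = act3 (g \<circ> quat I J K U) (\<Phi> (outer f h))"
    if g: "g \<in> Spn I J K" and U: "U \<in> Sp1" and f: "f \<in> A" and h: "h \<in> S3H_mod" for g U f h
  proof -
    have m2: "m (\<lambda>x. f x * c) = (\<lambda>x y z. c * m f x y z)" if "f \<in> A" for f c
      using m(5)[OF that, of c] by (simp add: fun_eq_iff mult.commute)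
    have 1: "t (outer f h) i j k = (\<lambda>x y z. h (i, j, k) * m f x y z)" for i j k
      unfolding t_def outer_def using m2[OF f] by simp
    have 2: "t (outer (\<rho> g f) (S3H_act U h)) i j k = pre (inv g) (rotS U (t (outer f h)) i j k)" for i j k
    proof -
      have "t (outer (\<rho> g f) (S3H_act U h)) i j k = (\<lambda>x y z. S3H_act U h (i, j, k) * m f (inv g x) (inv g y) (inv g z))"
        unfolding t_def outer_def using m2[OF \<rho>(1)[OF g f]] \<rho>(2)[OF g f] by (simp add: pre_def)
      then show ?thesis unfolding pre_def rotS_def 1 S3H_act_def by (simp add: sum_distrib_right mult.assoc)
    qed
    have 3: "etri (t (outer f h) i j k)" for i j k unfolding 1 by (rule etri_cmult[OF m(1)[OF f]])
    have "t (outer (\<rho> g f) (S3H_act U h)) = (\<lambda>i j k. pre (inv g) (rotS U (t (outer f h)) i j k))" by (intro ext) (simp only: 2)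
    then show ?thesis unfolding \<Phi>_def act3_Kap[of g U "t (outer f h)", OF g U 3] by (simp only:)
  qed
  ultimately show ?thesis unfolding underlies_def using submodule3_mods[OF l] by blast
qed

lemma LS_underlies: "underlies I J K {b. mods (2::nat) b} C0 act3 S3H_mod S3H_act"
proof (rule underlies_S3H[where m = cur])
  show "inj_on cur C0" by (rule inj_onI) (auto simp: fun_eq_iff)
  show "mods (2::nat) B \<longleftrightarrow> alt3 B \<and> (\<forall>x y z. Lq B x y z = - 3 *\<^sub>R B x y z) \<and> (\<forall>i j k. \<exists>f\<in>C0. Cmp B i j k = cur f)" for B :: "'a \<Rightarrow> 'a \<Rightarrow> 'a \<Rightarrow> complex"
  proof -
    have "(\<lambda>(x, y, z). Cmp B i j k x y z) \<in> C0 \<longleftrightarrow> (\<exists>f\<in>C0. Cmp B i j k = cur f)" for i j k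
    proof
      assume "(\<lambda>(x, y, z). Cmp B i j k x y z) \<in> C0"
      then show "\<exists>f\<in>C0. Cmp B i j k = cur f" by (rule bexI[rotated]) simp
    next
      assume "\<exists>f\<in>C0. Cmp B i j k = cur f"
      then show "(\<lambda>(x, y, z). Cmp B i j k x y z) \<in> C0" by auto
    qed
    then show ?thesis by (simp add: mods_def mLS_Cmp_iff)
  qed
qed (auto simp: cspace_C0 act3_C0 cur_act3 dest: C0_iff[THEN iffD1])

lemma ES_underlies: "underlies I J K {b. mods (3::nat) b} (E_mod I) act1 S3H_mod S3H_act"
proof (rule underlies_S3H[where m = wE])
  show "inj_on wE (E_mod I)" by (rule inj_onI) (metis tr0_wE)
  show "mods (3::nat) B \<longleftrightarrow> alt3 B \<and> (\<forall>x y z. Lq B x y z = - 3 *\<^sub>R B x y z) \<and> (\<forall>i j k. \<exists>f\<in>E_mod I. Cmp B i j k = wE f)" for B :: "'a \<Rightarrow> 'a \<Rightarrow> 'a \<Rightarrow> complex"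
    by (simp add: mods_def mES_Cmp_iff)
  show "wE (act1 g f) = pre (inv g) (wE f)" if "g \<in> Spn I J K" for g f
    using act3_wE[OF that, of f] by (simp add: fun_eq_iff act3_def pre_def)
qed (simp_all add: cspace_E etri_wE alt3_wE wE_add wE_mult act1_E)

text \<open>A single contraction inverts the parametrization of \<open>mEH\<close>, also for complex
  values.\<close>

lemma EH_recover:
  fixes \<beta> :: "'a \<Rightarrow> complex"
  assumes "linear \<beta>"
  shows "ctr I (WD (\<lambda>x. \<beta> (I x)) (\<lambda>x. \<beta> (J x)) (\<lambda>x. \<beta> (K x))) (I x) = (4 * of_nat n + 2) * \<beta> x"
  using ctr_WD(1)[of "\<lambda>x. \<beta> (I x)" "\<lambda>x. \<beta> (J x)" "\<lambda>x. \<beta> (K x)" "I x"] linear_comp_IJK[OF assms] linear_neg[OF assms]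
  by (simp add: algebra_simps scaleR_conv_of_real)

lemma n_complex': "(4 * of_nat n + 2 :: complex) \<noteq> 0"
  using of_nat_neq_0[of "4 * n + 1", where 'a = complex] by (simp add: algebra_simps)

lemma EH_underlies: "underlies I J K {b. mods (1::nat) b} (E_mod I) act1 H_mod H_act"
proof -
  let ?W = "\<lambda>\<beta> :: 'a \<Rightarrow> complex. WD (\<lambda>x. \<beta> (I x)) (\<lambda>x. \<beta> (J x)) (\<lambda>x. \<beta> (K x))"
  define \<beta> where "\<beta> T x = (\<Sum>i\<in>UNIV. T (kap i x, i))" for T :: "'a \<times> 2 \<Rightarrow> complex" and x
  define \<Phi> where "\<Phi> T = unc (?W (\<beta> T))" for T
  define \<gamma> where "\<gamma> F x = ctr I (cur F) (I x) / (4 * of_nat n + 2)" for F x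
  define \<Psi> where "\<Psi> F = (\<lambda>(x, i). prj i (\<gamma> F) x)" for F
  have TA: "(\<lambda>x. T (x, i)) \<in> E_mod I" if "T \<in> tensor (E_mod I) H_mod" for T i
    using that unfolding tensor_H[OF cspace_E] by blast
  have l: "linear (\<beta> T)" if "T \<in> tensor (E_mod I) H_mod" for T
    unfolding \<beta>_def using linear_compose[OF linear_kap, of "\<lambda>x. T (x, _)"] TA[OF that]
    by (intro linear_compose_sum ballI) (simp add: E_mod_def o_def)
  have \<gamma>W: "\<gamma> (unc (?W \<beta>)) = \<beta>" if "linear \<beta>" for \<beta> :: "'a \<Rightarrow> complex"
    using EH_recover[OF that] n_complex' by (simp add: \<gamma>_def fun_eq_iff)
  have F: "\<exists>b. linear b \<and> F = unc (?W b)" if "F \<in> complexify {b. mods (1::nat) b}" for F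
  proof -
    have "mEH (cur F)" using that[unfolded complexify_mods] by (simp add: mods_def)
    then obtain b where "linear b" "cur F = ?W b" unfolding mEH_def by blast
    then show ?thesis by (intro exI[of _ b] conjI) (auto simp: fun_eq_iff)
  qed
  have \<Psi>: "\<Psi> (unc (?W b)) \<in> tensor (E_mod I) H_mod" "\<Phi> (\<Psi> (unc (?W b))) = unc (?W b)" if "linear b" for b
    using prj_E[OF that] prj_decomp[OF that] unfolding tensor_H[OF cspace_E] \<Psi>_def \<gamma>W[OF that] \<Phi>_def \<beta>_def by simp_all
  have "bij_betw \<Phi> (tensor (E_mod I) H_mod) (complexify {b. mods (1::nat) b})"
  proof (rule bij_betw_byWitness[where f' = \<Psi>])
    show "\<forall>T\<in>tensor (E_mod I) H_mod. \<Psi> (\<Phi> T) = T"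
    proof
      fix T assume T: "T \<in> tensor (E_mod I) H_mod"
      have "prj i (\<beta> T) = (\<lambda>x. T (x, i))" for i
        unfolding \<beta>_def by (rule prj_unique[of "\<lambda>i x. T (x, i)", OF TA[OF T]])
      then show "\<Psi> (\<Phi> T) = T" unfolding \<Psi>_def \<Phi>_def \<gamma>W[OF l[OF T]] by auto
    qed
    show "\<forall>F\<in>complexify {b. mods (1::nat) b}. \<Phi> (\<Psi> F) = F" using \<Psi>(2) F by blast
    have "mods (1::nat) (?W (\<beta> T))" if "T \<in> tensor (E_mod I) H_mod" for T
      using l[OF that] by (auto simp: mods_def mEH_def)
    then show "\<Phi> ` tensor (E_mod I) H_mod \<subseteq> complexify {b. mods (1::nat) b}"
      unfolding \<Phi>_def by (auto simp only: complexify_mods prod.case)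
    show "\<Psi> ` complexify {b. mods (1::nat) b} \<subseteq> tensor (E_mod I) H_mod" using \<Psi>(1) F by blast
  qed
  moreover have "clinear_on (tensor (E_mod I) H_mod) \<Phi>"
    unfolding clinear_on_def \<Phi>_def \<beta>_def WD_def wd_def by (simp add: fun_eq_iff sum_2 scaleR_conv_of_real algebra_simps)
  moreover have "\<Phi> (outer (act1 g f) (H_act U h)) = act3 (g \<circ> quat I J K U) (\<Phi> (outer f h))"
    if g: "g \<in> Spn I J K" and U: "U \<in> Sp1" and f: "f \<in> E_mod I" and h: "h \<in> H_mod" for g U f h
  proof -
    let ?q = "quat I J K U"
    have iv: "inv (g \<circ> ?q) x = inv ?q (inv g x)" for x
      using inv_comp_orth[OF Spn_orth[OF g], of ?q] nrm_orth[OF nrm_qq] Sp1_entries(3)[OF U] unfolding quat_qq by simp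
    have T: "outer f h \<in> tensor (E_mod I) H_mod"
      unfolding tensor_H[OF cspace_E] using cspaceD(3)[OF cspace_E f] by (auto simp: outer_def mult.commute[of "f _"])
    have "\<beta> (outer (act1 g f) (H_act U h)) x = \<beta> (outer f h) (inv (g \<circ> ?q) x)" for x
      unfolding \<beta>_def outer_def act1_def H_act_def prod.case iv kap_quat[OF U f] kap_Spn[OF Spn_inv[OF g]]
      by (simp add: sum_2 algebra_simps)
    then have "\<beta> (outer (act1 g f) (H_act U h)) = (\<lambda>x. \<beta> (outer f h) (inv (g \<circ> ?q) x))" by blast
    then show ?thesis
      unfolding \<Phi>_def using pre_WD_EH[OF nrm_inv[OF nrm_Spn_quat[OF g U]] l[OF T]] by (simp add: fun_eq_iff act3_def pre_def)
  qed
  ultimately show ?thesis unfolding underlies_def using submodule3_mods[of 1] by auto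
qed

definition sy :: "2 \<Rightarrow> 2 \<Rightarrow> complex" where
  "sy i j = (if i = j then 0 else if i = 1 then 1 else - 1)"

lemma sy_simps [simp]: "sy i i = 0" "sy 1 2 = 1" "sy 2 1 = - 1"
  by (simp_all add: sy_def)

text \<open>The embedding of \<open>K \<otimes> H\<close>: the antisymmetrisation over the three slots of \<open>G \<otimes> \<omega>\<^sub>H \<otimes> h\<close>, with
  \<open>sy\<close> the matrix of the symplectic form \<open>\<omega>\<^sub>H\<close>.\<close>

definition tK :: "(2 \<Rightarrow> 'a \<times> 'a \<times> 'a \<Rightarrow> complex) \<Rightarrow> 2 \<Rightarrow> 2 \<Rightarrow> 2 \<Rightarrow> 'a \<Rightarrow> 'a \<Rightarrow> 'a \<Rightarrow> complex" where
  "tK T i j k x y z = sy i j * (T k (x, z, y) + T k (y, z, x)) + sy j k * (T i (y, x, z) + T i (z, x, y)) +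
     sy k i * (T j (z, y, x) + T j (x, y, z))"

lemma sy_skew: "sy j i = - sy i j"
  using exhaust_2[of i] exhaust_2[of j] by auto

lemma tK_swap: "tK T j i k y x z = - tK T i j k x y z" "tK T i k j x z y = - tK T i j k x y z"
  unfolding tK_def by (simp_all add: sy_skew[of j i] sy_skew[of i k] sy_skew[of k j] algebra_simps)

lemma
  assumes T: "\<And>i. T i \<in> Kmod"
  shows etri_tK: "etri (tK T i j k)" and tK_112: "tK T 1 1 2 x y z = - 3 * T 1 (x, y, z)"
    and tK_221: "tK T 2 2 1 x y z = 3 * T 2 (x, y, z)" and ctr_tK: "ctr J (tK T i j k) x = 0"
proof -
  note e = KmodD(1)[OF T]
  have p: "etri (\<lambda>x y z. T i (x, z, y))" "etri (\<lambda>x y z. T i (y, z, x))" "etri (\<lambda>x y z. T i (y, x, z))"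
    "etri (\<lambda>x y z. T i (z, x, y))" "etri (\<lambda>x y z. T i (z, y, x))" "etri (\<lambda>x y z. T i (x, y, z))" for i
    using e[of i] unfolding etri_iff by simp_all
  show "etri (tK T i j k)" unfolding tK_def by (intro etri_add etri_cmult p)
  have s: "T i (y, x, z) = - T i (x, y, z)" "T i (z, y, x) = - T i (y, z, x)" "T i (x, z, y) = - T i (z, x, y)"
    and c: "T i (z, x, y) = - T i (x, y, z) - T i (y, z, x)" for i x y z
    using KmodD(2)[OF T, of i x y z] KmodD(2)[OF T, of i y z x] KmodD(2)[OF T, of i z x y] KmodD(3)[OF T, of i x y z] by algebra+
  show "tK T 1 1 2 x y z = - 3 * T 1 (x, y, z)"
    unfolding tK_def using s[of 1 y x z] s[of 1 z y x] s[of 1 x z y] c[of 1 z x y] by simp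
  show "tK T 2 2 1 x y z = 3 * T 2 (x, y, z)"
    unfolding tK_def using s[of 2 y x z] s[of 2 z y x] s[of 2 x z y] c[of 2 z x y] by simp
  have a: "(\<Sum>u\<in>Basis. T i (x, u, J u)) = 0" for i x using KmodD(4)[OF T, of i x] by (simp add: ctr_def)
  have b: "(\<Sum>u\<in>Basis. T i (x, J u, u)) = 0" for i x using ctr_sub(3)[OF e, of i x] KmodD(4)[OF T, of i x] by simp
  have a': "(\<Sum>u\<in>Basis. T i (u, x, J u)) = 0" for i x using a[of i x] KmodD(2)[OF T, of i x] by (simp add: sum_negf)
  have b': "(\<Sum>u\<in>Basis. T i (J u, x, u)) = 0" for i x using b[of i x] KmodD(2)[OF T, of i x] by (simp add: sum_negf)
  have d: "(\<Sum>u\<in>Basis. T i (u, J u, x)) = 0" for i x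
  proof -
    have "(\<Sum>u\<in>Basis. T i (u, J u, x) + T i (J u, x, u) + T i (x, u, J u)) = 0" by (simp only: KmodD(3)[OF T] sum.neutral_const)
    then show ?thesis using a[of i x] b'[of i x] by (simp add: sum.distrib)
  qed
  have d': "(\<Sum>u\<in>Basis. T i (J u, u, x)) = 0" for i x
  proof -
    have "(\<Sum>u\<in>Basis. T i (J u, u, x)) = (\<Sum>u\<in>Basis. - T i (u, J u, x))" by (rule sum.cong[OF refl]) (rule KmodD(2)[OF T])
    then show ?thesis by (simp add: sum_negf d)
  qed
  show "ctr J (tK T i j k) x = 0"
    unfolding ctr_def tK_def by (simp add: sum.distrib sum_distrib_left[symmetric] a b a' b' d d')
qed

text \<open>Permuting slots and indices simultaneously only changes the sign, and every index triple
  can be permuted into 111, 222, 112 or 221.\<close>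

lemma alt_family_eq:
  fixes t s :: "2 \<Rightarrow> 2 \<Rightarrow> 2 \<Rightarrow> 'a \<Rightarrow> 'a \<Rightarrow> 'a \<Rightarrow> complex"
  assumes t: "\<And>i j k x y z. t j i k y x z = - t i j k x y z" "\<And>i j k x y z. t i k j x z y = - t i j k x y z"
    and s: "\<And>i j k x y z. s j i k y x z = - s i j k x y z" "\<And>i j k x y z. s i k j x z y = - s i j k x y z"
    and eq: "t 1 1 1 = s 1 1 1" "t 2 2 2 = s 2 2 2" "t 1 1 2 = s 1 1 2" "t 2 2 1 = s 2 2 1"
  shows "t = s"
proof (intro ext)
  fix i j k x y z
  have 121: "t 1 2 1 x y z = s 1 2 1 x y z" "t 2 1 2 x y z = s 2 1 2 x y z" for x y z
    using t(2)[of 1 2 1 x y z] s(2)[of 1 2 1 x y z] t(2)[of 2 1 2 x y z] s(2)[of 2 1 2 x y z] eq(3,4) by simp_all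
  have "t 2 1 1 x y z = s 2 1 1 x y z" "t 1 2 2 x y z = s 1 2 2 x y z"
    using t(1)[of 2 1 1 x y z] s(1)[of 2 1 1 x y z] t(1)[of 1 2 2 x y z] s(1)[of 1 2 2 x y z] 121[of y x z] by simp_all
  then show "t i j k x y z = s i j k x y z"
    using exhaust_2[of i] exhaust_2[of j] exhaust_2[of k] 121[of x y z] eq by auto
qed

lemma sy_invariant:
  assumes "U \<in> Sp1"
  shows "(\<Sum>a\<in>UNIV. \<Sum>b\<in>UNIV. U $ i $ a * U $ j $ b * sy a b) = sy i j"
proof -
  have d: "U $ 1 $ 1 * U $ 2 $ 2 - U $ 1 $ 2 * U $ 2 $ 1 = 1" using assms by (simp add: Sp1_def det_2)
  show ?thesis using exhaust_2[of i] exhaust_2[of j] d by (auto simp: sum_2 algebra_simps)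
qed

lemma rotS_tK:
  assumes U: "U \<in> Sp1"
  shows "rotS U (tK (\<lambda>i p. h i * G p)) i j k x y z = tK (\<lambda>i p. H_act U h i * G p) i j k x y z"
proof -
  have 0: "(\<Sum>a\<in>UNIV. \<Sum>b\<in>UNIV. \<Sum>c\<in>UNIV. U $ i $ a * U $ j $ b * U $ k $ c * (sy a b * h c)) = (\<Sum>a\<in>UNIV. \<Sum>b\<in>UNIV. U $ i $ a * U $ j $ b * sy a b) * H_act U h k"
    "(\<Sum>a\<in>UNIV. \<Sum>b\<in>UNIV. \<Sum>c\<in>UNIV. U $ i $ a * U $ j $ b * U $ k $ c * (sy b c * h a)) = (\<Sum>a\<in>UNIV. \<Sum>b\<in>UNIV. U $ j $ a * U $ k $ b * sy a b) * H_act U h i"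
    "(\<Sum>a\<in>UNIV. \<Sum>b\<in>UNIV. \<Sum>c\<in>UNIV. U $ i $ a * U $ j $ b * U $ k $ c * (sy c a * h b)) = (\<Sum>a\<in>UNIV. \<Sum>b\<in>UNIV. U $ k $ a * U $ i $ b * sy a b) * H_act U h j" for i j k
    unfolding H_act_def by (simp_all add: sum_2 algebra_simps)
  note 1 = 0[unfolded sy_invariant[OF U]]
  have 2: "(\<Sum>a\<in>UNIV. \<Sum>b\<in>UNIV. \<Sum>c\<in>UNIV. U $ i $ a * U $ j $ b * U $ k $ c * (sy a b * (h c * p + h c * p') + sy b c * (h a * q + h a * q') + sy c a * (h b * r + h b * r'))) =
    (\<Sum>a\<in>UNIV. \<Sum>b\<in>UNIV. \<Sum>c\<in>UNIV. U $ i $ a * U $ j $ b * U $ k $ c * (sy a b * h c)) * (p + p') +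
    (\<Sum>a\<in>UNIV. \<Sum>b\<in>UNIV. \<Sum>c\<in>UNIV. U $ i $ a * U $ j $ b * U $ k $ c * (sy b c * h a)) * (q + q') +
    (\<Sum>a\<in>UNIV. \<Sum>b\<in>UNIV. \<Sum>c\<in>UNIV. U $ i $ a * U $ j $ b * U $ k $ c * (sy c a * h b)) * (r + r')" for p p' q q' r r'
    by (simp add: sum_2 algebra_simps)
  show ?thesis unfolding rotS_def tK_def 2 1 by (simp add: algebra_simps)
qed

text \<open>For the eigenvalue 3 the three index transpositions add up to zero. Alternation converts
  index permutations into slot permutations, so for the pattern \<open>i i j\<close> this is the
  cyclic identity of \<open>Kmod\<close>.\<close>

lemma
  assumes B: "mKH B"
  shows mKH_Cmp_sum: "Cmp B j i k x y z + Cmp B i k j x y z + Cmp B k j i x y z = 0"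
    and mKH_Cmp: "i \<noteq> j \<Longrightarrow> (\<lambda>(x, y, z). Cmp B i i j x y z) \<in> Kmod"
proof -
  let ?c = "Cmp B"
  have al: "alt3 B" and tr: "\<forall>i j k x. ctr J (?c i j k) x = 0"
    using B ctr_Cmp_zero[of B] unfolding mKH_def by simp_all
  have Lq: "\<forall>x y z. Lq B x y z = 3 *\<^sub>R B x y z" using B unfolding mKH_def by blast
  have L: "3 * ?c i j k x y z - 2 * ?c j i k x y z - 2 * ?c i k j x y z - 2 * ?c k j i x y z = of_real 3 * ?c i j k x y z" for i j k x y z
    using Lq[unfolded Lq_Cmp_iff[OF alt3_trilin[OF al]]] by blast
  have L: "?c j i k x y z + ?c i k j x y z + ?c k j i x y z = 0" for i j k x y z
    using L[of i j k x y z] by (simp add: algebra_simps) algebra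
  show "?c j i k x y z + ?c i k j x y z + ?c k j i x y z = 0" by (rule L)
  note sw = Cmp_alt3[OF al]
  assume ij: "i \<noteq> j"
  show "(\<lambda>(x, y, z). ?c i i j x y z) \<in> Kmod"
  proof (rule KmodI)
    show "etri (cur (\<lambda>(x, y, z). ?c i i j x y z))" using etri_Cmp[OF alt3_trilin[OF al]] by simp
    show "(\<lambda>(x, y, z). ?c i i j x y z) (y, x, z) = - (\<lambda>(x, y, z). ?c i i j x y z) (x, y, z)" for x y z
      unfolding prod.case by (rule sw(1))
    show "(\<lambda>(x, y, z). ?c i i j x y z) (x, y, z) + (\<lambda>(x, y, z). ?c i i j x y z) (y, z, x) + (\<lambda>(x, y, z). ?c i i j x y z) (z, x, y) = 0" for x y z
      unfolding prod.case
      using L[of i i j x y z] sw(2)[of i i j x z y] sw(1)[of i i j z x y] sw(1)[of i j i x y z] sw(2)[of i i j y z x] sw(2)[of i i j y x z] sw(1)[of j i i x y z]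
      by algebra
    show "ctr J (cur (\<lambda>(x, y, z). ?c i i j x y z)) x = 0" for x using tr by simp
  qed
qed

lemma KH_underlies: "underlies I J K {b. mods (0::nat) b} Kmod act3 H_mod H_act"
proof -
  define \<Phi> where "\<Phi> T = unc (Kap (tK (\<lambda>i p. T (p, i))))" for T :: "('a \<times> 'a \<times> 'a) \<times> 2 \<Rightarrow> complex"
  \<comment> \<open>The divisors undo the factors in \<open>tK_112\<close> and
    \<open>tK_221\<close>.\<close>
  define \<Psi> where "\<Psi> F = (\<lambda>((x, y, z), i). if i = (1::2) then - Cmp (cur F) 1 1 2 x y z / 3 else Cmp (cur F) 2 2 1 x y z / 3)" for F
  have TA: "(\<lambda>p. T (p, i)) \<in> Kmod" if "T \<in> tensor Kmod H_mod" for T i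
    using that unfolding tensor_H[OF cspace_Kmod] by blast
  have C: "Cmp (Kap (tK T)) i j k = tK T i j k" if "\<And>i. T i \<in> Kmod" for T i j k
    by (intro ext) (rule Cmp_Kap[of "tK T", OF etri_tK[of T, OF that]])
  have K: "mods (0::nat) (Kap (tK T))" if T: "\<And>i. T i \<in> Kmod" for T
  proof -
    have al: "alt3 (Kap (tK T))" by (rule alt3_Kap[of "tK T", OF etri_tK[of T, OF T]]) (rule tK_swap)+
    have "tK T j i k x y z + tK T i k j x y z + tK T k j i x y z = 0" for i j k x y z
      using exhaust_2[of i] exhaust_2[of j] exhaust_2[of k] by (auto simp: tK_def)
    moreover have "3 * a - 2 * b - 2 * c - 2 * d = of_real 3 * a" if "b + c + d = 0" for a b c d :: complex
    proof -
      have "3 * a - 2 * b - 2 * c - 2 * d = 3 * a - 2 * (b + c + d)" by (simp add: algebra_simps)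
      then show ?thesis using that by simp
    qed
    ultimately have "3 * tK T i j k x y z - 2 * tK T j i k x y z - 2 * tK T i k j x y z - 2 * tK T k j i x y z = of_real 3 * tK T i j k x y z" for i j k x y z
      by blast
    then show ?thesis
      using al unfolding mods_def mKH_def ctr_Cmp_zero[OF al] Lq_Cmp_iff[OF alt3_trilin[OF al]] C[of T, OF T] by (simp add: ctr_tK[of T, OF T])
  qed
  have F: "mods (0::nat) (cur F)" if "F \<in> complexify {b. mods (0::nat) b}" for F using that unfolding complexify_mods .
  have \<Psi>: "\<Psi> F \<in> tensor Kmod H_mod" "\<Phi> (\<Psi> F) = F" if m: "mods (0::nat) (cur F)" for F
  proof -
    let ?c = "Cmp (cur F)"
    have B: "mKH (cur F)" using m by (simp add: mods_def)
    have al: "alt3 (cur F)" by (rule mKH_alt3[OF B])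
    note sw = Cmp_alt3[OF al]
    have T: "(\<lambda>p. \<Psi> F (p, i)) \<in> Kmod" for i
    proof -
      have e: "(\<lambda>p. \<Psi> F (p, 1)) = (\<lambda>p. (- 1 / 3) * (\<lambda>(x, y, z). ?c 1 1 2 x y z) p)"
        "(\<lambda>p. \<Psi> F (p, 2)) = (\<lambda>p. (1 / 3) * (\<lambda>(x, y, z). ?c 2 2 1 x y z) p)"
        by (auto simp: \<Psi>_def fun_eq_iff)
      have "(\<lambda>p. \<Psi> F (p, 1)) \<in> Kmod" unfolding e(1) by (rule cspaceD(3)[OF cspace_Kmod mKH_Cmp[OF B]]) simp
      moreover have "(\<lambda>p. \<Psi> F (p, 2)) \<in> Kmod" unfolding e(2) by (rule cspaceD(3)[OF cspace_Kmod mKH_Cmp[OF B]]) simp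
      ultimately show ?thesis using exhaust_2[of i] by (elim disjE) (simp_all only:)
    qed
    then show "\<Psi> F \<in> tensor Kmod H_mod" unfolding tensor_H[OF cspace_Kmod] by blast
    have "tK (\<lambda>i p. \<Psi> F (p, i)) = ?c"
    proof (rule alt_family_eq)
      show "tK (\<lambda>i p. \<Psi> F (p, i)) 1 1 1 = ?c 1 1 1" "tK (\<lambda>i p. \<Psi> F (p, i)) 2 2 2 = ?c 2 2 2"
        using mKH_Cmp_sum[OF B, of 1 1 1] mKH_Cmp_sum[OF B, of 2 2 2] by (simp_all add: fun_eq_iff tK_def)
      show "tK (\<lambda>i p. \<Psi> F (p, i)) 1 1 2 = ?c 1 1 2" "tK (\<lambda>i p. \<Psi> F (p, i)) 2 2 1 = ?c 2 2 1"
        using tK_112[of "\<lambda>i p. \<Psi> F (p, i)", OF T] tK_221[of "\<lambda>i p. \<Psi> F (p, i)", OF T] by (simp_all add: fun_eq_iff \<Psi>_def)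
    qed (rule tK_swap sw)+
    then show "\<Phi> (\<Psi> F) = F" unfolding \<Phi>_def using Kap_Cmp[OF alt3_trilin[OF al]] by simp
  qed
  have "bij_betw \<Phi> (tensor Kmod H_mod) (complexify {b. mods (0::nat) b})"
  proof (rule bij_betw_byWitness[where f' = \<Psi>])
    show "\<forall>T\<in>tensor Kmod H_mod. \<Psi> (\<Phi> T) = T"
    proof
      fix T assume T: "T \<in> tensor Kmod H_mod"
      note TK = TA[OF T]
      show "\<Psi> (\<Phi> T) = T"
      proof
        fix q :: "('a \<times> 'a \<times> 'a) \<times> 2"
        obtain x y z i where q: "q = ((x, y, z), i)" by (cases q) auto
        show "\<Psi> (\<Phi> T) q = T q"
          using exhaust_2[of i] tK_112[of "\<lambda>i p. T (p, i)", OF TK, of x y z] tK_221[of "\<lambda>i p. T (p, i)", OF TK, of x y z]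
          by (auto simp: q \<Psi>_def \<Phi>_def C[of "\<lambda>i p. T (p, i)", OF TK])
      qed
    qed
    show "\<forall>F\<in>complexify {b. mods (0::nat) b}. \<Phi> (\<Psi> F) = F" using \<Psi>(2) F by blast
    show "\<Phi> ` tensor Kmod H_mod \<subseteq> complexify {b. mods (0::nat) b}"
      using K TA unfolding \<Phi>_def by (auto simp: complexify_mods)
    show "\<Psi> ` complexify {b. mods (0::nat) b} \<subseteq> tensor Kmod H_mod" using \<Psi>(1) F by blast
  qed
  moreover have "clinear_on (tensor Kmod H_mod) \<Phi>"
    unfolding clinear_on_def \<Phi>_def Kap_def tK_def by (simp add: fun_eq_iff sum_2 algebra_simps)
  moreover have "\<Phi> (outer (act3 g f) (H_act U h)) = act3 (g \<circ> quat I J K U) (\<Phi> (outer f h))"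
    if g: "g \<in> Spn I J K" and U: "U \<in> Sp1" and f: "f \<in> Kmod" and h: "h \<in> H_mod" for g U f h
  proof -
    have o: "(\<lambda>i p. outer f h (p, i)) = (\<lambda>i p. h i * f p)" for f :: "'a \<times> 'a \<times> 'a \<Rightarrow> complex" and h :: "2 \<Rightarrow> complex"
      by (simp add: outer_def mult.commute)
    have k: "(\<lambda>p. h i * f p) \<in> Kmod" for i by (rule cspaceD(3)[OF cspace_Kmod f])
    have "tK (\<lambda>i p. H_act U h i * act3 g f p) = (\<lambda>i j k. pre (inv g) (rotS U (tK (\<lambda>i p. h i * f p)) i j k))"
      by (intro ext) (simp add: pre_def rotS_tK[OF U], simp add: tK_def act3_def)
    then show ?thesis unfolding \<Phi>_def o act3_Kap[of g U "tK (\<lambda>i p. h i * f p)", OF g U etri_tK[of "\<lambda>i p. h i * f p", OF k]] by (simp only:)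
  qed
  ultimately show ?thesis unfolding underlies_def using submodule3_mods[of "0::nat"] by auto
qed

text \<open>The inverse of an orthogonal map is its transpose, so a value of \<open>act3 g F\<close>
  is a polynomial in the coordinates of the vectors \<open>g u\<close>.\<close>

lemma continuous_act3:
  assumes F: "etri (cur F)" shows "continuous_on (Spn I J K) (\<lambda>g. act3 g F)"
proof (rule continuous_on_coordinatewise_then_product)
  fix p :: "'a \<times> 'a \<times> 'a"
  obtain x y z where p: "p = (x, y, z)" by (cases p)
  note t = etri_trilin[OF F]
  have e: "act3 g F p = (\<Sum>u\<in>Basis. (x \<bullet> g u) *\<^sub>R (\<Sum>v\<in>Basis. (y \<bullet> g v) *\<^sub>R (\<Sum>w\<in>Basis. (z \<bullet> g w) *\<^sub>R F (u, v, w))))"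
    if g: "g \<in> Spn I J K" for g
  proof -
    have c: "inv g x \<bullet> u = x \<bullet> g u" for x u
      using Spn_orth[OF g] orth_inv_apply(1)[OF Spn_orth[OF g], of x] unfolding orthogonal_transformation_def by metis
    note s = sum_Basis_linear[OF trilinD(1)[OF t], of "inv g x", symmetric] sum_Basis_linear[OF trilinD(2)[OF t], of "inv g y", symmetric]
      sum_Basis_linear[OF trilinD(3)[OF t], of "inv g z", symmetric]
    show ?thesis unfolding p act3_def prod.case s(1) by (simp only: s(2)) (simp only: s(3) c)
  qed
  have c: "continuous_on (Spn I J K) (\<lambda>g. g u)" for u :: 'a
    by (rule continuous_on_product_then_coordinatewise[OF continuous_on_id])
  have "continuous_on (Spn I J K) (\<lambda>g. \<Sum>u\<in>Basis. (x \<bullet> g u) *\<^sub>R (\<Sum>v\<in>Basis. (y \<bullet> g v) *\<^sub>R (\<Sum>w\<in>Basis. (z \<bullet> g w) *\<^sub>R F (u, v, w))))"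
    by (intro continuous_intros c)
  then show "continuous_on (Spn I J K) (\<lambda>g. act3 g F p)"
    by (rule continuous_on_eq) (rule e[symmetric])
qed

lemma w2_frame:
  assumes e: "frame n e"
  shows "w2 (J (e 0)) (J (e 1)) \<in> Kmod" "w2 (J (e 0)) (J (e 1)) \<noteq> (\<lambda>p. 0)"
proof -
  let ?w = "w2 (J (e 0)) (J (e 1))"
  have h: "horth (e 0) (e 1)" and u: "e 0 \<bullet> e 0 = 1" "e 1 \<bullet> e 1 = 1" using e n_gt_1 by (auto simp: frame_iff)
  have h': "horth (J (e 0)) (J (e 1))" using h by (simp add: horth_def)
  show "?w \<in> Kmod" by (rule w2_Kmod[OF h'])
  have "?w (J (e 0), J (e 1), J (e 0)) = 1"
    using h h' u unfolding w2_def horth_def by (simp add: eps_def inner_commute)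
  then show "?w \<noteq> (\<lambda>p. 0)" by (metis zero_neq_one)
qed

lemma is_K_mod_Kmod: "is_K_mod I J K n Kmod act3"
proof -
  obtain e where e: "frame n e" using frame_exists by blast
  note w = w2_frame(1)[OF e] and w0 = w2_frame(2)[OF e]
  have 1: "Spn_rep I J K Kmod act3"
    unfolding Spn_rep_def
  proof (intro conjI ballI)
    show "cfinite_dim Kmod" by (rule finite_dim_of_points[OF finite_XB cspace_Kmod Kmod_XB])
    show "act3 g ` Kmod \<subseteq> Kmod" if "g \<in> Spn I J K" for g using act3_Kmod[OF that] by blast
    show "clinear_on Kmod (act3 g)" for g by (auto simp: clinear_on_def act3_def fun_eq_iff)
    show "act3 id f = f" for f :: "'a \<times> 'a \<times> 'a \<Rightarrow> complex" by (auto simp: act3_def fun_eq_iff inv_id)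
    show "act3 (g \<circ> h) f = act3 g (act3 h f)" if "g \<in> Spn I J K" "h \<in> Spn I J K" for g h f
      using inv_comp_orth[OF Spn_orth[OF that(1)] Spn_orth[OF that(2)]] by (auto simp: act3_def fun_eq_iff)
    show "continuous_on (Spn I J K) (\<lambda>g. act3 g f)" if "f \<in> Kmod" for f by (rule continuous_act3[OF KmodD(1)[OF that]])
  qed (rule cspace_Kmod)
  have 2: "irreducible_Spn_rep I J K Kmod act3"
    unfolding irreducible_Spn_rep_def using 1 w w0 Kmod_irreducible by blast
  have "highest_weight I J K n Kmod act3 \<kappa>"
    unfolding highest_weight_def
  proof (intro exI[of _ e] conjI allI impI)
    show "is_weight I J K n e Kmod act3 \<kappa>"
      unfolding is_weight_def using w w0 w2_torus[of e] unfolding torus_def by blast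
    fix \<mu> assume "is_weight I J K n e Kmod act3 \<mu>"
    then show "\<exists>c :: nat \<Rightarrow> nat. \<forall>r<n. \<kappa> r - \<mu> r = (\<Sum>k<n. int (c k) * simple_root n k r)"
      unfolding is_weight_def using Kmod_weight_bound[OF e, of _ \<mu>] unfolding torus_def by blast
  qed (rule e)
  then show ?thesis unfolding is_K_mod_def using 2 by blast
qed

end

section \<open>Uniqueness of the submodules\<close>

lemma outer_tensor: "f \<in> A \<Longrightarrow> h \<in> B \<Longrightarrow> outer f h \<in> tensor A B"
  unfolding tensor_def mem_Collect_eq by (intro exI[of _ "1::nat"] exI[of _ "\<lambda>_. f"] exI[of _ "\<lambda>_. h"]) auto

lemma zero_tensor: "(\<lambda>p. 0) \<in> tensor A B"
  unfolding tensor_def mem_Collect_eq by (intro exI[of _ "0::nat"]) auto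

lemma cspace_tensor:
  assumes A: "cspace A" shows "cspace (tensor A B)"
proof -
  have Tadd: "(\<lambda>p. S p + T p) \<in> tensor A B" if ST: "S \<in> tensor A B" "T \<in> tensor A B" for S T
  proof -
    obtain m f h where S: "\<forall>l<m. f l \<in> A \<and> h l \<in> B" "S = (\<lambda>p. \<Sum>l<(m::nat). outer (f l) (h l) p)"
      using ST(1) unfolding tensor_def by blast
    obtain m' f' h' where T: "\<forall>l<m'. f' l \<in> A \<and> h' l \<in> B" "T = (\<lambda>p. \<Sum>l<(m'::nat). outer (f' l) (h' l) p)"
      using ST(2) unfolding tensor_def by blast
    let ?f = "\<lambda>l. if l < m then f l else f' (l - m)" and ?h = "\<lambda>l. if l < m then h l else h' (l - m)"
    have "(\<Sum>l<m + m'. outer (?f l) (?h l) p) = S p + T p" for p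
    proof -
      have "(\<Sum>l<m + m'. outer (?f l) (?h l) p) = (\<Sum>l<m. outer (?f l) (?h l) p) + (\<Sum>l<m'. outer (?f (m + l)) (?h (m + l)) p)"
        by (induction m') (simp_all add: add.assoc)
      then show ?thesis by (simp add: S(2) T(2))
    qed
    moreover have "\<forall>l<m + m'. ?f l \<in> A \<and> ?h l \<in> B" using S(1) T(1) by auto
    ultimately show ?thesis unfolding tensor_def mem_Collect_eq
      by (intro exI[of _ "m + m'"] exI[of _ ?f] exI[of _ ?h]) auto
  qed
  moreover have "(\<lambda>p. c * S p) \<in> tensor A B" if ST: "S \<in> tensor A B" for c S
  proof -
    obtain m f h where S: "\<forall>l<m. f l \<in> A \<and> h l \<in> B" "S = (\<lambda>p. \<Sum>l<(m::nat). outer (f l) (h l) p)"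
      using ST unfolding tensor_def by blast
    have "(\<lambda>p. c * S p) = (\<lambda>p. \<Sum>l<m. outer (\<lambda>x. c * f l x) (h l) p)"
      by (rule ext) (simp only: S(2) outer_def sum_distrib_left case_prod_beta mult.assoc)
    moreover have "\<forall>l<m. (\<lambda>x. c * f l x) \<in> A \<and> h l \<in> B" using S(1) by (auto intro: cspaceD(3)[OF A])
    ultimately show ?thesis unfolding tensor_def mem_Collect_eq
      by (intro exI[of _ m] exI[of _ "\<lambda>l x. c * f l x"] exI[of _ h] conjI)
  qed
  ultimately show ?thesis unfolding cspace_def by (intro conjI ballI allI zero_tensor)
qed

lemma cspace_complexify:
  assumes M: "submodule3 I J K M" shows "cspace (complexify M)"
proof -
  have z: "(\<lambda>x y z. 0) \<in> M" and a: "\<And>a b. a \<in> M \<Longrightarrow> b \<in> M \<Longrightarrow> (\<lambda>x y z. a x y z + b x y z) \<in> M"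
    and s: "\<And>c b. b \<in> M \<Longrightarrow> (\<lambda>x y z. c * b x y z) \<in> M"
    using M unfolding submodule3_def zero3_def add3_def scale3_def by blast+
  have d: "(\<lambda>x y z. r * a x y z - t * b x y z) \<in> M" if "a \<in> M" "b \<in> M" for a b r t
    using a[OF s[OF that(1), of r] s[OF that(2), of "- t"]] by simp
  show ?thesis
    unfolding cspace_def Ball_def complexify_iff using z a d a[OF s s] by simp
qed

lemma complexify_alt3:
  fixes F :: "'a::euclidean_space \<times> 'a \<times> 'a \<Rightarrow> complex"
  assumes M: "submodule3 I J K M" and F: "F \<in> complexify M" shows "alt3 (\<lambda>x y z. F (x, y, z))"
proof -
  have "M \<subseteq> Lambda3" using M by (simp add: submodule3_def)
  then show ?thesis using F unfolding complexify_iff alt3_complex_iff[of "\<lambda>x y z. F (x, y, z)"] Lambda3_alt3 by auto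
qed

lemma complexify_inj:
  assumes "submodule3 I J K M" "submodule3 I J K N" "complexify M = complexify N" shows "M = N"
proof -
  have "b \<in> M \<longleftrightarrow> (\<lambda>(x, y, z). complex_of_real (b x y z)) \<in> complexify M" if "submodule3 I J K M" for M b
    using that unfolding complexify_iff submodule3_def zero3_def by simp
  from this[OF assms(1)] this[OF assms(2)] show ?thesis using assms(3) by auto
qed

text \<open>Fixes one isomorphism witnessing \<open>underlies\<close>, so that two witnesses with
  different carriers can be compared.\<close>

locale module_iso = quaternionic I J K n
  for I J K :: "'a::euclidean_space \<Rightarrow> 'a" and n +
  fixes M :: "'a form3 set" and A :: "('x \<Rightarrow> complex) set" and \<rho> :: "('a \<Rightarrow> 'a) \<Rightarrow> ('x \<Rightarrow> complex) \<Rightarrow> 'x \<Rightarrow> complex"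
    and B :: "('y \<Rightarrow> complex) set" and \<sigma> :: "complex^2^2 \<Rightarrow> ('y \<Rightarrow> complex) \<Rightarrow> 'y \<Rightarrow> complex"
    and \<Phi> :: "('x \<times> 'y \<Rightarrow> complex) \<Rightarrow> 'a \<times> 'a \<times> 'a \<Rightarrow> complex"
  assumes sub: "submodule3 I J K M" and bij: "bij_betw \<Phi> (tensor A B) (complexify M)"
    and lin_\<Phi>: "clinear_on (tensor A B) \<Phi>"
    and eqv: "\<And>g U f h. g \<in> Spn I J K \<Longrightarrow> U \<in> Sp1 \<Longrightarrow> f \<in> A \<Longrightarrow> h \<in> B \<Longrightarrow>
      \<Phi> (outer (\<rho> g f) (\<sigma> U h)) = act3 (g \<circ> quat I J K U) (\<Phi> (outer f h))"
begin

lemma image_mem: "T \<in> tensor A B \<Longrightarrow> \<Phi> T \<in> complexify M"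
  using bij by (auto simp: bij_betw_def)

lemma image_alt3: "f \<in> A \<Longrightarrow> h \<in> B \<Longrightarrow> alt3 (cur (\<Phi> (outer f h)))"
  by (rule complexify_alt3[OF sub image_mem[OF outer_tensor]])

lemma map_add: "S \<in> tensor A B \<Longrightarrow> T \<in> tensor A B \<Longrightarrow> \<Phi> (\<lambda>p. S p + T p) = (\<lambda>q. \<Phi> S q + \<Phi> T q)"
  and map_mult: "S \<in> tensor A B \<Longrightarrow> \<Phi> (\<lambda>p. c * S p) = (\<lambda>q. c * \<Phi> S q)"
  using lin_\<Phi> unfolding clinear_on_def by blast+

lemma map_zero: "\<Phi> (\<lambda>p. 0) = (\<lambda>q. 0)"
  using map_mult[OF zero_tensor, of 0] by simp

lemma map_sum:
  assumes "\<And>l. l < (m::nat) \<Longrightarrow> f l \<in> A \<and> h l \<in> B"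
  shows "\<Phi> (\<lambda>p. \<Sum>l<m. outer (f l) (h l) p) = (\<lambda>q. \<Sum>l<m. \<Phi> (outer (f l) (h l)) q)"
  using assms
proof (induction m)
  case (Suc m)
  have "(\<lambda>p. \<Sum>l<m. outer (f l) (h l) p) \<in> tensor A B"
    unfolding tensor_def mem_Collect_eq by (rule exI[of _ m], rule exI[of _ f], rule exI[of _ h]) (use Suc.prems in auto)
  then show ?case using map_add[OF _ outer_tensor[of "f m" A "h m" B]] Suc by simp
qed (simp add: map_zero)

lemma generated:
  assumes W: "cspace W" and g: "\<And>f h. f \<in> A \<Longrightarrow> h \<in> B \<Longrightarrow> \<Phi> (outer f h) \<in> W"
  shows "complexify M \<subseteq> W"
proof
  fix F assume "F \<in> complexify M"
  then obtain T where "T \<in> tensor A B" "F = \<Phi> T" using bij by (auto simp: bij_betw_def)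
  then obtain m :: nat and f h where fh: "\<forall>l<m. f l \<in> A \<and> h l \<in> B" "T = (\<lambda>p. \<Sum>l<m. outer (f l) (h l) p)"
    unfolding tensor_def by blast
  have "F = (\<lambda>q. \<Sum>l<m. \<Phi> (outer (f l) (h l)) q)"
    using fh map_sum[of m f h] \<open>F = \<Phi> T\<close> by simp
  then show "F \<in> W" using cspace_sum[OF W, of "{..<m}" "\<lambda>l. \<Phi> (outer (f l) (h l))"] fh(1) g by simp
qed

lemma outer_add1:
  assumes "f \<in> A" "f' \<in> A" "h \<in> B"
  shows "\<Phi> (outer (\<lambda>x. f x + f' x) h) = (\<lambda>q. \<Phi> (outer f h) q + \<Phi> (outer f' h) q)"
proof -
  have "outer (\<lambda>x. f x + f' x) h = (\<lambda>p. outer f h p + outer f' h p)" by (auto simp: outer_def algebra_simps)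
  then show ?thesis using map_add[OF outer_tensor outer_tensor] assms by simp
qed

lemma outer_mult1:
  assumes "f \<in> A" "h \<in> B" shows "\<Phi> (outer (\<lambda>x. c * f x) h) = (\<lambda>q. c * \<Phi> (outer f h) q)"
proof -
  have "outer (\<lambda>x. c * f x) h = (\<lambda>p. c * outer f h p)" by (auto simp: outer_def)
  then show ?thesis using map_mult[OF outer_tensor] assms by simp
qed

lemma outer_mult2:
  assumes "f \<in> A" "h \<in> B" shows "\<Phi> (outer f (\<lambda>x. c * h x)) = (\<lambda>q. c * \<Phi> (outer f h) q)"
proof -
  have "outer f (\<lambda>x. c * h x) = (\<lambda>p. c * outer f h p)" by (auto simp: outer_def)
  then show ?thesis using map_mult[OF outer_tensor] assms by simp
qed

lemma outer_sum2:
  assumes "f \<in> A" "\<And>l. l < (m::nat) \<Longrightarrow> h l \<in> B"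
  shows "\<Phi> (outer f (\<lambda>y. \<Sum>l<m. h l y)) = (\<lambda>q. \<Sum>l<m. \<Phi> (outer f (h l)) q)"
proof -
  have "outer f (\<lambda>y. \<Sum>l<m. h l y) = (\<lambda>p. \<Sum>l<m. outer f (h l) p)" by (auto simp: outer_def sum_distrib_left)
  then show ?thesis using map_sum[of m "\<lambda>_. f" h] assms by simp
qed

end

text \<open>An injection into the given module, which has the same finite dimension, is onto.\<close>

lemma (in quaternionic) iso_image_eq:
  assumes 1: "module_iso I J K n M A \<rho> B \<sigma> \<Phi>" and 2: "module_iso I J K n N A \<rho>' B \<sigma>' \<Psi>"
    and le: "complexify N \<subseteq> complexify M" and A: "cspace A" and fin: "cfinite_dim (complexify M)"
  shows "N = M"
proof -
  interpret M: module_iso I J K n M A \<rho> B \<sigma> \<Phi> by (rule 1)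
  interpret N: module_iso I J K n N A \<rho>' B \<sigma>' \<Psi> by (rule 2)
  let ?T = "tensor A B" and ?C = "complexify M"
  define \<Theta> where "\<Theta> = inv_into ?T \<Phi>"
  have t: "\<Theta> F \<in> ?T" "\<Phi> (\<Theta> F) = F" if "F \<in> ?C" for F
    using that M.bij unfolding \<Theta>_def bij_betw_def by (metis inv_into_into, metis f_inv_into_f)
  have i: "\<Theta> (\<Phi> T) = T" if "T \<in> ?T" for T
    using that M.bij unfolding \<Theta>_def bij_betw_def by (auto intro: inv_into_f_f)
  \<comment> \<open>The composite of \<Psi> with \<Theta> will be an injective endomorphism of
    \<open>complexify M\<close> with values in \<open>complexify N\<close>.\<close>
  note T = cspaceD[OF cspace_tensor[OF A, of B]]
  have Cs: "cspace ?C" by (rule cspace_complexify[OF M.sub])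
  have \<Theta>_add: "\<Theta> (\<lambda>q. F q + G q) = (\<lambda>p. \<Theta> F p + \<Theta> G p)" if "F \<in> ?C" "G \<in> ?C" for F G
    using i[OF T(2)[OF t(1)[OF that(1)] t(1)[OF that(2)]]] M.map_add[OF t(1)[OF that(1)] t(1)[OF that(2)]] t(2) that by simp
  have \<Theta>_mult: "\<Theta> (\<lambda>q. c * F q) = (\<lambda>p. c * \<Theta> F p)" if "F \<in> ?C" for c F
    using i[OF T(3)[OF t(1)[OF that], of c]] M.map_mult[OF t(1)[OF that], of c] t(2)[OF that] by simp
  let ?g = "\<lambda>F. \<Psi> (\<Theta> F)"
  have "?g ` ?C = ?C"
  proof (rule inj_endo_surj[OF Cs fin])
    show "clinear_on ?C ?g"
      unfolding clinear_on_def by (intro conjI ballI allI) (simp_all only: \<Theta>_add \<Theta>_mult N.map_add[OF t(1) t(1)] N.map_mult[OF t(1)])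
    show "inj_on ?g ?C"
    proof (rule inj_onI)
      fix F G assume FG: "F \<in> ?C" "G \<in> ?C" "?g F = ?g G"
      have "\<Theta> F = \<Theta> G" using N.bij FG(3) t(1)[OF FG(1)] t(1)[OF FG(2)] unfolding bij_betw_def by (blast dest: inj_onD)
      then show "F = G" using t(2)[OF FG(1)] t(2)[OF FG(2)] by metis
    qed
    show "?g ` ?C \<subseteq> ?C" using N.image_mem t(1) le by blast
  qed
  moreover have "?g ` ?C \<subseteq> complexify N" by (rule image_subsetI) (rule N.image_mem[OF t(1)])
  ultimately have "?C \<subseteq> complexify N" by (simp only:)
  then show ?thesis using complexify_inj[OF N.sub M.sub] le by blast
qed

context quaternionic
begin

lemma Cmp_add: "Cmp (\<lambda>x y z. B x y z + C x y z) i j k x y z = Cmp B i j k x y z + Cmp C i j k x y z"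
  and Cmp_cmult: "Cmp (\<lambda>x y z. c * B x y z) i j k x y z = c * Cmp B i j k x y z"
  using exhaust_2[of i] exhaust_2[of j] exhaust_2[of k]
  by (auto simp: Cmp_def prj_simps field_simps)

lemma Cmp_act3:
  assumes g: "g \<in> Spn I J K" and U: "U \<in> Sp1" and B: "trilin (cur F)"
  shows "Cmp (cur (act3 (g \<circ> quat I J K U) F)) i j k = pre (inv g) (rotS U (Cmp (cur F)) i j k)"
proof -
  note e = etri_Cmp[OF B]
  have er: "etri (pre (inv g) (rotS U (Cmp (cur F)) i j k))" for i j k
    unfolding rotS_def sum_2 by (intro etri_pre Spn_inv[OF g] etri_add etri_cmult e)
  have F: "F = unc (Kap (Cmp (cur F)))" unfolding Kap_Cmp[OF B] by simp
  have "act3 (g \<circ> quat I J K U) F = unc (Kap (\<lambda>i j k. pre (inv g) (rotS U (Cmp (cur F)) i j k)))"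
    using act3_Kap[of g U "Cmp (cur F)", OF g U e] F by simp
  then have "cur (act3 (g \<circ> quat I J K U) F) = Kap (\<lambda>i j k. pre (inv g) (rotS U (Cmp (cur F)) i j k))" by simp
  then show ?thesis
    by (intro ext) (simp add: Cmp_Kap[of "\<lambda>i j k. pre (inv g) (rotS U (Cmp (cur F)) i j k)", OF er])
qed

lemma rotS_one: "rotS (mat 1) t i j k = t i j k"
  using exhaust_2[of i] exhaust_2[of j] exhaust_2[of k]
  by (auto simp: fun_eq_iff rotS_def sum_2 mat_def)

lemma mat1_Sp1: "mat 1 \<in> Sp1"
proof -
  have "(\<chi> i j. cnj ((mat 1 :: complex^2^2) $ j $ i)) = mat 1" by (simp add: vec_eq_iff mat_def)
  then show ?thesis by (simp add: Sp1_def)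
qed

lemma quat_mat1: "quat I J K (mat 1) = id"
  by (simp add: fun_eq_iff quat_def mat_def)

lemma Cmp_Spn:
  assumes "g \<in> Spn I J K" "trilin (cur F)"
  shows "Cmp (cur (act3 g F)) i j k = pre (inv g) (Cmp (cur F) i j k)"
  using Cmp_act3[OF assms(1) mat1_Sp1 assms(2), of i j k] unfolding quat_mat1 rotS_one by simp

lemma H_act_one: "H_act (mat 1) h = h"
  by (auto simp: fun_eq_iff H_act_def sum_2 mat_def) (metis exhaust_2)

lemma S3H_act_one: "S3H_act (mat 1) s = s"
proof
  fix p :: "2 \<times> 2 \<times> 2"
  obtain i j k where "p = (i, j, k)" by (cases p)
  then show "S3H_act (mat 1) s p = s p"
    using exhaust_2[of i] exhaust_2[of j] exhaust_2[of k] by (auto simp: S3H_act_def sum_2 mat_def)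
qed

subsection \<open>The Casimir operator of \<open>Sp(1)\<close> as an element of the group algebra\<close>

definition mq :: "complex \<Rightarrow> complex \<Rightarrow> complex^2^2" where
  "mq \<alpha> \<beta> = (\<chi> i j. if i = 1 then if j = 1 then \<alpha> else \<beta> else if j = 1 then - cnj \<beta> else cnj \<alpha>)"

lemma mq_entries [simp]: "mq \<alpha> \<beta> $ 1 $ 1 = \<alpha>" "mq \<alpha> \<beta> $ 1 $ 2 = \<beta>" "mq \<alpha> \<beta> $ 2 $ 1 = - cnj \<beta>" "mq \<alpha> \<beta> $ 2 $ 2 = cnj \<alpha>"
  by (simp_all add: mq_def)

lemma mq_Sp1:
  assumes "(Re \<alpha>)\<^sup>2 + (Im \<alpha>)\<^sup>2 + (Re \<beta>)\<^sup>2 + (Im \<beta>)\<^sup>2 = 1" shows "mq \<alpha> \<beta> \<in> Sp1"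
proof -
  have 1: "\<alpha> * cnj \<alpha> + \<beta> * cnj \<beta> = 1"
    using assms by (simp add: complex_eq_iff power2_eq_square algebra_simps)
  then show ?thesis unfolding Sp1_def
    by (auto simp: vec_eq_iff forall_2 matrix_matrix_mult_def sum_2 mat_def det_2 algebra_simps)
qed

text \<open>The six unit quaternions \<open>(1 \<plusminus> A) / \<surd>2\<close>, \<open>A = I, J, K\<close>.\<close>

definition six :: "nat \<Rightarrow> complex^2^2" where
  "six l = (let s = complex_of_real (1 / sqrt 2) in
     if l = 0 then mq (s * (1 + \<i>)) 0 else if l = 1 then mq (s * (1 - \<i>)) 0 else if l = 2 then mq s s
     else if l = 3 then mq s (- s) else if l = 4 then mq s (s * \<i>) else mq s (- (s * \<i>)))"

lemma sum_6: "(\<Sum>l<6. f l) = f 0 + f 1 + f 2 + f 3 + f 4 + f (5::nat)" for f :: "nat \<Rightarrow> complex"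
  by (simp add: eval_nat_numeral)

lemma six_Sp1: "six l \<in> Sp1"
  unfolding six_def Let_def by (auto intro!: mq_Sp1 simp: power_divide)

text \<open>Expanding the products for \<open>+\<close> and \<open>-\<close>, the terms with an odd
  number of \<open>a\<close>, \<open>b\<close>, \<open>c\<close> cancel; the factor of the others is
  \<open>2 s^3 = s\<close>.\<close>

lemma pre_pair:
  fixes B :: "'a \<Rightarrow> 'a \<Rightarrow> 'a \<Rightarrow> complex"
  assumes B: "trilin B" and s: "s * s = (1 / 2 :: real)"
  shows "B (s *\<^sub>R x - s *\<^sub>R a) (s *\<^sub>R y - s *\<^sub>R b) (s *\<^sub>R z - s *\<^sub>R c) + B (s *\<^sub>R x + s *\<^sub>R a) (s *\<^sub>R y + s *\<^sub>R b) (s *\<^sub>R z + s *\<^sub>R c) =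
    of_real s * (B x y z + B a b z + B a y c + B x b c)"
proof -
  have r: "s *\<^sub>R s *\<^sub>R v = (1 / 2) *\<^sub>R v" for v :: complex by (simp add: s)
  show ?thesis unfolding scaleR_diff_right[symmetric] scaleR_add_right[symmetric] trilin_simps(10-12)[OF B] r
    by (simp add: trilin_simps[OF B] scaleR_conv_of_real algebra_simps)
qed

lemma six_act3:
  assumes B: "trilin (cur F)"
  shows "(\<Sum>l<6. act3 (quat I J K (six l)) F (x, y, z)) = of_real (1 / sqrt 2) * (3 * F (x, y, z) + Lq (cur F) x y z)"
proof -
  let ?s = "1 / sqrt 2"
  have s: "?s * ?s = 1 / 2" by simp
  have i: "inv (quat I J K (six l)) = qq (Re (six l $ 1 $ 1)) (- Im (six l $ 1 $ 1)) (- Re (six l $ 1 $ 2)) (- Im (six l $ 1 $ 2))" for l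
    unfolding quat_qq by (rule inv_qq) (rule Sp1_entries(3)[OF six_Sp1])
  have e: "inv (quat I J K (six 0)) v = ?s *\<^sub>R v - ?s *\<^sub>R I v" "inv (quat I J K (six 1)) v = ?s *\<^sub>R v + ?s *\<^sub>R I v"
    "inv (quat I J K (six 2)) v = ?s *\<^sub>R v - ?s *\<^sub>R J v" "inv (quat I J K (six 3)) v = ?s *\<^sub>R v + ?s *\<^sub>R J v"
    "inv (quat I J K (six 4)) v = ?s *\<^sub>R v - ?s *\<^sub>R K v" "inv (quat I J K (six 5)) v = ?s *\<^sub>R v + ?s *\<^sub>R K v" for v
    unfolding i by (simp_all add: six_def Let_def qq_def)
  have "(\<Sum>l<6. act3 (quat I J K (six l)) F (x, y, z)) =
    of_real ?s * (F (x, y, z) + F (I x, I y, z) + F (I x, y, I z) + F (x, I y, I z)) +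
    of_real ?s * (F (x, y, z) + F (J x, J y, z) + F (J x, y, J z) + F (x, J y, J z)) +
    of_real ?s * (F (x, y, z) + F (K x, K y, z) + F (K x, y, K z) + F (x, K y, K z))"
    unfolding sum_6 act3_def prod.case e pre_pair[OF B s, symmetric] by (simp only: add.assoc)
  then show ?thesis unfolding Lq_def by (simp add: algebra_simps)
qed

lemma six_H: "(\<Sum>l<6. H_act (six l) h i) = 6 * of_real (1 / sqrt 2) * h i"
  unfolding sum_6 using exhaust_2[of i]
  by (auto simp: six_def Let_def H_act_def sum_2 algebra_simps)

lemma six_S3H:
  assumes h: "h \<in> S3H_mod" shows "(\<Sum>l<6. S3H_act (six l) h p) = 0"
proof -
  obtain i j k where p: "p = (i, j, k)" by (cases p)
  have sw: "h (j, i, k) = h (i, j, k)" "h (i, k, j) = h (i, j, k)" for i j k using h unfolding S3H_mod_def by blast+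
  have e: "h (1, 2, 1) = h (1, 1, 2)" "h (2, 1, 1) = h (1, 1, 2)" "h (2, 1, 2) = h (1, 2, 2)" "h (2, 2, 1) = h (1, 2, 2)"
    using sw(2)[of 1 1 2] sw(1)[of 1 2 1] sw(1)[of 1 2 2] sw(2)[of 2 1 2] by simp_all
  define s where "s = complex_of_real (1 / sqrt 2)"
  have sc: "cnj s = s" by (simp add: s_def)
  show ?thesis unfolding sum_6 p S3H_act_def prod.case sum_2 six_def Let_def s_def[symmetric]
    using exhaust_2[of i] exhaust_2[of j] exhaust_2[of k]
    by (elim disjE) (simp_all add: e sc algebra_simps)
qed

lemma S3H_act_mem:
  assumes h: "h \<in> S3H_mod" shows "S3H_act U h \<in> S3H_mod"
proof -
  have sw: "h (j, i, k) = h (i, j, k)" "h (i, k, j) = h (i, j, k)" for i j k using h unfolding S3H_mod_def by blast+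
  have e: "h (1, 2, 1) = h (1, 1, 2)" "h (2, 1, 1) = h (1, 1, 2)" "h (2, 1, 2) = h (1, 2, 2)" "h (2, 2, 1) = h (1, 2, 2)"
    using sw(2)[of 1 1 2] sw(1)[of 1 2 1] sw(1)[of 1 2 2] sw(2)[of 2 1 2] by simp_all
  have "S3H_act U h (j, i, k) = S3H_act U h (i, j, k) \<and> S3H_act U h (i, k, j) = S3H_act U h (i, j, k)" for i j k
    unfolding S3H_act_def prod.case sum_2 by (simp add: e algebra_simps)
  then show ?thesis unfolding S3H_mod_def by blast
qed

end

context module_iso
begin

lemma eqv_Spn:
  assumes "g \<in> Spn I J K" "f \<in> A" "h \<in> B" "\<sigma> (mat 1) h = h"
  shows "\<Phi> (outer (\<rho> g f) h) = act3 g (\<Phi> (outer f h))"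
  using eqv[OF assms(1) mat1_Sp1 assms(2,3)] unfolding quat_mat1 assms(4) by simp

text \<open>Equivariance moves the six elements from the second tensor factor to the form, where
  they act as \<open>(3 + L) / sqrt 2\<close>. With \<open>c = 6\<close> for H and
  \<open>c = 0\<close> for S^3 H this yields the eigenvalues 3 and \<open>- 3\<close>.\<close>

lemma casimir:
  assumes f: "f \<in> A" "\<rho> id f = f" and h: "h \<in> B" "\<And>U. \<sigma> U h \<in> B"
    and c: "\<And>p. (\<Sum>l<6. \<sigma> (six l) h p) = c * of_real (1 / sqrt 2) * h p"
  shows "Lq (cur (\<Phi> (outer f h))) x y z = (c - 3) * \<Phi> (outer f h) (x, y, z)"
proof -
  let ?F = "\<Phi> (outer f h)"
  have "\<Phi> (outer f (\<lambda>p. \<Sum>l<6. \<sigma> (six l) h p)) = (\<lambda>q. \<Sum>l<6. \<Phi> (outer f (\<sigma> (six l) h)) q)"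
    by (rule outer_sum2[OF f(1)]) (rule h(2))
  also have "\<dots> = (\<lambda>q. \<Sum>l<6. act3 (quat I J K (six l)) ?F q)"
    using eqv[OF Spn_id six_Sp1 f(1) h(1)] unfolding f(2) by simp
  finally have "(\<lambda>q. c * of_real (1 / sqrt 2) * ?F q) = (\<lambda>q. \<Sum>l<6. act3 (quat I J K (six l)) ?F q)"
    unfolding c outer_mult2[OF f(1) h(1)] .
  from fun_cong[OF this, of "(x, y, z)"]
  have "of_real (1 / sqrt 2) * (c * ?F (x, y, z)) = of_real (1 / sqrt 2) * (3 * ?F (x, y, z) + Lq (cur ?F) x y z)"
    unfolding six_act3[OF alt3_trilin[OF image_alt3[OF f(1) h(1)]]] by (simp add: mult_ac)
  then have "c * ?F (x, y, z) = 3 * ?F (x, y, z) + Lq (cur ?F) x y z"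
    by (subst (asm) mult_cancel_left) simp
  then show ?thesis by (simp add: algebra_simps)
qed

end

section \<open>Copies of the modules whose Sp(n)-factor is E or \<Lambda>_0^3 E\<close>

context quaternionic
begin

lemma trilin_XB:
  assumes t: "trilin (cur F)" and 0: "\<And>p. p \<in> XB \<Longrightarrow> F p = 0" shows "F = (\<lambda>p. 0 :: complex)"
proof
  fix p :: "'a \<times> 'a \<times> 'a"
  obtain x y z where p: "p = (x, y, z)" by (cases p)
  have 3: "F (u, v, z) = 0" if "u \<in> Basis" "v \<in> Basis" for u v z
    using sum_Basis_linear[OF trilinD(3)[OF t, of u v], of z] 0 that by (simp add: XB_def)
  have 2: "F (u, y, z) = 0" if "u \<in> Basis" for u y z
    using sum_Basis_linear[OF trilinD(2)[OF t, of u z], of y] 3[OF that] by simp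
  show "F p = 0"
    using sum_Basis_linear[OF trilinD(1)[OF t, of y z], of x] 2 by (simp add: p)
qed

lemma complexify_finite_dim:
  assumes M: "submodule3 I J K M" shows "cfinite_dim (complexify M)"
  by (rule finite_dim_of_points[OF finite_XB cspace_complexify[OF M]])
    (rule trilin_XB[OF alt3_trilin[OF complexify_alt3[OF M]]])

lemma underlies_iff:
  "underlies I J K M A \<rho> B \<sigma> \<longleftrightarrow> (\<exists>\<Phi>. module_iso I J K n M A \<rho> B \<sigma> \<Phi>)"
  unfolding underlies_def module_iso_def module_iso_axioms_def using quaternionic_axioms by blast

lemma submodule_unique:
  assumes i: "i < (4::nat)" and ex: "underlies I J K {b. mods i b} A \<rho> B \<sigma>" and A: "cspace A"
    and le: "\<And>M \<Phi>. module_iso I J K n M A \<rho> B \<sigma> \<Phi> \<Longrightarrow> complexify M \<subseteq> complexify {b. mods i b}"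
    and M: "underlies I J K M A \<rho> B \<sigma>"
  shows "M = {b. mods i b}"
proof -
  obtain \<Phi> \<Psi> where "module_iso I J K n {b. mods i b} A \<rho> B \<sigma> \<Phi>" "module_iso I J K n M A \<rho> B \<sigma> \<Psi>"
    using ex M unfolding underlies_iff by blast
  then show ?thesis using iso_image_eq[OF _ _ le A complexify_finite_dim[OF submodule3_mods[OF i]]] by blast
qed

lemma cspace_mods: "i < (4::nat) \<Longrightarrow> cspace (complexify {b. mods i b})"
  by (rule cspace_complexify[OF submodule3_mods])

lemma L3E_Cmp_le:
  assumes "module_iso I J K n M A \<rho> S3H_mod S3H_act \<Phi>" and id: "\<And>f. f \<in> A \<Longrightarrow> \<rho> id f = f" and f: "f \<in> A" and h: "h \<in> S3H_mod"
  shows "alt3 (cur (\<Phi> (outer f h)))" "Lq (cur (\<Phi> (outer f h))) x y z = - 3 *\<^sub>R cur (\<Phi> (outer f h)) x y z"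
proof -
  interpret M: module_iso I J K n M A \<rho> S3H_mod S3H_act \<Phi> by fact
  show "alt3 (cur (\<Phi> (outer f h)))" by (rule M.image_alt3[OF f h])
  show "Lq (cur (\<Phi> (outer f h))) x y z = - 3 *\<^sub>R cur (\<Phi> (outer f h)) x y z"
    using M.casimir[OF f id[OF f] h S3H_act_mem[OF h], of 0] six_S3H[OF h] by (simp add: scaleR_conv_of_real)
qed

lemma act3_id: "act3 id F = F"
  by (auto simp: act3_def fun_eq_iff inv_id)

lemma act1_id: "act1 id f = f"
  by (auto simp: act1_def fun_eq_iff inv_id)

text \<open>Once the eigenvalue is known, only the traces of the components can keep a form out of
  \<open>mLS\<close>. For fixed \<open>h\<close> they depend equivariantly on \<open>F\<close>, so
  \<open>Hom_C0_dual\<close> applies.\<close>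

lemma LS_le:
  assumes M: "module_iso I J K n M C0 act3 S3H_mod S3H_act \<Phi>"
  shows "complexify M \<subseteq> complexify {b. mods (2::nat) b}"
proof -
  interpret M: module_iso I J K n M C0 act3 S3H_mod S3H_act \<Phi> by (rule M)
  show ?thesis
  proof (rule M.generated[OF cspace_mods])
    fix F :: "'a \<times> 'a \<times> 'a \<Rightarrow> complex" and h :: "2 \<times> 2 \<times> 2 \<Rightarrow> complex" assume F: "F \<in> C0" and h: "h \<in> S3H_mod"
    note al = L3E_Cmp_le(1)[OF M act3_id _ h] and Lq = L3E_Cmp_le(2)[OF M act3_id F h]
    note e = etri_Cmp[OF alt3_trilin[OF al]]
    define \<psi> where "\<psi> i j k F = ctr J (Cmp (cur (\<Phi> (outer F h))) i j k)" for i j k F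
    have "\<psi> i j k F = (\<lambda>x. 0)" for i j k
    proof (rule Hom_C0_dual[OF _ _ _ _ F])
      show "\<psi> i j k (\<lambda>p. F p + G p) = (\<lambda>x. \<psi> i j k F x + \<psi> i j k G x)" if "F \<in> C0" "G \<in> C0" for F G
        unfolding \<psi>_def M.outer_add1[OF that h] by (simp add: Cmp_add[abs_def] ctr_add fun_eq_iff)
      show "\<psi> i j k (\<lambda>p. c * F p) = (\<lambda>x. c * \<psi> i j k F x)" if "F \<in> C0" for c F
        unfolding \<psi>_def M.outer_mult1[OF that h] by (simp add: Cmp_cmult[abs_def] ctr_def sum_distrib_left fun_eq_iff)
      show "\<psi> i j k (act3 g F) = (\<lambda>x. \<psi> i j k F (inv g x))" if g: "g \<in> Spn I J K" and F: "F \<in> C0" for g F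
        unfolding \<psi>_def M.eqv_Spn[OF g F h S3H_act_one] Cmp_Spn[OF g alt3_trilin[OF al[OF F]]]
        by (rule ext) (rule ctr_J_pre[OF etri_trilin[OF e[OF F]] Spn_inv[OF g]])
      show "linear (\<psi> i j k F)" if "F \<in> C0" for F unfolding \<psi>_def by (rule linear_ctr[OF etri_trilin[OF e[OF that]]])
    qed
    then have "mLS (cur (\<Phi> (outer F h)))"
      unfolding mLS_def ctr_Cmp_zero[OF al[OF F]] using al[OF F] Lq unfolding \<psi>_def by (simp add: fun_eq_iff)
    then show "\<Phi> (outer F h) \<in> complexify {b. mods (2::nat) b}" unfolding complexify_mods by (simp add: mods_def)
  qed simp
qed

text \<open>The trace-free parts of the components are the obstruction here; they form an
  equivariant map from E to \<open>C0\<close>, which is zero by \<open>Hom_E_C0\<close>.\<close>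

lemma ES_le:
  assumes M: "module_iso I J K n M (E_mod I) act1 S3H_mod S3H_act \<Phi>"
  shows "complexify M \<subseteq> complexify {b. mods (3::nat) b}"
proof -
  interpret M: module_iso I J K n M "E_mod I" act1 S3H_mod S3H_act \<Phi> by (rule M)
  show ?thesis
  proof (rule M.generated[OF cspace_mods])
    fix f :: "'a \<Rightarrow> complex" and h :: "2 \<times> 2 \<times> 2 \<Rightarrow> complex" assume f: "f \<in> E_mod I" and h: "h \<in> S3H_mod"
    note al = L3E_Cmp_le(1)[OF M act1_id _ h] and Lq = L3E_Cmp_le(2)[OF M act1_id _ h]
    note e = etri_Cmp[OF alt3_trilin[OF al]]
    define c where "c i j k f = Cmp (cur (\<Phi> (outer f h))) i j k" for i j k f
    define \<psi> where "\<psi> i j k f = (\<lambda>(x, y, z). c i j k f x y z - wE (tr0 (c i j k f)) x y z)" for i j k f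
    have ce: "etri (c i j k f)" if "f \<in> E_mod I" for i j k f unfolding c_def by (rule e[OF that])
    have 0: "\<psi> i j k f = (\<lambda>p. 0)" for i j k
    proof (rule Hom_E_C0[OF _ _ _ _ f])
      have add: "c i j k (\<lambda>x. f x + f' x) = (\<lambda>x y z. c i j k f x y z + c i j k f' x y z)" if "f \<in> E_mod I" "f' \<in> E_mod I" for f f'
        unfolding c_def M.outer_add1[OF that h] by (simp add: Cmp_add fun_eq_iff)
      have mult: "c i j k (\<lambda>x. a * f x) = (\<lambda>x y z. a * c i j k f x y z)" if "f \<in> E_mod I" for a f
        unfolding c_def M.outer_mult1[OF that h] by (simp add: Cmp_cmult fun_eq_iff)
      have pre: "c i j k (act1 g f) = pre (inv g) (c i j k f)" if g: "g \<in> Spn I J K" and f: "f \<in> E_mod I" for g f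
        unfolding c_def M.eqv_Spn[OF g f h S3H_act_one] by (rule Cmp_Spn[OF g alt3_trilin[OF al[OF f]]])
      have tadd: "tr0 (\<lambda>x y z. B x y z + C x y z) = (\<lambda>x. tr0 B x + tr0 C x)" for B C
        by (simp add: tr0_def fun_eq_iff ctr_add add_divide_distrib)
      have tmult: "tr0 (\<lambda>x y z. a * B x y z) = (\<lambda>x. a * tr0 B x)" for a B
        by (simp add: tr0_def fun_eq_iff ctr_def sum_distrib_left)
      show "\<psi> i j k (\<lambda>x. f x + f' x) = (\<lambda>p. \<psi> i j k f p + \<psi> i j k f' p)" if "f \<in> E_mod I" "f' \<in> E_mod I" for f f'
        unfolding \<psi>_def add[OF that] tadd by (auto simp: fun_eq_iff wE_add)
      show "\<psi> i j k (\<lambda>x. a * f x) = (\<lambda>p. a * \<psi> i j k f p)" if "f \<in> E_mod I" for a f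
        unfolding \<psi>_def mult[OF that] tmult by (auto simp: fun_eq_iff wE_mult algebra_simps)
      show "\<psi> i j k (act1 g f) = act3 g (\<psi> i j k f)" if g: "g \<in> Spn I J K" and f: "f \<in> E_mod I" for g f
      proof -
        have t: "tr0 (pre (inv g) (c i j k f)) = act1 g (tr0 (c i j k f))"
          by (simp add: fun_eq_iff tr0_def act1_def ctr_J_pre[OF etri_trilin[OF ce[OF f]] Spn_inv[OF g]])
        have "wE (act1 g (tr0 (c i j k f))) x y z = wE (tr0 (c i j k f)) (inv g x) (inv g y) (inv g z)" for x y z
          using fun_cong[OF act3_wE[OF g, of "tr0 (c i j k f)"], of "(x, y, z)"] by (simp add: act3_def)
        then show ?thesis unfolding \<psi>_def pre[OF g f] t by (auto simp: fun_eq_iff act3_def pre_def)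
      qed
      show "\<psi> i j k f \<in> C0" if "f \<in> E_mod I" for f
        unfolding \<psi>_def by (rule L3E_decomp[OF ce[OF that]]) (unfold c_def, rule Cmp_sym_alt3[OF al[OF that]], use Lq[OF that] in blast)
    qed
    have "c i j k f = wE (tr0 (c i j k f))" for i j k
    proof (intro ext)
      fix x y z show "c i j k f x y z = wE (tr0 (c i j k f)) x y z"
        using fun_cong[OF 0[of i j k], of "(x, y, z)"] by (simp add: \<psi>_def)
    qed
    then have "mES (cur (\<Phi> (outer f h)))"
      unfolding mES_Cmp_iff using al[OF f] Lq[OF f] tr0_E[OF ce[OF f]] unfolding c_def by blast
    then show "\<Phi> (outer f h) \<in> complexify {b. mods (3::nat) b}" unfolding complexify_mods by (simp add: mods_def)
  qed simp
qed

definition eg :: "('a \<Rightarrow> 'a \<Rightarrow> 'a \<Rightarrow> complex) \<Rightarrow> 'a \<Rightarrow> complex" where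
  "eg B x = ctr I B (I x) / (4 * of_nat n + 2)"

lemma linear_eg:
  assumes "trilin B" shows "linear (eg B)"
proof -
  have "linear (\<lambda>x. ctr I B (I x))" using linear_comp_IJK(1)[OF linear_ctr[OF assms]] .
  then show ?thesis unfolding eg_def[abs_def] by (simp add: linear_iff add_divide_distrib scaleR_conv_of_real)
qed

text \<open>The difference of a form and its \<open>EH\<close>-component (for forms in \<open>(K + E)H\<close>).\<close>

definition kc :: "('a \<Rightarrow> 'a \<Rightarrow> 'a \<Rightarrow> complex) \<Rightarrow> 'a \<Rightarrow> 'a \<Rightarrow> 'a \<Rightarrow> complex" where
  "kc B x y z = B x y z - WD (\<lambda>x. eg B (I x)) (\<lambda>x. eg B (J x)) (\<lambda>x. eg B (K x)) x y z"

text \<open>The real classification splits the real and imaginary parts into KH and EH. The part in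
  KH has no contractions, so \<open>eg\<close> of the form is the parameter of the EH-part, and
  subtracting it leaves the other one.\<close>

lemma kc_mKH:
  assumes B: "alt3 B" and L: "\<And>x y z. Lq B x y z = 3 *\<^sub>R B x y z"
  shows "mKH (kc B)"
proof -
  have real: "\<exists>k e. mKH k \<and> mEH e \<and> b = add3 k e" if b: "alt3 b" "\<And>x y z. Lq b x y z = 3 *\<^sub>R b x y z" for b :: "'a form3"
  proof -
    have "b \<in> sum3 {b. mKH b} {b. mEH b} \<longleftrightarrow> L_op I J K b = scale3 3 b"
      using classification[of b, OF _ refl refl refl refl] b(1) unfolding Lambda3_alt3 by simp
    moreover have "L_op I J K b = scale3 3 b" using b(2) by (simp add: fun_eq_iff L_op_eq scale3_def)
    ultimately have "b \<in> sum3 {b. mKH b} {b. mEH b}" by (simp only:)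
    then show ?thesis unfolding sum3_def mem_Collect_eq by blast
  qed
  have 1: "alt3 (\<lambda>x y z. Re (B x y z))" "alt3 (\<lambda>x y z. Im (B x y z))" using B unfolding alt3_complex_iff[of B] by blast+
  have 2: "Lq (\<lambda>x y z. Re (B x y z)) x y z = 3 *\<^sub>R Re (B x y z)" "Lq (\<lambda>x y z. Im (B x y z)) x y z = 3 *\<^sub>R Im (B x y z)" for x y z
    unfolding Lq_complex[symmetric] L by simp_all
  obtain k e k' e' where ke: "mKH k" "mEH e" "(\<lambda>x y z. Re (B x y z)) = add3 k e" "mKH k'" "mEH e'" "(\<lambda>x y z. Im (B x y z)) = add3 k' e'"
    using real[OF 1(1) 2(1)] real[OF 1(2) 2(2)] by blast
  define k0 where "k0 x y z = complex_of_real (k x y z) + \<i> * complex_of_real (k' x y z)" for x y z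
  define e0 where "e0 x y z = complex_of_real (e x y z) + \<i> * complex_of_real (e' x y z)" for x y z
  have k0: "mKH k0" unfolding mKH_complex_iff[of k0] k0_def using ke(1,4) by simp
  have "mEH e0" unfolding mEH_complex_iff[of e0] e0_def using ke(2,5) by simp
  then obtain \<beta> where \<beta>: "linear \<beta>" "e0 = WD (\<lambda>x. \<beta> (I x)) (\<lambda>x. \<beta> (J x)) (\<lambda>x. \<beta> (K x))" unfolding mEH_def by blast
  have Be: "B = (\<lambda>x y z. k0 x y z + e0 x y z)"
    using ke(3,6) by (simp add: fun_eq_iff complex_eq_iff k0_def e0_def add3_def)
  have "ctr I k0 x = 0" for x using k0 unfolding mKH_def by blast
  then have "eg B = \<beta>" unfolding Be eg_def ctr_add \<beta>(2) using EH_recover[OF \<beta>(1)] n_complex' by (simp add: fun_eq_iff)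
  then have "kc B = k0" unfolding kc_def[abs_def] by (simp add: fun_eq_iff Be \<beta>(2))
  then show ?thesis using k0 by simp
qed

lemma mKH_zero_of_Cmp:
  assumes "mKH k" "\<And>i j. i \<noteq> j \<Longrightarrow> Cmp k i i j = (\<lambda>x y z. 0)"
  shows "k x y z = 0"
proof -
  have al: "alt3 k" by (rule mKH_alt3[OF assms(1)])
  have "Cmp k = (\<lambda>i j k x y z. 0)"
  proof (rule alt_family_eq)
    show "Cmp k j i l y x z = - Cmp k i j l x y z" "Cmp k i l j x z y = - Cmp k i j l x y z" for i j l x y z
      by (rule Cmp_alt3[OF al])+
    show "Cmp k 1 1 1 = (\<lambda>x y z. 0)" "Cmp k 2 2 2 = (\<lambda>x y z. 0)"
      using mKH_Cmp_sum[OF assms(1), of 1 1 1] mKH_Cmp_sum[OF assms(1), of 2 2 2] by (simp_all add: fun_eq_iff)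
  qed (simp_all add: assms(2))
  then have "Kap (Cmp k) x y z = 0" by (simp add: Kap_def)
  then show ?thesis unfolding Kap_Cmp[OF alt3_trilin[OF al]] .
qed

text \<open>The obstruction is the KH-part \<open>kc\<close>. Its components of pattern
  \<open>i i j\<close> determine it and are equivariant maps from E to \<open>Kmod\<close>, which
  vanish by \<open>Hom_E_K\<close>.\<close>

lemma EH_le:
  assumes M: "module_iso I J K n M (E_mod I) act1 H_mod H_act \<Phi>"
  shows "complexify M \<subseteq> complexify {b. mods (1::nat) b}"
proof -
  interpret M: module_iso I J K n M "E_mod I" act1 H_mod H_act \<Phi> by (rule M)
  have H: "h \<in> H_mod" for h by (simp add: H_mod_def)
  show ?thesis
  proof (rule M.generated[OF cspace_mods])
    fix f :: "'a \<Rightarrow> complex" and h :: "2 \<Rightarrow> complex" assume f: "f \<in> E_mod I"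
    define B where "B f = cur (\<Phi> (outer f h))" for f
    have al: "alt3 (B f)" if "f \<in> E_mod I" for f unfolding B_def by (rule M.image_alt3[OF that H])
    have Lq: "Lq (B f) x y z = 3 *\<^sub>R B f x y z" if "f \<in> E_mod I" for f x y z
      using M.casimir[OF that act1_id H H, where c = 6 and h = h] six_H unfolding B_def by (simp add: scaleR_conv_of_real)
    note k = kc_mKH[OF al Lq]
    define \<psi> where "\<psi> i j f = (\<lambda>(x, y, z). Cmp (kc (B f)) i i j x y z)" for i j f
    have add: "kc (B (\<lambda>x. f x + f' x)) = (\<lambda>x y z. kc (B f) x y z + kc (B f') x y z)" if "f \<in> E_mod I" "f' \<in> E_mod I" for f f'
      unfolding B_def M.outer_add1[OF that H] kc_def[abs_def] eg_def ctr_add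
      by (simp add: fun_eq_iff WD_def wd_def add_divide_distrib scaleR_conv_of_real algebra_simps)
    have mult: "kc (B (\<lambda>x. a * f x)) = (\<lambda>x y z. a * kc (B f) x y z)" if "f \<in> E_mod I" for a f
    proof -
      have "eg (\<lambda>x y z. a * C x y z) = (\<lambda>x. a * eg C x)" for C by (simp add: fun_eq_iff eg_def ctr_def sum_distrib_left)
      then show ?thesis unfolding B_def M.outer_mult1[OF that H] kc_def[abs_def]
        by (simp add: fun_eq_iff WD_def wd_def scaleR_conv_of_real algebra_simps)
    qed
    have pre: "kc (B (act1 g f)) = pre (inv g) (kc (B f))" if g: "g \<in> Spn I J K" and f: "f \<in> E_mod I" for g f
    proof -
      note gi = Spn_inv[OF g]
      have 1: "B (act1 g f) = pre (inv g) (B f)" unfolding B_def M.eqv_Spn[OF g f H H_act_one] by (rule cur_act3)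
      note t = alt3_trilin[OF al[OF f]]
      have 2: "eg (pre (inv g) (B f)) x = eg (B f) (inv g x)" for x
        unfolding eg_def ctr_def pre_def Spn_comm(1)[OF gi]
        using trace_orthogonal[OF Spn_orth[OF gi], of "\<lambda>u v. B f (I (inv g x)) u (I v)"] trilinD(2)[OF t] linear_compose[OF lin(1) trilinD(3)[OF t], unfolded o_def]
        by simp
      note l = linear_eg[OF t]
      show ?thesis unfolding 1
        using pre_WD_EH[OF nrm_Spn[OF gi] l] by (simp add: fun_eq_iff kc_def 2 pre_def)
    qed
    have 0: "\<psi> i j f = (\<lambda>p. 0)" if ij: "i \<noteq> j" for i j
    proof (rule Hom_E_K[OF _ _ _ _ f])
      show "\<psi> i j (\<lambda>x. f x + f' x) = (\<lambda>p. \<psi> i j f p + \<psi> i j f' p)" if "f \<in> E_mod I" "f' \<in> E_mod I" for f f'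
        unfolding \<psi>_def add[OF that] by (auto simp: fun_eq_iff Cmp_add)
      show "\<psi> i j (\<lambda>x. a * f x) = (\<lambda>p. a * \<psi> i j f p)" if "f \<in> E_mod I" for a f
        unfolding \<psi>_def mult[OF that] by (auto simp: fun_eq_iff Cmp_cmult)
      show "\<psi> i j (act1 g f) = act3 g (\<psi> i j f)" if g: "g \<in> Spn I J K" and f: "f \<in> E_mod I" for g f
        using Cmp_Spn[OF g, of "unc (kc (B f))" i i j] alt3_trilin[OF mKH_alt3[OF k[OF f f]]]
        unfolding \<psi>_def pre[OF g f] cur_act3 by (auto simp: fun_eq_iff act3_def pre_def)
      show "\<psi> i j f \<in> Kmod" if "f \<in> E_mod I" for f
        unfolding \<psi>_def by (rule mKH_Cmp[OF k[OF that that] ij])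
    qed
    have "Cmp (kc (B f)) i i j = (\<lambda>x y z. 0)" if "i \<noteq> j" for i j
      using 0[OF that] unfolding \<psi>_def by (simp add: fun_eq_iff)
    then have "kc (B f) x y z = 0" for x y z using mKH_zero_of_Cmp[OF k[OF f f]] by blast
    then have "B f = WD (\<lambda>x. eg (B f) (I x)) (\<lambda>x. eg (B f) (J x)) (\<lambda>x. eg (B f) (K x))"
      by (simp add: kc_def fun_eq_iff)
    moreover have "linear (eg (B f))" by (rule linear_eg[OF alt3_trilin[OF al[OF f]]])
    ultimately have "mEH (B f)" unfolding mEH_def by blast
    then show "\<Phi> (outer f h) \<in> complexify {b. mods (1::nat) b}" unfolding complexify_mods B_def by (simp add: mods_def)
  qed simp
qed

end

context module_iso
begin

lemma invariant:
  assumes g: "g \<in> Spn I J K" and U: "U \<in> Sp1" and cl: "\<And>f. f \<in> A \<Longrightarrow> \<rho> g f \<in> A" "\<And>h. h \<in> B \<Longrightarrow> \<sigma> U h \<in> B"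
    and F: "F \<in> complexify M"
  shows "act3 (g \<circ> quat I J K U) F \<in> complexify M"
proof -
  note C = cspaceD[OF cspace_complexify[OF sub]]
  let ?W = "{F. act3 (g \<circ> quat I J K U) F \<in> complexify M}"
  have a: "act3 T (\<lambda>x. F x + G x) = (\<lambda>x. act3 T F x + act3 T G x)" "act3 T (\<lambda>x. c * F x) = (\<lambda>x. c * act3 T F x)"
    "act3 T (\<lambda>x. 0) = (\<lambda>x. 0)" for T :: "'a \<Rightarrow> 'a" and F G c
    by (auto simp: act3_def)
  have "cspace ?W" unfolding cspace_def using C(1-3) by (auto simp only: a mem_Collect_eq)
  moreover have "\<Phi> (outer f h) \<in> ?W" if "f \<in> A" "h \<in> B" for f h
    using image_mem[OF outer_tensor[OF cl(1)[OF that(1)] cl(2)[OF that(2)]]] eqv[OF g U that] by simp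
  ultimately show ?thesis using generated F by blast
qed

end

section \<open>Copies of K H, compared through highest weight vectors\<close>

context quaternionic
begin

text \<open>Since \<open>zt\<^sup>4 \<noteq> 1\<close>, the torus element \<open>mq zt 0\<close> separates the weight \<open>1\<close> of \<open>Sp(1)\<close> from \<open>3, - 1, - 3\<close>.\<close>

definition zt :: complex where
  "zt = Complex (3 / 5) (4 / 5)"

lemma zt_Sp1: "mq zt 0 \<in> Sp1"
  by (rule mq_Sp1) (simp add: zt_def power2_eq_square)

lemma zt_neq: "zt * zt * zt \<noteq> zt" "cnj zt * cnj zt * zt \<noteq> zt" "cnj zt * cnj zt * cnj zt \<noteq> zt"
  by (simp_all add: zt_def complex_eq_iff)

lemma Cmp_weight:
  assumes t: "trilin (cur F)" and w: "act3 (quat I J K (mq zt 0)) F = (\<lambda>p. zt * F p)"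
  shows "Cmp (cur F) 1 1 1 = (\<lambda>x y z. 0)" "Cmp (cur F) 2 2 1 = (\<lambda>x y z. 0)" "Cmp (cur F) 2 2 2 = (\<lambda>x y z. 0)"
proof -
  have c: "zt * Cmp (cur F) i j k x y z = rotS (mq zt 0) (Cmp (cur F)) i j k x y z" for i j k x y z
    using Cmp_act3[OF Spn_id zt_Sp1 t, of i j k] w by (simp add: Cmp_cmult pre_def inv_id fun_eq_iff)
  have "(zt * zt * zt - zt) * Cmp (cur F) 1 1 1 x y z = 0" "(cnj zt * cnj zt * zt - zt) * Cmp (cur F) 2 2 1 x y z = 0"
    "(cnj zt * cnj zt * cnj zt - zt) * Cmp (cur F) 2 2 2 x y z = 0" for x y z
    using c[of 1 1 1 x y z] c[of 2 2 1 x y z] c[of 2 2 2 x y z] by (simp_all only: rotS_def sum_2 mq_entries left_diff_distrib) simp_all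
  then show "Cmp (cur F) 1 1 1 = (\<lambda>x y z. 0)" "Cmp (cur F) 2 2 1 = (\<lambda>x y z. 0)" "Cmp (cur F) 2 2 2 = (\<lambda>x y z. 0)"
    using zt_neq by (simp_all add: fun_eq_iff)
qed

text \<open>The alternating forms of weight (2,1,0,...) under the torus of Sp(n) and of weight 1
  under that of Sp(1), the latter tested on the single element \<open>mq zt 0\<close>.\<close>

definition hwt :: "(nat \<Rightarrow> 'a) \<Rightarrow> ('a \<times> 'a \<times> 'a \<Rightarrow> complex) \<Rightarrow> bool" where
  "hwt e F \<longleftrightarrow> alt3 (cur F) \<and> act3 (quat I J K (mq zt 0)) F = (\<lambda>p. zt * F p) \<and>
     (\<forall>g \<theta>. torus n e \<theta> g \<longrightarrow> act3 g F = (\<lambda>p. cis (\<Sum>r<n. of_int (\<kappa> r) * \<theta> r) * F p))"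

text \<open>The weight for Sp(1) leaves the components of pattern 112, and the weight for Sp(n)
  leaves one entry of them.\<close>

lemma hwt_zero:
  assumes e: "frame n e" and F: "hwt e F" and 0: "Cmp (cur F) 1 1 2 (J (e 0)) (J (e 1)) (J (e 0)) = 0"
  shows "F = (\<lambda>p. 0)"
proof -
  have al: "alt3 (cur F)" and w: "act3 (quat I J K (mq zt 0)) F = (\<lambda>p. zt * F p)"
    and wt: "\<And>g \<theta>. torus n e \<theta> g \<Longrightarrow> act3 g F = (\<lambda>p. cis (\<Sum>r<n. of_int (\<kappa> r) * \<theta> r) * F p)"
    using F unfolding hwt_def by blast+
  note t = alt3_trilin[OF al]
  have 112: "Cmp (cur F) 1 1 2 x y z = 0" for x y z
  proof (rule highest_component_unique[OF e etri_Cmp[OF t] _ _ 0])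
    show "Cmp (cur F) 1 1 2 y x z = - Cmp (cur F) 1 1 2 x y z" for x y z by (rule Cmp_alt3(1)[OF al])
    show "Cmp (cur F) 1 1 2 (inv g x) (inv g y) (inv g z) = cis (\<Sum>r<n. of_int (\<kappa> r) * \<theta> r) * Cmp (cur F) 1 1 2 x y z"
      if g: "torus n e \<theta> g" for g \<theta> x y z
    proof -
      have "g \<in> Spn I J K" using g by (simp add: torus_def)
      from fun_cong[OF fun_cong[OF fun_cong[OF Cmp_Spn[OF this t, of 1 1 2], of x], of y], of z]
      show ?thesis unfolding wt[OF g] Cmp_cmult pre_def by (rule sym)
    qed
  qed
  have "Cmp (cur F) = (\<lambda>i j k x y z. 0)"
  proof (rule alt_family_eq)
    show "Cmp (cur F) j i l y x z = - Cmp (cur F) i j l x y z" "Cmp (cur F) i l j x z y = - Cmp (cur F) i j l x y z" for i j l x y z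
      by (rule Cmp_alt3[OF al])+
  qed (simp_all add: Cmp_weight[OF t w] 112 fun_eq_iff)
  then have "Kap (Cmp (cur F)) = (\<lambda>x y z. 0)" by (simp add: Kap_def fun_eq_iff)
  then show ?thesis unfolding Kap_Cmp[OF t] by (auto simp: fun_eq_iff)
qed

text \<open>The weight space is at most a line in the space of all alternating complex forms, not
  only in one submodule. Two copies of K H therefore share their highest weight vector up to a
  scalar, however K is realized.\<close>

lemma hwt_unique:
  assumes e: "frame n e" and F: "hwt e F" "F \<noteq> (\<lambda>p. 0)" and G: "hwt e G"
  shows "\<exists>c. G = (\<lambda>p. c * F p)"
proof -
  let ?v = "\<lambda>F. Cmp (cur F) 1 1 2 (J (e 0)) (J (e 1)) (J (e 0))"
  have nz: "?v F \<noteq> 0" using hwt_zero[OF e F(1)] F(2) by blast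
  define b where "b = - ?v G / ?v F"
  define D where "D p = G p + b * F p" for p
  have a: "act3 T D p = act3 T G p + b * act3 T F p" for T p
    by (cases p) (simp add: D_def act3_def)
  have al: "alt3 (\<lambda>x y z. G (x, y, z) + c * F (x, y, z))" for c
  proof -
    have "alt3 (cur F)" "alt3 (cur G)" using F(1) G unfolding hwt_def by blast+
    then have "trilin (\<lambda>x y z. G (x, y, z) + c * F (x, y, z))"
      using trilin_add[OF alt3_trilin trilin_cmult[OF alt3_trilin], of "cur G" "cur F" c] by simp
    moreover have "G (y, x, z) + c * F (y, x, z) = - (G (x, y, z) + c * F (x, y, z))" "G (x, z, y) + c * F (x, z, y) = - (G (x, y, z) + c * F (x, y, z))" for x y z
      using alt3_swap12[OF \<open>alt3 (cur F)\<close>, of y x z] alt3_swap12[OF \<open>alt3 (cur G)\<close>, of y x z]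
        alt3_swap23[OF \<open>alt3 (cur F)\<close>, of x z y] alt3_swap23[OF \<open>alt3 (cur G)\<close>, of x z y] by (simp_all add: algebra_simps)
    ultimately show ?thesis unfolding alt3_def by blast
  qed
  have "hwt e D"
    unfolding hwt_def
  proof (intro conjI allI impI)
    show "alt3 (cur D)" unfolding D_def by (rule al)
    have "act3 (quat I J K (mq zt 0)) F = (\<lambda>p. zt * F p)" "act3 (quat I J K (mq zt 0)) G = (\<lambda>p. zt * G p)"
      using F(1) G unfolding hwt_def by blast+
    then show "act3 (quat I J K (mq zt 0)) D = (\<lambda>p. zt * D p)" by (intro ext) (simp only: a, simp only: D_def distrib_left mult.left_commute)
    fix g \<theta> assume g: "torus n e \<theta> g"
    then have "act3 g F = (\<lambda>p. cis (\<Sum>r<n. of_int (\<kappa> r) * \<theta> r) * F p)" "act3 g G = (\<lambda>p. cis (\<Sum>r<n. of_int (\<kappa> r) * \<theta> r) * G p)"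
      using F(1) G unfolding hwt_def by blast+
    then show "act3 g D = (\<lambda>p. cis (\<Sum>r<n. of_int (\<kappa> r) * \<theta> r) * D p)" by (intro ext) (simp only: a, simp only: D_def distrib_left mult.left_commute)
  qed
  moreover have "?v D = 0"
    using nz unfolding D_def Cmp_add Cmp_cmult by (simp add: b_def)
  ultimately have D0: "D = (\<lambda>p. 0)" by (rule hwt_zero[OF e])
  have "G p = - b * F p" for p using fun_cong[OF D0, of p] unfolding D_def by (simp add: add_eq_0_iff2)
  then show ?thesis by blast
qed

lemma H_basis: "(\<lambda>i. H_act (mq zt 0) (\<lambda>i. if i = 1 then 1 else 0) i) = (\<lambda>i. zt * (if i = 1 then 1 else 0))"
  "H_act (mq 0 (- 1)) (\<lambda>i. if i = 1 then 1 else 0) = (\<lambda>i. if i = 2 then 1 else 0)"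
proof -
  have "H_act (mq zt 0) (\<lambda>i. if i = 1 then 1 else 0) i = zt * (if i = 1 then 1 else 0)"
    "H_act (mq 0 (- 1)) (\<lambda>i. if i = 1 then 1 else 0) i = (if i = 2 then 1 else 0)" for i
    using exhaust_2[of i] by (auto simp: H_act_def sum_2)
  then show "(\<lambda>i. H_act (mq zt 0) (\<lambda>i. if i = 1 then 1 else 0) i) = (\<lambda>i. zt * (if i = 1 then 1 else 0))"
    "H_act (mq 0 (- 1)) (\<lambda>i. if i = 1 then 1 else 0) = (\<lambda>i. if i = 2 then 1 else 0)" by (intro ext; simp only:)+
qed

lemma hwt_image:
  assumes M: "module_iso I J K n M S \<rho> H_mod H_act \<Phi>" and rep: "Spn_rep I J K S \<rho>" and f: "f \<in> S" "f \<noteq> (\<lambda>x. 0)"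
    and w: "\<And>g \<theta>. torus n e \<theta> g \<Longrightarrow> \<rho> g f = (\<lambda>x. cis (\<Sum>r<n. of_int (\<kappa> r) * \<theta> r) * f x)"
  shows "hwt e (\<Phi> (outer f (\<lambda>i. if i = 1 then 1 else 0)))" "\<Phi> (outer f (\<lambda>i. if i = 1 then 1 else 0)) \<noteq> (\<lambda>p. 0)"
proof -
  interpret M: module_iso I J K n M S \<rho> H_mod H_act \<Phi> by (rule M)
  let ?d = "\<lambda>i :: 2. if i = 1 then 1 else 0 :: complex"
  have d: "?d \<in> H_mod" by (simp add: H_mod_def)
  have id: "\<rho> id f = f" using rep f(1) unfolding Spn_rep_def by blast
  show "hwt e (\<Phi> (outer f ?d))" unfolding hwt_def
  proof (intro conjI allI impI)
    show "alt3 (cur (\<Phi> (outer f ?d)))" by (rule M.image_alt3[OF f(1) d])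
    show "act3 (quat I J K (mq zt 0)) (\<Phi> (outer f ?d)) = (\<lambda>p. zt * \<Phi> (outer f ?d) p)"
      using M.eqv[OF Spn_id zt_Sp1 f(1) d] M.outer_mult2[OF f(1) d, of zt] H_basis(1) unfolding id by simp
    fix g \<theta> assume g: "torus n e \<theta> g"
    then have "g \<in> Spn I J K" by (simp add: torus_def)
    from M.eqv_Spn[OF this f(1) d H_act_one] show "act3 g (\<Phi> (outer f ?d)) = (\<lambda>p. cis (\<Sum>r<n. of_int (\<kappa> r) * \<theta> r) * \<Phi> (outer f ?d) p)"
      unfolding w[OF g] M.outer_mult1[OF f(1) d] by (rule sym)
  qed
  show "\<Phi> (outer f ?d) \<noteq> (\<lambda>p. 0)"
  proof
    assume "\<Phi> (outer f ?d) = (\<lambda>p. 0)"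
    then have z: "outer f ?d = (\<lambda>p. 0)"
      using M.bij outer_tensor[OF f(1) d] zero_tensor M.map_zero unfolding bij_betw_def by (metis inj_onD)
    have "f x = 0" for x using fun_cong[OF z, of "(x, 1)"] by (simp add: outer_def)
    then show False using f(2) by blast
  qed
qed

text \<open>The elements \<open>k\<close> of the Sp(n)-factor whose products with both basis vectors
  of H land in \<open>M\<close> form an invariant subspace. It contains the highest weight vector,
  so by irreducibility it is everything.\<close>

lemma KH_le:
  assumes M: "module_iso I J K n M S \<rho> H_mod H_act \<Phi>" and repM: "Spn_rep I J K S \<rho>"
    and N: "module_iso I J K n N S' \<rho>' H_mod H_act \<Psi>" and irr: "irreducible_Spn_rep I J K S' \<rho>'"
    and e: "frame n e"
    and f: "f \<in> S" "f \<noteq> (\<lambda>x. 0)" "\<And>g \<theta>. torus n e \<theta> g \<Longrightarrow> \<rho> g f = (\<lambda>x. cis (\<Sum>r<n. of_int (\<kappa> r) * \<theta> r) * f x)"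
    and f': "f' \<in> S'" "f' \<noteq> (\<lambda>x. 0)" "\<And>g \<theta>. torus n e \<theta> g \<Longrightarrow> \<rho>' g f' = (\<lambda>x. cis (\<Sum>r<n. of_int (\<kappa> r) * \<theta> r) * f' x)"
  shows "complexify N \<subseteq> complexify M"
proof -
  interpret M: module_iso I J K n M S \<rho> H_mod H_act \<Phi> by (rule M)
  interpret N: module_iso I J K n N S' \<rho>' H_mod H_act \<Psi> by (rule N)
  have repN: "Spn_rep I J K S' \<rho>'" using irr by (simp add: irreducible_Spn_rep_def)
  have rhoN: "\<rho>' g k \<in> S'" if "g \<in> Spn I J K" "k \<in> S'" for g k using repN that unfolding Spn_rep_def by blast
  have rhoM: "\<rho> g k \<in> S" if "g \<in> Spn I J K" "k \<in> S" for g k using repM that unfolding Spn_rep_def by blast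
  have H: "h \<in> H_mod" for h by (simp add: H_mod_def)
  let ?d = "\<lambda>l i. if i = (l :: 2) then 1 else 0 :: complex"
  note C = cspaceD[OF cspace_complexify[OF M.sub]]
  have inv: "act3 (g \<circ> quat I J K U) F \<in> complexify M" if "g \<in> Spn I J K" "U \<in> Sp1" "F \<in> complexify M" for g U F
    by (rule M.invariant[OF that(1,2) rhoM[OF that(1)] H that(3)])
  define W where "W = {k \<in> S'. \<forall>l. \<Psi> (outer k (?d l)) \<in> complexify M}"
  have S': "cspace S'" using repN by (simp add: Spn_rep_def)
  have Wc: "cspace W"
  proof -
    have z: "\<Psi> (outer (\<lambda>x. 0) h) = (\<lambda>q. 0)" for h
      using N.outer_mult1[OF cspaceD(1)[OF S'] H, of 0 h] by simp
    show ?thesis unfolding cspace_def W_def mem_Collect_eq Ball_def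
      by (auto simp only: z N.outer_add1[OF _ _ H] N.outer_mult1[OF _ H] intro!: C(1-3) cspaceD(1-3)[OF S'])
  qed
  have Winv: "\<rho>' g k \<in> W" if "g \<in> Spn I J K" "k \<in> W" for g k
    using that rhoN inv[OF that(1) mat1_Sp1] unfolding W_def quat_mat1 by (simp add: N.eqv_Spn[OF _ _ H H_act_one])
  have "f' \<in> W"
  proof -
    obtain c where c: "\<Psi> (outer f' (?d 1)) = (\<lambda>p. c * \<Phi> (outer f (?d 1)) p)"
      using hwt_unique[OF e hwt_image[OF M repM f] hwt_image(1)[OF N repN f']] by blast
    have 1: "\<Psi> (outer f' (?d 1)) \<in> complexify M"
      unfolding c by (rule C(3)[OF M.image_mem[OF outer_tensor[OF f(1) H]]])
    have "\<rho>' id f' = f'" using repN f'(1) unfolding Spn_rep_def by blast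
    moreover have U: "mq 0 (- 1) \<in> Sp1" by (rule mq_Sp1) simp
    \<comment> \<open>The matrix \<open>mq 0 (- 1)\<close> takes the first basis vector of H to the
      second, and the complexification of \<open>M\<close> is invariant.\<close>
    ultimately have "\<Psi> (outer f' (?d 2)) = act3 (id \<circ> quat I J K (mq 0 (- 1))) (\<Psi> (outer f' (?d 1)))"
      using N.eqv[OF Spn_id U f'(1) H, of "?d 1"] unfolding H_basis(2) by simp
    then have "\<Psi> (outer f' (?d 2)) \<in> complexify M" using inv[OF Spn_id U 1] by simp
    then have "\<Psi> (outer f' (?d l)) \<in> complexify M" for l using 1 exhaust_2[of l] by metis
    then show ?thesis unfolding W_def using f'(1) by blast
  qed
  moreover have "W = {\<lambda>x. 0} \<or> W = S'"
    using irr Wc Winv unfolding irreducible_Spn_rep_def W_def by blast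
  ultimately have WS: "W = S'" using f'(2) by blast
  show ?thesis
  proof (rule N.generated[OF cspace_complexify[OF M.sub]])
    fix k :: "_ \<Rightarrow> complex" and h :: "2 \<Rightarrow> complex" assume k: "k \<in> S'"
    let ?ix = "\<lambda>l :: nat. if l = 0 then 1 else 2 :: 2"
    have h: "h = (\<lambda>y. \<Sum>l<(2::nat). h (?ix l) * ?d (?ix l) y)"
    proof
      fix y show "h y = (\<Sum>l<(2::nat). h (?ix l) * ?d (?ix l) y)"
        using exhaust_2[of y] by (auto simp: numeral_2_eq_2)
    qed
    have "\<Psi> (outer k h) = (\<lambda>q. \<Sum>l<(2::nat). \<Psi> (outer k (\<lambda>y. h (?ix l) * ?d (?ix l) y)) q)"
      by (subst h, rule N.outer_sum2[OF k H])
    also have "\<dots> = (\<lambda>q. \<Sum>l<(2::nat). h (?ix l) * \<Psi> (outer k (?d (?ix l))) q)"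
      by (simp only: N.outer_mult2[OF k H])
    also have "\<dots> \<in> complexify M"
      by (rule cspace_sum[OF cspace_complexify[OF M.sub]]) (use k WS C(3) in \<open>auto simp only: W_def mem_Collect_eq finite_lessThan\<close>)
    finally show "\<Psi> (outer k h) \<in> complexify M" .
  qed
qed

lemma is_KH_iff: "is_KH I J K n M \<longleftrightarrow> M = {b. mods (0::nat) b}"
proof
  assume "M = {b. mods (0::nat) b}"
  then show "is_KH I J K n M" unfolding is_KH_def using is_K_mod_Kmod KH_underlies by blast
next
  assume "is_KH I J K n M"
  then obtain S :: "('a \<times> 'a \<times> 'a \<Rightarrow> complex) set" and \<rho> where S: "is_K_mod I J K n S \<rho>" "underlies I J K M S \<rho> H_mod H_act"
    unfolding is_KH_def by blast
  have irr: "irreducible_Spn_rep I J K S \<rho>" "irreducible_Spn_rep I J K Kmod act3"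
    using S(1) is_K_mod_Kmod unfolding is_K_mod_def by blast+
  then have rep: "Spn_rep I J K S \<rho>" "Spn_rep I J K Kmod act3" by (simp_all add: irreducible_Spn_rep_def)
  obtain e where e: "frame n e" and wt: "is_weight I J K n e S \<rho> \<kappa>"
    using S(1) unfolding is_K_mod_def highest_weight_def by blast
  obtain f where f: "f \<in> S" "f \<noteq> (\<lambda>x. 0)" "\<And>g \<theta>. torus n e \<theta> g \<Longrightarrow> \<rho> g f = (\<lambda>x. cis (\<Sum>r<n. of_int (\<kappa> r) * \<theta> r) * f x)"
    using wt unfolding is_weight_def torus_def by blast
  have w: "w2 (J (e 0)) (J (e 1)) \<in> Kmod" "w2 (J (e 0)) (J (e 1)) \<noteq> (\<lambda>x. 0)" by (rule w2_frame[OF e])+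
  obtain \<Phi> \<Psi> where iso: "module_iso I J K n M S \<rho> H_mod H_act \<Phi>" "module_iso I J K n {b. mods (0::nat) b} Kmod act3 H_mod H_act \<Psi>"
    using S(2) KH_underlies unfolding underlies_iff by blast
  \<comment> \<open>Both Sp(n)-factors are irreducible, so the inclusion holds in either direction
    and no dimension of K is needed.\<close>
  have "complexify M = complexify {b. mods (0::nat) b}"
    using KH_le[OF iso(1) rep(1) iso(2) irr(2) e f w w2_torus] KH_le[OF iso(2) rep(2) iso(1) irr(1) e w w2_torus f] by blast
  then show "M = {b. mods (0::nat) b}"
    using complexify_inj[OF _ submodule3_mods] S(2) unfolding underlies_def by auto
qed

lemma is_EH_iff: "is_EH I J K M \<longleftrightarrow> M = {b. mods (1::nat) b}"
  unfolding is_EH_def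
proof
  assume "M = {b. mods (1::nat) b}"
  then show "underlies I J K M (E_mod I) act1 H_mod H_act" by (simp only: EH_underlies)
qed (rule submodule_unique[OF _ EH_underlies cspace_E EH_le], simp)

lemma is_LS_iff: "is_L03E_S3H I J K M \<longleftrightarrow> M = {b. mods (2::nat) b}"
  unfolding is_L03E_S3H_def L03E_eq
proof
  assume "M = {b. mods (2::nat) b}"
  then show "underlies I J K M C0 act3 S3H_mod S3H_act" by (simp only: LS_underlies)
qed (rule submodule_unique[OF _ LS_underlies cspace_C0 LS_le], simp)

lemma is_ES_iff: "is_E_S3H I J K M \<longleftrightarrow> M = {b. mods (3::nat) b}"
  unfolding is_E_S3H_def
proof
  assume "M = {b. mods (3::nat) b}"
  then show "underlies I J K M (E_mod I) act1 S3H_mod S3H_act" by (simp only: ES_underlies)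
qed (rule submodule_unique[OF _ ES_underlies cspace_E ES_le], simp)

end

theorem mainTheorem3:
  fixes I J K :: "'a::euclidean_space \<Rightarrow> 'a" and n :: nat
  assumes "DIM('a) = 4 * n" and "n > 1" and "adapted_basis I J K"
  shows
   "(\<exists>!C. invariant_complement I J K C) \<and>
    (n = 2 \<longrightarrow> L03E_mod I J K = {\<lambda>p. 0}) \<and>
    (\<exists>!M. is_KH I J K n M) \<and> (\<exists>!M. is_EH I J K M) \<and>
    (\<exists>!M. is_L03E_S3H I J K M) \<and> (\<exists>!M. is_E_S3H I J K M) \<and>
    (let KH = (THE M. is_KH I J K n M);
         EH = (THE M. is_EH I J K M);
         LS = (THE M. is_L03E_S3H I J K M);
         ES = (THE M. is_E_S3H I J K M);
         L = L_op I J K;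
         \<xi> = xi I J K n;
         \<xi>' = xiA I J K n
     in
       bij_betw (\<lambda>(a, b, c, d). add3 a (add3 b (add3 c d))) (KH \<times> EH \<times> LS \<times> ES) Lambda3 \<and>
       (\<forall>b\<in>Lambda3.
          \<comment> \<open>1\<close> (b \<in> {zero3} \<longleftrightarrow> b = zero3) \<and>
          \<comment> \<open>2\<close> (b \<in> KH \<longleftrightarrow> L b = scale3 3 b \<and> \<xi> b = (\<lambda>x. 0)) \<and>
            (b \<in> KH \<longleftrightarrow> (\<forall>A\<in>{I, J, K}. pair_op A b = b) \<and> \<xi> b = (\<lambda>x. 0)) \<and>
          \<comment> \<open>3\<close> (b \<in> EH \<longleftrightarrow> b = xi_Omega I J K n b) \<and>
          \<comment> \<open>4\<close> (b \<in> LS \<longleftrightarrow> L b = scale3 (- 3) b \<and> (\<forall>A\<in>{I, J, K}. \<xi>' A b = (\<lambda>x. 0))) \<and>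
            (b \<in> LS \<longleftrightarrow> L23_op I J K b = scale3 (- 1) b \<and> (\<forall>A\<in>{I, J, K}. \<xi>' A b = (\<lambda>x. 0))) \<and>
          \<comment> \<open>5\<close> (b \<in> ES \<longleftrightarrow> b = scale3 (- 2) (xi_omega I J K n b) \<and> \<xi> b = (\<lambda>x. 0)) \<and>
          \<comment> \<open>6\<close> (b \<in> sum3 KH EH \<longleftrightarrow> L b = scale3 3 b) \<and>
            (b \<in> sum3 KH EH \<longleftrightarrow> (\<forall>A\<in>{I, J, K}. pair_op A b = b)) \<and>
          \<comment> \<open>7\<close> (b \<in> sum3 KH LS \<longleftrightarrow> (\<forall>A\<in>{I, J, K}. \<xi>' A b = (\<lambda>x. 0))) \<and>
          \<comment> \<open>8\<close> (b \<in> sum3 KH ES \<longleftrightarrow> L b = add3 (scale3 3 b) (scale3 12 (xi_omega I J K n b))) \<and>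
          \<comment> \<open>9\<close> (b \<in> sum3 EH LS \<longleftrightarrow>
              L b = add3 (scale3 (- 3) b) (scale3 6 (xi_Omega I J K n b)) \<and>
              \<xi>' I b = \<xi>' J b \<and> \<xi>' J b = \<xi>' K b) \<and>
          \<comment> \<open>10\<close> (b \<in> sum3 EH ES \<longleftrightarrow> b = scale3 (- 2) (xi_omega I J K n b)) \<and>
          \<comment> \<open>11\<close> (b \<in> sum3 LS ES \<longleftrightarrow> L b = scale3 (- 3) b) \<and>
            (b \<in> sum3 LS ES \<longleftrightarrow> L23_op I J K b = scale3 (- 1) b) \<and>
          \<comment> \<open>12\<close> (b \<in> sum3 (sum3 KH EH) LS \<longleftrightarrow> \<xi>' I b = \<xi>' J b \<and> \<xi>' J b = \<xi>' K b) \<and>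
          \<comment> \<open>13\<close> (b \<in> sum3 (sum3 KH EH) ES \<longleftrightarrow>
              L b = add3 (scale3 3 b)
                (add3 (scale3 6 (xi_Omega I J K n b)) (scale3 12 (xi_omega I J K n b)))) \<and>
          \<comment> \<open>14\<close> (b \<in> sum3 KH (sum3 LS ES) \<longleftrightarrow> \<xi> b = (\<lambda>x. 0)) \<and>
          \<comment> \<open>15\<close> (b \<in> sum3 EH (sum3 LS ES) \<longleftrightarrow>
              L b = add3 (scale3 (- 3) b) (scale3 6 (xi_Omega I J K n b))) \<and>
          \<comment> \<open>16\<close> b \<in> sum3 (sum3 KH EH) (sum3 LS ES)))"
proof -
  interpret quaternionic I J K n
    using assms by unfold_locales
  have m: "{b. mods (0::nat) b} = {b. mKH b}" "{b. mods (1::nat) b} = {b. mEH b}" "{b. mods (2::nat) b} = {b. mLS b}"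
    "{b. mods (3::nat) b} = {b. mES b}"
    by (simp_all add: mods_def)
  note i = is_KH_iff[unfolded m] is_EH_iff[unfolded m] is_LS_iff[unfolded m] is_ES_iff[unfolded m]
  have T: "(THE M. is_KH I J K n M) = {b. mKH b}" "(THE M. is_EH I J K M) = {b. mEH b}"
    "(THE M. is_L03E_S3H I J K M) = {b. mLS b}" "(THE M. is_E_S3H I J K M) = {b. mES b}"
    by (simp_all add: i)
  have 1: "\<exists>!C. invariant_complement I J K C"
    using invariant_complement_C0 invariant_complement_unique by blast
  have 2: "n = 2 \<longrightarrow> L03E_mod I J K = {\<lambda>p. 0}" unfolding L03E_eq using C0_dim8 by blast
  have 3: "\<exists>!M. is_KH I J K n M" "\<exists>!M. is_EH I J K M" "\<exists>!M. is_L03E_S3H I J K M" "\<exists>!M. is_E_S3H I J K M"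
    unfolding i by simp_all
  show ?thesis
    unfolding Let_def T
    by (rule conjI[OF 1] conjI[OF 2] conjI[OF 3(1)] conjI[OF 3(2)] conjI[OF 3(3)] conjI[OF 3(4)] conjI[OF bij_decomposition] ballI classification[OF _ refl refl refl refl] | assumption)+
qed

end
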